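(* Let $\sigma$ be a measurable function on $\mathbb{R}^d_+$ such that there exists $n\in\mathbb{N}_0^d$ for which $\sigma(\rho)/(\mathbf 1+\rho)^n\in L^2(\mathbb{R}^d_+)$. Then $\tilde\sigma(x,\xi)=\sigma(2v(x,\xi))\in(\mathcal{S}(\mathbb{R}^{2d}))'$. The Weyl pseudo-differential operator $W_{\tilde\sigma}$ is a continuous mapping from $\mathcal{S}(\mathbb{R}^d)$ into $\mathcal{S}(\mathbb{R}^d)$ and it extends to a continuous mapping from $(\mathcal{S}(\mathbb{R}^d))'$ into $(\mathcal{S}(\mathbb{R}^d))'$. Let $\sigma^{(j)}$, $j\in\mathbb{N}$, be measurable functions on $\mathbb{R}^d_+$ such that for each $j\in\mathbb{N}$ there exists $n^{(j)}\in\mathbb{N}_0^d$ for which $\sigma^{(j)}(\rho)/(\mathbf 1+\rho)^{n^{(j)}}\in L^2(\mathbb{R}^d_+)$, and put $\tilde\sigma^{(j)}(x,\xi)=\sigma^{(j)}(2v(x,\xi))$. If $\sigma$ is a measurable function on $\mathbb{R}^d_+$ such that $\sigma(\rho)/(\mathbf 1+\rho)^n\in L^2(\mathbb{R}^d_+)$ for some $n\in\mathbb{N}_0^d$, and if $\sigma^{(j)}\to\sigma$ in $(\mathcal{S}(\mathbb{R}^d_+))'$, then $W_{\tilde\sigma^{(j)}}\to W_{\tilde\sigma}$ in the strong topology of $\mathcal{L}(\mathcal{S}(\mathbb{R}^d),\mathcal{S}(\mathbb{R}^d))$ and of $\mathcal{L}((\mathcal{S}(\mathbb{R}^d))',(\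mathcal{S}(\mathbb{R}^d))')$.
   Context: $\mathbb{R}^d_+=(0,\infty)^d$, $\mathbb{N}_0=\{0,1,2,\dots\}$, $\mathbf 1=(1,\dots,1)$, $(\mathbf 1+\rho)^n=\prod_l(1+\rho_l)^{n_l}$. The map $v:\mathbb{R}^{2d}\to[0,\infty)^d$ is $v(x,\xi)=(x_1^2+\xi_1^2,\dots,x_d^2+\xi_d^2)$ (so $\sigma(2v(x,\xi))$ is defined for almost every $(x,\xi)$). $\mathcal{S}(\mathbb{R}^d_+)$ is the Fréchet space of all $f\in C^\infty(\mathbb{R}^d_+)$ all of whose derivatives extend continuously to $[0,\infty)^d$ and with $\sup_{x\in\mathbb{R}^d_+}x^k|D^pf(x)|<\infty$ for all $k,p\in\mathbb{N}_0^d$ (these are the defining seminorms); $(\mathcal{S}(\mathbb{R}^d_+))'$ is its strong dual. $\mathcal{S}(\mathbb{R}^d)$ is the Schwartz space and $(\mathcal{S}(\mathbb{R}^d))'$ its strong dual. Functions are identified with functionals by integration. Wigner transform: $W(f,g)(x,\xi)=(2\pi)^{-d/2}\int_{\mathbb{R}^d}e^{-i\xi\cdot p}f(x+\frac p2)\overline{g(x-\frac p2)}\,dp$ for $f,g\in\mathcal{S}(\mathbb{R}^d)$. For $\tau\in(\mathcal{S}(\mathbb{R}^{2d}))'$ the Weyl pseudo-differential operator $W_\tau:\mathcal{S}(\mathbb{R}^d)\to(\mathcal{S}(\mathbb{R}^d))'$ is defined by $(W_\tau f)(g)=(2\pi)^{-d/2}\langle\tau,W(f,\overline g)\rangle$.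 $\mathcal{L}(E,F)$ is the space of continuous linear maps $E\to F$; its strong topology is that of uniform convergence on bounded subsets of $E$. *)

theory Defs
  imports "HOL-Analysis.Analysis"
begin

text \<open>A locally convex space is given by its underlying set and a defining family of seminorms;
  addition and scalar multiplication are pointwise.  Two conventions are used throughout: a function
  or map that lives on a proper subset of its type is normalised to be 0 elsewhere, so that equality
  in HOL is equality of the mathematical objects; and \<open>-\<close> on functions is pointwise.\<close>

datatype 'v lcs = LCS (vectors: "'v set") (seminorms: "('v \<Rightarrow> real) set")

definition lcs_topology :: "('v::minus) lcs \<Rightarrow> 'v topology" where
  "lcs_topology E = topology_generated_by
     {{g \<in> vectors E. p (g - f) < e} | f p e. f \<in> vectors E \<and> p \<in> seminorms E \<and> e > 0}"

definition bounded_in :: "'v lcs \<Rightarrow> 'v set \<Rightarrow> bool" where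
  "bounded_in E B \<longleftrightarrow> B \<subseteq> vectors E \<and> (\<forall>p \<in> seminorms E. bdd_above (p ` B))"

text \<open>In \<open>strong_dual\<close> and \<open>Lin\<close>, \<open>B \<noteq> {}\<close> is required only because the supremum of the empty
  set of reals is unspecified.\<close>

definition dual_vectors :: "('x \<Rightarrow> complex) lcs \<Rightarrow> (('x \<Rightarrow> complex) \<Rightarrow> complex) set" where
  "dual_vectors E = {T.
     (\<forall>f \<in> vectors E. \<forall>g \<in> vectors E. T (\<lambda>x. f x + g x) = T f + T g) \<and>
     (\<forall>c. \<forall>f \<in> vectors E. T (\<lambda>x. c * f x) = c * T f) \<and>
     continuous_map (lcs_topology E) euclidean T \<and>
     (\<forall>f. f \<notin> vectors E \<longrightarrow> T f = 0)}"

definition strong_dual :: "('x \<Rightarrow> complex) lcs \<Rightarrow> (('x \<Rightarrow> complex) \<Rightarrow> complex) lcs" where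
  "strong_dual E = LCS (dual_vectors E)
     {\<lambda>T. SUP f\<in>B. cmod (T f) | B. bounded_in E B \<and> B \<noteq> {}}"

definition lin_vectors ::
  "('x \<Rightarrow> complex) lcs \<Rightarrow> ('y \<Rightarrow> complex) lcs \<Rightarrow> (('x \<Rightarrow> complex) \<Rightarrow> ('y \<Rightarrow> complex)) set" where
  "lin_vectors E F = {A.
     (\<forall>f \<in> vectors E. \<forall>g \<in> vectors E. A (\<lambda>x. f x + g x) = (\<lambda>y. A f y + A g y)) \<and>
     (\<forall>c. \<forall>f \<in> vectors E. A (\<lambda>x. c * f x) = (\<lambda>y. c * A f y)) \<and>
     continuous_map (lcs_topology E) (lcs_topology F) A \<and>
     (\<forall>f. f \<notin> vectors E \<longrightarrow> A f = (\<lambda>y. 0))}"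

definition Lin ::
  "('x \<Rightarrow> complex) lcs \<Rightarrow> ('y \<Rightarrow> complex) lcs \<Rightarrow> (('x \<Rightarrow> complex) \<Rightarrow> ('y \<Rightarrow> complex)) lcs" where
  "Lin E F = LCS (lin_vectors E F)
     {\<lambda>A. SUP f\<in>B. q (A f) | B q. bounded_in E B \<and> B \<noteq> {} \<and> q \<in> seminorms F}"

definition dir_deriv :: "'a::euclidean_space \<Rightarrow> ('a \<Rightarrow> complex) \<Rightarrow> 'a \<Rightarrow> complex" where
  "dir_deriv b f x = vector_derivative (\<lambda>t. f (x + t *\<^sub>R b)) (at 0)"

text \<open>The partial derivatives \<open>D\<^sup>p f\<close> are indexed by lists of basis vectors in place of
  multi-indices; for smooth functions only the number of occurrences of each basis vector
  matters.\<close>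

definition partial_deriv :: "'a::euclidean_space list \<Rightarrow> ('a \<Rightarrow> complex) \<Rightarrow> 'a \<Rightarrow> complex" where
  "partial_deriv bs f = foldr dir_deriv bs f"

definition smooth_on :: "'a::euclidean_space set \<Rightarrow> ('a \<Rightarrow> complex) \<Rightarrow> bool" where
  "smooth_on U f \<longleftrightarrow> (\<forall>bs \<in> lists Basis.
     continuous_on U (partial_deriv bs f) \<and>
     (\<forall>b \<in> Basis. \<forall>x \<in> U. (\<lambda>t::real. partial_deriv bs f (x + t *\<^sub>R b)) differentiable (at 0)))"

definition monomial :: "('a::euclidean_space \<Rightarrow> nat) \<Rightarrow> 'a \<Rightarrow> real" where
  "monomial k x = (\<Prod>b\<in>Basis. (x \<bullet> b) ^ k b)"

text \<open>Meant for open \<open>U\<close>.  For \<open>U = UNIV\<close> the extension condition follows from smoothness and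
  this is the usual Schwartz space.\<close>

definition schwartz_functions :: "'a::euclidean_space set \<Rightarrow> ('a \<Rightarrow> complex) set" where
  "schwartz_functions U = {f.
     smooth_on U f \<and>
     (\<forall>bs \<in> lists Basis. \<exists>g. continuous_on (closure U) g \<and> (\<forall>x \<in> U. g x = partial_deriv bs f x)) \<and>
     (\<forall>k. \<forall>bs \<in> lists Basis. bdd_above ((\<lambda>x. \<bar>monomial k x\<bar> * cmod (partial_deriv bs f x)) ` U)) \<and>
     (\<forall>x. x \<notin> U \<longrightarrow> f x = 0)}"

definition schwartz :: "'a::euclidean_space set \<Rightarrow> ('a \<Rightarrow> complex) lcs" where
  "schwartz U = LCS (schwartz_functions U)
     {\<lambda>f. SUP x\<in>U. \<bar>monomial k x\<bar> * cmod (partial_deriv bs f x) | k bs. bs \<in> lists Basis}"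

definition orthant :: "(real^'n) set" where
  "orthant = {x. \<forall>i. 0 < x $ i}"

lemma closure_orthant: "closure (orthant :: (real^'n) set) = {x. \<forall>i. 0 \<le> x $ i}"
proof
  have "closed {x::real^'n. \<forall>i. 0 \<le> x $ i}"
    by (intro closed_Collect_all closed_Collect_le continuous_intros)
  then show "closure orthant \<subseteq> {x::real^'n. \<forall>i. 0 \<le> x $ i}"
    by (intro closure_minimal) (auto simp: orthant_def less_imp_le)
  show "{x::real^'n. \<forall>i. 0 \<le> x $ i} \<subseteq> closure orthant"
  proof
    fix x :: "real^'n"
    assume x: "x \<in> {x. \<forall>i. 0 \<le> x $ i}"
    let ?y = "\<lambda>m. x + inverse (real (Suc m)) *\<^sub>R (\<chi> i. 1)"
    have "?y \<longlonglongrightarrow> x + 0 *\<^sub>R (\<chi> i. 1)"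
      by (intro tendsto_intros LIMSEQ_inverse_real_of_nat)
    moreover have "?y m \<in> orthant" for m
      using x by (auto simp: orthant_def add_nonneg_pos)
    ultimately show "x \<in> closure orthant"
      unfolding closure_sequential by (intro exI[of _ ?y]) auto
  qed
qed

abbreviation S_space :: "('a::euclidean_space \<Rightarrow> complex) lcs" where
  "S_space \<equiv> schwartz UNIV"

abbreviation S_dual :: "(('a::euclidean_space \<Rightarrow> complex) \<Rightarrow> complex) lcs" where
  "S_dual \<equiv> strong_dual S_space"

text \<open>The functional on \<open>schwartz U\<close> with which a function on \<open>U\<close> is identified.  The Bochner
  integral is 0 for non-integrable functions, hence the integrability clause in
  \<open>tempered_function\<close>.\<close>

definition functional :: "'a::euclidean_space set \<Rightarrow> ('a \<Rightarrow> complex) \<Rightarrow> ('a \<Rightarrow> complex) \<Rightarrow> complex" where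
  "functional U h g =
     (if g \<in> vectors (schwartz U) then (\<integral>x. h x * g x \<partial>(lebesgue_on U)) else 0)"

definition tempered_function :: "('a::euclidean_space \<Rightarrow> complex) \<Rightarrow> bool" where
  "tempered_function h \<longleftrightarrow>
     (\<forall>g \<in> vectors S_space. integrable lebesgue (\<lambda>x. h x * g x)) \<and>
     functional UNIV h \<in> vectors S_dual"

definition wigner :: "(real^'n \<Rightarrow> complex) \<Rightarrow> (real^'n \<Rightarrow> complex) \<Rightarrow>
    (real^'n) \<times> (real^'n) \<Rightarrow> complex" where
  "wigner f g = (\<lambda>(x, \<xi>). of_real ((2 * pi) powr (- (real CARD('n) / 2))) *
     (\<integral>p. exp (- \<i> * of_real (\<xi> \<bullet> p)) * f (x + p /\<^sub>R 2) * cnj (g (x - p /\<^sub>R 2)) \<partial>lebesgue))"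

definition weyl :: "(((real^'n) \<times> (real^'n) \<Rightarrow> complex) \<Rightarrow> complex) \<Rightarrow>
    (real^'n \<Rightarrow> complex) \<Rightarrow> (real^'n \<Rightarrow> complex) \<Rightarrow> complex" where
  "weyl \<tau> f g = (if g \<in> vectors S_space
     then of_real ((2 * pi) powr (- (real CARD('n) / 2))) * \<tau> (wigner f (\<lambda>x. cnj (g x)))
     else 0)"

text \<open>\<open>A\<close> is the Weyl operator of \<open>\<tau>\<close> regarded as a continuous map from the Schwartz space into
  itself, respectively a continuous extension of it to the dual.\<close>

definition weyl_on_S :: "(((real^'n) \<times> (real^'n) \<Rightarrow> complex) \<Rightarrow> complex) \<Rightarrow>
    ((real^'n \<Rightarrow> complex) \<Rightarrow> (real^'n \<Rightarrow> complex)) \<Rightarrow> bool" where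
  "weyl_on_S \<tau> A \<longleftrightarrow> A \<in> vectors (Lin S_space S_space) \<and>
     (\<forall>f \<in> vectors S_space. functional UNIV (A f) = weyl \<tau> f)"

definition weyl_on_S_dual :: "(((real^'n) \<times> (real^'n) \<Rightarrow> complex) \<Rightarrow> complex) \<Rightarrow>
    (((real^'n \<Rightarrow> complex) \<Rightarrow> complex) \<Rightarrow> ((real^'n \<Rightarrow> complex) \<Rightarrow> complex)) \<Rightarrow> bool" where
  "weyl_on_S_dual \<tau> A \<longleftrightarrow> A \<in> vectors (Lin S_dual S_dual) \<and>
     (\<forall>f \<in> vectors S_space. A (functional UNIV f) = weyl \<tau> f)"

definition vmap :: "(real^'n) \<times> (real^'n) \<Rightarrow> real^'n" where
  "vmap = (\<lambda>(x, \<xi>). \<chi> i. (x $ i)\<^sup>2 + (\<xi> $ i)\<^sup>2)"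

definition radial :: "(real^'n \<Rightarrow> complex) \<Rightarrow> (real^'n) \<times> (real^'n) \<Rightarrow> complex" where
  "radial \<sigma> z = \<sigma> (2 *\<^sub>R vmap z)"

definition L2_on :: "'a::euclidean_space set \<Rightarrow> ('a \<Rightarrow> complex) \<Rightarrow> bool" where
  "L2_on U h \<longleftrightarrow> h \<in> borel_measurable (lebesgue_on U) \<and>
     integrable (lebesgue_on U) (\<lambda>x. (cmod (h x))\<^sup>2)"

text \<open>The values of \<open>\<sigma>\<close> outside the open orthant are irrelevant.\<close>

definition polynomially_L2 :: "(real^'n \<Rightarrow> complex) \<Rightarrow> bool" where
  "polynomially_L2 \<sigma> \<longleftrightarrow> \<sigma> \<in> borel_measurable (lebesgue_on orthant) \<and>
     (\<exists>n :: 'n \<Rightarrow> nat. L2_on orthant (\<lambda>\<rho>. \<sigma> \<rho> / of_real (\<Prod>l\<in>UNIV. (1 + \<rho> $ l) ^ n l)))"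

end

(*
  The Hermite functions h_a turn everything into sequences.  The Wigner transform of h_a and h_b is a
  product over phase planes of functions that acquire the phase exp(i (b_k - a_k) t) when the k-th
  plane is rotated by t.  A radial symbol is therefore orthogonal to it unless a = b, and for a = b it
  is, up to sign and a constant, the Laguerre function l_a at 2v.  Since 2v maps Lebesgue measure on
  phase space to a multiple of Lebesgue measure on the orthant, the Weyl operator of sigma(2v) is
  diagonal: h_a is an eigenvector for a constant multiple of (-1)^|a| <sigma, l_a>.  The seminorms of
  l_a grow polynomially in a, hence so do the eigenvalues, which gives continuity on S and, by
  transposition, on S'.  Rapidly decreasing multiples of the l_a form a bounded set, so strong
  convergence of the sigma_j makes the eigenvalues converge uniformly against rapidly decreasing
  weights, and this controls both operator topologies.  The extension to S' is unique because finite
  Hermite sums are dense in S'.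
*)
theory Submission imports Defs "HOL-Probability.Probability" begin

text \<open>Three families must be bounded in every Schwartz norm: \<open>hermite_fun\<close>,
  \<open>laguerre_fun\<close> and \<open>wig_fun\<close>. Closed formulas for their derivatives are
  avoided. On each family, differentiation and multiplication by a coordinate act as matrices with
  polynomially bounded entries, so a sup bound that is polynomial in the index suffices
  (\<open>schwartz_ladder_family\<close>). For Laguerre functions this sup bound is not drawn from
  their recurrence: Wigner functions are bounded by 2 because Hermite functions are normalised, and
  their diagonal consists of Laguerre functions. In the other direction, rapid decay of the Hermite
  coefficients of a Schwartz function comes from the harmonic oscillators, which are symmetric and
  multiply the coefficient of index \<open>\<alpha>\<close> by \<open>2 * \<alpha> i + 1\<close>.
  Conjugation cancels in \<open>weyl\<close>, so its diagonal expansion is symmetric in both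
  arguments; the operator is its own transpose, and precomposition with it is the extension to the
  dual. Both operator topologies rest on one fact: the Hermite coefficients of a bounded set have a
  common rapidly decreasing majorant.\<close>

abbreviation S_funs :: "('a::euclidean_space \<Rightarrow> complex) set" where
  "S_funs \<equiv> schwartz_functions UNIV"

type_synonym 'n mindex = "'n \<Rightarrow> nat"

text \<open>The exponent is twice the dimension because this makes the function integrable; see
  \<open>integrable_weight\<close>.\<close>

abbreviation decay :: "'a::euclidean_space \<Rightarrow> real" where
  "decay x \<equiv> 1 / (1 + norm x) ^ (2 * DIM('a))"

abbreviation wderiv :: "nat \<Rightarrow> 'a::euclidean_space list \<Rightarrow> ('a \<Rightarrow> complex) \<Rightarrow> 'a \<Rightarrow> real" where
  "wderiv m bs f x \<equiv> (1 + norm x) ^ m * cmod (partial_deriv bs f x)"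

section \<open>Locally convex spaces\<close>

text \<open>The seminorm axioms for a space of complex-valued functions, asked on
  \<open>vectors E\<close> only. Homogeneity at the scalar 0 gives value 0 at the zero function;
  homogeneity at -1 together with subadditivity gives nonnegativity
  (\<open>fun_lcs_nonneg\<close>).\<close>

definition fun_lcs :: "('x \<Rightarrow> complex) lcs \<Rightarrow> bool" where
  "fun_lcs E \<longleftrightarrow> seminorms E \<noteq> {} \<and> (\<lambda>x. 0) \<in> vectors E \<and>
     (\<forall>f\<in>vectors E. \<forall>g\<in>vectors E. (\<lambda>x. f x + g x) \<in> vectors E) \<and>
     (\<forall>c. \<forall>f\<in>vectors E. (\<lambda>x. c * f x) \<in> vectors E) \<and>
     (\<forall>p\<in>seminorms E. \<forall>f\<in>vectors E. \<forall>g\<in>vectors E. p (\<lambda>x. f x + g x) \<le> p f + p g) \<and>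
     (\<forall>p\<in>seminorms E. \<forall>c. \<forall>f\<in>vectors E. p (\<lambda>x. c * f x) = cmod c * p f)"

text \<open>Elements of \<open>Lin E F\<close> are maps between function spaces and not
  complex-valued functions, so \<open>fun_lcs\<close> cannot be stated for them. Vanishing on
  \<open>a - a\<close> and the triangle inequality are what open sets and limits require.\<close>

definition triangle_lcs :: "('v::minus) lcs \<Rightarrow> bool" where
  "triangle_lcs E \<longleftrightarrow> seminorms E \<noteq> {} \<and>
     (\<forall>p\<in>seminorms E. \<forall>a\<in>vectors E. p (a - a) = 0) \<and>
     (\<forall>p\<in>seminorms E. \<forall>a\<in>vectors E. \<forall>b\<in>vectors E. \<forall>c\<in>vectors E. p (a - c) \<le> p (a - b) + p (b - c))"

section \<open>Topology of a family of seminorms: open sets and limits\<close>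

text \<open>Some seminorm exists and vanishes on \<open>a - a\<close>, so every vector lies in a
  generating ball centred at itself.\<close>

lemma topspace_lcs:
  assumes "triangle_lcs E"
  shows "topspace (lcs_topology E) = vectors E"
proof -
  obtain p where p: "p \<in> seminorms E" using assms by (auto simp: triangle_lcs_def)
  have *: "p (a - a) = 0" if "a \<in> vectors E" for a using assms p that unfolding triangle_lcs_def by blast
  show ?thesis unfolding lcs_topology_def topology_generated_by_topspace
  proof (intro subset_antisym subsetI)
    fix a assume a: "a \<in> vectors E"
    show "a \<in> \<Union> {{g \<in> vectors E. p (g - f) < e} |f p e. f \<in> vectors E \<and> p \<in> seminorms E \<and> e > 0}"
      by (rule UnionI[of "{g \<in> vectors E. p (g - a) < 1}"])
        (use a p *[OF a] in \<open>auto intro!: exI[of _ a] exI[of _ p] exI[of _ 1]\<close>)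
  qed auto
qed

lemma openin_lcs_ball:
  assumes "f \<in> vectors E" "p \<in> seminorms E" "e > 0"
  shows "openin (lcs_topology E) {g \<in> vectors E. p (g - f) < e}"
  unfolding lcs_topology_def using assms by (intro topology_generated_by_Basis) blast

text \<open>The generating balls use one seminorm each and form only a subbase. A neighbourhood
  condition with finitely many seminorms corresponds to a finite intersection of them.\<close>

lemma openin_lcsI:
  assumes E: "triangle_lcs E" and W: "W \<subseteq> vectors E"
    and nbhd: "\<And>a. a \<in> W \<Longrightarrow> \<exists>P e. finite P \<and> P \<subseteq> seminorms E \<and> e > 0 \<and>
       (\<forall>b\<in>vectors E. (\<forall>p\<in>P. p (b - a) < e) \<longrightarrow> b \<in> W)"
  shows "openin (lcs_topology E) W"
proof (subst openin_subopen, intro ballI)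
  fix a assume a: "a \<in> W"
  then obtain P e where P: "finite P" "P \<subseteq> seminorms E" "e > 0"
    and *: "\<And>b. b \<in> vectors E \<Longrightarrow> (\<forall>p\<in>P. p (b - a) < e) \<Longrightarrow> b \<in> W" using nbhd by metis
  have aV: "a \<in> vectors E" using a W by auto
  \<comment> \<open>For empty \<open>P\<close> the intersection is the whole type; the factor
    \<open>topspace\<close> cuts it back to the space.\<close>
  let ?T = "topspace (lcs_topology E) \<inter> (\<Inter>p\<in>P. {b \<in> vectors E. p (b - a) < e})"
  have "openin (lcs_topology E) ?T"
  proof (cases "P = {}")
    case False
    then show ?thesis using P aV by (intro openin_Int openin_topspace openin_INT2 openin_lcs_ball) auto
  qed simp
  moreover have "\<forall>p\<in>P. p (a - a) < e" using E aV P unfolding triangle_lcs_def by (metis subsetD)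
  then have "a \<in> ?T" using aV unfolding topspace_lcs[OF E] by blast
  moreover have "?T \<subseteq> W" using * by (auto simp: topspace_lcs[OF E])
  ultimately show "\<exists>T. openin (lcs_topology E) T \<and> a \<in> T \<and> T \<subseteq> W" by blast
qed

text \<open>Testing on a subbase suffices: the property that a set containing \<open>l\<close>
  eventually contains \<open>f j\<close> passes to finite intersections and arbitrary unions, so
  induction over the generation of the open set applies.\<close>

lemma limitin_topology_generated_by:
  assumes l: "l \<in> \<Union>S" and ev: "\<And>U. U \<in> S \<Longrightarrow> l \<in> U \<Longrightarrow> eventually (\<lambda>j. f j \<in> U) F"
  shows "limitin (topology_generated_by S) f l F" unfolding limitin_def
proof (intro conjI allI impI)
  show "l \<in> topspace (topology_generated_by S)" using l by (simp add: topology_generated_by_topspace)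
  fix U assume "openin (topology_generated_by S) U \<and> l \<in> U"
  then have "generate_topology_on S U" "l \<in> U" by (auto simp: openin_topology_generated_by_iff)
  then show "eventually (\<lambda>j. f j \<in> U) F"
  proof (induction rule: generate_topology_on.induct)
    case (Int a b)
    then show ?case by (auto simp: eventually_conj_iff)
  next
    case (UN K)
    then obtain k where "k \<in> K" "l \<in> k" by auto
    then have "eventually (\<lambda>j. f j \<in> k) F" using UN by blast
    then show ?case by (rule eventually_mono) (use \<open>k \<in> K\<close> in auto)
  next
    case (Basis s)
    then show ?case using ev by auto
  qed auto
qed

lemma limitin_lcs_iff:
  assumes E: "triangle_lcs E"
  shows "limitin (lcs_topology E) f l F \<longleftrightarrow> l \<in> vectors E \<and>
     (\<forall>p\<in>seminorms E. \<forall>e>0. eventually (\<lambda>j. f j \<in> vectors E \<and> p (f j - l) < e) F)"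
    (is "?L \<longleftrightarrow> ?R")
proof
  assume L: ?L
  then have l: "l \<in> vectors E" using limitin_topspace topspace_lcs[OF E] by metis
  moreover have "eventually (\<lambda>j. f j \<in> vectors E \<and> p (f j - l) < e) F"
    if "p \<in> seminorms E" "e > 0" for p e
  proof -
    have "p (l - l) = 0" using E l that unfolding triangle_lcs_def by blast
    then have "l \<in> {g \<in> vectors E. p (g - l) < e}" using l that by auto
    then have "eventually (\<lambda>j. f j \<in> {g \<in> vectors E. p (g - l) < e}) F"
      using L openin_lcs_ball[OF l that] unfolding limitin_def by blast
    then show ?thesis by simp
  qed
  ultimately show ?R by blast
next
  assume R: ?R
  show ?L unfolding lcs_topology_def
  proof (rule limitin_topology_generated_by)
    show "l \<in> \<Union> {{g \<in> vectors E. p (g - f) < e} |f p e. f \<in> vectors E \<and> p \<in> seminorms E \<and> 0 < e}"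
      using R topspace_lcs[OF E] unfolding lcs_topology_def topology_generated_by_topspace by blast
    fix U assume "U \<in> {{g \<in> vectors E. p (g - f) < e} |f p e. f \<in> vectors E \<and> p \<in> seminorms E \<and> 0 < e}"
      and lU: "l \<in> U"
    then obtain g p e where U: "U = {b \<in> vectors E. p (b - g) < e}"
      and g: "g \<in> vectors E" "p \<in> seminorms E" "e > 0" by auto
    \<comment> \<open>The ball is centred at \<open>g\<close> and not at \<open>l\<close>. Around
      \<open>l\<close> the radius \<open>e - p (l - g)\<close> is left, which is positive because
      \<open>l\<close> lies in the ball.\<close>
    have "eventually (\<lambda>j. f j \<in> vectors E \<and> p (f j - l) < e - p (l - g)) F" using R g lU U by auto
    then show "eventually (\<lambda>j. f j \<in> U) F"
    proof (rule eventually_mono)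
      fix j assume j: "f j \<in> vectors E \<and> p (f j - l) < e - p (l - g)"
      have "p (f j - g) \<le> p (f j - l) + p (l - g)" using E g j R unfolding triangle_lcs_def by blast
      then show "f j \<in> U" using j U by auto
    qed
  qed
qed

lemma fun_lcsD:
  assumes "fun_lcs E"
  shows "seminorms E \<noteq> {}" "(\<lambda>x. 0) \<in> vectors E"
    "\<And>f g. f \<in> vectors E \<Longrightarrow> g \<in> vectors E \<Longrightarrow> (\<lambda>x. f x + g x) \<in> vectors E"
    "\<And>c f. f \<in> vectors E \<Longrightarrow> (\<lambda>x. c * f x) \<in> vectors E"
    "\<And>p f g. p \<in> seminorms E \<Longrightarrow> f \<in> vectors E \<Longrightarrow> g \<in> vectors E \<Longrightarrow> p (\<lambda>x. f x + g x) \<le> p f + p g"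
    "\<And>p c f. p \<in> seminorms E \<Longrightarrow> f \<in> vectors E \<Longrightarrow> p (\<lambda>x. c * f x) = cmod c * p f" using assms unfolding fun_lcs_def by blast+

lemma fun_minus_eq: "f - g = (\<lambda>x. f x + (-1) * g x)" for f g :: "'x \<Rightarrow> complex" by (simp add: fun_eq_iff)

lemma fun_lcs_minus:
  assumes "fun_lcs E" "f \<in> vectors E" "g \<in> vectors E"
  shows "f - g \<in> vectors E" unfolding fun_minus_eq by (intro fun_lcsD[OF assms(1)] assms)

lemma fun_lcs_zero:
  assumes "fun_lcs E" "p \<in> seminorms E"
  shows "p (\<lambda>x. 0) = 0" using fun_lcsD(6)[OF assms(1) assms(2) fun_lcsD(2)[OF assms(1)], of 0] by simp

lemma fun_lcs_nonneg:
  assumes "fun_lcs E" "p \<in> seminorms E" "f \<in> vectors E"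
  shows "0 \<le> p f"
proof -
  have "p (\<lambda>x. f x + (-1) * f x) \<le> p f + p (\<lambda>x. (-1) * f x)" by (intro fun_lcsD[OF assms(1)] assms)
  also have "p (\<lambda>x. (-1) * f x) = p f" by (subst fun_lcsD(6)[OF assms(1)]) (use assms in auto)
  finally show ?thesis using fun_lcs_zero[OF assms(1,2)] by simp
qed

lemma fun_lcs_triangle:
  assumes E: "fun_lcs E"
  shows "triangle_lcs E" unfolding triangle_lcs_def
proof (intro conjI ballI)
  show "seminorms E \<noteq> {}" by (rule fun_lcsD[OF E])
  fix p a assume p: "p \<in> seminorms E" "a \<in> vectors E"
  have "a - a = (\<lambda>x. 0)" by auto
  then show "p (a - a) = 0" using fun_lcs_zero[OF E p(1)] by simp
  fix b c assume bc: "b \<in> vectors E" "c \<in> vectors E"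
  have "a - c = (\<lambda>x. (a - b) x + (b - c) x)" by auto
  then show "p (a - c) \<le> p (a - b) + p (b - c)" using fun_lcsD(5)[OF E p(1)] fun_lcs_minus[OF E] p(2) bc by metis
qed

lemma limitin_lcs_I:
  assumes E: "triangle_lcs E" and l: "l \<in> vectors E" and f: "\<And>j. f j \<in> vectors E"
    and p: "\<And>p. p \<in> seminorms E \<Longrightarrow> \<exists>r. (\<forall>j. p (f j - l) \<le> r j) \<and> (r \<longlongrightarrow> 0) F"
  shows "limitin (lcs_topology E) f l F" unfolding limitin_lcs_iff[OF E]
proof (intro conjI ballI allI impI l)
  fix q and e :: real assume q: "q \<in> seminorms E" and e: "e > 0"
  obtain r where r: "\<And>j. q (f j - l) \<le> r j" "(r \<longlongrightarrow> 0) F" using p[OF q] by auto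
  have "eventually (\<lambda>j. r j < e) F" using order_tendstoD(2)[OF r(2) e] .
  then show "eventually (\<lambda>j. f j \<in> vectors E \<and> q (f j - l) < e) F"
    by (rule eventually_mono) (use f r(1) in \<open>auto intro: le_less_trans\<close>)
qed

section \<open>Boundedness under continuous maps; strong duals and spaces of maps\<close>

text \<open>Suppose \<open>r (f n) > n + 1\<close> for some \<open>f n\<close> in \<open>B\<close>.
  The multiples \<open>f n / (n + 1)\<close> tend to 0, since each seminorm is bounded on
  \<open>B\<close>, while \<open>r\<close> stays above 1 on them. Applied to moduli of functionals
  and to seminorms of operator values, this shows that the suprema in \<open>strong_dual\<close> and
  \<open>Lin\<close> are suprema of bounded sets.\<close>

lemma bounded_in_image_bdd:
  assumes E: "fun_lcs E" and B: "bounded_in E B"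
    and hom: "\<And>c f. f \<in> vectors E \<Longrightarrow> r (\<lambda>x. c * f x) = cmod c * (r f :: real)"
    and cont: "\<And>fs. limitin (lcs_topology E) fs (\<lambda>x. 0) sequentially \<Longrightarrow>
        eventually (\<lambda>n. r (fs n) < 1) sequentially"
  shows "bdd_above (r ` B)"
proof (rule ccontr)
  assume "\<not> bdd_above (r ` B)"
  then have "\<forall>n. \<exists>f\<in>B. r f > real (Suc n)" unfolding bdd_above_def by (metis image_iff not_le)
  then obtain f where f: "\<And>n. f n \<in> B" "\<And>n. r (f n) > real (Suc n)" by metis
  have fV: "f n \<in> vectors E" for n using B f(1) by (auto simp: bounded_in_def)
  define fs where "fs n = (\<lambda>x. of_real (inverse (real (Suc n))) * f n x)" for n
  have fsV: "fs n \<in> vectors E" for n unfolding fs_def by (intro fun_lcsD(4)[OF E] fV)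
  have "limitin (lcs_topology E) fs (\<lambda>x. 0) sequentially"
  proof (rule limitin_lcs_I[OF fun_lcs_triangle[OF E] fun_lcsD(2)[OF E] fsV])
    fix p assume p: "p \<in> seminorms E"
    then obtain K where K: "\<And>g. g \<in> B \<Longrightarrow> p g \<le> K" using B unfolding bounded_in_def bdd_above_def by (meson imageI)
    have "p (fs n - (\<lambda>x. 0)) \<le> K * inverse (real (Suc n))" for n
    proof -
      have "fs n - (\<lambda>x. 0) = fs n" by auto
      then have "p (fs n - (\<lambda>x. 0)) = inverse (real (Suc n)) * p (f n)"
        unfolding fs_def using fun_lcsD(6)[OF E p fV] by (simp only: norm_of_real) auto
      then show ?thesis using K[OF f(1)[of n]] by (simp add: divide_right_mono field_simps)
    qed
    moreover have "(\<lambda>n. K * inverse (real (Suc n))) \<longlonglongrightarrow> 0" using tendsto_mult_right_zero[OF LIMSEQ_inverse_real_of_nat] .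
    ultimately show "\<exists>r. (\<forall>j. p (fs j - (\<lambda>x. 0)) \<le> r j) \<and> (r \<longlongrightarrow> 0) sequentially"
      by (intro exI[of _ "\<lambda>n. K * inverse (real (Suc n))"] conjI allI)
  qed
  from cont[OF this] obtain n where "r (fs n) < 1" by (meson eventually_sequentially order_refl)
  moreover have "r (fs n) = inverse (real (Suc n)) * r (f n)" unfolding fs_def using hom[OF fV] by (simp only: norm_of_real) auto
  moreover have "inverse (real (Suc n)) * r (f n) > inverse (real (Suc n)) * real (Suc n)" by (intro mult_strict_left_mono f(2)) auto
  ultimately show False by simp
qed

lemma vectors_strong_dual [simp]: "vectors (strong_dual E) = dual_vectors E" by (simp add: strong_dual_def)

lemma vectors_Lin [simp]: "vectors (Lin E F) = lin_vectors E F" by (simp add: Lin_def)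

lemma dual_vectorsD:
  assumes "T \<in> dual_vectors E"
  shows "\<And>f g. f \<in> vectors E \<Longrightarrow> g \<in> vectors E \<Longrightarrow> T (\<lambda>x. f x + g x) = T f + T g"
    "\<And>c f. f \<in> vectors E \<Longrightarrow> T (\<lambda>x. c * f x) = c * T f"
    "continuous_map (lcs_topology E) euclidean T" "\<And>f. f \<notin> vectors E \<Longrightarrow> T f = 0" using assms unfolding dual_vectors_def by blast+

lemma lin_vectorsD:
  assumes "A \<in> lin_vectors E F"
  shows "\<And>f g. f \<in> vectors E \<Longrightarrow> g \<in> vectors E \<Longrightarrow> A (\<lambda>x. f x + g x) = (\<lambda>x. A f x + A g x)"
    "\<And>c f. f \<in> vectors E \<Longrightarrow> A (\<lambda>x. c * f x) = (\<lambda>x. c * A f x)"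
    "continuous_map (lcs_topology E) (lcs_topology F) A" "\<And>f. f \<notin> vectors E \<Longrightarrow> A f = (\<lambda>x. 0)"
  using assms unfolding lin_vectors_def by blast+

lemma lin_vectors_into:
  assumes "A \<in> lin_vectors E F" "fun_lcs E" "fun_lcs F"
  shows "A f \<in> vectors F"
proof (cases "f \<in> vectors E")
  case True
  then show ?thesis using continuous_map_image_subset_topspace[OF lin_vectorsD(3)[OF assms(1)]]
      topspace_lcs[OF fun_lcs_triangle[OF assms(2)]] topspace_lcs[OF fun_lcs_triangle[OF assms(3)]] by (simp add: image_subset_iff)
next
  case False
  then show ?thesis using lin_vectorsD(4)[OF assms(1)] fun_lcsD(2)[OF assms(3)] by simp
qed

lemma dual_vectors_minus:
  assumes "T \<in> dual_vectors E" "fun_lcs E" "f \<in> vectors E" "g \<in> vectors E"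
  shows "T (f - g) = T f - T g"
proof -
  have "T (\<lambda>x. f x + (-1) * g x) = T f + T (\<lambda>x. (-1) * g x)" by (intro dual_vectorsD(1)[OF assms(1)] fun_lcsD[OF assms(2)] assms)
  also have "T (\<lambda>x. (-1) * g x) = (-1) * T g" by (intro dual_vectorsD(2)[OF assms(1)] assms)
  finally show ?thesis unfolding fun_minus_eq by simp
qed

lemma dual_bdd:
  assumes E: "fun_lcs E" and T: "T \<in> dual_vectors E" and B: "bounded_in E B"
  shows "bdd_above ((\<lambda>f. cmod (T f)) ` B)"
proof (rule bounded_in_image_bdd[OF E B])
  show "cmod (T (\<lambda>x. c * f x)) = cmod c * cmod (T f)" if "f \<in> vectors E" for c f
    using dual_vectorsD(2)[OF T that] by (simp add: norm_mult)
  fix fs assume "limitin (lcs_topology E) fs (\<lambda>x. 0) sequentially"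
  from continuous_map_limit[OF dual_vectorsD(3)[OF T] this]
  have "(\<lambda>n. T (fs n)) \<longlonglongrightarrow> T (\<lambda>x. 0)" by (simp add: comp_def)
  moreover have "T (\<lambda>x. 0) = 0" using dual_vectorsD(2)[OF T fun_lcsD(2)[OF E], of 0] by simp
  ultimately have "(\<lambda>n. cmod (T (fs n))) \<longlonglongrightarrow> 0" by (simp add: tendsto_norm_zero)
  then show "eventually (\<lambda>n. cmod (T (fs n)) < 1) sequentially" by (rule order_tendstoD) simp
qed

lemma lin_bdd:
  assumes E: "fun_lcs E" and F: "fun_lcs F" and A: "A \<in> lin_vectors E F"
    and B: "bounded_in E B" and q: "q \<in> seminorms F"
  shows "bdd_above ((\<lambda>f. q (A f)) ` B)"
proof (rule bounded_in_image_bdd[OF E B])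
  show "q (A (\<lambda>x. c * f x)) = cmod c * q (A f)" if "f \<in> vectors E" for c f
    using lin_vectorsD(2)[OF A that] fun_lcsD(6)[OF F q lin_vectors_into[OF A E F]] by simp
  fix fs assume "limitin (lcs_topology E) fs (\<lambda>x. 0) sequentially"
  from continuous_map_limit[OF lin_vectorsD(3)[OF A] this]
  have "limitin (lcs_topology F) (\<lambda>n. A (fs n)) (A (\<lambda>x. 0)) sequentially" by (simp add: comp_def)
  moreover have "A (\<lambda>x. 0) = (\<lambda>x. 0)" using lin_vectorsD(2)[OF A fun_lcsD(2)[OF E], of 0] by simp
  ultimately have "\<forall>p\<in>seminorms F. \<forall>e>0. eventually (\<lambda>n. A (fs n) \<in> vectors F \<and> p (A (fs n) - (\<lambda>x. 0)) < e) sequentially"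
    unfolding limitin_lcs_iff[OF fun_lcs_triangle[OF F]] by simp
  from this[rule_format, OF q zero_less_one]
  have "eventually (\<lambda>n. A (fs n) \<in> vectors F \<and> q (A (fs n) - (\<lambda>x. 0)) < 1) sequentially" .
  moreover have "g - (\<lambda>x. 0) = g" for g :: "'b \<Rightarrow> complex" by auto
  ultimately show "eventually (\<lambda>n. q (A (fs n)) < 1) sequentially" by (auto elim: eventually_mono)
qed

lemma bounded_in_zero:
  assumes "fun_lcs E" shows "bounded_in E {\<lambda>x. 0}" using assms fun_lcsD(2)[OF assms] by (auto simp: bounded_in_def)

lemma bounded_in_sing:
  assumes "fun_lcs E" "f \<in> vectors E" shows "bounded_in E {f}" using assms by (auto simp: bounded_in_def)

lemma fun_lcs_strong_dual:
  assumes E: "fun_lcs E"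
  shows "fun_lcs (strong_dual E)" unfolding fun_lcs_def
proof (intro conjI ballI allI)
  show "seminorms (strong_dual E) \<noteq> {}" using bounded_in_zero[OF E] unfolding strong_dual_def by auto
  show "(\<lambda>x. 0) \<in> vectors (strong_dual E)" by (simp add: dual_vectors_def)
  fix T assume T: "T \<in> vectors (strong_dual E)"
  then have T': "T \<in> dual_vectors E" by simp
  note TD = dual_vectorsD[OF T']
  show cT: "(\<lambda>x. c * T x) \<in> vectors (strong_dual E)" for c
  proof -
    have "continuous_map (lcs_topology E) euclidean (\<lambda>x. c * T x)"
      using continuous_map_compose[OF TD(3), of euclidean "\<lambda>z. c * z"] by (simp add: comp_def continuous_on_mult_left)
    then show ?thesis by (auto simp: dual_vectors_def TD algebra_simps)
  qed
  fix p assume p: "p \<in> seminorms (strong_dual E)"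
  then obtain B where B: "bounded_in E B" "B \<noteq> {}" and p_eq: "p = (\<lambda>T. SUP f\<in>B. cmod (T f))" unfolding strong_dual_def by auto
  show "p (\<lambda>x. c * T x) = cmod c * p T" for c
  proof -
    \<comment> \<open>Multiplication by \<open>cmod c\<close> is monotone and continuous, so it
      commutes with the supremum of a nonempty bounded set; this covers \<open>c = 0\<close> as
      well.\<close>
    have "(\<lambda>r. cmod c * r) (Sup ((\<lambda>f. cmod (T f)) ` B)) = Sup ((\<lambda>r. cmod c * r) ` ((\<lambda>f. cmod (T f)) ` B))"
      by (rule continuous_at_Sup_mono)
        (use B dual_bdd[OF E T' B(1)] in \<open>auto intro!: mult_left_mono monoI continuous_intros\<close>)
    then show ?thesis unfolding p_eq by (simp add: norm_mult image_comp comp_def)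
  qed
  fix S assume "S \<in> vectors (strong_dual E)"
  then have S': "S \<in> dual_vectors E" by simp
  show "p (\<lambda>x. T x + S x) \<le> p T + p S" unfolding p_eq
  proof (rule cSUP_least[OF B(2)])
    fix f assume f: "f \<in> B"
    have "cmod (T f + S f) \<le> cmod (T f) + cmod (S f)" by (rule norm_triangle_ineq)
    also have "... \<le> (SUP f\<in>B. cmod (T f)) + (SUP f\<in>B. cmod (S f))" by (intro add_mono cSUP_upper f dual_bdd[OF E _ B(1)] T' S')
    finally show "cmod (T f + S f) \<le> (SUP f\<in>B. cmod (T f)) + (SUP f\<in>B. cmod (S f))" .
  qed
next
  fix T S assume "T \<in> vectors (strong_dual E)" "S \<in> vectors (strong_dual E)"
  then have T: "T \<in> dual_vectors E" and S: "S \<in> dual_vectors E" by auto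
  have "continuous_map (lcs_topology E) euclidean (\<lambda>x. T x + S x)" by (intro continuous_map_add dual_vectorsD(3) T S)
  then show "(\<lambda>x. T x + S x) \<in> vectors (strong_dual E)"
    by (auto simp: dual_vectors_def dual_vectorsD[OF T] dual_vectorsD[OF S] algebra_simps)
qed

lemma triangle_lcs_Lin:
  assumes E: "fun_lcs E" and F: "fun_lcs F"
  shows "triangle_lcs (Lin E F)" unfolding triangle_lcs_def
proof (intro conjI ballI)
  obtain q where "q \<in> seminorms F" using fun_lcsD(1)[OF F] by auto
  then show "seminorms (Lin E F) \<noteq> {}" using bounded_in_zero[OF E] unfolding Lin_def by auto
  fix p assume "p \<in> seminorms (Lin E F)"
  then obtain B q where B: "bounded_in E B" "B \<noteq> {}" and q: "q \<in> seminorms F"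
    and p_eq: "p = (\<lambda>A. SUP f\<in>B. q (A f))" unfolding Lin_def by auto
  fix a assume "a \<in> vectors (Lin E F)"
  then have a: "a \<in> lin_vectors E F" by simp
  have "(a - a) f = (\<lambda>x. 0)" for f by auto
  then show "p (a - a) = 0" unfolding p_eq using fun_lcs_zero[OF F q] B(2) by simp
  fix b c assume "b \<in> vectors (Lin E F)" "c \<in> vectors (Lin E F)"
  then have b: "b \<in> lin_vectors E F" and c: "c \<in> lin_vectors E F" by auto
  \<comment> \<open>A real supremum dominates the members only when the set is bounded above. For a
    difference of maps this follows from \<open>lin_bdd\<close> for each of them.\<close>
  have bd: "bdd_above ((\<lambda>f. q ((u - v) f)) ` B)" if u: "u \<in> lin_vectors E F" and v: "v \<in> lin_vectors E F" for u v
  proof -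
    obtain M where M: "\<And>f. f \<in> B \<Longrightarrow> q (u f) \<le> M" using lin_bdd[OF E F u B(1) q] by (auto simp: bdd_above_def)
    obtain N where N: "\<And>f. f \<in> B \<Longrightarrow> q (v f) \<le> N" using lin_bdd[OF E F v B(1) q] by (auto simp: bdd_above_def)
    have "q ((u - v) f) \<le> M + N" if "f \<in> B" for f
    proof -
      have "(u - v) f = (\<lambda>x. u f x + (-1) * v f x)" by auto
      then have "q ((u - v) f) \<le> q (u f) + q (\<lambda>x. (-1) * v f x)"
        using fun_lcsD(5)[OF F q lin_vectors_into[OF u E F] fun_lcsD(4)[OF F lin_vectors_into[OF v E F]], of f "-1" f] by simp
      also have "q (\<lambda>x. (-1) * v f x) = q (v f)" using fun_lcsD(6)[OF F q lin_vectors_into[OF v E F], of "-1"] by simp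
      finally show ?thesis using M[OF that] N[OF that] by linarith
    qed
    then show ?thesis by (auto simp: bdd_above_def)
  qed
  show "p (a - c) \<le> p (a - b) + p (b - c)" unfolding p_eq
  proof (rule cSUP_least[OF B(2)])
    fix f assume f: "f \<in> B"
    have "(a - c) f = (\<lambda>x. (a f - b f) x + (b f - c f) x)" by auto
    moreover have eq: "(u - v) f = u f - v f" for u v :: "('a \<Rightarrow> complex) \<Rightarrow> 'b \<Rightarrow> complex" by simp
    ultimately have "q ((a - c) f) \<le> q (a f - b f) + q (b f - c f)"
      using fun_lcsD(5)[OF F q fun_lcs_minus[OF F lin_vectors_into[OF a E F] lin_vectors_into[OF b E F]]
          fun_lcs_minus[OF F lin_vectors_into[OF b E F] lin_vectors_into[OF c E F]], of f f f f] by simp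
    also have "q (a f - b f) \<le> (SUP f\<in>B. q ((a - b) f))" using cSUP_upper[OF f bd[OF a b]] unfolding eq .
    also have "q (b f - c f) \<le> (SUP f\<in>B. q ((b - c) f))" using cSUP_upper[OF f bd[OF b c]] unfolding eq .
    finally show "q ((a - c) f) \<le> (SUP f\<in>B. q ((a - b) f)) + (SUP f\<in>B. q ((b - c) f))" by linarith
  qed
qed

section \<open>Continuity from estimates between seminorms\<close>

text \<open>Turns an estimate by a finite sum of seminorms into one radius that works for each of
  them.\<close>

lemma small_sum:
  assumes P: "finite P" and C: "C \<ge> (0::real)" and d: "d > 0"
  shows "\<exists>e>0. \<forall>x. (\<forall>p\<in>P. x p < e) \<longrightarrow> C * (\<Sum>p\<in>P. x p) < d"
\<comment> \<open>The summands 1 keep the denominator positive when \<open>C = 0\<close> or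
  \<open>P\<close> is empty; passing from \<open>C\<close> to \<open>C + 1\<close> makes the final
  inequality strict.\<close>
proof (intro exI[of _ "d / ((C + 1) * (real (card P) + 1))"] conjI allI impI)
  let ?e = "d / ((C + 1) * (real (card P) + 1))"
  show "?e > 0" using C d by (intro divide_pos_pos mult_pos_pos) auto
  fix x :: "'a \<Rightarrow> real" assume "\<forall>p\<in>P. x p < ?e"
  then have "(\<Sum>p\<in>P. x p) \<le> real (card P) * ?e" by (intro sum_bounded_above) auto
  then have "C * (\<Sum>p\<in>P. x p) \<le> C * (real (card P) * ?e)" using C by (intro mult_left_mono)
  also have "... \<le> C * ((real (card P) + 1) * ?e)" using C \<open>?e > 0\<close> by (intro mult_left_mono mult_right_mono) auto
  also have "... < (C + 1) * ((real (card P) + 1) * ?e)" by (intro mult_strict_right_mono mult_pos_pos \<open>?e > 0\<close>) auto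
  also have "... = d" using C d by (simp add: field_simps add_nonneg_eq_0_iff)
  finally show "C * (\<Sum>p\<in>P. x p) < d" .
qed

text \<open>\<open>A\<close> respects differences, so an estimate at the origin holds with the same
  constants around every point.\<close>

lemma continuous_map_lcsI:
  assumes E: "fun_lcs E" and F: "fun_lcs F" and into: "\<And>f. f \<in> vectors E \<Longrightarrow> A f \<in> vectors F"
    and minus: "\<And>f g. f \<in> vectors E \<Longrightarrow> g \<in> vectors E \<Longrightarrow> A (f - g) = A f - A g"
    and bound: "\<And>q. q \<in> seminorms F \<Longrightarrow> \<exists>P C. finite P \<and> P \<subseteq> seminorms E \<and> C \<ge> 0 \<and>
       (\<forall>f\<in>vectors E. q (A f) \<le> C * (\<Sum>p\<in>P. p f))"
  shows "continuous_map (lcs_topology E) (lcs_topology F) A" unfolding lcs_topology_def[of F]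
proof (rule continuous_on_generated_topo)
  note TE = topspace_lcs[OF fun_lcs_triangle[OF E]]
  note TF = topspace_lcs[OF fun_lcs_triangle[OF F]]
  show "A ` topspace (lcs_topology E) \<subseteq> \<Union> {{g \<in> vectors F. p (g - f) < e} |f p e. f \<in> vectors F \<and> p \<in> seminorms F \<and> 0 < e}"
    using into TF unfolding TE lcs_topology_def topology_generated_by_topspace by blast
  fix U assume "U \<in> {{g \<in> vectors F. p (g - f) < e} |f p e. f \<in> vectors F \<and> p \<in> seminorms F \<and> 0 < e}"
  then obtain h q e where U: "U = {g \<in> vectors F. q (g - h) < e}" and h: "h \<in> vectors F"
    and q: "q \<in> seminorms F" and e: "e > 0" by auto
  show "openin (lcs_topology E) (A -` U \<inter> topspace (lcs_topology E))"
  proof (rule openin_lcsI[OF fun_lcs_triangle[OF E]])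
    show "A -` U \<inter> topspace (lcs_topology E) \<subseteq> vectors E" by (simp add: TE)
    fix a assume "a \<in> A -` U \<inter> topspace (lcs_topology E)"
    then have a: "a \<in> vectors E" "q (A a - h) < e" by (auto simp: TE U)
    obtain P C where P: "finite P" "P \<subseteq> seminorms E" "C \<ge> 0"
      and b: "\<And>f. f \<in> vectors E \<Longrightarrow> q (A f) \<le> C * (\<Sum>p\<in>P. p f)" using bound[OF q] by auto
    obtain d where d: "d > 0"
      "\<And>x. (\<forall>p\<in>P. x p < d) \<Longrightarrow> C * (\<Sum>p\<in>P. x p) < e - q (A a - h)" using small_sum[OF P(1,3), of "e - q (A a - h)"] a by auto
    have "v \<in> A -` U \<inter> topspace (lcs_topology E)" if v: "v \<in> vectors E" "\<forall>p\<in>P. p (v - a) < d" for v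
    proof -
      have "q (A v - h) \<le> q (A v - A a) + q (A a - h)"
        using fun_lcs_triangle[OF F] q into[OF v(1)] into[OF a(1)] h unfolding triangle_lcs_def by blast
      also have "q (A v - A a) \<le> C * (\<Sum>p\<in>P. p (v - a))" using b[OF fun_lcs_minus[OF E v(1) a(1)]] minus[OF v(1) a(1)] by simp
      also have "... < e - q (A a - h)" using d(2)[of "\<lambda>p. p (v - a)"] v(2) by blast
      finally have "q (A v - h) < e" by linarith
      then show ?thesis using v into[OF v(1)] unfolding TE U by blast
    qed
    then show "\<exists>P e. finite P \<and> P \<subseteq> seminorms E \<and> e > 0 \<and>
       (\<forall>b\<in>vectors E. (\<forall>p\<in>P. p (b - a) < e) \<longrightarrow> b \<in> A -` U \<inter> topspace (lcs_topology E))" using P d(1) by blast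
  qed
qed

text \<open>The codomain of a functional is the complex plane with its own topology and not an
  \<open>lcs\<close>, hence a criterion separate from \<open>continuous_map_lcsI\<close>; the
  argument is the same.\<close>

lemma dual_vectorsI:
  assumes E: "fun_lcs E"
    and add: "\<And>f g. f \<in> vectors E \<Longrightarrow> g \<in> vectors E \<Longrightarrow> T (\<lambda>x. f x + g x) = T f + T g"
    and scale: "\<And>c f. f \<in> vectors E \<Longrightarrow> T (\<lambda>x. c * f x) = c * T f"
    and zero: "\<And>f. f \<notin> vectors E \<Longrightarrow> T f = 0"
    and P: "finite P" "P \<subseteq> seminorms E" "C \<ge> 0"
    and b: "\<And>f. f \<in> vectors E \<Longrightarrow> cmod (T f) \<le> C * (\<Sum>p\<in>P. p f)"
  shows "T \<in> dual_vectors E"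
proof -
  note TE = topspace_lcs[OF fun_lcs_triangle[OF E]]
  have minus: "T (f - g) = T f - T g" if "f \<in> vectors E" "g \<in> vectors E" for f g
  proof -
    have "T (\<lambda>x. f x + (-1) * g x) = T f + T (\<lambda>x. (-1) * g x)" by (intro add fun_lcsD[OF E] that)
    then show ?thesis unfolding fun_minus_eq using scale[OF that(2), of "-1"] by simp
  qed
  have "continuous_map (lcs_topology E) euclidean T" unfolding continuous_map_def
  proof (intro conjI allI impI)
    show "T \<in> topspace (lcs_topology E) \<rightarrow> topspace euclidean" by simp
    fix U :: "complex set" assume "openin euclidean U"
    then have U: "open U" by simp
    show "openin (lcs_topology E) {x \<in> topspace (lcs_topology E). T x \<in> U}"
    proof (rule openin_lcsI[OF fun_lcs_triangle[OF E]])
      show "{x \<in> topspace (lcs_topology E). T x \<in> U} \<subseteq> vectors E" by (auto simp: TE)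
      fix a assume "a \<in> {x \<in> topspace (lcs_topology E). T x \<in> U}"
      then have a: "a \<in> vectors E" "T a \<in> U" by (auto simp: TE)
      then obtain e where e: "e > 0" "ball (T a) e \<subseteq> U" using U open_contains_ball by blast
      obtain d where d: "d > 0" "\<And>x. (\<forall>p\<in>P. x p < d) \<Longrightarrow> C * (\<Sum>p\<in>P. x p) < e" using small_sum[OF P(1,3) e(1)] by auto
      have "v \<in> {x \<in> topspace (lcs_topology E). T x \<in> U}" if v: "v \<in> vectors E" "\<forall>p\<in>P. p (v - a) < d" for v
      proof -
        have "cmod (T v - T a) \<le> C * (\<Sum>p\<in>P. p (v - a))" using b[OF fun_lcs_minus[OF E v(1) a(1)]] minus[OF v(1) a(1)] by simp
        also have "... < e" using d(2)[of "\<lambda>p. p (v - a)"] v(2) by blast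
        finally have "T v \<in> ball (T a) e" by (simp add: dist_norm norm_minus_commute)
        then show ?thesis using v e by (auto simp: TE)
      qed
      then show "\<exists>P e. finite P \<and> P \<subseteq> seminorms E \<and> e > 0 \<and>
         (\<forall>b\<in>vectors E. (\<forall>p\<in>P. p (b - a) < e) \<longrightarrow> b \<in> {x \<in> topspace (lcs_topology E). T x \<in> U})" using P d(1) by blast
    qed
  qed
  then show ?thesis using add scale zero by (auto simp: dual_vectors_def)
qed

section \<open>Schwartz spaces\<close>

abbreviation has_dir_deriv :: "'a::euclidean_space \<Rightarrow> ('a \<Rightarrow> complex) \<Rightarrow> complex \<Rightarrow> 'a \<Rightarrow> bool" where
  "has_dir_deriv b f D x \<equiv> ((\<lambda>t. f (x + t *\<^sub>R b)) has_vector_derivative D) (at 0)"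

lemma dir_deriv_eqI: "has_dir_deriv b f D x \<Longrightarrow> dir_deriv b f x = D" unfolding dir_deriv_def by (rule vector_derivative_at)

lemma partial_deriv_Nil [simp]: "partial_deriv [] f = f"
  and partial_deriv_Cons [simp]: "partial_deriv (b # bs) f = dir_deriv b (partial_deriv bs f)"
  and partial_deriv_append: "partial_deriv (bs @ cs) f = partial_deriv bs (partial_deriv cs f)" by (simp_all add: partial_deriv_def)

lemma smooth_on_has_dir_deriv:
  assumes "smooth_on U f" "bs \<in> lists Basis" "b \<in> Basis" "x \<in> U"
  shows "has_dir_deriv b (partial_deriv bs f) (partial_deriv (b # bs) f x) x"
  using assms unfolding smooth_on_def partial_deriv_Cons dir_deriv_def by (auto intro: vector_derivative_works[THEN iffD1])

lemma has_dir_deriv_cong: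
  assumes "open U" "x \<in> U" "\<And>y. y \<in> U \<Longrightarrow> f y = g y" "has_dir_deriv b f D x"
  shows "has_dir_deriv b g D x"
proof -
  have "open ((\<lambda>t::real. x + t *\<^sub>R b) -` U)" by (intro open_vimage assms continuous_intros)
  moreover have "0 \<in> (\<lambda>t::real. x + t *\<^sub>R b) -` U" using assms by simp
  ultimately show ?thesis by (rule has_vector_derivative_transform_within_open[OF assms(4)]) (use assms(3) in auto)
qed

text \<open>The way in which iterated derivatives are computed: a candidate \<open>D bs\<close> is
  given for every list in advance, and only single derivatives have to be checked. Openness of
  \<open>U\<close> makes each derivative depend on the values in \<open>U\<close> alone.\<close>

lemma partial_deriv_family:
  assumes U: "open U" and D0: "\<And>x. x \<in> U \<Longrightarrow> f x = D [] x"
    and step: "\<And>bs b x. bs \<in> lists Basis \<Longrightarrow> b \<in> Basis \<Longrightarrow> x \<in> U \<Longrightarrow> has_dir_deriv b (D bs) (D (b # bs) x) x"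
    and bs: "bs \<in> lists Basis" and x: "x \<in> U"
  shows "partial_deriv bs f x = D bs x" using bs x
proof (induction bs arbitrary: x)
  case (Cons b bs)
  have "has_dir_deriv b (partial_deriv bs f) (D (b # bs) x) x"
    by (rule has_dir_deriv_cong[OF U Cons.prems, of "D bs"]) (use Cons step in auto)
  then show ?case by (simp add: dir_deriv_eqI)
qed (simp add: D0)

lemma abs_monomial_le: "\<bar>monomial k x\<bar> \<le> (1 + norm x) ^ (\<Sum>b\<in>Basis. k b)" for x :: "'a::euclidean_space"
proof -
  have "\<bar>monomial k x\<bar> = (\<Prod>b\<in>Basis. \<bar>x \<bullet> b\<bar> ^ k b)" by (simp add: monomial_def abs_prod power_abs)
  also have "... \<le> (\<Prod>b\<in>Basis. (1 + norm x) ^ k b)" by (intro prod_mono conjI power_mono) (auto intro: order_trans[OF Basis_le_norm])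
  finally show ?thesis by (simp add: power_sum)
qed

text \<open>Let \<open>M\<close> be the maximum of 1 and the moduli of the coordinates. Then
  \<open>1 + norm x\<close> is at most \<open>(1 + DIM('a)) * M\<close>, and \<open>M ^ m\<close> is
  either 1 or a single pure power. Finitely many monomials therefore dominate the radial
  weight.\<close>

lemma power_norm_le_monomials:
  fixes x :: "'a::euclidean_space"
  shows "(1 + norm x) ^ m \<le> (1 + real DIM('a)) ^ m *
     (\<bar>monomial (\<lambda>_. 0) x\<bar> + (\<Sum>b\<in>Basis. \<bar>monomial (\<lambda>c. if c = b then m else 0) x\<bar>))"
proof -
  define M where "M = Max (insert 1 ((\<lambda>b. \<bar>x \<bullet> b\<bar>) ` (Basis::'a set)))"
  have M1: "1 \<le> M" and Mb: "\<And>b. b \<in> Basis \<Longrightarrow> \<bar>x \<bullet> b\<bar> \<le> M" unfolding M_def by (intro Max_ge; simp)+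
  have "1 + norm x \<le> 1 + (\<Sum>b\<in>Basis. \<bar>x \<bullet> b\<bar>)" using norm_le_l1[of x] by simp
  also have "... \<le> M + (\<Sum>b\<in>(Basis::'a set). M)" using M1 Mb by (intro add_mono sum_mono) auto
  also have "... = (1 + real DIM('a)) * M" by (simp add: algebra_simps)
  finally have "(1 + norm x) ^ m \<le> ((1 + real DIM('a)) * M) ^ m" by (intro power_mono) auto
  also have "... = (1 + real DIM('a)) ^ m * M ^ m" by (simp add: power_mult_distrib)
  also have "M ^ m \<le> 1 + (\<Sum>b\<in>Basis. \<bar>x \<bullet> b\<bar> ^ m)"
  proof -
    have "M \<in> insert 1 ((\<lambda>b. \<bar>x \<bullet> b\<bar>) ` (Basis::'a set))" unfolding M_def by (intro Max_in) auto
    then consider "M = 1" | b where "b \<in> Basis" "M = \<bar>x \<bullet> b\<bar>" by auto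
    then show ?thesis
    proof cases
      case 1
      then show ?thesis by (simp add: sum_nonneg)
    next
      case 2
      then have "M ^ m \<le> (\<Sum>b\<in>Basis. \<bar>x \<bullet> b\<bar> ^ m)" by (auto intro!: member_le_sum)
      then show ?thesis by simp
    qed
  qed
  also have "(\<Sum>b\<in>Basis. \<bar>x \<bullet> b\<bar> ^ m) = (\<Sum>b\<in>Basis. \<bar>monomial (\<lambda>c. if c = b then m else 0) x\<bar>)"
  proof (intro sum.cong refl)
    fix b :: 'a assume b: "b \<in> Basis"
    have "monomial (\<lambda>c. if c = b then m else 0) x = (\<Prod>c\<in>Basis. if c = b then (x \<bullet> b) ^ m else 1)"
      unfolding monomial_def by (intro prod.cong) auto
    then show "\<bar>x \<bullet> b\<bar> ^ m = \<bar>monomial (\<lambda>c. if c = b then m else 0) x\<bar>" using b by (simp add: power_abs)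
  qed
  finally show ?thesis by (simp add: monomial_def)
qed

lemma vectors_schwartz [simp]: "vectors (schwartz U) = schwartz_functions U" by (simp add: schwartz_def)

definition schwartz_seminorm :: "'a::euclidean_space set \<Rightarrow> 'a mindex \<Rightarrow> 'a list \<Rightarrow> ('a \<Rightarrow> complex) \<Rightarrow> real" where
  "schwartz_seminorm U k bs f = (SUP x\<in>U. \<bar>monomial k x\<bar> * cmod (partial_deriv bs f x))"

lemma seminorms_schwartz:
  "seminorms (schwartz U) = {schwartz_seminorm U k bs | k bs. bs \<in> lists Basis}"
  by (simp add: schwartz_def schwartz_seminorm_def[abs_def])

lemma schwartz_functionsD:
  fixes f :: "'a::euclidean_space \<Rightarrow> complex" and k :: "'a mindex"
  assumes "f \<in> schwartz_functions U"
  shows "smooth_on U f" "bs \<in> lists Basis \<Longrightarrow> \<exists>g. continuous_on (closure U) g \<and> (\<forall>x \<in> U. g x = partial_deriv bs f x)"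
    "bs \<in> lists Basis \<Longrightarrow> bdd_above ((\<lambda>x. \<bar>monomial k x\<bar> * cmod (partial_deriv bs f x)) ` U)"
    "x \<notin> U \<Longrightarrow> f x = 0" using assms unfolding schwartz_functions_def mem_Collect_eq by metis+

lemma schwartz_seminorm_ge:
  fixes f :: "'a::euclidean_space \<Rightarrow> complex" and k :: "'a mindex"
  assumes "f \<in> schwartz_functions U" "bs \<in> lists Basis" "x \<in> U"
  shows "\<bar>monomial k x\<bar> * cmod (partial_deriv bs f x) \<le> schwartz_seminorm U k bs f" unfolding schwartz_seminorm_def
  using schwartz_functionsD(3)[OF assms(1,2)] assms(3) by (intro cSUP_upper) auto

lemma schwartz_seminorm_nonneg:
  assumes "f \<in> schwartz_functions U" "bs \<in> lists Basis" "U \<noteq> {}"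
  shows "0 \<le> schwartz_seminorm U k bs f"
proof -
  obtain x where x: "x \<in> U" using assms by auto
  have "\<bar>monomial k x\<bar> * cmod (partial_deriv bs f x) \<le> schwartz_seminorm U k bs f" by (rule schwartz_seminorm_ge[OF assms(1,2) x])
  then show ?thesis by (meson abs_ge_zero mult_nonneg_nonneg norm_ge_zero order_trans)
qed

text \<open>The common entrance to a Schwartz space: derivatives are supplied as a family, and decay
  is asked with powers of \<open>1 + norm x\<close>, which dominate all monomials.\<close>

lemma schwartz_functionsI:
  fixes f :: "'a::euclidean_space \<Rightarrow> complex"
  assumes U: "open U" and out: "\<And>x. x \<notin> U \<Longrightarrow> f x = 0" and D0: "\<And>x. x \<in> U \<Longrightarrow> f x = D [] x"
    and step: "\<And>bs b x. bs \<in> lists Basis \<Longrightarrow> b \<in> Basis \<Longrightarrow> x \<in> U \<Longrightarrow> has_dir_deriv b (D bs) (D (b # bs) x) x"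
    and cont: "\<And>bs. bs \<in> lists Basis \<Longrightarrow> \<exists>g. continuous_on (closure U) g \<and> (\<forall>x \<in> U. g x = D bs x)"
    and bound: "\<And>m bs. bs \<in> lists Basis \<Longrightarrow> \<exists>K. \<forall>x\<in>U. (1 + norm x) ^ m * cmod (D bs x) \<le> K"
  shows "f \<in> schwartz_functions U"
proof -
  have pd: "partial_deriv bs f x = D bs x" if "bs \<in> lists Basis" "x \<in> U" for bs x
    by (rule partial_deriv_family[where U = U]) (use assms that in auto)
  have ext: "\<exists>g. continuous_on (closure U) g \<and> (\<forall>x \<in> U. g x = partial_deriv bs f x)"
    if "bs \<in> lists Basis" for bs using cont[OF that] pd[OF that] by auto
  show ?thesis unfolding schwartz_functions_def smooth_on_def
  proof (intro CollectI conjI ballI allI impI)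
    fix bs :: "'a list" assume bs: "bs \<in> lists Basis"
    show "\<exists>g. continuous_on (closure U) g \<and> (\<forall>x \<in> U. g x = partial_deriv bs f x)" by (rule ext[OF bs])
    then obtain g where "continuous_on U g" "\<And>x. x \<in> U \<Longrightarrow> g x = partial_deriv bs f x" using continuous_on_subset closure_subset by metis
    then show "continuous_on U (partial_deriv bs f)" using continuous_on_cong by metis
    show "(\<lambda>t. partial_deriv bs f (x + t *\<^sub>R b)) differentiable at 0" if "b \<in> Basis" "x \<in> U" for b x
      using has_dir_deriv_cong[OF U that(2), of "D bs" "partial_deriv bs f", OF _ step[OF bs that]] pd[OF bs]
      by (auto simp: differentiableI_vector)
    fix k :: "'a mindex"
    obtain K where K: "\<And>x. x \<in> U \<Longrightarrow> (1 + norm x) ^ (\<Sum>b\<in>Basis. k b) * cmod (D bs x) \<le> K" using bound[OF bs] by blast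
    have "\<bar>monomial k x\<bar> * cmod (partial_deriv bs f x) \<le> K" if "x \<in> U" for x
    proof -
      have "\<bar>monomial k x\<bar> * cmod (partial_deriv bs f x) \<le> (1 + norm x) ^ (\<Sum>b\<in>Basis. k b) * cmod (D bs x)"
        unfolding pd[OF bs that] by (intro mult_right_mono abs_monomial_le) auto
      also have "... \<le> K" by (rule K[OF that])
      finally show ?thesis .
    qed
    then show "bdd_above ((\<lambda>x. \<bar>monomial k x\<bar> * cmod (partial_deriv bs f x)) ` U)" by (auto simp: bdd_above_def)
  qed (rule out)
qed

definition blists :: "nat \<Rightarrow> 'a::euclidean_space list set" where
  "blists m = {bs. set bs \<subseteq> Basis \<and> length bs \<le> m}"

lemma finite_blists [simp]: "finite (blists m)" unfolding blists_def by (rule finite_lists_length_le) simp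

lemma blists_lists: "bs \<in> blists m \<Longrightarrow> bs \<in> lists Basis" by (auto simp: blists_def)

lemma Nil_in_blists [simp]: "[] \<in> blists m" by (simp add: blists_def)

text \<open>An increasing sequence of norms that defines the topology of \<open>schwartz U\<close>.\<close>

definition snorm :: "'a::euclidean_space set \<Rightarrow> nat \<Rightarrow> ('a \<Rightarrow> complex) \<Rightarrow> real" where
  "snorm U m f = (SUP x\<in>U. (1 + norm x) ^ m * (\<Sum>bs\<in>blists m. cmod (partial_deriv bs f x)))"

lemma weighted_partial_deriv_le:
  fixes x :: "'a::euclidean_space"
  assumes "f \<in> schwartz_functions U" "bs \<in> lists Basis" "x \<in> U"
  shows "wderiv m bs f x \<le> (1 + real DIM('a)) ^ m *
     (schwartz_seminorm U (\<lambda>_. 0) bs f + (\<Sum>b\<in>Basis. schwartz_seminorm U (\<lambda>c. if c = b then m else 0) bs f))"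
proof -
  have "wderiv m bs f x \<le> (1 + real DIM('a)) ^ m *
     (\<bar>monomial (\<lambda>_. 0) x\<bar> + (\<Sum>b\<in>Basis. \<bar>monomial (\<lambda>c. if c = b then m else 0) x\<bar>)) * cmod (partial_deriv bs f x)"
    by (intro mult_right_mono power_norm_le_monomials) auto
  also have "... = (1 + real DIM('a)) ^ m * (\<bar>monomial (\<lambda>_. 0) x\<bar> * cmod (partial_deriv bs f x) +
     (\<Sum>b\<in>Basis. \<bar>monomial (\<lambda>c. if c = b then m else 0) x\<bar> * cmod (partial_deriv bs f x)))"
    by (simp add: algebra_simps sum_distrib_left)
  also have "... \<le> (1 + real DIM('a)) ^ m *
     (schwartz_seminorm U (\<lambda>_. 0) bs f + (\<Sum>b\<in>Basis. schwartz_seminorm U (\<lambda>c. if c = b then m else 0) bs f))"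
    by (intro mult_left_mono add_mono sum_mono schwartz_seminorm_ge assms) auto
  finally show ?thesis .
qed

lemma snorm_bound_sum:
  fixes x :: "'a::euclidean_space"
  assumes "f \<in> schwartz_functions U" "x \<in> U"
  shows "(1 + norm x) ^ m * (\<Sum>bs\<in>blists m. cmod (partial_deriv bs f x)) \<le> (1 + real DIM('a)) ^ m *
     (\<Sum>bs\<in>blists m. schwartz_seminorm U (\<lambda>_. 0) bs f + (\<Sum>b\<in>Basis. schwartz_seminorm U (\<lambda>c. if c = b then m else 0) bs f))"
proof -
  have "wderiv m bs f x \<le> (1 + real DIM('a)) ^ m *
     (schwartz_seminorm U (\<lambda>_. 0) bs f + (\<Sum>b\<in>Basis. schwartz_seminorm U (\<lambda>c. if c = b then m else 0) bs f))"
    if "bs \<in> blists m" for bs by (rule weighted_partial_deriv_le[OF assms(1) blists_lists[OF that] assms(2)])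
  then show ?thesis unfolding sum_distrib_left[of _ _ "blists m"] by (rule sum_mono)
qed

lemma snorm_ge_sum:
  assumes "f \<in> schwartz_functions U" "x \<in> U"
  shows "(1 + norm x) ^ m * (\<Sum>bs\<in>blists m. cmod (partial_deriv bs f x)) \<le> snorm U m f"
  unfolding snorm_def using snorm_bound_sum[OF assms(1), of _ m] assms(2) by (intro cSUP_upper) (auto simp: bdd_above_def)

lemma snorm_ge:
  assumes "f \<in> schwartz_functions U" "x \<in> U" "bs \<in> blists m"
  shows "wderiv m bs f x \<le> snorm U m f"
proof -
  have "cmod (partial_deriv bs f x) \<le> (\<Sum>bs\<in>blists m. cmod (partial_deriv bs f x))" by (rule member_le_sum[OF assms(3)]) auto
  then have "wderiv m bs f x \<le>
     (1 + norm x) ^ m * (\<Sum>bs\<in>blists m. cmod (partial_deriv bs f x))" by (intro mult_left_mono) auto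
  also note snorm_ge_sum[OF assms(1,2)]
  finally show ?thesis .
qed

lemma snorm_ge_cmod:
  assumes "f \<in> schwartz_functions U" "x \<in> U" "bs \<in> blists m"
  shows "cmod (partial_deriv bs f x) \<le> snorm U m f"
proof -
  have "1 * cmod (partial_deriv bs f x) \<le> wderiv m bs f x" by (intro mult_right_mono one_le_power) auto
  also note snorm_ge[OF assms]
  finally show ?thesis by simp
qed

lemma snorm_nonneg:
  assumes "f \<in> schwartz_functions U" "U \<noteq> {}"
  shows "0 \<le> snorm U m f"
proof -
  obtain x where "x \<in> U" using assms(2) by auto
  from snorm_ge_cmod[OF assms(1) this Nil_in_blists, of m] show ?thesis by (meson norm_ge_zero order_trans)
qed

lemma snorm_le:
  fixes f :: "'a::euclidean_space \<Rightarrow> complex"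
  assumes "U \<noteq> {}"
    and "\<And>x bs. x \<in> U \<Longrightarrow> bs \<in> blists m \<Longrightarrow> wderiv m bs f x \<le> K"
  shows "snorm U m f \<le> real (card (blists m :: 'a list set)) * K" unfolding snorm_def sum_distrib_left
  by (intro cSUP_least assms sum_bounded_above) auto

lemma seminorm_le_snorm:
  assumes p: "p \<in> seminorms (schwartz U)" and U: "U \<noteq> {}"
  shows "\<exists>m. \<forall>f\<in>schwartz_functions U. p f \<le> snorm U m f"
proof -
  obtain k bs where p: "p = schwartz_seminorm U k bs" and bs: "bs \<in> lists Basis" using p by (auto simp: seminorms_schwartz)
  \<comment> \<open>\<open>snorm\<close> uses a single index both for the power and for the order of
    differentiation, so it has to cover the degree of the monomial and the length of the
    list.\<close>
  define m where "m = max (\<Sum>b\<in>Basis. k b) (length bs)"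
  have "p f \<le> snorm U m f" if f: "f \<in> schwartz_functions U" for f unfolding p schwartz_seminorm_def
  proof (rule cSUP_least[OF U])
    fix x assume x: "x \<in> U"
    have "\<bar>monomial k x\<bar> * cmod (partial_deriv bs f x) \<le> (1 + norm x) ^ (\<Sum>b\<in>Basis. k b) * cmod (partial_deriv bs f x)"
      by (intro mult_right_mono abs_monomial_le) auto
    also have "... \<le> wderiv m bs f x" by (intro mult_right_mono power_increasing) (auto simp: m_def)
    also have "... \<le> snorm U m f" by (rule snorm_ge[OF f x]) (use bs in \<open>auto simp: blists_def m_def\<close>)
    finally show "\<bar>monomial k x\<bar> * cmod (partial_deriv bs f x) \<le> snorm U m f" .
  qed
  then show ?thesis by blast
qed

text \<open>Converse to \<open>seminorm_le_snorm\<close>: each family of seminorms dominates the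
  other, so continuity and boundedness can be decided with the sequence \<open>snorm U m\<close>
  alone.\<close>

lemma snorm_le_seminorms:
  fixes U :: "'a::euclidean_space set"
  assumes U: "U \<noteq> {}"
  shows "\<exists>P C. finite P \<and> P \<subseteq> seminorms (schwartz U) \<and> C \<ge> 0 \<and>
     (\<forall>f\<in>schwartz_functions U. snorm U m f \<le> C * (\<Sum>p\<in>P. p f))"
proof -
  \<comment> \<open>The exponents that occur in \<open>power_norm_le_monomials\<close>: the constant
    monomial and the pure powers of degree \<open>m\<close>.\<close>
  define K :: "'a mindex set" where "K = insert (\<lambda>_. 0) ((\<lambda>b c. if c = b then m else 0) ` Basis)"
  define P where "P = (\<lambda>(k, bs). schwartz_seminorm U k bs) ` (K \<times> blists m)"
  define C where "C = (1 + real DIM('a)) ^ m * (real (card (blists m :: 'a list set)) * (1 + real DIM('a)))"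
  have fin: "finite P" unfolding P_def K_def by simp
  have sub: "P \<subseteq> seminorms (schwartz U)" unfolding P_def seminorms_schwartz by (auto dest: blists_lists)
  have "snorm U m f \<le> C * (\<Sum>p\<in>P. p f)" if f: "f \<in> schwartz_functions U" for f
  proof -
    have nonneg: "0 \<le> p f" if "p \<in> P" for p using that unfolding P_def by (auto intro!: schwartz_seminorm_nonneg[OF f blists_lists U])
    have single: "schwartz_seminorm U k bs f \<le> (\<Sum>p\<in>P. p f)" if "k \<in> K" "bs \<in> blists m" for k bs
    proof -
      have "schwartz_seminorm U k bs \<in> P" unfolding P_def using that by (intro image_eqI[of _ _ "(k, bs)"]) auto
      then show ?thesis using nonneg fin by (intro member_le_sum[of _ P "\<lambda>p. p f"]) blast+
    qed
    have "snorm U m f \<le> (1 + real DIM('a)) ^ m * (\<Sum>bs\<in>(blists m :: 'a list set). schwartz_seminorm U (\<lambda>_. 0) bs f +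
        (\<Sum>b\<in>Basis. schwartz_seminorm U (\<lambda>c. if c = b then m else 0) bs f))"
      unfolding snorm_def by (intro cSUP_least U snorm_bound_sum f)
    also have "... \<le> (1 + real DIM('a)) ^ m * (\<Sum>bs\<in>(blists m :: 'a list set). (\<Sum>p\<in>P. p f) + (\<Sum>b\<in>(Basis :: 'a set). \<Sum>p\<in>P. p f))"
      by (intro mult_left_mono sum_mono add_mono single) (auto simp: K_def)
    also have "... = C * (\<Sum>p\<in>P. p f)" unfolding C_def by (simp add: algebra_simps)
    finally show ?thesis .
  qed
  moreover have "C \<ge> 0" unfolding C_def by simp
  ultimately show ?thesis using fin sub by blast
qed

lemma schwartz_add:
  assumes U: "open U" and f: "f \<in> schwartz_functions U" and g: "g \<in> schwartz_functions U"
  shows "(\<lambda>x. f x + g x) \<in> schwartz_functions U"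
    "bs \<in> lists Basis \<Longrightarrow> x \<in> U \<Longrightarrow> partial_deriv bs (\<lambda>x. f x + g x) x = partial_deriv bs f x + partial_deriv bs g x"
proof -
  let ?D = "\<lambda>bs x. partial_deriv bs f x + partial_deriv bs g x"
  have step: "has_dir_deriv b (?D bs) (?D (b # bs) x) x" if "bs \<in> lists Basis" "b \<in> Basis" "x \<in> U" for bs b x
    by (intro has_vector_derivative_add smooth_on_has_dir_deriv[OF schwartz_functionsD(1)[OF f]]
        smooth_on_has_dir_deriv[OF schwartz_functionsD(1)[OF g]] that)
  show "(\<lambda>x. f x + g x) \<in> schwartz_functions U"
  proof (rule schwartz_functionsI[where D = ?D, OF U _ _ step])
    fix bs :: "'a list" and m assume bs: "bs \<in> lists Basis"
    obtain f' g' where "continuous_on (closure U) f'" "\<forall>x\<in>U. f' x = partial_deriv bs f x"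
      "continuous_on (closure U) g'" "\<forall>x\<in>U. g' x = partial_deriv bs g x"
      using schwartz_functionsD(2)[OF f bs] schwartz_functionsD(2)[OF g bs] by metis
    then show "\<exists>h. continuous_on (closure U) h \<and> (\<forall>x\<in>U. h x = ?D bs x)"
      by (intro exI[of _ "\<lambda>x. f' x + g' x"]) (auto intro: continuous_intros)
    obtain Kf Kg where K: "\<And>x. x \<in> U \<Longrightarrow> wderiv m bs f x \<le> Kf"
      "\<And>x. x \<in> U \<Longrightarrow> wderiv m bs g x \<le> Kg" using weighted_partial_deriv_le[OF f bs] weighted_partial_deriv_le[OF g bs] by metis
    have "(1 + norm x) ^ m * cmod (?D bs x) \<le> Kf + Kg" if "x \<in> U" for x
    proof -
      have "(1 + norm x) ^ m * cmod (?D bs x) \<le> (1 + norm x) ^ m * (cmod (partial_deriv bs f x) + cmod (partial_deriv bs g x))"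
        by (intro mult_left_mono norm_triangle_ineq) auto
      then show ?thesis using K[OF that] by (simp add: algebra_simps)
    qed
    then show "\<exists>K. \<forall>x\<in>U. (1 + norm x) ^ m * cmod (?D bs x) \<le> K" by blast
  qed (use schwartz_functionsD(4)[OF f] schwartz_functionsD(4)[OF g] in auto)
  show "bs \<in> lists Basis \<Longrightarrow> x \<in> U \<Longrightarrow> partial_deriv bs (\<lambda>x. f x + g x) x = ?D bs x" by (rule partial_deriv_family[OF U _ step]) auto
qed

lemma schwartz_scale:
  assumes U: "open U" and f: "f \<in> schwartz_functions U"
  shows "(\<lambda>x. c * f x) \<in> schwartz_functions U"
    "bs \<in> lists Basis \<Longrightarrow> x \<in> U \<Longrightarrow> partial_deriv bs (\<lambda>x. c * f x) x = c * partial_deriv bs f x"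
proof -
  let ?D = "\<lambda>bs x. c * partial_deriv bs f x"
  have step: "has_dir_deriv b (?D bs) (?D (b # bs) x) x" if "bs \<in> lists Basis" "b \<in> Basis" "x \<in> U" for bs b x
    by (intro has_vector_derivative_mult_right smooth_on_has_dir_deriv[OF schwartz_functionsD(1)[OF f]] that)
  show "(\<lambda>x. c * f x) \<in> schwartz_functions U"
  proof (rule schwartz_functionsI[where D = ?D, OF U _ _ step])
    fix bs :: "'a list" and m assume bs: "bs \<in> lists Basis"
    obtain f' where "continuous_on (closure U) f'" "\<forall>x\<in>U. f' x = partial_deriv bs f x" using schwartz_functionsD(2)[OF f bs] by metis
    then show "\<exists>h. continuous_on (closure U) h \<and> (\<forall>x\<in>U. h x = ?D bs x)"
      by (intro exI[of _ "\<lambda>x. c * f' x"]) (auto intro: continuous_intros)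
    obtain Kf where K: "\<And>x. x \<in> U \<Longrightarrow> wderiv m bs f x \<le> Kf" using weighted_partial_deriv_le[OF f bs] by metis
    have "(1 + norm x) ^ m * cmod (?D bs x) \<le> cmod c * Kf" if "x \<in> U" for x
      using mult_left_mono[OF K[OF that], of "cmod c"] by (simp add: norm_mult algebra_simps)
    then show "\<exists>K. \<forall>x\<in>U. (1 + norm x) ^ m * cmod (?D bs x) \<le> K" by blast
  qed (use schwartz_functionsD(4)[OF f] in auto)
  show "bs \<in> lists Basis \<Longrightarrow> x \<in> U \<Longrightarrow> partial_deriv bs (\<lambda>x. c * f x) x = ?D bs x" by (rule partial_deriv_family[OF U _ step]) auto
qed

lemma schwartz_zero: "open U \<Longrightarrow> (\<lambda>x. 0) \<in> schwartz_functions U"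
  by (rule schwartz_functionsI[where D = "\<lambda>_ _. 0"]) (auto intro!: exI[of _ "\<lambda>_. 0"] exI[of _ 0])

lemma fun_lcs_schwartz:
  fixes U :: "'a::euclidean_space set"
  assumes U: "open U" "U \<noteq> {}"
  shows "fun_lcs (schwartz U)" unfolding fun_lcs_def vectors_schwartz
proof (intro conjI ballI allI)
  show "seminorms (schwartz U) \<noteq> {}" unfolding seminorms_schwartz using lists.Nil by blast
  show "(\<lambda>x. 0) \<in> schwartz_functions U" by (rule schwartz_zero[OF U(1)])
  fix f :: "'a \<Rightarrow> complex" assume f: "f \<in> schwartz_functions U"
  show "(\<lambda>x. c * f x) \<in> schwartz_functions U" for c by (rule schwartz_scale[OF U(1) f])
  show "(\<lambda>x. f x + g x) \<in> schwartz_functions U" if "g \<in> schwartz_functions U" for g by (rule schwartz_add[OF U(1) f that])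
  fix p assume "p \<in> seminorms (schwartz U)"
  then obtain k bs where p: "p = schwartz_seminorm U k bs" and bs: "bs \<in> lists Basis" by (auto simp: seminorms_schwartz)
  show "p (\<lambda>x. f x + g x) \<le> p f + p g" if g: "g \<in> schwartz_functions U" for g
    unfolding p schwartz_seminorm_def[of U k bs "\<lambda>x. f x + g x"]
  proof (rule cSUP_least[OF U(2)])
    fix x assume x: "x \<in> U"
    have "\<bar>monomial k x\<bar> * cmod (partial_deriv bs (\<lambda>x. f x + g x) x) \<le>
        \<bar>monomial k x\<bar> * (cmod (partial_deriv bs f x) + cmod (partial_deriv bs g x))"
      unfolding schwartz_add(2)[OF U(1) f g bs x] by (intro mult_left_mono norm_triangle_ineq) auto
    then show "\<bar>monomial k x\<bar> * cmod (partial_deriv bs (\<lambda>x. f x + g x) x) \<le>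
        schwartz_seminorm U k bs f + schwartz_seminorm U k bs g"
      using schwartz_seminorm_ge[OF f bs x, of k] schwartz_seminorm_ge[OF g bs x, of k] by (simp add: algebra_simps)
  qed
  have le: "schwartz_seminorm U k bs (\<lambda>x. c * h x) \<le> cmod c * schwartz_seminorm U k bs h"
    if h: "h \<in> schwartz_functions U" for c h unfolding schwartz_seminorm_def[of U k bs "\<lambda>x. c * h x"]
  proof (rule cSUP_least[OF U(2)])
    fix x assume x: "x \<in> U"
    show "\<bar>monomial k x\<bar> * cmod (partial_deriv bs (\<lambda>x. c * h x) x) \<le> cmod c * schwartz_seminorm U k bs h"
      unfolding schwartz_scale(2)[OF U(1) h bs x] norm_mult
      using mult_left_mono[OF schwartz_seminorm_ge[OF h bs x, of k], of "cmod c"] by (simp add: algebra_simps)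
  qed
  \<comment> \<open>\<open>le\<close> gives one inequality. The other is \<open>le\<close> for the
    scalar \<open>inverse c\<close> and the function \<open>c * f\<close>; the scalar 0 is settled
    by nonnegativity.\<close>
  show "p (\<lambda>x. c * f x) = cmod c * p f" for c unfolding p
  proof (cases "c = 0")
    case True
    have "schwartz_seminorm U k bs (\<lambda>x. 0 * f x) \<ge> 0" by (intro schwartz_seminorm_nonneg schwartz_scale U bs f)
    then show "schwartz_seminorm U k bs (\<lambda>x. c * f x) = cmod c * schwartz_seminorm U k bs f" using le[OF f, of 0] True by auto
  next
    case False
    have "schwartz_seminorm U k bs (\<lambda>x. inverse c * (c * f x)) \<le> cmod (inverse c) * schwartz_seminorm U k bs (\<lambda>x. c * f x)"
      by (intro le schwartz_scale U f)
    then have "cmod c * schwartz_seminorm U k bs f \<le> schwartz_seminorm U k bs (\<lambda>x. c * f x)"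
      using False by (simp add: mult.assoc[symmetric] norm_divide field_simps)
    then show "schwartz_seminorm U k bs (\<lambda>x. c * f x) = cmod c * schwartz_seminorm U k bs f" using le[OF f, of c] by simp
  qed
qed

lemma snorm_add:
  assumes U: "open U" "U \<noteq> {}" and f: "f \<in> schwartz_functions U" and g: "g \<in> schwartz_functions U"
  shows "snorm U m (\<lambda>x. f x + g x) \<le> snorm U m f + snorm U m g" unfolding snorm_def[of U m "\<lambda>x. f x + g x"]
proof (rule cSUP_least[OF U(2)])
  fix x assume x: "x \<in> U"
  have "(1 + norm x) ^ m * (\<Sum>bs\<in>blists m. cmod (partial_deriv bs (\<lambda>x. f x + g x) x)) \<le>
     (1 + norm x) ^ m * (\<Sum>bs\<in>blists m. cmod (partial_deriv bs f x) + cmod (partial_deriv bs g x))" by (intro mult_left_mono sum_mono)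
      (auto simp: schwartz_add(2)[OF U(1) f g blists_lists x] norm_triangle_ineq)
  then show "(1 + norm x) ^ m * (\<Sum>bs\<in>blists m. cmod (partial_deriv bs (\<lambda>x. f x + g x) x)) \<le> snorm U m f + snorm U m g"
    using snorm_ge_sum[OF f x, of m] snorm_ge_sum[OF g x, of m] by (simp add: sum.distrib algebra_simps)
qed

lemma snorm_scale_le:
  assumes U: "open U" "U \<noteq> {}" and f: "f \<in> schwartz_functions U"
  shows "snorm U m (\<lambda>x. c * f x) \<le> cmod c * snorm U m f" unfolding snorm_def[of U m "\<lambda>x. c * f x"]
proof (rule cSUP_least[OF U(2)])
  fix x assume x: "x \<in> U"
  have "(1 + norm x) ^ m * (\<Sum>bs\<in>blists m. cmod (partial_deriv bs (\<lambda>x. c * f x) x)) =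
     cmod c * ((1 + norm x) ^ m * (\<Sum>bs\<in>blists m. cmod (partial_deriv bs f x)))"
    by (simp add: schwartz_scale(2)[OF U(1) f blists_lists x] norm_mult sum_distrib_left mult_ac)
  then show "(1 + norm x) ^ m * (\<Sum>bs\<in>blists m. cmod (partial_deriv bs (\<lambda>x. c * f x) x)) \<le> cmod c * snorm U m f"
    using mult_left_mono[OF snorm_ge_sum[OF f x, of m], of "cmod c"] by (metis norm_ge_zero)
qed

lemma schwartz_sum:
  assumes U: "open U" and fin: "finite I" and F: "\<And>i. i \<in> I \<Longrightarrow> F i \<in> schwartz_functions U"
  shows "(\<lambda>x. \<Sum>i\<in>I. F i x) \<in> schwartz_functions U \<and>
    (\<forall>bs x. bs \<in> lists Basis \<longrightarrow> x \<in> U \<longrightarrow> partial_deriv bs (\<lambda>x. \<Sum>i\<in>I. F i x) x = (\<Sum>i\<in>I. partial_deriv bs (F i) x))" using fin F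
proof (induction I rule: finite_induct)
  case empty
  have "partial_deriv bs (\<lambda>x. 0) x = 0" if "bs \<in> lists Basis" "x \<in> U" for bs x
    using schwartz_scale(2)[OF U schwartz_zero[OF U] that, of 0] by simp
  then show ?case using schwartz_zero[OF U] by simp
next
  case (insert i I)
  then show ?case using schwartz_add[OF U, of "F i" "\<lambda>x. \<Sum>i\<in>I. F i x"] by simp
qed

lemma schwartz_minus:
  assumes U: "open U" and f: "f \<in> schwartz_functions U" and g: "g \<in> schwartz_functions U"
  shows "f - g \<in> schwartz_functions U"
    "bs \<in> lists Basis \<Longrightarrow> x \<in> U \<Longrightarrow> partial_deriv bs (f - g) x = partial_deriv bs f x - partial_deriv bs g x"
proof -
  show "f - g \<in> schwartz_functions U" unfolding fun_minus_eq by (intro schwartz_add schwartz_scale assms)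
  show "partial_deriv bs (f - g) x = partial_deriv bs f x - partial_deriv bs g x"
    if "bs \<in> lists Basis" "x \<in> U" unfolding fun_minus_eq
    using schwartz_add(2)[OF U f schwartz_scale(1)[OF U g] that, of "-1"] schwartz_scale(2)[OF U g that, of "-1"] by simp
qed

lemma bounded_in_schwartz_iff:
  fixes U :: "'a::euclidean_space set"
  assumes U: "open U" "U \<noteq> {}"
  shows "bounded_in (schwartz U) B \<longleftrightarrow> B \<subseteq> schwartz_functions U \<and> (\<forall>m. bdd_above (snorm U m ` B))"
proof
  assume B: "bounded_in (schwartz U) B"
  have sub: "B \<subseteq> schwartz_functions U" using B by (auto simp: bounded_in_def)
  moreover have "bdd_above (snorm U m ` B)" for m
  proof -
    obtain P C where P: "finite P" "P \<subseteq> seminorms (schwartz U)" "C \<ge> 0"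
      and b: "\<And>f. f \<in> schwartz_functions U \<Longrightarrow> snorm U m f \<le> C * (\<Sum>p\<in>P. p f)" using snorm_le_seminorms[OF U(2), of m] by blast
    have "\<forall>p\<in>P. \<exists>K. \<forall>f\<in>B. p f \<le> K" using B P(2) unfolding bounded_in_def bdd_above_def by blast
    then obtain K where K: "\<And>p f. p \<in> P \<Longrightarrow> f \<in> B \<Longrightarrow> p f \<le> K p" by metis
    have "snorm U m f \<le> C * (\<Sum>p\<in>P. K p)" if "f \<in> B" for f
    proof -
      have "snorm U m f \<le> C * (\<Sum>p\<in>P. p f)" using b sub that by blast
      also have "... \<le> C * (\<Sum>p\<in>P. K p)" by (intro mult_left_mono sum_mono K that P(3))
      finally show ?thesis .
    qed
    then show ?thesis by (auto simp: bdd_above_def)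
  qed
  ultimately show "B \<subseteq> schwartz_functions U \<and> (\<forall>m. bdd_above (snorm U m ` B))" by blast
next
  assume B: "B \<subseteq> schwartz_functions U \<and> (\<forall>m. bdd_above (snorm U m ` B))"
  show "bounded_in (schwartz U) B" unfolding bounded_in_def vectors_schwartz
  proof (intro conjI ballI)
    fix p assume "p \<in> seminorms (schwartz U)"
    then obtain m where m: "\<And>f. f \<in> schwartz_functions U \<Longrightarrow> p f \<le> snorm U m f" using seminorm_le_snorm[OF _ U(2)] by blast
    obtain K where "\<And>f. f \<in> B \<Longrightarrow> snorm U m f \<le> K" using B unfolding bdd_above_def by blast
    then have "p f \<le> K" if "f \<in> B" for f using m B that by (meson order_trans subsetD)
    then show "bdd_above (p ` B)" by (auto simp: bdd_above_def)
  qed (use B in blast)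
qed

lemma dual_schwartzI:
  fixes U :: "'a::euclidean_space set"
  assumes U: "open U" "U \<noteq> {}"
    and add: "\<And>f g. f \<in> schwartz_functions U \<Longrightarrow> g \<in> schwartz_functions U \<Longrightarrow> T (\<lambda>x. f x + g x) = T f + T g"
    and scale: "\<And>c f. f \<in> schwartz_functions U \<Longrightarrow> T (\<lambda>x. c * f x) = c * T f"
    and zero: "\<And>f. f \<notin> schwartz_functions U \<Longrightarrow> T f = 0"
    and b: "\<And>f. f \<in> schwartz_functions U \<Longrightarrow> cmod (T f) \<le> K * snorm U m f"
  shows "T \<in> dual_vectors (schwartz U)"
proof -
  obtain P C where P: "finite P" "P \<subseteq> seminorms (schwartz U)" "C \<ge> 0"
    and b': "\<And>f. f \<in> schwartz_functions U \<Longrightarrow> snorm U m f \<le> C * (\<Sum>p\<in>P. p f)" using snorm_le_seminorms[OF U(2), of m] by blast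
  \<comment> \<open>The constant \<open>K\<close> of the hypothesis carries no sign, whereas the
    criterion wants a nonnegative one.\<close>
  have "cmod (T f) \<le> (\<bar>K\<bar> * C) * (\<Sum>p\<in>P. p f)" if f: "f \<in> schwartz_functions U" for f
  proof -
    have "cmod (T f) \<le> \<bar>K\<bar> * snorm U m f" using b[OF f] mult_right_mono[OF abs_ge_self[of K] snorm_nonneg[OF f U(2), of m]] by linarith
    also have "... \<le> \<bar>K\<bar> * (C * (\<Sum>p\<in>P. p f))" by (intro mult_left_mono b' f) auto
    finally show ?thesis by simp
  qed
  then show ?thesis by (intro dual_vectorsI[OF fun_lcs_schwartz[OF U], of T P "\<bar>K\<bar> * C"]) (use assms P in auto)
qed

lemma lin_schwartzI:
  fixes U :: "'a::euclidean_space set" and V :: "'b::euclidean_space set"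
  assumes U: "open U" "U \<noteq> {}" and V: "open V" "V \<noteq> {}"
    and into: "\<And>f. f \<in> schwartz_functions U \<Longrightarrow> A f \<in> schwartz_functions V"
    and add: "\<And>f g. f \<in> schwartz_functions U \<Longrightarrow> g \<in> schwartz_functions U \<Longrightarrow> A (\<lambda>x. f x + g x) = (\<lambda>x. A f x + A g x)"
    and scale: "\<And>c f. f \<in> schwartz_functions U \<Longrightarrow> A (\<lambda>x. c * f x) = (\<lambda>x. c * A f x)"
    and zero: "\<And>f. f \<notin> schwartz_functions U \<Longrightarrow> A f = (\<lambda>x. 0)"
    and b: "\<And>m. \<exists>K m'. \<forall>f\<in>schwartz_functions U. snorm V m (A f) \<le> K * snorm U m' f"
  shows "A \<in> lin_vectors (schwartz U) (schwartz V)"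
proof -
  have minus: "A (f - g) = A f - A g" if "f \<in> schwartz_functions U" "g \<in> schwartz_functions U" for f g
    unfolding fun_minus_eq using add[OF that(1) schwartz_scale(1)[OF U(1) that(2)], of "-1"] scale[OF that(2), of "-1"] by simp
  have "continuous_map (lcs_topology (schwartz U)) (lcs_topology (schwartz V)) A"
  proof (rule continuous_map_lcsI[OF fun_lcs_schwartz[OF U] fun_lcs_schwartz[OF V]])
    fix q assume "q \<in> seminorms (schwartz V)"
    then obtain m where m: "\<And>f. f \<in> schwartz_functions V \<Longrightarrow> q f \<le> snorm V m f" using seminorm_le_snorm[OF _ V(2)] by blast
    obtain K m' where K: "\<And>f. f \<in> schwartz_functions U \<Longrightarrow> snorm V m (A f) \<le> K * snorm U m' f" using b by blast
    obtain P C where P: "finite P" "P \<subseteq> seminorms (schwartz U)" "C \<ge> 0"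
      and b': "\<And>f. f \<in> schwartz_functions U \<Longrightarrow> snorm U m' f \<le> C * (\<Sum>p\<in>P. p f)" using snorm_le_seminorms[OF U(2), of m'] by blast
    have "q (A f) \<le> (\<bar>K\<bar> * C) * (\<Sum>p\<in>P. p f)" if f: "f \<in> schwartz_functions U" for f
    proof -
      have "q (A f) \<le> K * snorm U m' f" using m[OF into[OF f]] K[OF f] by linarith
      also have "... \<le> \<bar>K\<bar> * snorm U m' f" using snorm_nonneg[OF f U(2)] by (intro mult_right_mono) auto
      also have "... \<le> \<bar>K\<bar> * (C * (\<Sum>p\<in>P. p f))" by (intro mult_left_mono b' f) auto
      finally show ?thesis by simp
    qed
    then show "\<exists>P C. finite P \<and> P \<subseteq> seminorms (schwartz U) \<and> C \<ge> 0 \<and>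
       (\<forall>f\<in>vectors (schwartz U). q (A f) \<le> C * (\<Sum>p\<in>P. p f))" using P by (intro exI[of _ P] exI[of _ "\<bar>K\<bar> * C"]) auto
  qed (use into minus in auto)
  then show ?thesis using add scale zero by (auto simp: lin_vectors_def)
qed

section \<open>Derivatives, coordinate multiplication and series in the Schwartz space\<close>

lemma continuous_on_partial_deriv:
  assumes "f \<in> S_funs" "bs \<in> lists Basis"
  shows "continuous_on UNIV (partial_deriv bs f)" using schwartz_functionsD(1)[OF assms(1)] assms(2) by (auto simp: smooth_on_def)

text \<open>Appending \<open>b\<close> at the end of a list means differentiating along
  \<open>b\<close> before anything else, so derivatives never have to be interchanged. The price is
  one order of the norm.\<close>

lemma schwartz_dir_deriv:
  fixes f :: "'a::euclidean_space \<Rightarrow> complex"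
  assumes f: "f \<in> S_funs" and b: "b \<in> Basis"
  shows "dir_deriv b f \<in> S_funs"
    "snorm UNIV m (dir_deriv b f) \<le> real (card (blists m :: 'a list set)) * snorm UNIV (Suc m) f"
proof -
  have D: "partial_deriv bs (dir_deriv b f) = partial_deriv (bs @ [b]) f" for bs :: "'a list" by (simp add: partial_deriv_append)
  show "dir_deriv b f \<in> S_funs"
  proof (rule schwartz_functionsI[where D = "\<lambda>bs. partial_deriv (bs @ [b]) f"])
    fix bs :: "'a list" and m assume bs: "bs \<in> lists Basis"
    then have bs': "bs @ [b] \<in> lists Basis" using b by auto
    show "\<exists>g. continuous_on (closure UNIV) g \<and> (\<forall>x\<in>UNIV. g x = partial_deriv (bs @ [b]) f x)"
      using continuous_on_partial_deriv[OF f bs'] by (intro exI[of _ "partial_deriv (bs @ [b]) f"]) simp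
    show "\<exists>K. \<forall>x\<in>UNIV. (1 + norm x) ^ m * cmod (partial_deriv (bs @ [b]) f x) \<le> K" using weighted_partial_deriv_le[OF f bs'] by blast
    show "has_dir_deriv c (partial_deriv (bs @ [b]) f) (partial_deriv ((c # bs) @ [b]) f x) x" if "c \<in> Basis" for c x
      using smooth_on_has_dir_deriv[OF schwartz_functionsD(1)[OF f] bs' that] by simp
  qed auto
  show "snorm UNIV m (dir_deriv b f) \<le> real (card (blists m :: 'a list set)) * snorm UNIV (Suc m) f"
  proof (rule snorm_le)
    fix x :: 'a and bs :: "'a list" assume bs: "bs \<in> blists m"
    have "(1 + norm x) ^ m * cmod (partial_deriv (bs @ [b]) f x) \<le> (1 + norm x) ^ Suc m * cmod (partial_deriv (bs @ [b]) f x)"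
      by (intro mult_right_mono power_increasing) auto
    also have "... \<le> snorm UNIV (Suc m) f" by (rule snorm_ge[OF f]) (use bs b in \<open>auto simp: blists_def\<close>)
    finally show "wderiv m bs (dir_deriv b f) x \<le> snorm UNIV (Suc m) f" unfolding D .
  qed simp
qed

text \<open>All lists obtained by deleting one occurrence of \<open>b\<close>. They index the
  Leibniz rule for a coordinate function: differentiating \<open>(x \<bullet> b) * f x\<close> along
  \<open>bs\<close> gives \<open>x \<bullet> b\<close> times the derivative of \<open>f\<close> plus
  one term per occurrence of \<open>b\<close>, since the coordinate has derivative 1 along
  \<open>b\<close> and 0 along the other basis vectors.\<close>

primrec del_one :: "'a \<Rightarrow> 'a list \<Rightarrow> 'a list list" where
  "del_one b [] = []"
| "del_one b (c # bs) = map ((#) c) (del_one b bs) @ (if c = b then [bs] else [])"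

lemma length_del_one_le: "length (del_one b bs) \<le> length bs" by (induction bs) auto

lemma del_one_blists: "bs \<in> blists m \<Longrightarrow> l \<in> set (del_one b bs) \<Longrightarrow> l \<in> blists m"
proof (induction bs arbitrary: l m)
  case (Cons c bs)
  from Cons.prems(1) have c: "c \<in> Basis" and bs: "bs \<in> blists (m - 1)" and m: "m \<ge> 1" by (auto simp: blists_def)
  from Cons.prems(2) consider l' where "l' \<in> set (del_one b bs)" "l = c # l'" | "l = bs" by (auto split: if_splits)
  then show ?case
  proof cases
    case 1
    have "l' \<in> blists (m - 1)" by (rule Cons.IH[OF bs 1(1)])
    then show ?thesis using 1(2) c m by (auto simp: blists_def)
  next
    case 2
    then show ?thesis using bs by (auto simp: blists_def)
  qed
qed simp

lemma has_dir_deriv_sum_list: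
  assumes "\<And>l. l \<in> set ls \<Longrightarrow> has_dir_deriv c (g l) (g' l) x"
  shows "has_dir_deriv c (\<lambda>x. \<Sum>l\<leftarrow>ls. g l x) (\<Sum>l\<leftarrow>ls. g' l) x" using assms
proof (induction ls)
  case (Cons l ls)
  then show ?case by (auto intro!: has_vector_derivative_add)
qed auto

lemma has_dir_deriv_coord:
  assumes "has_dir_deriv c g D x"
  shows "has_dir_deriv c (\<lambda>x. of_real (x \<bullet> b) * g x) (of_real (c \<bullet> b) * g x + of_real (x \<bullet> b) * D) x"
proof -
  have "((\<lambda>t. complex_of_real ((x + t *\<^sub>R c) \<bullet> b)) has_vector_derivative of_real (c \<bullet> b)) (at 0)"
    by (auto simp: inner_add_left intro!: derivative_eq_intros)
  from has_vector_derivative_mult[OF this assms] show ?thesis by (simp add: algebra_simps)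
qed

lemma norm_sum_list_le: "norm (\<Sum>l\<leftarrow>ls. g l :: 'b::real_normed_vector) \<le> (\<Sum>l\<leftarrow>ls. norm (g l))"
  by (induction ls) (auto intro: norm_triangle_le)

lemma sum_list_le_const: "(\<And>l. l \<in> set ls \<Longrightarrow> g l \<le> K) \<Longrightarrow> (\<Sum>l\<leftarrow>ls. g l :: real) \<le> real (length ls) * K"
  by (induction ls) (auto simp: algebra_simps intro: add_mono)

lemma schwartz_coord_mult:
  fixes f :: "'a::euclidean_space \<Rightarrow> complex"
  assumes f: "f \<in> S_funs" and b: "b \<in> Basis"
  shows "(\<lambda>x. of_real (x \<bullet> b) * f x) \<in> S_funs"
    "snorm UNIV m (\<lambda>x. of_real (x \<bullet> b) * f x) \<le>
       real (card (blists m :: 'a list set)) * ((1 + real m) * snorm UNIV (Suc m) f)"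
proof -
  let ?D = "\<lambda>bs x. of_real (x \<bullet> b) * partial_deriv bs f x + (\<Sum>l\<leftarrow>del_one b bs. partial_deriv l f x)"
  have del: "l \<in> lists Basis" if "bs \<in> lists Basis" "l \<in> set (del_one b bs)" for bs l
    using del_one_blists[of bs "length bs" l b] that by (auto simp: blists_def)
  have step: "has_dir_deriv c (?D bs) (?D (c # bs) x) x" if bs: "bs \<in> lists Basis" and c: "c \<in> Basis" for bs c x
  proof -
    have 1: "has_dir_deriv c (partial_deriv l f) (partial_deriv (c # l) f x) x" if "l \<in> lists Basis" for l
      by (rule smooth_on_has_dir_deriv[OF schwartz_functionsD(1)[OF f] that c]) simp
    have "has_dir_deriv c (?D bs) ((of_real (c \<bullet> b) * partial_deriv bs f x + of_real (x \<bullet> b) * partial_deriv (c # bs) f x)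
       + (\<Sum>l\<leftarrow>del_one b bs. partial_deriv (c # l) f x)) x"
      by (rule has_vector_derivative_add[OF has_dir_deriv_coord[OF 1[OF bs]] has_dir_deriv_sum_list[OF 1[OF del[OF bs]]]])
    also have "(of_real (c \<bullet> b) * partial_deriv bs f x + of_real (x \<bullet> b) * partial_deriv (c # bs) f x)
       + (\<Sum>l\<leftarrow>del_one b bs. partial_deriv (c # l) f x) = ?D (c # bs) x" using b c by (auto simp: inner_Basis comp_def)
    finally show ?thesis .
  qed
  have bound: "(1 + norm x) ^ m * cmod (?D bs x) \<le> (1 + real m) * snorm UNIV (Suc m) f" if bs: "bs \<in> blists m" for m bs x
  proof -
    have bs': "bs \<in> blists (Suc m)" using bs by (auto simp: blists_def)
    have xb: "\<bar>x \<bullet> b\<bar> \<le> 1 + norm x" using Basis_le_norm[OF b, of x] by linarith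
    have "cmod (?D bs x) \<le> cmod (of_real (x \<bullet> b) * partial_deriv bs f x) + cmod (\<Sum>l\<leftarrow>del_one b bs. partial_deriv l f x)"
      by (rule norm_triangle_ineq)
    also have "... \<le> (1 + norm x) * cmod (partial_deriv bs f x) + (\<Sum>l\<leftarrow>del_one b bs. cmod (partial_deriv l f x))"
      unfolding norm_mult norm_of_real by (intro add_mono norm_sum_list_le mult_right_mono xb norm_ge_zero)
    finally have "(1 + norm x) ^ m * cmod (?D bs x) \<le> (1 + norm x) ^ m * \<dots>" by (intro mult_left_mono) auto
    also have "... = (1 + norm x) ^ Suc m * cmod (partial_deriv bs f x) + (\<Sum>l\<leftarrow>del_one b bs. (1 + norm x) ^ m * cmod (partial_deriv l f x))"
      unfolding sum_list_const_mult by (simp add: algebra_simps)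
    also have "... \<le> snorm UNIV (Suc m) f + real (length (del_one b bs)) * snorm UNIV (Suc m) f"
    proof (intro add_mono sum_list_le_const snorm_ge f bs')
      fix l assume l: "l \<in> set (del_one b bs)"
      have "(1 + norm x) ^ m * cmod (partial_deriv l f x) \<le> (1 + norm x) ^ Suc m * cmod (partial_deriv l f x)"
        by (intro mult_right_mono power_increasing) auto
      also have "... \<le> snorm UNIV (Suc m) f" by (rule snorm_ge[OF f]) (use del_one_blists[OF bs' l] in auto)
      finally show "(1 + norm x) ^ m * cmod (partial_deriv l f x) \<le> snorm UNIV (Suc m) f" .
    qed auto
    \<comment> \<open>A list of length at most \<open>m\<close> contains at most \<open>m\<close>
      occurrences of \<open>b\<close>.\<close>
    also have "... \<le> snorm UNIV (Suc m) f + real m * snorm UNIV (Suc m) f"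
      using length_del_one_le[of b bs] bs snorm_nonneg[OF f, of "Suc m"] by (intro add_mono mult_right_mono) (auto simp: blists_def)
    finally show ?thesis by (simp add: algebra_simps)
  qed
  show "(\<lambda>x. of_real (x \<bullet> b) * f x) \<in> S_funs"
  proof (rule schwartz_functionsI[where D = ?D])
    fix bs :: "'a list" and m assume bs: "bs \<in> lists Basis"
    have "continuous_on UNIV (?D bs)"
    proof (intro continuous_intros continuous_on_partial_deriv f bs)
      have "continuous_on UNIV (\<lambda>x. \<Sum>l\<leftarrow>ls. partial_deriv l f x)" if "\<And>l. l \<in> set ls \<Longrightarrow> l \<in> lists Basis" for ls using that
      proof (induction ls)
        case (Cons l ls)
        then show ?case by (auto intro!: continuous_intros continuous_on_partial_deriv f)
      qed auto
      then show "continuous_on UNIV (\<lambda>x. \<Sum>l\<leftarrow>del_one b bs. partial_deriv l f x)" using del[OF bs] by blast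
    qed
    then show "\<exists>g. continuous_on (closure UNIV) g \<and> (\<forall>x\<in>UNIV. g x = ?D bs x)" by auto
    have "(1 + norm x) ^ m * cmod (?D bs x) \<le> (1 + real (max m (length bs))) * snorm UNIV (Suc (max m (length bs))) f" for x
    proof -
      have "(1 + norm x) ^ m * cmod (?D bs x) \<le> (1 + norm x) ^ (max m (length bs)) * cmod (?D bs x)"
        by (intro mult_right_mono power_increasing) auto
      also have "... \<le> (1 + real (max m (length bs))) * snorm UNIV (Suc (max m (length bs))) f"
        by (rule bound) (use bs in \<open>auto simp: blists_def\<close>)
      finally show ?thesis .
    qed
    then show "\<exists>K. \<forall>x\<in>UNIV. (1 + norm x) ^ m * cmod (?D bs x) \<le> K" by blast
  qed (use step in auto)
  have pd: "partial_deriv bs (\<lambda>x. of_real (x \<bullet> b) * f x) x = ?D bs x" if "bs \<in> lists Basis" for bs x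
    by (rule partial_deriv_family[where U = UNIV and D = ?D]) (use that step in auto)
  show "snorm UNIV m (\<lambda>x. of_real (x \<bullet> b) * f x) \<le>
       real (card (blists m :: 'a list set)) * ((1 + real m) * snorm UNIV (Suc m) f)"
    by (rule snorm_le) (simp_all only: UNIV_not_empty not_False_eq_True pd[OF blists_lists] bound)
qed

text \<open>\<open>has_dir_deriv\<close> speaks of the parameter 0 only; moving the base point along
  the line gives the derivative at every parameter.\<close>

lemma has_dir_deriv_line:
  assumes "has_dir_deriv b f D (x + t *\<^sub>R b)"
  shows "((\<lambda>t. f (x + t *\<^sub>R b)) has_vector_derivative D) (at t)"
proof -
  have "((\<lambda>s. f (x + (t + s) *\<^sub>R b)) has_vector_derivative D) (at 0)" using assms by (simp add: algebra_simps)
  then have "((\<lambda>s. f (x + (t + s) *\<^sub>R b)) \<circ> (\<lambda>s. s - t) has_vector_derivative 1 *\<^sub>R D) (at t)"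
    by (intro vector_diff_chain_at) (auto intro!: derivative_eq_intros)
  then show ?thesis by (simp add: comp_def)
qed

text \<open>Termwise differentiation on the line through \<open>x\<close> in direction
  \<open>b\<close>. The majorant \<open>M\<close> is uniform in the point, so the series of
  derivatives converges uniformly by the Weierstrass test.\<close>

lemma has_dir_deriv_series:
  fixes f :: "nat \<Rightarrow> 'a::euclidean_space \<Rightarrow> complex"
  assumes f: "\<And>n x. has_dir_deriv b (f n) (f' n x) x"
    and M: "summable M" "\<And>n x. cmod (f' n x) \<le> M n" and s: "\<And>x. summable (\<lambda>n. f n x)"
  shows "has_dir_deriv b (\<lambda>x. \<Sum>n. f n x) (\<Sum>n. f' n x) x"
proof -
  have ul: "uniform_limit UNIV (\<lambda>n x. \<Sum>i<n. f' i x) (\<lambda>x. \<Sum>i. f' i x) sequentially" by (rule Weierstrass_m_test[OF M(2) M(1)])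
  have "\<exists>g. \<forall>t\<in>UNIV. (\<lambda>n. f n (x + t *\<^sub>R b)) sums g t \<and>
     (g has_derivative (\<lambda>h. h *\<^sub>R (\<Sum>n. f' n (x + t *\<^sub>R b)))) (at t within UNIV)"
  proof (rule has_derivative_series[where f' = "\<lambda>n t h. h *\<^sub>R f' n (x + t *\<^sub>R b)" and x = 0])
    fix e :: real assume "e > 0"
    then have "\<forall>\<^sub>F n in sequentially. \<forall>y\<in>UNIV. dist (\<Sum>i<n. f' i y) (\<Sum>i. f' i y) < e" using ul unfolding uniform_limit_iff by blast
    then show "\<forall>\<^sub>F n in sequentially. \<forall>t\<in>UNIV. \<forall>h. norm ((\<Sum>i<n. h *\<^sub>R f' i (x + t *\<^sub>R b)) - h *\<^sub>R (\<Sum>n. f' n (x + t *\<^sub>R b))) \<le> e * norm h"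
    proof (rule eventually_mono, intro ballI allI)
      fix n and t h :: real
      assume *: "\<forall>y\<in>UNIV. dist (\<Sum>i<n. f' i y) (\<Sum>i. f' i y) < e"
      have "norm ((\<Sum>i<n. h *\<^sub>R f' i (x + t *\<^sub>R b)) - h *\<^sub>R (\<Sum>n. f' n (x + t *\<^sub>R b))) =
         \<bar>h\<bar> * dist (\<Sum>i<n. f' i (x + t *\<^sub>R b)) (\<Sum>n. f' n (x + t *\<^sub>R b))"
        by (simp add: dist_norm scaleR_sum_right[symmetric] scaleR_diff_right[symmetric])
      also have "... \<le> \<bar>h\<bar> * e" using * by (intro mult_left_mono) (auto intro: less_imp_le)
      finally show "norm ((\<Sum>i<n. h *\<^sub>R f' i (x + t *\<^sub>R b)) - h *\<^sub>R (\<Sum>n. f' n (x + t *\<^sub>R b))) \<le> e * norm h" by (simp add: mult.commute)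
    qed
  next
    show "(\<lambda>n. f n (x + 0 *\<^sub>R b)) sums (\<Sum>n. f n x)" using summable_sums[OF s] by simp
    show "((\<lambda>t. f n (x + t *\<^sub>R b)) has_derivative (\<lambda>h. h *\<^sub>R f' n (x + t *\<^sub>R b))) (at t within UNIV)" for n t
      using has_dir_deriv_line[OF f] by (simp add: has_vector_derivative_def comp_def)
  qed (auto simp: comp_def)
  then obtain g where g: "\<And>t. (\<lambda>n. f n (x + t *\<^sub>R b)) sums g t"
    "\<And>t. (g has_vector_derivative (\<Sum>n. f' n (x + t *\<^sub>R b))) (at t)" by (auto simp: has_vector_derivative_def)
  have "g = (\<lambda>t. \<Sum>n. f n (x + t *\<^sub>R b))" using g(1) sums_unique by blast
  then show ?thesis using g(2)[of 0] by simp
qed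

text \<open>Every series of derivatives is dominated by a summable sequence of norms, uniformly in
  the point, and so is the series one derivative higher. This is completeness of the Schwartz space
  in the form that expansions use.\<close>

lemma schwartz_series:
  fixes F :: "nat \<Rightarrow> 'a::euclidean_space \<Rightarrow> complex"
  assumes F: "\<And>n. F n \<in> S_funs" and S: "\<And>m. summable (\<lambda>n. snorm UNIV m (F n))"
  shows "(\<lambda>x. \<Sum>n. F n x) \<in> S_funs"
    "bs \<in> lists Basis \<Longrightarrow> partial_deriv bs (\<lambda>x. \<Sum>n. F n x) x = (\<Sum>n. partial_deriv bs (F n) x)"
proof -
  let ?D = "\<lambda>bs x. \<Sum>n. partial_deriv bs (F n) x"
  have le: "wderiv m bs (F n) x \<le> snorm UNIV (max m (length bs)) (F n)"
    if "bs \<in> lists Basis" for bs n x m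
  proof -
    have "wderiv m bs (F n) x \<le> (1 + norm x) ^ max m (length bs) * cmod (partial_deriv bs (F n) x)"
      by (intro mult_right_mono power_increasing) auto
    also have "... \<le> snorm UNIV (max m (length bs)) (F n)" by (rule snorm_ge[OF F]) (use that in \<open>auto simp: blists_def\<close>)
    finally show ?thesis .
  qed
  have le0: "cmod (partial_deriv bs (F n) x) \<le> snorm UNIV (max 0 (length bs)) (F n)" if "bs \<in> lists Basis" for bs n x
    using le[OF that, of x 0] by simp
  have summ: "summable (\<lambda>n. cmod (partial_deriv bs (F n) x))" if "bs \<in> lists Basis" for bs x
    by (rule summable_comparison_test'[OF S[of "max 0 (length bs)"]]) (use le0[OF that] in simp)
  have step: "has_dir_deriv b (?D bs) (?D (b # bs) x) x" if bs: "bs \<in> lists Basis" and b: "b \<in> Basis" for bs b x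
  proof (rule has_dir_deriv_series[where M = "\<lambda>n. snorm UNIV (max 0 (length (b # bs))) (F n)"])
    show "has_dir_deriv b (partial_deriv bs (F n)) (partial_deriv (b # bs) (F n) x) x" for n x
      by (rule smooth_on_has_dir_deriv[OF schwartz_functionsD(1)[OF F] bs b]) simp
    show "cmod (partial_deriv (b # bs) (F n) x) \<le> snorm UNIV (max 0 (length (b # bs))) (F n)" for n x by (rule le0) (use bs b in auto)
  qed (use S summable_norm_cancel[OF summ[OF bs]] in auto)
  show "(\<lambda>x. \<Sum>n. F n x) \<in> S_funs"
  proof (rule schwartz_functionsI[where D = ?D])
    fix bs :: "'a list" and m assume bs: "bs \<in> lists Basis"
    have "uniform_limit UNIV (\<lambda>n x. \<Sum>i<n. partial_deriv bs (F i) x) (?D bs) sequentially" by (rule Weierstrass_m_test[OF le0[OF bs] S])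
    moreover have "continuous_on UNIV (\<lambda>x. \<Sum>i<n. partial_deriv bs (F i) x)" for n
      by (intro continuous_intros continuous_on_partial_deriv F bs)
    ultimately have "continuous_on UNIV (?D bs)" by (intro uniform_limit_theorem[OF always_eventually]) auto
    then show "\<exists>g. continuous_on (closure UNIV) g \<and> (\<forall>x\<in>UNIV. g x = ?D bs x)" by auto
    have "(1 + norm x) ^ m * cmod (?D bs x) \<le> (\<Sum>n. snorm UNIV (max m (length bs)) (F n))" for x
    proof -
      have "(1 + norm x) ^ m * cmod (?D bs x) \<le> (1 + norm x) ^ m * (\<Sum>n. cmod (partial_deriv bs (F n) x))"
        by (intro mult_left_mono summable_norm summ bs) auto
      also have "... = (\<Sum>n. wderiv m bs (F n) x)" by (rule suminf_mult[symmetric]) (rule summ[OF bs])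
      also have "... \<le> (\<Sum>n. snorm UNIV (max m (length bs)) (F n))" by (intro suminf_le le bs summable_mult summ S)
      finally show ?thesis .
    qed
    then show "\<exists>K. \<forall>x\<in>UNIV. (1 + norm x) ^ m * cmod (?D bs x) \<le> K" by blast
  qed (use step in auto)
  show "bs \<in> lists Basis \<Longrightarrow> partial_deriv bs (\<lambda>x. \<Sum>n. F n x) x = ?D bs x"
    by (rule partial_deriv_family[where U = UNIV and D = ?D]) (use step in auto)
qed

lemma infsum_eq_suminf:
  fixes a :: "'i \<Rightarrow> complex" and e :: "nat \<Rightarrow> 'i"
  assumes "a summable_on UNIV" "bij e"
  shows "infsum a UNIV = (\<Sum>n. a (e n))"
proof -
  have "(a has_sum infsum a UNIV) UNIV" using assms by simp
  then have "((\<lambda>n. a (e n)) has_sum infsum a UNIV) UNIV" using has_sum_reindex_bij_betw[OF assms(2)] by blast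
  from sums_unique[OF has_sum_imp_sums[OF this]] show ?thesis .
qed

text \<open>A countable infinite index type is in bijection with the naturals, and absolute
  summability makes the sum independent of the enumeration; \<open>schwartz_series\<close> then
  applies.\<close>

lemma schwartz_infsum:
  fixes F :: "'i::countable \<Rightarrow> 'a::euclidean_space \<Rightarrow> complex"
  assumes inf: "infinite (UNIV :: 'i set)"
    and F: "\<And>i. F i \<in> S_funs" and S: "\<And>m. (\<lambda>i. snorm UNIV m (F i)) summable_on UNIV"
  shows "(\<lambda>x. \<Sum>\<^sub>\<infinity>i. F i x) \<in> S_funs"
    "bs \<in> lists Basis \<Longrightarrow> (\<lambda>i. cmod (partial_deriv bs (F i) x)) summable_on UNIV"
    "bs \<in> lists Basis \<Longrightarrow> partial_deriv bs (\<lambda>x. \<Sum>\<^sub>\<infinity>i. F i x) x = (\<Sum>\<^sub>\<infinity>i. partial_deriv bs (F i) x)"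
proof -
  obtain e :: "nat \<Rightarrow> 'i" where e: "bij e" using bij_betw_from_nat_into[OF countableI_type inf] by blast
  have abs: "(\<lambda>i. cmod (partial_deriv bs (F i) x)) summable_on UNIV" if "bs \<in> lists Basis" for bs x
  proof (rule summable_on_comparison_test[OF S[of "length bs"]])
    show "cmod (partial_deriv bs (F i) x) \<le> snorm UNIV (length bs) (F i)" for i
      by (rule snorm_ge_cmod[OF F]) (use that in \<open>auto simp: blists_def\<close>)
  qed auto
  have eq: "(\<Sum>\<^sub>\<infinity>i. partial_deriv bs (F i) x) = (\<Sum>n. partial_deriv bs (F (e n)) x)" if "bs \<in> lists Basis" for bs x
    by (rule infsum_eq_suminf[OF abs_summable_summable[OF abs[OF that]] e])
  have S': "summable (\<lambda>n. snorm UNIV m (F (e n)))" for m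
    using summable_on_imp_summable summable_on_reindex_bij_betw[OF e, of "\<lambda>i. snorm UNIV m (F i)"] S by blast
  have eq0: "(\<lambda>x. \<Sum>\<^sub>\<infinity>i. F i x) = (\<lambda>x. \<Sum>n. F (e n) x)" using eq[of "[]"] by simp
  show "(\<lambda>x. \<Sum>\<^sub>\<infinity>i. F i x) \<in> S_funs" unfolding eq0 by (rule schwartz_series(1)[OF F S'])
  show "bs \<in> lists Basis \<Longrightarrow> partial_deriv bs (\<lambda>x. \<Sum>\<^sub>\<infinity>i. F i x) x = (\<Sum>\<^sub>\<infinity>i. partial_deriv bs (F i) x)"
    unfolding eq0 eq by (rule schwartz_series(2)[OF F S'])
  show "bs \<in> lists Basis \<Longrightarrow> (\<lambda>i. cmod (partial_deriv bs (F i) x)) summable_on UNIV" by (rule abs)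
qed

lemma infsum_Compl:
  fixes f :: "'i \<Rightarrow> 'b::banach"
  assumes "f summable_on UNIV" "finite I"
  shows "infsum f (- I) = infsum f UNIV - sum f I" using infsum_Diff[OF assms(1), of I] assms(2) by (simp add: Compl_eq_Diff_UNIV)

lemma infsum_Compl_tendsto:
  fixes f :: "'i \<Rightarrow> real"
  assumes "f summable_on UNIV"
  shows "((\<lambda>I. infsum f (- I)) \<longlongrightarrow> 0) (finite_subsets_at_top UNIV)"
proof -
  have "(sum f \<longlongrightarrow> infsum f UNIV) (finite_subsets_at_top UNIV)" using has_sum_infsum[OF assms] by (simp add: has_sum_def)
  from tendsto_diff[OF tendsto_const[of "infsum f UNIV"] this]
  have "((\<lambda>I. infsum f UNIV - sum f I) \<longlongrightarrow> 0) (finite_subsets_at_top UNIV)" by simp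
  then show ?thesis by (rule Lim_transform_eventually)
      (auto intro!: eventually_finite_subsets_at_top_weakI infsum_Compl[OF assms, symmetric])
qed

text \<open>Partial sum minus full sum is the negative of the sum over the complement, derivative by
  derivative. The cardinality counts the derivatives collected in \<open>snorm\<close>.\<close>

lemma snorm_infsum_remainder:
  fixes F :: "'i::countable \<Rightarrow> 'a::euclidean_space \<Rightarrow> complex"
  assumes inf: "infinite (UNIV :: 'i set)"
    and F: "\<And>i. F i \<in> S_funs" and S: "\<And>m. (\<lambda>i. snorm UNIV m (F i)) summable_on UNIV"
    and I: "finite I"
  shows "snorm UNIV m ((\<lambda>x. \<Sum>i\<in>I. F i x) - (\<lambda>x. \<Sum>\<^sub>\<infinity>i. F i x)) \<le>
     real (card (blists m :: 'a list set)) * infsum (\<lambda>i. snorm UNIV m (F i)) (- I)"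
proof (rule snorm_le)
  note T = schwartz_infsum[OF inf F S]
  fix x :: 'a and bs :: "'a list" assume bs: "bs \<in> blists m"
  note bl = blists_lists[OF bs]
  have "partial_deriv bs ((\<lambda>x. \<Sum>i\<in>I. F i x) - (\<lambda>x. \<Sum>\<^sub>\<infinity>i. F i x)) x =
     (\<Sum>i\<in>I. partial_deriv bs (F i) x) - (\<Sum>\<^sub>\<infinity>i. partial_deriv bs (F i) x)"
    using schwartz_minus(2)[OF open_UNIV _ T(1) bl] schwartz_sum[OF open_UNIV I F] T(3)[OF bl] bl by simp
  also have "... = - infsum (\<lambda>i. partial_deriv bs (F i) x) (- I)"
    using infsum_Compl[OF abs_summable_summable[OF T(2)[OF bl]] I] by simp
  finally have "wderiv m bs ((\<lambda>x. \<Sum>i\<in>I. F i x) - (\<lambda>x. \<Sum>\<^sub>\<infinity>i. F i x)) x =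
     (1 + norm x) ^ m * cmod (infsum (\<lambda>i. partial_deriv bs (F i) x) (- I))" by simp
  also have "... \<le> (1 + norm x) ^ m * infsum (\<lambda>i. cmod (partial_deriv bs (F i) x)) (- I)"
    by (intro mult_left_mono norm_infsum_bound summable_on_subset_banach[OF T(2)[OF bl]]) auto
  also have "... = infsum (\<lambda>i. wderiv m bs (F i) x) (- I)" by (rule infsum_cmult_right'[symmetric])
  also have "... \<le> infsum (\<lambda>i. snorm UNIV m (F i)) (- I)"
    by (intro infsum_mono summable_on_cmult_right summable_on_subset_banach[OF T(2)[OF bl]]
        summable_on_subset_banach[OF S] snorm_ge F bs) auto
  finally show "wderiv m bs ((\<lambda>x. \<Sum>i\<in>I. F i x) - (\<lambda>x. \<Sum>\<^sub>\<infinity>i. F i x)) x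
     \<le> infsum (\<lambda>i. snorm UNIV m (F i)) (- I)" .
qed simp

lemma snorm_infsum_le:
  fixes F :: "'i::countable \<Rightarrow> 'a::euclidean_space \<Rightarrow> complex"
  assumes inf: "infinite (UNIV :: 'i set)"
    and F: "\<And>i. F i \<in> S_funs" and S: "\<And>m. (\<lambda>i. snorm UNIV m (F i)) summable_on UNIV"
  shows "snorm UNIV m (\<lambda>x. \<Sum>\<^sub>\<infinity>i. F i x) \<le> real (card (blists m :: 'a list set)) * (\<Sum>\<^sub>\<infinity>i. snorm UNIV m (F i))"
proof (rule snorm_le)
  note T = schwartz_infsum[OF inf F S]
  fix x :: 'a and bs :: "'a list" assume bs: "bs \<in> blists m"
  note bl = blists_lists[OF bs]
  have "wderiv m bs (\<lambda>x. \<Sum>\<^sub>\<infinity>i. F i x) x \<le>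
      (1 + norm x) ^ m * (\<Sum>\<^sub>\<infinity>i. cmod (partial_deriv bs (F i) x))"
    unfolding T(3)[OF bl] by (intro mult_left_mono norm_infsum_bound T(2)[OF bl]) auto
  also have "... = (\<Sum>\<^sub>\<infinity>i. wderiv m bs (F i) x)" by (rule infsum_cmult_right'[symmetric])
  also have "... \<le> (\<Sum>\<^sub>\<infinity>i. snorm UNIV m (F i))" by (intro infsum_mono summable_on_cmult_right T(2)[OF bl] S snorm_ge F bs) auto
  finally show "wderiv m bs (\<lambda>x. \<Sum>\<^sub>\<infinity>i. F i x) x \<le> (\<Sum>\<^sub>\<infinity>i. snorm UNIV m (F i))" .
qed simp

lemma dual_sum:
  assumes T: "T \<in> dual_vectors (schwartz U)" and U: "open U" and fin: "finite I"
    and F: "\<And>i. i \<in> I \<Longrightarrow> F i \<in> schwartz_functions U"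
  shows "T (\<lambda>x. \<Sum>i\<in>I. c i * F i x) = (\<Sum>i\<in>I. c i * T (F i))" using fin F
proof (induction I rule: finite_induct)
  case empty
  show ?case using dual_vectorsD(2)[OF T, of "\<lambda>x. 0" 0] schwartz_zero[OF U] by simp
next
  case (insert i I)
  have "T (\<lambda>x. c i * F i x + (\<Sum>i\<in>I. c i * F i x)) = T (\<lambda>x. c i * F i x) + T (\<lambda>x. \<Sum>i\<in>I. c i * F i x)" by (rule dual_vectorsD(1)[OF T])
      (use insert.prems schwartz_scale(1)[OF U] schwartz_sum[OF U insert.hyps(1), of "\<lambda>i x. c i * F i x"] in auto)
  then show ?case using insert dual_vectorsD(2)[OF T, of "F i" "c i"] by simp
qed

text \<open>Finite partial sums converge to the full sum in the Schwartz topology by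
  \<open>snorm_infsum_remainder\<close>. Continuity of \<open>T\<close> carries this over to
  convergence along the finite subsets, which is what \<open>has_sum\<close> means.\<close>

lemma dual_has_sum:
  fixes F :: "'i::countable \<Rightarrow> 'a::euclidean_space \<Rightarrow> complex"
  assumes inf: "infinite (UNIV :: 'i set)"
    and F: "\<And>i. F i \<in> S_funs" and S: "\<And>m. (\<lambda>i. snorm UNIV m (F i)) summable_on UNIV"
    and T: "T \<in> dual_vectors S_space"
  shows "((\<lambda>i. T (F i)) has_sum T (\<lambda>x. \<Sum>\<^sub>\<infinity>i. F i x)) UNIV"
proof -
  let ?f = "\<lambda>I x. if finite I then \<Sum>i\<in>I. F i x else 0"
  have fin: "?f I = (\<lambda>x. \<Sum>i\<in>I. F i x)" if "finite I" for I using that by simp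
  have "limitin (lcs_topology S_space) ?f (\<lambda>x. \<Sum>\<^sub>\<infinity>i. F i x) (finite_subsets_at_top UNIV)"
    unfolding limitin_lcs_iff[OF fun_lcs_triangle[OF fun_lcs_schwartz[OF open_UNIV UNIV_not_empty]]]
  proof (intro conjI ballI allI impI)
    show "(\<lambda>x. \<Sum>\<^sub>\<infinity>i. F i x) \<in> vectors S_space" using schwartz_infsum(1)[OF inf F S] by simp
    fix p and d :: real assume p: "p \<in> seminorms (S_space :: ('a \<Rightarrow> complex) lcs)" and d: "d > 0"
    then obtain m where m: "\<And>f. f \<in> S_funs \<Longrightarrow> p f \<le> snorm UNIV m f" using seminorm_le_snorm[OF p UNIV_not_empty] by blast
    let ?r = "\<lambda>I. real (card (blists m :: 'a list set)) * infsum (\<lambda>i. snorm UNIV m (F i)) (- I)"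
    have "(?r \<longlongrightarrow> 0) (finite_subsets_at_top UNIV)" using tendsto_mult_right_zero[OF infsum_Compl_tendsto[OF S]] .
    from order_tendstoD(2)[OF this d]
    have "\<forall>\<^sub>F I in finite_subsets_at_top UNIV. ?r I < d" .
    moreover have "\<forall>\<^sub>F I in finite_subsets_at_top (UNIV :: 'i set). finite I" by (rule eventually_finite_subsets_at_top_weakI) simp
    ultimately show "\<forall>\<^sub>F I in finite_subsets_at_top UNIV. ?f I \<in> vectors S_space \<and> p (?f I - (\<lambda>x. \<Sum>\<^sub>\<infinity>i. F i x)) < d"
    proof eventually_elim
      case (elim I)
      have s: "(\<lambda>x. \<Sum>i\<in>I. F i x) \<in> S_funs" using schwartz_sum[of UNIV I F] elim(2) F by blast
      have "p ((\<lambda>x. \<Sum>i\<in>I. F i x) - (\<lambda>x. \<Sum>\<^sub>\<infinity>i. F i x)) \<le> snorm UNIV m ((\<lambda>x. \<Sum>i\<in>I. F i x) - (\<lambda>x. \<Sum>\<^sub>\<infinity>i. F i x))"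
        by (intro m schwartz_minus(1) open_UNIV s schwartz_infsum(1)[OF inf F S])
      also have "... \<le> ?r I" by (rule snorm_infsum_remainder[OF inf F S elim(2)])
      also have "... < d" by (rule elim(1))
      finally show ?case unfolding fin[OF elim(2)] using s by simp
    qed
  qed
  from continuous_map_limit[OF dual_vectorsD(3)[OF T] this]
  have "((\<lambda>I. T (?f I)) \<longlongrightarrow> T (\<lambda>x. \<Sum>\<^sub>\<infinity>i. F i x)) (finite_subsets_at_top UNIV)" by (simp add: comp_def)
  then show ?thesis unfolding has_sum_def by (rule Lim_transform_eventually)
      (use dual_sum[OF T open_UNIV _ F, of _ "\<lambda>_. 1"] in \<open>auto intro!: eventually_finite_subsets_at_top_weakI\<close>)
qed

section \<open>Polynomial bounds, coefficient matrices and ladder families\<close>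

text \<open>A bound from above only, which is why the product rule asks for a nonnegative factor.
  The index type is arbitrary because both single multi-indices and pairs of them occur.\<close>

definition poly_bounded :: "('i \<Rightarrow> real) \<Rightarrow> ('i \<Rightarrow> real) \<Rightarrow> bool" where
  "poly_bounded w f \<longleftrightarrow> (\<exists>C M. C \<ge> 0 \<and> (\<forall>i. f i \<le> C * w i ^ M))"

lemma poly_bounded_mono: "poly_bounded w g \<Longrightarrow> (\<And>i. f i \<le> g i) \<Longrightarrow> poly_bounded w f" unfolding poly_bounded_def by (meson order_trans)

lemma poly_bounded_power: "poly_bounded w (\<lambda>i. w i ^ M)" unfolding poly_bounded_def by (intro exI[of _ 1] exI[of _ M]) auto

lemma poly_bounded_const:
  assumes "\<And>i. w i \<ge> 1" shows "poly_bounded w (\<lambda>i. c)" unfolding poly_bounded_def by (intro exI[of _ "\<bar>c\<bar>"] exI[of _ 0]) auto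

lemma poly_bounded_add:
  assumes w: "\<And>i. w i \<ge> 1" and "poly_bounded w f" "poly_bounded w g"
  shows "poly_bounded w (\<lambda>i. f i + g i)"
proof -
  obtain C M where C: "C \<ge> 0" "\<And>i. f i \<le> C * w i ^ M" using assms(2) by (auto simp: poly_bounded_def)
  obtain D N where D: "D \<ge> 0" "\<And>i. g i \<le> D * w i ^ N" using assms(3) by (auto simp: poly_bounded_def)
  have "f i + g i \<le> (C + D) * w i ^ (max M N)" for i
  proof -
    have "f i + g i \<le> C * w i ^ M + D * w i ^ N" using C D by (intro add_mono)
    also have "... \<le> C * w i ^ max M N + D * w i ^ max M N" using C D w[of i] by (intro add_mono mult_left_mono power_increasing) auto
    finally show ?thesis by (simp add: algebra_simps)
  qed
  then show ?thesis unfolding poly_bounded_def using C D by (intro exI[of _ "C + D"] exI[of _ "max M N"]) auto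
qed

lemma poly_bounded_sum:
  assumes w: "\<And>i. w i \<ge> 1" and "finite I" "\<And>k. k \<in> I \<Longrightarrow> poly_bounded w (f k)"
  shows "poly_bounded w (\<lambda>i. \<Sum>k\<in>I. f k i)" using assms(2,3)
proof (induction I rule: finite_induct)
  case empty
  then show ?case using poly_bounded_const[where c = 0, OF w] by simp
next
  case (insert k I)
  then show ?case using poly_bounded_add[where f = "f k" and g = "\<lambda>i. \<Sum>k\<in>I. f k i", OF w] by simp
qed

lemma poly_bounded_mult:
  assumes w: "\<And>i. w i \<ge> 1" and "poly_bounded w f" "poly_bounded w g" and g: "\<And>i. g i \<ge> 0"
  shows "poly_bounded w (\<lambda>i. f i * g i)"
proof -
  obtain C M where C: "C \<ge> 0" "\<And>i. f i \<le> C * w i ^ M" using assms(2) by (auto simp: poly_bounded_def)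
  obtain D N where D: "D \<ge> 0" "\<And>i. g i \<le> D * w i ^ N" using assms(3) by (auto simp: poly_bounded_def)
  have "f i * g i \<le> (C * D) * w i ^ (M + N)" for i
  proof -
    have w0: "0 \<le> w i" using w[of i] by linarith
    have "f i * g i \<le> (C * w i ^ M) * (D * w i ^ N)" using C D g w0 by (intro mult_mono mult_nonneg_nonneg zero_le_power) auto
    then show ?thesis by (simp add: power_add mult_ac)
  qed
  then show ?thesis unfolding poly_bounded_def using C D by (intro exI[of _ "C * D"] exI[of _ "M + N"]) auto
qed

lemma poly_bounded_cmult:
  assumes "\<And>i. w i \<ge> 1" "poly_bounded w f" "c \<ge> 0"
  shows "poly_bounded w (\<lambda>i. c * f i)"
  using poly_bounded_mult[OF assms(1,2) poly_bounded_const[where c = c, OF assms(1)]] assms(3) by (simp add: mult.commute)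

lemma poly_bounded_powr:
  assumes w: "\<And>i. w i \<ge> 1" and "poly_bounded w f" and f: "\<And>i. f i \<ge> 0"
  shows "poly_bounded w (\<lambda>i. f i ^ n)"
proof (induction n)
  case 0
  then show ?case using poly_bounded_const[where c = 1, OF w] by simp
next
  case (Suc n)
  then show ?case using poly_bounded_mult[OF w assms(2) Suc] f by simp
qed

text \<open>Formal linear combinations of a family \<open>\<Phi>\<close>, as lists of coefficients and indices.\<close>

definition lc_eval :: "('i \<Rightarrow> 'a \<Rightarrow> complex) \<Rightarrow> (complex \<times> 'i) list \<Rightarrow> 'a \<Rightarrow> complex" where
  "lc_eval \<Phi> ts x = (\<Sum>(a, j)\<leftarrow>ts. a * \<Phi> j x)"

text \<open>An l1 norm of the coefficients, weighted by a power of the index weight. It bounds the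
  value of the combination as soon as the family grows at most like that power
  (\<open>cmod_lc_eval_le\<close>), and it stays under control when combinations are substituted
  (\<open>lc_cost_bind_le\<close>).\<close>

definition lc_cost :: "('i \<Rightarrow> real) \<Rightarrow> nat \<Rightarrow> (complex \<times> 'i) list \<Rightarrow> real" where
  "lc_cost w M ts = (\<Sum>(a, j)\<leftarrow>ts. cmod a * w j ^ M)"

text \<open>Substitutes the combination \<open>l j\<close> for each index \<open>j\<close>. On
  coefficient matrices this is the matrix product, so repeated \<open>lc_bind\<close> represents
  composed operators.\<close>

definition lc_bind :: "('i \<Rightarrow> (complex \<times> 'i) list) \<Rightarrow> (complex \<times> 'i) list \<Rightarrow> (complex \<times> 'i) list" where
  "lc_bind l ts = concat (map (\<lambda>(a, j). map (\<lambda>(a', k). (a * a', k)) (l j)) ts)"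

lemma lc_simps [simp]:
  "lc_eval \<Phi> [] x = 0" "lc_eval \<Phi> (t # ts) x = fst t * \<Phi> (snd t) x + lc_eval \<Phi> ts x"
  "lc_cost w M [] = 0" "lc_cost w M (t # ts) = cmod (fst t) * w (snd t) ^ M + lc_cost w M ts"
  "lc_bind l [] = []" "lc_bind l (t # ts) = map (\<lambda>(a', k). (fst t * a', k)) (l (snd t)) @ lc_bind l ts"
  "lc_eval \<Phi> (ts @ us) x = lc_eval \<Phi> ts x + lc_eval \<Phi> us x"
  "lc_cost w M (ts @ us) = lc_cost w M ts + lc_cost w M us" by (auto simp: lc_eval_def lc_cost_def lc_bind_def split: prod.splits)

lemma lc_map_simps:
  "lc_eval \<Phi> (map (\<lambda>(a', k). (a * a', k)) ts) x = a * lc_eval \<Phi> ts x"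
  "lc_cost w M (map (\<lambda>(a', k). (a * a', k)) ts) = cmod a * lc_cost w M ts" by (induction ts) (auto simp: algebra_simps norm_mult)

lemma lc_eval_bind: "lc_eval \<Phi> (lc_bind l ts) x = (\<Sum>(a, j)\<leftarrow>ts. a * lc_eval \<Phi> (l j) x)" by (induction ts) (auto simp: lc_map_simps)

lemma lc_cost_bind_le:
  assumes "\<And>j. lc_cost w M (l j) \<le> C * w j ^ M'"
  shows "lc_cost w M (lc_bind l ts) \<le> C * lc_cost w M' ts"
proof (induction ts)
  case (Cons t ts)
  have "cmod (fst t) * lc_cost w M (l (snd t)) \<le> cmod (fst t) * (C * w (snd t) ^ M')" by (intro mult_left_mono assms) auto
  then show ?case using Cons by (simp add: lc_map_simps distrib_left mult.left_commute)
qed simp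

lemma cmod_lc_eval_le:
  assumes "\<And>j. cmod (\<Phi> j x) \<le> C * w j ^ M"
  shows "cmod (lc_eval \<Phi> ts x) \<le> C * lc_cost w M ts"
proof (induction ts)
  case (Cons t ts)
  have "cmod (fst t) * cmod (\<Phi> (snd t) x) \<le> cmod (fst t) * (C * w (snd t) ^ M)" by (intro mult_left_mono assms) auto
  then show ?case using Cons norm_triangle_ineq[of "fst t * \<Phi> (snd t) x" "lc_eval \<Phi> ts x"] by (auto simp: algebra_simps norm_mult)
qed simp

text \<open>With every coefficient and every target weight below \<open>h\<close>, each entry costs
  at most \<open>h * h ^ M\<close>, and there are polynomially many entries. Each concrete ladder is
  checked through these three bounds.\<close>

lemma lc_cost_poly_boundedI:
  assumes w: "\<And>i. w i \<ge> 1"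
    and len: "poly_bounded w (\<lambda>i. real (length (l i)))" and h: "poly_bounded w h" "\<And>i. h i \<ge> 0"
    and terms: "\<And>i a j. (a, j) \<in> set (l i) \<Longrightarrow> cmod a \<le> h i \<and> w j \<le> h i"
  shows "poly_bounded w (\<lambda>i. lc_cost w M (l i))"
proof (rule poly_bounded_mono)
  show "poly_bounded w (\<lambda>i. real (length (l i)) * (h i * h i ^ M))"
    by (intro poly_bounded_mult w len poly_bounded_powr h mult_nonneg_nonneg zero_le_power)
  show "lc_cost w M (l i) \<le> real (length (l i)) * (h i * h i ^ M)" for i unfolding lc_cost_def
  proof (rule sum_list_le_const)
    fix t assume t: "t \<in> set (l i)"
    obtain a j where aj: "t = (a, j)" by (cases t)
    have "0 \<le> w j" using w[of j] by linarith
    then show "(case t of (a, j) \<Rightarrow> cmod a * w j ^ M) \<le> h i * h i ^ M"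
      using terms[of a j i] t h(2)[of i] unfolding aj by (auto intro!: mult_mono power_mono)
  qed
qed

lemma one_plus_norm_le: "1 + norm x \<le> 1 + (\<Sum>b\<in>Basis. \<bar>x \<bullet> b\<bar>)" using norm_le_l1[of x] by simp

text \<open>A family that is bounded polynomially in a weight of its index, and on which multiplication
  by coordinates and differentiation act by matrices with polynomially bounded entries, has
  polynomially bounded Schwartz norms.\<close>

lemma schwartz_ladder_family:
  fixes \<Phi> :: "'i \<Rightarrow> 'a::euclidean_space \<Rightarrow> complex"
  assumes U: "open U" "U \<noteq> {}" and w: "\<And>i. w i \<ge> 1"
    and cont: "\<And>i. continuous_on UNIV (\<Phi> i)"
    and sup: "\<And>i x. x \<in> U \<Longrightarrow> cmod (\<Phi> i x) \<le> C0 * w i ^ N0"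
    and deriv: "\<And>b i x. b \<in> Basis \<Longrightarrow> has_dir_deriv b (\<Phi> i) (lc_eval \<Phi> (dl b i) x) x"
    and mult: "\<And>b i x. b \<in> Basis \<Longrightarrow> of_real (x \<bullet> b) * \<Phi> i x = lc_eval \<Phi> (ml b i) x"
    and dl: "\<And>b M. b \<in> Basis \<Longrightarrow> poly_bounded w (\<lambda>i. lc_cost w M (dl b i))"
    and ml: "\<And>b M. b \<in> Basis \<Longrightarrow> poly_bounded w (\<lambda>i. lc_cost w M (ml b i))"
  shows "(\<lambda>x. if x \<in> U then \<Phi> i x else 0) \<in> schwartz_functions U"
    "poly_bounded w (\<lambda>i. snorm U m (\<lambda>x. if x \<in> U then \<Phi> i x else 0))"
proof -
  \<comment> \<open>\<open>T bs i\<close> is the combination that represents the derivative of the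
    \<open>i\<close>-th function along \<open>bs\<close>, with one substitution per
    derivative.\<close>
  define T where "T = (\<lambda>bs i. foldr (\<lambda>b. lc_bind (dl b)) bs [(1, i)])"
  have T_simps: "T [] i = [(1, i)]" "T (b # bs) i = lc_bind (dl b) (T bs i)" for b bs i by (simp_all add: T_def)
  define D where "D = (\<lambda>i bs x. lc_eval \<Phi> (T bs i) x)"
  have step: "has_dir_deriv b (D i bs) (D i (b # bs) x) x" if "b \<in> Basis" for i b bs x
  proof -
    have "has_dir_deriv b (\<lambda>x. \<Sum>t\<leftarrow>T bs i. fst t * \<Phi> (snd t) x) (\<Sum>t\<leftarrow>T bs i. fst t * lc_eval \<Phi> (dl b (snd t)) x) x"
      by (intro has_dir_deriv_sum_list has_vector_derivative_mult_right deriv that)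
    then show ?thesis unfolding D_def T_simps lc_eval_bind by (simp add: lc_eval_def[abs_def] case_prod_unfold)
  qed
  have bind: "poly_bounded w (\<lambda>i. lc_cost w M (lc_bind l (ts i)))"
    if l: "\<And>M. poly_bounded w (\<lambda>i. lc_cost w M (l i))" and ts: "\<And>M. poly_bounded w (\<lambda>i. lc_cost w M (ts i))" for l ts M
  proof -
    obtain C M' where C: "C \<ge> 0" "\<And>j. lc_cost w M (l j) \<le> C * w j ^ M'" using l[of M] by (auto simp: poly_bounded_def)
    show ?thesis by (rule poly_bounded_mono[OF poly_bounded_cmult[OF w ts[of M'] C(1)] lc_cost_bind_le[OF C(2)]])
  qed
  have cost_T: "poly_bounded w (\<lambda>i. lc_cost w M (T bs i))" if "bs \<in> lists Basis" for bs M using that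
  proof (induction bs arbitrary: M)
    case Nil
    then show ?case using poly_bounded_power[of w M] by (simp add: T_simps)
  next
    case (Cons b bs)
    then show ?case unfolding T_simps by (intro bind dl) auto
  qed
  \<comment> \<open>Induction on the power. One factor \<open>1 + norm x\<close> is at most 1 plus
    the sum of the moduli of the coordinates, and each coordinate is absorbed into the combination
    by \<open>ml\<close>. At power 0 the sup bound of the family is all that enters.\<close>
  have eval_bound: "\<exists>g. poly_bounded w g \<and> (\<forall>i. \<forall>x\<in>U. (1 + norm x) ^ m * cmod (lc_eval \<Phi> (ts i) x) \<le> g i)"
    if "\<And>M. poly_bounded w (\<lambda>i. lc_cost w M (ts i))" for m ts using that
  proof (induction m arbitrary: ts)
    case 0
    let ?g = "\<lambda>i. \<bar>C0\<bar> * lc_cost w N0 (ts i)"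
    have "cmod (lc_eval \<Phi> (ts i) x) \<le> ?g i" if "x \<in> U" for i x
    proof (rule cmod_lc_eval_le)
      fix j
      have "cmod (\<Phi> j x) \<le> C0 * w j ^ N0" by (rule sup[OF that])
      also have "... \<le> \<bar>C0\<bar> * w j ^ N0" using w[of j] by (intro mult_right_mono) auto
      finally show "cmod (\<Phi> j x) \<le> \<bar>C0\<bar> * w j ^ N0" .
    qed
    moreover have "poly_bounded w ?g" by (intro poly_bounded_cmult w 0) auto
    ultimately show ?case by (intro exI[of _ ?g]) auto
  next
    case (Suc m)
    obtain g0 where g0: "poly_bounded w g0" "\<And>i x. x \<in> U \<Longrightarrow> (1 + norm x) ^ m * cmod (lc_eval \<Phi> (ts i) x) \<le> g0 i"
      using Suc.IH[OF Suc.prems] by blast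
    have "\<exists>g. poly_bounded w g \<and> (\<forall>i. \<forall>x\<in>U. (1 + norm x) ^ m * cmod (lc_eval \<Phi> (lc_bind (ml b) (ts i)) x) \<le> g i)"
      if "b \<in> Basis" for b by (rule Suc.IH) (rule bind[OF ml[OF that] Suc.prems])
    then obtain g where g: "\<And>b. b \<in> Basis \<Longrightarrow> poly_bounded w (g b)"
      "\<And>b i x. b \<in> Basis \<Longrightarrow> x \<in> U \<Longrightarrow> (1 + norm x) ^ m * cmod (lc_eval \<Phi> (lc_bind (ml b) (ts i)) x) \<le> g b i" by metis
    have "(1 + norm x) ^ Suc m * cmod (lc_eval \<Phi> (ts i) x) \<le> g0 i + (\<Sum>b\<in>Basis. g b i)" if x: "x \<in> U" for i x
    proof -
      have m: "\<bar>x \<bullet> b\<bar> * cmod (lc_eval \<Phi> (ts i) x) = cmod (lc_eval \<Phi> (lc_bind (ml b) (ts i)) x)" if "b \<in> Basis" for b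
      proof -
        have "lc_eval \<Phi> (lc_bind (ml b) (ts i)) x = (\<Sum>(a, j)\<leftarrow>ts i. a * (of_real (x \<bullet> b) * \<Phi> j x))"
          unfolding lc_eval_bind by (simp add: mult[OF that])
        also have "... = of_real (x \<bullet> b) * lc_eval \<Phi> (ts i) x"
          unfolding lc_eval_def sum_list_const_mult[symmetric] by (simp add: case_prod_unfold mult_ac)
        finally show ?thesis by (simp add: norm_mult)
      qed
      have "(1 + norm x) ^ Suc m * cmod (lc_eval \<Phi> (ts i) x) = ((1 + norm x) ^ m * cmod (lc_eval \<Phi> (ts i) x)) * (1 + norm x)" by simp
      also have "... \<le> ((1 + norm x) ^ m * cmod (lc_eval \<Phi> (ts i) x)) * (1 + (\<Sum>b\<in>Basis. \<bar>x \<bullet> b\<bar>))"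
        by (intro mult_left_mono one_plus_norm_le) auto
      also have "... = (1 + norm x) ^ m * cmod (lc_eval \<Phi> (ts i) x) +
          (\<Sum>b\<in>Basis. (1 + norm x) ^ m * (\<bar>x \<bullet> b\<bar> * cmod (lc_eval \<Phi> (ts i) x)))" by (simp add: algebra_simps sum_distrib_left)
      also have "... \<le> g0 i + (\<Sum>b\<in>Basis. g b i)" by (intro add_mono sum_mono g0 x) (simp add: m g x)
      finally show ?thesis .
    qed
    moreover have "poly_bounded w (\<lambda>i. g0 i + (\<Sum>b\<in>Basis. g b i))" by (intro poly_bounded_add poly_bounded_sum w g0 g) auto
    ultimately show ?case by (intro exI[of _ "\<lambda>i. g0 i + (\<Sum>b\<in>Basis. g b i)"]) auto
  qed
  have D_bound: "\<exists>g. poly_bounded w g \<and> (\<forall>i. \<forall>x\<in>U. (1 + norm x) ^ m * cmod (D i bs x) \<le> g i)"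
    if "bs \<in> lists Basis" for bs m unfolding D_def by (rule eval_bound[OF cost_T[OF that]])
  have D_cont: "continuous_on UNIV (D i bs)" for i bs
  proof -
    have "continuous_on UNIV (lc_eval \<Phi> ts)" for ts by (induction ts) (auto intro!: continuous_intros cont)
    then show ?thesis unfolding D_def .
  qed
  show "(\<lambda>x. if x \<in> U then \<Phi> i x else 0) \<in> schwartz_functions U" for i
  proof (rule schwartz_functionsI[where D = "D i", OF U(1)])
    fix bs :: "'a list" and m assume bs: "bs \<in> lists Basis"
    show "\<exists>g. continuous_on (closure U) g \<and> (\<forall>x\<in>U. g x = D i bs x)" using continuous_on_subset[OF D_cont] by blast
    show "\<exists>K. \<forall>x\<in>U. (1 + norm x) ^ m * cmod (D i bs x) \<le> K" using D_bound[OF bs] by blast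
  next
    show "(if x \<in> U then \<Phi> i x else 0) = D i [] x" if "x \<in> U" for x using that by (simp add: D_def T_simps)
  qed (auto intro: step)
  have pd: "partial_deriv bs (\<lambda>x. if x \<in> U then \<Phi> i x else 0) x = D i bs x" if "bs \<in> lists Basis" "x \<in> U" for i bs x
    by (rule partial_deriv_family[OF U(1) _ step that]) (simp_all add: D_def T_simps)
  have "\<forall>bs\<in>lists Basis. \<exists>g. poly_bounded w g \<and> (\<forall>i. \<forall>x\<in>U. (1 + norm x) ^ m * cmod (D i bs x) \<le> g i)" using D_bound by blast
  then obtain g where g: "\<And>bs. bs \<in> lists Basis \<Longrightarrow> poly_bounded w (g bs)"
    "\<And>bs i x. bs \<in> lists Basis \<Longrightarrow> x \<in> U \<Longrightarrow> (1 + norm x) ^ m * cmod (D i bs x) \<le> g bs i" by metis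
  have g_nonneg: "0 \<le> g bs i" if bs: "bs \<in> lists Basis" for bs i
  proof -
    obtain x where "x \<in> U" using U(2) by auto
    from g(2)[OF bs this, of i] show ?thesis by (rule order_trans[rotated]) auto
  qed
  show "poly_bounded w (\<lambda>i. snorm U m (\<lambda>x. if x \<in> U then \<Phi> i x else 0))"
  proof (rule poly_bounded_mono)
    show "poly_bounded w (\<lambda>i. real (card (blists m :: 'a list set)) * (\<Sum>bs\<in>blists m. g bs i))"
      by (intro poly_bounded_cmult poly_bounded_sum w g blists_lists finite_blists) auto
    show "snorm U m (\<lambda>x. if x \<in> U then \<Phi> i x else 0) \<le>
        real (card (blists m :: 'a list set)) * (\<Sum>bs\<in>blists m. g bs i)" for i
    proof (rule snorm_le[OF U(2)])
      fix x :: 'a and bs :: "'a list" assume x: "x \<in> U" and bs: "bs \<in> blists m"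
      have "wderiv m bs (\<lambda>x. if x \<in> U then \<Phi> i x else 0) x \<le> g bs i"
        unfolding pd[OF blists_lists[OF bs] x] by (rule g(2)[OF blists_lists[OF bs] x])
      also have "... \<le> (\<Sum>bs\<in>blists m. g bs i)" by (intro member_le_sum bs g_nonneg finite_blists) (auto dest: blists_lists)
      finally show "wderiv m bs (\<lambda>x. if x \<in> U then \<Phi> i x else 0) x \<le> (\<Sum>bs\<in>blists m. g bs i)" .
    qed
  qed
qed

section \<open>Pairings with functions\<close>

lemma nn_integral_inverse_1_plus_square: "(\<integral>\<^sup>+x. ennreal (1 / (1 + x\<^sup>2)) \<partial>lborel) < \<infinity>"
proof -
  have "integrable lborel (\<lambda>x::real. inverse (1 + x\<^sup>2))" using integrable_inverse_1_plus_square by (simp add: set_integrable_def)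
  then have "(\<integral>\<^sup>+x. ennreal (norm (inverse (1 + x\<^sup>2 :: real))) \<partial>lborel) < \<infinity>" by (simp add: integrable_iff_bounded)
  also have "(\<lambda>x::real. ennreal (norm (inverse (1 + x\<^sup>2)))) = (\<lambda>x. ennreal (1 / (1 + x\<^sup>2)))"
    by (auto simp: inverse_eq_divide abs_of_nonneg)
  finally show ?thesis .
qed

text \<open>The exponent provides one factor \<open>(1 + norm x)\<^sup>2\<close> for every
  coordinate, and this factor dominates \<open>1 + (x \<bullet> b)\<^sup>2\<close>. The product of
  the one-dimensional functions \<open>1 / (1 + t\<^sup>2)\<close> has finite integral by
  Tonelli.\<close>

lemma integrable_weight: "integrable lborel (\<lambda>x::'a::euclidean_space. decay x)"
proof (rule integrableI_nonneg)
  show "(\<lambda>x::'a. decay x) \<in> borel_measurable lborel" by measurable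
  have "decay x \<le> (\<Prod>b\<in>Basis. 1 / (1 + (x \<bullet> b)\<^sup>2))" for x :: 'a
  proof -
    have "(\<Prod>b\<in>Basis. 1 + (x \<bullet> b)\<^sup>2) \<le> (\<Prod>b\<in>(Basis :: 'a set). (1 + norm x)\<^sup>2)"
    proof (intro prod_mono conjI)
      fix b :: 'a assume b: "b \<in> Basis"
      have "(x \<bullet> b)\<^sup>2 \<le> (norm x)\<^sup>2" using Basis_le_norm[OF b, of x] by (metis abs_ge_zero power2_abs power_mono)
      then show "1 + (x \<bullet> b)\<^sup>2 \<le> (1 + norm x)\<^sup>2" by (simp add: power2_sum add_increasing2)
    qed auto
    also have "... = (1 + norm x) ^ (2 * DIM('a))" by (simp add: power_mult)
    finally have "decay x \<le> 1 / (\<Prod>b\<in>Basis. 1 + (x \<bullet> b)\<^sup>2)"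
      by (intro divide_left_mono mult_pos_pos prod_pos) (auto simp: add_pos_nonneg)
    then show ?thesis by (simp add: prod_dividef)
  qed
  then have "(\<integral>\<^sup>+x. ennreal (decay x) \<partial>(lborel :: 'a measure)) \<le>
      (\<integral>\<^sup>+x. (\<Prod>b\<in>Basis. ennreal (1 / (1 + (x \<bullet> b)\<^sup>2))) \<partial>(lborel :: 'a measure))"
    by (intro nn_integral_mono) (simp add: prod_ennreal ennreal_leI)
  also have "... = (\<Prod>b\<in>(Basis :: 'a set). (\<integral>\<^sup>+x. ennreal (1 / (1 + x\<^sup>2)) \<partial>lborel))" by (rule nn_integral_lborel_prod) auto
  also have "... < \<infinity>" using nn_integral_inverse_1_plus_square by (simp add: less_top[symmetric] power_eq_top_ennreal)
  finally show "(\<integral>\<^sup>+x. ennreal (decay x) \<partial>(lborel :: 'a measure)) < \<infinity>" .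
qed auto

text \<open>\<open>lborel\<close> is the image of a product measure indexed by the basis, and over
  that measure a function of product form integrates to the product of the integrals.\<close>

lemma lborel_prod_Basis:
  fixes f :: "'a::euclidean_space \<Rightarrow> real \<Rightarrow> 'b::{real_normed_field,banach,second_countable_topology}"
  assumes f: "\<And>b. b \<in> Basis \<Longrightarrow> integrable lborel (f b)"
  shows "integrable lborel (\<lambda>x. \<Prod>b\<in>Basis. f b (x \<bullet> b))"
    "(\<integral>x. (\<Prod>b\<in>Basis. f b (x \<bullet> b)) \<partial>lborel) = (\<Prod>b\<in>Basis. \<integral>x. f b x \<partial>lborel)"
proof -
  interpret product_sigma_finite "\<lambda>_::'a. lborel :: real measure" by standard
  have meas: "f b \<in> borel_measurable borel" if "b \<in> Basis" for b using borel_measurable_integrable[OF f[OF that]] by simp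
  have m: "(\<lambda>f. \<Sum>b\<in>Basis. f b *\<^sub>R b) \<in> (\<Pi>\<^sub>M b\<in>(Basis::'a set). lborel) \<rightarrow>\<^sub>M (borel :: 'a measure)" by measurable
  have mp: "(\<lambda>x::'a. \<Prod>b\<in>Basis. f b (x \<bullet> b)) \<in> borel_measurable borel"
    by (intro borel_measurable_prod measurable_compose[OF _ meas]) auto
  have eq: "(\<Prod>b\<in>Basis. f b ((\<Sum>b\<in>Basis. g b *\<^sub>R b) \<bullet> b)) = (\<Prod>b\<in>Basis. f b (g b))" for g by (intro prod.cong refl) simp
  show "integrable lborel (\<lambda>x. \<Prod>b\<in>Basis. f b (x \<bullet> b))"
    by (subst lborel_eq[where 'a = 'a], subst integrable_distr_eq[OF m mp], unfold eq,
        rule product_integrable_prod) (auto intro: f)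
  show "(\<integral>x. (\<Prod>b\<in>Basis. f b (x \<bullet> b)) \<partial>lborel) = (\<Prod>b\<in>Basis. \<integral>x. f b x \<partial>lborel)"
    by (subst lborel_eq[where 'a = 'a], subst integral_distr[OF m mp], unfold eq,
        rule product_integral_prod) (auto intro: f)
qed

lemma Basis_vec_eq: "(Basis :: (real^'n) set) = (\<lambda>i. axis i 1) ` UNIV" by (auto simp: Basis_vec_def)

lemma prod_Basis_vec: "(\<Prod>b\<in>(Basis :: (real^'n) set). g b) = (\<Prod>i\<in>UNIV. g (axis i 1))"
  unfolding Basis_vec_eq by (subst prod.reindex) (auto simp: inj_on_def axis_eq_axis)

lemma lborel_prod_vec:
  fixes f :: "'n::finite \<Rightarrow> real \<Rightarrow> 'b::{real_normed_field,banach,second_countable_topology}"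
  assumes f: "\<And>i. integrable lborel (f i)"
  shows "integrable lborel (\<lambda>x::real^'n. \<Prod>i\<in>UNIV. f i (x $ i))"
    "(\<integral>x. (\<Prod>i\<in>UNIV. f i (x $ i)) \<partial>(lborel :: (real^'n) measure)) = (\<Prod>i\<in>UNIV. \<integral>x. f i x \<partial>lborel)"
proof -
  \<comment> \<open>The index is recovered from its axis vector, so that the version over
    \<open>Basis\<close> can be used.\<close>
  define g :: "real^'n \<Rightarrow> real \<Rightarrow> 'b" where "g b = f (THE i. b = axis i 1)" for b
  have g: "g (axis i 1) = f i" for i unfolding g_def by (simp add: axis_eq_axis)
  have *: "integrable lborel (g b)" if "b \<in> Basis" for b using that unfolding Basis_vec_eq by (auto simp: g f)
  have eq: "(\<Prod>b\<in>(Basis :: (real^'n) set). g b (x \<bullet> b)) = (\<Prod>i\<in>UNIV. f i (x $ i))" for x by (simp add: prod_Basis_vec g inner_axis)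
  show "integrable lborel (\<lambda>x::real^'n. \<Prod>i\<in>UNIV. f i (x $ i))" using lborel_prod_Basis(1)[of g, OF *] by (simp add: eq)
  show "(\<integral>x. (\<Prod>i\<in>UNIV. f i (x $ i)) \<partial>(lborel :: (real^'n) measure)) = (\<Prod>i\<in>UNIV. \<integral>x. f i x \<partial>lborel)"
    using lborel_prod_Basis(2)[of g, OF *] by (simp add: eq prod_Basis_vec g)
qed

lemma nn_integral_lborel_prod_vec:
  fixes f :: "'n::finite \<Rightarrow> real \<Rightarrow> ennreal"
  assumes f: "\<And>i. f i \<in> borel_measurable borel"
  shows "(\<integral>\<^sup>+x. (\<Prod>i\<in>UNIV. f i (x $ i)) \<partial>(lborel :: (real^'n) measure)) = (\<Prod>i\<in>UNIV. \<integral>\<^sup>+x. f i x \<partial>lborel)"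
proof -
  define g :: "real^'n \<Rightarrow> real \<Rightarrow> ennreal" where "g b = f (THE i. b = axis i 1)" for b
  have g: "g (axis i 1) = f i" for i unfolding g_def by (simp add: axis_eq_axis)
  have *: "g b \<in> borel_measurable borel" if "b \<in> Basis" for b using that unfolding Basis_vec_eq by (auto simp: g f)
  have eq: "(\<Prod>b\<in>(Basis :: (real^'n) set). g b (x \<bullet> b)) = (\<Prod>i\<in>UNIV. f i (x $ i))" for x by (simp add: prod_Basis_vec g inner_axis)
  show ?thesis using nn_integral_lborel_prod[of g, OF *] by (simp add: eq prod_Basis_vec g)
qed

lemma schwartz_measurable:
  fixes U :: "'a::euclidean_space set"
  assumes U: "open U" and g: "g \<in> schwartz_functions U"
  shows "g \<in> borel_measurable (lebesgue_on U)"
proof -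
  have "continuous_on U (partial_deriv [] g)" using schwartz_functionsD(1)[OF g] unfolding smooth_on_def using lists.Nil by blast
  then show ?thesis using U by (auto intro!: continuous_imp_measurable_on_sets_lebesgue)
qed

lemma schwartz_decay:
  fixes U :: "'a::euclidean_space set"
  assumes g: "g \<in> schwartz_functions U" and x: "x \<in> U"
  shows "cmod (g x) \<le> snorm U k g * (1 / (1 + norm x) ^ k)"
proof -
  have "(1 + norm x) ^ k * cmod (g x) \<le> snorm U k g" using snorm_ge[OF g x Nil_in_blists, of k] by simp
  then show ?thesis by (simp add: field_simps add_pos_nonneg)
qed

text \<open>Decay of \<open>g\<close> of order \<open>k\<close> supplies the factor that makes
  \<open>h\<close> integrable. The constant is the weighted integral of \<open>h\<close>, so the
  estimate is at the same time continuity in \<open>g\<close>.\<close>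

lemma schwartz_pairing:
  fixes U :: "'a::euclidean_space set" and h :: "'a \<Rightarrow> complex"
  assumes U: "open U" and h: "h \<in> borel_measurable (lebesgue_on U)"
    and int: "integrable (lebesgue_on U) (\<lambda>x. cmod (h x) * (1 / (1 + norm x) ^ k))"
    and g: "g \<in> schwartz_functions U"
  shows "integrable (lebesgue_on U) (\<lambda>x. h x * g x)"
    "cmod (\<integral>x. h x * g x \<partial>(lebesgue_on U)) \<le> (\<integral>x. cmod (h x) * (1 / (1 + norm x) ^ k) \<partial>(lebesgue_on U)) * snorm U k g"
proof -
  have le: "cmod (h x * g x) \<le> snorm U k g * (cmod (h x) * (1 / (1 + norm x) ^ k))" if "x \<in> U" for x
    using mult_left_mono[OF schwartz_decay[OF g that, of k], of "cmod (h x)"] by (simp add: norm_mult mult_ac)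
  have int': "integrable (lebesgue_on U) (\<lambda>x. snorm U k g * (cmod (h x) * (1 / (1 + norm x) ^ k)))"
    using int by (rule integrable_mult_right)
  have sp: "space (lebesgue_on U) = U" by (simp add: space_restrict_space)
  show i: "integrable (lebesgue_on U) (\<lambda>x. h x * g x)"
  proof (rule Bochner_Integration.integrable_bound[OF int'])
    show "(\<lambda>x. h x * g x) \<in> borel_measurable (lebesgue_on U)" using h schwartz_measurable[OF U g] by measurable
    show "AE x in lebesgue_on U. norm (h x * g x) \<le> norm (snorm U k g * (cmod (h x) * (1 / (1 + norm x) ^ k)))"
      unfolding real_norm_def by (intro AE_I2 order_trans[OF le abs_ge_self]) (simp add: sp)
  qed
  have "cmod (\<integral>x. h x * g x \<partial>(lebesgue_on U)) \<le> (\<integral>x. cmod (h x * g x) \<partial>(lebesgue_on U))" by (rule integral_norm_bound)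
  also have "... \<le> (\<integral>x. snorm U k g * (cmod (h x) * (1 / (1 + norm x) ^ k)) \<partial>(lebesgue_on U))"
    by (intro integral_mono int' integrable_norm i) (use le in \<open>simp add: sp\<close>)
  finally show "cmod (\<integral>x. h x * g x \<partial>(lebesgue_on U)) \<le> (\<integral>x. cmod (h x) * (1 / (1 + norm x) ^ k) \<partial>(lebesgue_on U)) * snorm U k g"
    unfolding Bochner_Integration.integral_mult_right_zero by (simp only: mult.commute)
qed

lemma functional_dual:
  fixes U :: "'a::euclidean_space set" and h :: "'a \<Rightarrow> complex"
  assumes U: "open U" "U \<noteq> {}" and h: "h \<in> borel_measurable (lebesgue_on U)"
    and int: "integrable (lebesgue_on U) (\<lambda>x. cmod (h x) * (1 / (1 + norm x) ^ k))"
  shows "functional U h \<in> dual_vectors (schwartz U)"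
proof (rule dual_schwartzI[OF U])
  note P = schwartz_pairing[OF U(1) h int]
  show "functional U h (\<lambda>x. f x + g x) = functional U h f + functional U h g"
    if "f \<in> schwartz_functions U" "g \<in> schwartz_functions U" for f g
    using P(1)[OF that(1)] P(1)[OF that(2)] that schwartz_add(1)[OF U(1) that] by (simp add: functional_def distrib_left)
  show "functional U h (\<lambda>x. c * f x) = c * functional U h f" if "f \<in> schwartz_functions U" for c f
  proof -
    have "(\<lambda>x. h x * (c * f x)) = (\<lambda>x. c * (h x * f x))" by (auto simp: mult_ac)
    then show ?thesis using that schwartz_scale(1)[OF U(1) that, of c] by (simp add: functional_def)
  qed
  show "cmod (functional U h f) \<le> (\<integral>x. cmod (h x) * (1 / (1 + norm x) ^ k) \<partial>(lebesgue_on U)) * snorm U k f"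
    if "f \<in> schwartz_functions U" for f using P(2)[OF that] that by (simp add: functional_def)
qed (simp add: functional_def)

lemma integrable_of_decay:
  fixes f :: "'a::euclidean_space \<Rightarrow> complex"
  assumes "f \<in> borel_measurable borel" "\<And>x. cmod (f x) \<le> K * decay x"
  shows "integrable lborel f"
proof (rule Bochner_Integration.integrable_bound[OF integrable_mult_right[OF integrable_weight, of K]])
  show "AE x in lborel. norm (f x) \<le> norm (K * decay x)" unfolding real_norm_def by (intro AE_I2 order_trans[OF assms(2) abs_ge_self])
qed (use assms(1) in simp)

section \<open>Integration by parts\<close>

lemma dir_deriv_increment_bound:
  fixes f :: "'a::euclidean_space \<Rightarrow> complex"
  assumes d: "\<And>x. has_dir_deriv b f (f' x) x" and B: "\<And>s. 0 \<le> s \<Longrightarrow> s \<le> t \<Longrightarrow> cmod (f' (x + s *\<^sub>R b)) \<le> B"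
    and t: "0 \<le> t"
  shows "cmod (f (x + t *\<^sub>R b) - f x) \<le> B * t"
proof -
  have "norm (f (x + t *\<^sub>R b) - f (x + 0 *\<^sub>R b)) \<le> B * norm (t - 0)"
  proof (rule differentiable_bound[where S = "{0..t}" and f' = "\<lambda>s h. h *\<^sub>R f' (x + s *\<^sub>R b)"])
    fix s assume s: "s \<in> {0..t}"
    show "((\<lambda>s. f (x + s *\<^sub>R b)) has_derivative (\<lambda>h. h *\<^sub>R f' (x + s *\<^sub>R b))) (at s within {0..t})"
      using has_dir_deriv_line[OF d] unfolding has_vector_derivative_def by (rule has_derivative_at_withinI)
    show "onorm (\<lambda>h. h *\<^sub>R f' (x + s *\<^sub>R b)) \<le> B"
      using B[of s] s by (intro onorm_le) (auto simp: mult.commute[of B] intro: mult_left_mono)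
  qed (use t in auto)
  then show ?thesis using t by simp
qed

text \<open>Difference quotients of \<open>f\<close> have integral 0 by translation invariance, and
  they converge to \<open>f'\<close>. The mean value estimate and the decay of \<open>f'\<close>
  near \<open>x\<close> give an integrable majorant, so dominated convergence applies.\<close>

lemma integral_dir_deriv_eq_0:
  fixes f :: "'a::euclidean_space \<Rightarrow> complex"
  assumes b: "b \<in> Basis" and d: "\<And>x. has_dir_deriv b f (f' x) x"
    and cont: "continuous_on UNIV f" "continuous_on UNIV f'"
    and decay: "\<And>x. cmod (f x) \<le> K * decay x"
      "\<And>x. cmod (f' x) \<le> K * decay x"
  shows "(\<integral>x. f' x \<partial>lborel) = 0"
proof -
  have [measurable]: "f \<in> borel_measurable borel" "f' \<in> borel_measurable borel"
    using cont by (auto intro: borel_measurable_continuous_onI)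
  have int: "integrable lborel f" by (rule integrable_of_decay[OF _ decay(1)]) simp
  define t where "t n = inverse (real (Suc n))" for n
  have t: "t n > 0" "t n \<le> 1" for n by (auto simp: t_def inverse_le_1_iff)
  have t0: "t \<longlonglongrightarrow> 0" unfolding t_def by (rule LIMSEQ_inverse_real_of_nat)
  define g where "g n x = (1 / t n) *\<^sub>R (f (x + t n *\<^sub>R b) - f x)" for n x
  have shift: "integrable lborel (\<lambda>x. f (x + c))" "(\<integral>x. f (x + c) \<partial>lborel) = (\<integral>x. f x \<partial>lborel)" for c
  proof -
    have "integrable (distr lborel borel ((+) c)) f" using int by (simp add: lborel_distr_plus)
    then show "integrable lborel (\<lambda>x. f (x + c))" by (subst (asm) integrable_distr_eq) (auto simp: add.commute)
    have "(\<integral>x. f x \<partial>lborel) = (\<integral>x. f x \<partial>distr lborel borel ((+) c))" by (simp add: lborel_distr_plus)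
    also have "... = (\<integral>x. f (c + x) \<partial>lborel)" by (rule integral_distr) auto
    finally show "(\<integral>x. f (x + c) \<partial>lborel) = (\<integral>x. f x \<partial>lborel)" by (simp add: add.commute)
  qed
  have g0: "(\<integral>x. g n x \<partial>lborel) = 0" for n unfolding g_def using shift[of "t n *\<^sub>R b"] int by simp
  have lim: "(\<lambda>n. g n x) \<longlonglongrightarrow> f' x" for x
  proof -
    have "((\<lambda>h. norm (f (x + h *\<^sub>R b) - f x - h *\<^sub>R f' x) / norm h) \<longlongrightarrow> 0) (at 0)"
      using d[of x] unfolding has_vector_derivative_def has_derivative_at by simp
    moreover have "filterlim t (at 0) sequentially" unfolding filterlim_at using t0 t(1) by (simp add: less_imp_neq[THEN not_sym])
    ultimately have "(\<lambda>n. norm (f (x + t n *\<^sub>R b) - f x - t n *\<^sub>R f' x) / norm (t n)) \<longlonglongrightarrow> 0" by (rule filterlim_compose)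
    moreover have "norm (f (x + t n *\<^sub>R b) - f x - t n *\<^sub>R f' x) / norm (t n) = norm (g n x - f' x)" for n
    proof -
      have "g n x - f' x = (1 / t n) *\<^sub>R (f (x + t n *\<^sub>R b) - f x - t n *\<^sub>R f' x)"
        using t(1)[of n] by (simp add: g_def scaleR_diff_right)
      then show ?thesis using t(1)[of n] by (simp add: divide_inverse mult.commute)
    qed
    ultimately have "(\<lambda>n. g n x - f' x) \<longlonglongrightarrow> 0" by (simp add: tendsto_norm_zero_iff)
    then show ?thesis by (rule LIM_zero_cancel)
  qed
  have K: "K \<ge> 0"
  proof -
    have "0 \<le> K * decay (0::'a)" using decay(1)[of 0] norm_ge_zero order_trans by blast
    then show ?thesis by simp
  qed
  \<comment> \<open>The steps \<open>t n\<close> are at most 1, so along the segment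
    \<open>1 + norm x\<close> is at most twice \<open>1 + norm (x + s *\<^sub>R b)\<close>. This is
    the origin of the power of 2.\<close>
  let ?B = "\<lambda>x::'a. (K * 2 ^ (2 * DIM('a))) * decay x"
  have bound: "cmod (g n x) \<le> ?B x" for n x
  proof -
    have "cmod (f (x + t n *\<^sub>R b) - f x) \<le> ?B x * t n"
    proof (rule dir_deriv_increment_bound[OF d])
      fix s assume s: "0 \<le> s" "s \<le> t n"
      have "norm x \<le> norm (x + s *\<^sub>R b) + norm (s *\<^sub>R b)" using norm_triangle_ineq4[of "x + s *\<^sub>R b" "s *\<^sub>R b"] by simp
      then have "1 + norm x \<le> 2 * (1 + norm (x + s *\<^sub>R b))" using s t(2)[of n] b norm_ge_zero[of "x + s *\<^sub>R b"]
        unfolding norm_scaleR norm_Basis[OF b] abs_of_nonneg[OF s(1)] mult_1_right by (simp only: distrib_left)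
      then have "(1 + norm x) ^ (2 * DIM('a)) \<le> (2 * (1 + norm (x + s *\<^sub>R b))) ^ (2 * DIM('a))" by (intro power_mono) auto
      then have "decay (x + s *\<^sub>R b) \<le> 2 ^ (2 * DIM('a)) * decay x"
        unfolding power_mult_distrib by (simp add: field_simps add_pos_nonneg)
      from mult_left_mono[OF this K] show "cmod (f' (x + s *\<^sub>R b)) \<le> ?B x" using decay(2)[of "x + s *\<^sub>R b"] by (simp add: mult.assoc)
    qed (use t(1)[of n] in simp)
    moreover have "cmod (g n x) = cmod (f (x + t n *\<^sub>R b) - f x) / t n" unfolding g_def norm_scaleR using t(1)[of n] by simp
    ultimately show ?thesis using t(1)[of n] by (simp only: pos_divide_le_eq)
  qed
  have "(\<lambda>n. \<integral>x. g n x \<partial>lborel) \<longlonglongrightarrow> (\<integral>x. f' x \<partial>lborel)"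
  proof (rule integral_dominated_convergence[where w = ?B])
    show "integrable lborel ?B" by (intro integrable_mult_right integrable_weight)
    show "g n \<in> borel_measurable lborel" for n unfolding g_def by measurable
  qed (use lim bound in auto)
  then show ?thesis unfolding g0 by (simp add: LIMSEQ_const_iff)
qed

lemma schwartz_continuous: "f \<in> S_funs \<Longrightarrow> continuous_on UNIV f" using continuous_on_partial_deriv[of f "[]"] by simp

lemma schwartz_borel: "f \<in> S_funs \<Longrightarrow> f \<in> borel_measurable borel" by (intro borel_measurable_continuous_onI schwartz_continuous)

lemma schwartz_integrable:
  fixes f :: "'a::euclidean_space \<Rightarrow> complex"
  assumes "f \<in> S_funs"
  shows "integrable lborel f" by (rule integrable_of_decay[OF schwartz_borel[OF assms] schwartz_decay[OF assms]]) simp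

lemma schwartz_bounded: "f \<in> S_funs \<Longrightarrow> cmod (f x) \<le> snorm UNIV 0 f" using schwartz_decay[of f UNIV x 0] by simp

lemma schwartz_product_decay:
  fixes f g :: "'a::euclidean_space \<Rightarrow> complex"
  assumes f: "f \<in> S_funs" and g: "\<And>x. cmod (g x) \<le> B"
  shows "cmod (f x * g x) \<le> (snorm UNIV k f * B) * (1 / (1 + norm x) ^ k)"
proof -
  have "cmod (f x * g x) \<le> (snorm UNIV k f * (1 / (1 + norm x) ^ k)) * B"
    unfolding norm_mult using snorm_nonneg[OF f UNIV_not_empty] by (intro mult_mono schwartz_decay[OF f] g) auto
  then show ?thesis by (simp add: mult_ac)
qed

lemma schwartz_product_integrable:
  fixes f g :: "'a::euclidean_space \<Rightarrow> complex"
  assumes "f \<in> S_funs" "g \<in> borel_measurable borel" "\<And>x. cmod (g x) \<le> B"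
  shows "integrable lborel (\<lambda>x. f x * g x)"
proof (rule integrable_of_decay[OF _ schwartz_product_decay[OF assms(1,3)]])
  show "(\<lambda>x. f x * g x) \<in> borel_measurable borel" using schwartz_borel[OF assms(1)] assms(2) by measurable
qed

lemma schwartz_has_dir_deriv:
  "f \<in> S_funs \<Longrightarrow> b \<in> Basis \<Longrightarrow> has_dir_deriv b f (dir_deriv b f x) x"
  using smooth_on_has_dir_deriv[of UNIV f "[]" b x] schwartz_functionsD(1)[of f UNIV] by simp

text \<open>The derivative of the product integrates to 0. Each of its terms decays because one
  factor does while the other is bounded.\<close>

lemma integration_by_parts:
  fixes f g :: "'a::euclidean_space \<Rightarrow> complex"
  assumes f: "f \<in> S_funs" and g: "g \<in> S_funs" and b: "b \<in> Basis"
  shows "(\<integral>x. dir_deriv b f x * g x \<partial>lborel) = - (\<integral>x. f x * dir_deriv b g x \<partial>lborel)"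
proof -
  note f' = schwartz_dir_deriv(1)[OF f b] and g' = schwartz_dir_deriv(1)[OF g b]
  let ?K1 = "snorm UNIV (2 * DIM('a)) f * snorm UNIV 0 g"
  let ?K2 = "snorm UNIV (2 * DIM('a)) f * snorm UNIV 0 (dir_deriv b g) + snorm UNIV (2 * DIM('a)) (dir_deriv b f) * snorm UNIV 0 g"
  have "(\<integral>x. f x * dir_deriv b g x + dir_deriv b f x * g x \<partial>lborel) = 0"
  proof (rule integral_dir_deriv_eq_0[OF b, where f = "\<lambda>x. f x * g x" and K = "max ?K1 ?K2"])
    show "has_dir_deriv b (\<lambda>x. f x * g x) (f x * dir_deriv b g x + dir_deriv b f x * g x) x" for x
      using has_vector_derivative_mult[OF schwartz_has_dir_deriv[OF f b] schwartz_has_dir_deriv[OF g b]] by simp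
    show "cmod (f x * g x) \<le> max ?K1 ?K2 * decay x" for x
      by (rule order_trans[OF schwartz_product_decay[OF f schwartz_bounded[OF g]] mult_right_mono]) auto
    have "cmod (f x * dir_deriv b g x + dir_deriv b f x * g x) \<le> ?K2 * decay x" for x
      unfolding distrib_right by (rule order_trans[OF norm_triangle_ineq add_mono[OF
            schwartz_product_decay[OF f schwartz_bounded[OF g']] schwartz_product_decay[OF f' schwartz_bounded[OF g]]]])
    then show "cmod (f x * dir_deriv b g x + dir_deriv b f x * g x) \<le> max ?K1 ?K2 * decay x" for x
      by (rule order_trans[OF _ mult_right_mono]) auto
  qed (intro continuous_intros schwartz_continuous f g f' g')+
  moreover have "integrable lborel (\<lambda>x. f x * dir_deriv b g x)"
    by (rule schwartz_product_integrable[OF f schwartz_borel[OF g'] schwartz_bounded[OF g']])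
  moreover have "integrable lborel (\<lambda>x. dir_deriv b f x * g x)"
    by (rule schwartz_product_integrable[OF f' schwartz_borel[OF g] schwartz_bounded[OF g]])
  ultimately show ?thesis by (simp add: eq_neg_iff_add_eq_0 add.commute)
qed

section \<open>Hermite functions\<close>

text \<open>The Hermite functions normalised in L2, by their three-term recurrence; the power of
  \<open>pi\<close> normalises the Gaussian.\<close>

fun hermite :: "nat \<Rightarrow> real \<Rightarrow> real" where
  "hermite 0 x = pi powr (- (1/4)) * exp (- x\<^sup>2 / 2)"
| "hermite (Suc 0) x = sqrt 2 * x * hermite 0 x"
| "hermite (Suc (Suc n)) x = (sqrt 2 * x * hermite (Suc n) x - sqrt (real (Suc n)) * hermite n x) / sqrt (real (Suc (Suc n)))"

text \<open>This form includes \<open>n = 0\<close>: the truncated index \<open>n - 1\<close> then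
  comes with the coefficient \<open>sqrt 0\<close>. All ladder formulas below rest on this
  convention.\<close>

lemma hermite_Suc: "sqrt (real (Suc n)) * hermite (Suc n) x = sqrt 2 * x * hermite n x - sqrt (real n) * hermite (n - 1) x"
  by (cases n) auto

lemma hermite_Suc_eq: "hermite (Suc n) x = (sqrt 2 * x * hermite n x - sqrt (real n) * hermite (n - 1) x) / sqrt (real (Suc n))"
  using hermite_Suc[of n x] by (simp add: field_simps)

lemma sqrt_mult_self_left: "a \<ge> 0 \<Longrightarrow> sqrt a * (sqrt a * c) = a * c" by (simp add: mult.assoc[symmetric])

text \<open>Differentiating the recurrence brings in the derivatives at the two previous indices,
  known by induction. The recurrence, read at \<open>k\<close> and at \<open>k - 1\<close>, then
  collects the terms.\<close>

lemma hermite_deriv: "(hermite n has_real_derivative sqrt 2 * sqrt (real n) * hermite (n - 1) x - x * hermite n x) (at x)"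
proof (induction n rule: less_induct)
  case (less n)
  show ?case
  proof (cases n)
    case 0
    have "((\<lambda>x. pi powr (- (1/4)) * exp (- x\<^sup>2 / 2)) has_real_derivative pi powr (- (1/4)) * (exp (- x\<^sup>2 / 2) * (- (2 * x) / 2))) (at x)"
      by (auto intro!: derivative_eq_intros)
    moreover have "hermite 0 = (\<lambda>x. pi powr (- (1/4)) * exp (- x\<^sup>2 / 2))" by (auto simp: fun_eq_iff)
    ultimately show ?thesis using 0 by (simp add: mult_ac)
  next
    case (Suc k)
    define d where "d j = sqrt 2 * sqrt (real j) * hermite (j - 1) x - x * hermite j x" for j
    have IH: "(hermite k has_real_derivative d k) (at x)" "(hermite (k - 1) has_real_derivative d (k - 1)) (at x)"
      using less[of k] less[of "k - 1"] Suc by (auto simp: d_def)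
    have "((\<lambda>x. (sqrt 2 * x * hermite k x - sqrt (real k) * hermite (k - 1) x) / sqrt (real (Suc k))) has_real_derivative
       (sqrt 2 * hermite k x + sqrt 2 * x * d k - sqrt (real k) * d (k - 1)) / sqrt (real (Suc k))) (at x)"
      by (intro DERIV_cdivide) (auto intro!: derivative_eq_intros IH simp: algebra_simps simp del: One_nat_def)
    moreover have "(sqrt 2 * hermite k x + sqrt 2 * x * d k - sqrt (real k) * d (k - 1)) = sqrt (real (Suc k)) * d (Suc k)"
    proof -
      have 1: "sqrt 2 * x * hermite k x - sqrt (real k) * hermite (k - 1) x = sqrt (real (Suc k)) * hermite (Suc k) x"
        by (rule hermite_Suc[symmetric])
      \<comment> \<open>The recurrence one index lower, multiplied by \<open>sqrt (real k)\<close>;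
        for \<open>k = 0\<close> both sides vanish.\<close>
      have 2: "sqrt (real k) * (sqrt 2 * x * hermite (k - 1) x - sqrt (real (k - 1)) * hermite (k - 1 - 1) x) = real k * hermite k x"
      proof (cases k)
        case (Suc j)
        then show ?thesis using hermite_Suc[of j x] sqrt_mult_self_left[of "real (Suc j)" "hermite (Suc j) x"] by simp
      qed simp
      have "sqrt 2 * hermite k x + sqrt 2 * x * d k - sqrt (real k) * d (k - 1) =
        sqrt 2 * hermite k x - x * (sqrt 2 * x * hermite k x - sqrt (real k) * hermite (k - 1) x)
        + sqrt 2 * (sqrt (real k) * (sqrt 2 * x * hermite (k - 1) x - sqrt (real (k - 1)) * hermite (k - 1 - 1) x))"
        by (simp add: d_def algebra_simps)
      also have "... = sqrt 2 * hermite k x - x * (sqrt (real (Suc k)) * hermite (Suc k) x) + sqrt 2 * (real k * hermite k x)"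
        unfolding 1 2 ..
      also have "... = sqrt 2 * (real (Suc k) * hermite k x) - x * (sqrt (real (Suc k)) * hermite (Suc k) x)"
        by (simp add: algebra_simps)
      also have "real (Suc k) * hermite k x = sqrt (real (Suc k)) * (sqrt (real (Suc k)) * hermite k x)"
        by (simp only: sqrt_mult_self_left of_nat_0_le_iff)
      finally show ?thesis by (simp add: d_def algebra_simps)
    qed
    ultimately have "((\<lambda>x. hermite (Suc k) x) has_real_derivative d (Suc k)) (at x)" by (simp add: hermite_Suc_eq[abs_def])
    then show ?thesis using Suc by (simp add: d_def)
  qed
qed

text \<open>The recurrence removes the factor \<open>x\<close>. What is left is the lowering
  operator minus the raising operator with coefficients free of \<open>x\<close>, as
  \<open>schwartz_ladder_family\<close> wants it.\<close>

lemma hermite_deriv_ladder: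
  "sqrt 2 * sqrt (real n) * hermite (n - 1) x - x * hermite n x =
     sqrt (real n / 2) * hermite (n - 1) x - sqrt (real (Suc n) / 2) * hermite (Suc n) x"
proof -
  have "sqrt 2 * (sqrt 2 * sqrt (real n) * hermite (n - 1) x - x * hermite n x) =
      2 * sqrt (real n) * hermite (n - 1) x - sqrt 2 * x * hermite n x" by (simp add: algebra_simps)
  also have "... = sqrt (real n) * hermite (n - 1) x - sqrt (real (Suc n)) * hermite (Suc n) x" unfolding hermite_Suc by simp
  also have "... = sqrt 2 * (sqrt (real n / 2) * hermite (n - 1) x - sqrt (real (Suc n) / 2) * hermite (Suc n) x)"
    by (simp add: real_sqrt_divide algebra_simps)
  finally show ?thesis by simp
qed

lemma hermite_mult_ladder:
  "x * hermite n x = sqrt (real (Suc n) / 2) * hermite (Suc n) x + sqrt (real n / 2) * hermite (n - 1) x"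
proof -
  have "sqrt 2 * (x * hermite n x) = sqrt 2 * (sqrt (real (Suc n) / 2) * hermite (Suc n) x + sqrt (real n / 2) * hermite (n - 1) x)"
    using hermite_Suc[of n x] by (simp add: real_sqrt_divide algebra_simps)
  then show ?thesis by simp
qed

lemma hermite_continuous: "continuous_on UNIV (hermite n)" using hermite_deriv by (meson DERIV_isCont continuous_at_imp_continuous_on)

lemma hermite_borel [measurable]: "hermite n \<in> borel_measurable borel" by (rule borel_measurable_continuous_onI[OF hermite_continuous])

lemma power_over_fact_le_exp:
  fixes y :: real
  assumes "y \<ge> 0"
  shows "y ^ k / fact k \<le> exp y"
proof -
  have "(\<Sum>n\<in>{k}. y ^ n /\<^sub>R fact n) \<le> exp y" unfolding exp_def using assms by (intro sum_le_suminf[OF summable_exp_generic]) auto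
  then show ?thesis by (simp add: field_simps)
qed

lemma hermite_power_bound: "\<exists>C. \<forall>x. \<bar>x\<bar> ^ k * \<bar>hermite n x\<bar> \<le> C"
proof (induction n arbitrary: k rule: less_induct)
  case (less n)
  show ?case
  proof (cases n)
    case 0
    have "\<bar>x\<bar> ^ k * \<bar>hermite 0 x\<bar> \<le> pi powr (- (1/4)) * (1 + 2 ^ k * fact k)" for x :: real
    proof -
      \<comment> \<open>An even power can be compared with a single term of the exponential series
        of \<open>x\<^sup>2 / 2\<close>.\<close>
      have "\<bar>x\<bar> ^ k \<le> 1 + \<bar>x\<bar> ^ (2 * k)"
      proof (cases "\<bar>x\<bar> \<le> 1")
        case True
        then have "\<bar>x\<bar> ^ k \<le> 1" by (simp add: power_le_one)
        then show ?thesis by (simp add: add_increasing2)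
      next
        case False
        then have "\<bar>x\<bar> ^ k \<le> \<bar>x\<bar> ^ (2 * k)" by (intro power_increasing) auto
        then show ?thesis by simp
      qed
      moreover have "\<bar>x\<bar> ^ (2 * k) = 2 ^ k * fact k * ((x\<^sup>2 / 2) ^ k / fact k)" by (simp add: power_mult power_divide)
      moreover have "2 ^ k * fact k * ((x\<^sup>2 / 2) ^ k / fact k) \<le> 2 ^ k * fact k * exp (x\<^sup>2 / 2)"
        by (intro mult_left_mono power_over_fact_le_exp) auto
      ultimately have "\<bar>x\<bar> ^ k \<le> 1 + 2 ^ k * fact k * exp (x\<^sup>2 / 2)" by linarith
      then have "\<bar>x\<bar> ^ k * exp (- (x\<^sup>2 / 2)) \<le> (1 + 2 ^ k * fact k * exp (x\<^sup>2 / 2)) * exp (- (x\<^sup>2 / 2))"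
        by (intro mult_right_mono) auto
      also have "... = exp (- (x\<^sup>2 / 2)) + 2 ^ k * fact k" by (simp add: distrib_right exp_minus)
      also have "... \<le> 1 + 2 ^ k * fact k" by simp
      finally have "\<bar>x\<bar> ^ k * exp (- (x\<^sup>2 / 2)) \<le> 1 + 2 ^ k * fact k" .
      from mult_left_mono[OF this, of "pi powr (- (1/4))"] show ?thesis by (simp add: abs_mult mult_ac)
    qed
    then show ?thesis using 0 by blast
  next
    case (Suc j)
    obtain C1 where C1: "\<And>x. \<bar>x\<bar> ^ Suc k * \<bar>hermite j x\<bar> \<le> C1" using less[of j "Suc k"] Suc by auto
    obtain C2 where C2: "\<And>x. \<bar>x\<bar> ^ k * \<bar>hermite (j - 1) x\<bar> \<le> C2" using less[of "j - 1" k] Suc less_Suc_eq_le[of "j - 1" j] diff_le_self[of j 1] by metis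
    have "\<bar>x\<bar> ^ k * \<bar>hermite (Suc j) x\<bar> \<le> (sqrt 2 * C1 + sqrt (real j) * C2) / sqrt (real (Suc j))" for x
    proof -
      have "\<bar>x\<bar> ^ k * \<bar>sqrt 2 * x * hermite j x - sqrt (real j) * hermite (j - 1) x\<bar> \<le>
        \<bar>x\<bar> ^ k * (\<bar>sqrt 2 * x * hermite j x\<bar> + \<bar>sqrt (real j) * hermite (j - 1) x\<bar>)" by (intro mult_left_mono abs_triangle_ineq4) auto
      also have "... = sqrt 2 * (\<bar>x\<bar> ^ Suc k * \<bar>hermite j x\<bar>) + sqrt (real j) * (\<bar>x\<bar> ^ k * \<bar>hermite (j - 1) x\<bar>)"
        by (simp add: abs_mult algebra_simps)
      also have "... \<le> sqrt 2 * C1 + sqrt (real j) * C2" by (intro add_mono mult_left_mono C1 C2) auto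
      finally show ?thesis unfolding hermite_Suc_eq[of j] by (simp add: abs_divide field_simps)
    qed
    then show ?thesis using Suc by blast
  qed
qed

lemma hermite_decay: "\<exists>C\<ge>0. \<forall>x. \<bar>hermite n x\<bar> \<le> C * (1 / (1 + \<bar>x\<bar>) ^ k)"
proof -
  obtain C0 where C0: "\<And>x. \<bar>x\<bar> ^ 0 * \<bar>hermite n x\<bar> \<le> C0" using hermite_power_bound by blast
  obtain C1 where C1: "\<And>x. \<bar>x\<bar> ^ k * \<bar>hermite n x\<bar> \<le> C1" using hermite_power_bound by blast
  have "0 \<le> C0" using C0[of 0] by simp
  have "(1 + \<bar>x\<bar>) ^ k * \<bar>hermite n x\<bar> \<le> 2 ^ k * (C0 + C1)" for x
  proof -
    have "(1 + \<bar>x\<bar>) ^ k \<le> (2 * max 1 \<bar>x\<bar>) ^ k" by (intro power_mono) auto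
    also have "... \<le> 2 ^ k * (1 + \<bar>x\<bar> ^ k)" by (auto simp: power_mult_distrib max_def)
    finally have "(1 + \<bar>x\<bar>) ^ k * \<bar>hermite n x\<bar> \<le> 2 ^ k * (1 + \<bar>x\<bar> ^ k) * \<bar>hermite n x\<bar>" by (rule mult_right_mono) auto
    also have "... = 2 ^ k * (\<bar>x\<bar> ^ 0 * \<bar>hermite n x\<bar> + \<bar>x\<bar> ^ k * \<bar>hermite n x\<bar>)" by (simp add: algebra_simps)
    also have "... \<le> 2 ^ k * (C0 + C1)" by (intro mult_left_mono add_mono C0 C1) auto
    finally show ?thesis .
  qed
  then have "\<bar>hermite n x\<bar> \<le> (2 ^ k * (C0 + C1)) * (1 / (1 + \<bar>x\<bar>) ^ k)" for x by (simp add: field_simps add_pos_nonneg)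
  moreover have "0 \<le> C1" using C1[of 0] by (meson abs_ge_zero mult_nonneg_nonneg order_trans zero_le_power)
  ultimately show ?thesis using \<open>0 \<le> C0\<close> by (intro exI[of _ "2 ^ k * (C0 + C1)"]) auto
qed

lemma hermite_bounded: "\<exists>C\<ge>0. \<forall>x. \<bar>hermite n x\<bar> \<le> C" using hermite_decay[of n 0] by simp

lemma hermite_product_decay: "\<exists>C\<ge>0. \<forall>x. \<bar>x ^ j * (hermite m x * hermite n x)\<bar> \<le> C * (1 / (1 + \<bar>x\<bar>) ^ 2)"
proof -
  obtain A where A: "A \<ge> 0" "\<And>x. \<bar>hermite m x\<bar> \<le> A * (1 / (1 + \<bar>x\<bar>) ^ 2)" using hermite_decay by blast
  obtain B where B: "\<And>x. \<bar>x\<bar> ^ j * \<bar>hermite n x\<bar> \<le> B" using hermite_power_bound by blast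
  have B0: "0 \<le> B" using B[of 0] by (meson abs_ge_zero mult_nonneg_nonneg order_trans zero_le_power)
  have "\<bar>x ^ j * (hermite m x * hermite n x)\<bar> \<le> (A * B) * (1 / (1 + \<bar>x\<bar>) ^ 2)" for x
  proof -
    have "\<bar>x ^ j * (hermite m x * hermite n x)\<bar> = \<bar>hermite m x\<bar> * (\<bar>x\<bar> ^ j * \<bar>hermite n x\<bar>)" by (simp add: abs_mult power_abs mult_ac)
    also have "... \<le> (A * (1 / (1 + \<bar>x\<bar>) ^ 2)) * B" using A B0 by (intro mult_mono A B) auto
    finally show ?thesis by (simp add: mult_ac)
  qed
  then show ?thesis using A(1) B0 by (intro exI[of _ "A * B"]) auto
qed

lemma integrable_of_decay_real:
  fixes f :: "real \<Rightarrow> real"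
  assumes "f \<in> borel_measurable borel" "\<And>x. \<bar>f x\<bar> \<le> K * (1 / (1 + \<bar>x\<bar>) ^ 2)"
  shows "integrable lborel f"
proof -
  have "integrable lborel (\<lambda>x. complex_of_real (f x))" by (rule integrable_of_decay[where K = K]) (use assms in auto)
  then show ?thesis unfolding complex_of_real_integrable_eq .
qed

lemma integrable_hermite_product: "integrable lborel (\<lambda>x. x ^ j * (hermite m x * hermite n x))"
proof -
  obtain C where "\<And>x. \<bar>x ^ j * (hermite m x * hermite n x)\<bar> \<le> C * (1 / (1 + \<bar>x\<bar>) ^ 2)" using hermite_product_decay by blast
  then show ?thesis by (intro integrable_of_decay_real[where K = C]) measurable
qed

lemma integrable_hermite_product0: "integrable lborel (\<lambda>x. hermite m x * hermite n x)"
  and integrable_hermite_product1: "integrable lborel (\<lambda>x. x * (hermite m x * hermite n x))"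
  using integrable_hermite_product[of 0] integrable_hermite_product[of 1] by simp_all

lemma integral_deriv_eq_0_real:
  fixes f :: "real \<Rightarrow> real"
  assumes d: "\<And>x. (f has_real_derivative f' x) (at x)" and cont: "continuous_on UNIV f'"
    and decay: "\<And>x. \<bar>f x\<bar> \<le> K * (1 / (1 + \<bar>x\<bar>) ^ 2)" "\<And>x. \<bar>f' x\<bar> \<le> K * (1 / (1 + \<bar>x\<bar>) ^ 2)"
  shows "(\<integral>x. f' x \<partial>lborel) = 0"
proof -
  have "(\<integral>x. complex_of_real (f' x) \<partial>lborel) = 0"
  proof (rule integral_dir_deriv_eq_0[where b = 1 and f = "\<lambda>x. complex_of_real (f x)" and K = K])
    fix x :: real
    have "((\<lambda>t. f (x + t)) has_real_derivative f' x) (at 0)" using DERIV_shift[of f "f' x" 0 x] d[of x] by (simp add: add.commute)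
    then show "has_dir_deriv 1 (\<lambda>x. complex_of_real (f x)) (complex_of_real (f' x)) x"
      by (auto intro!: has_vector_derivative_of_real simp: has_real_derivative_iff_has_vector_derivative)
  next
    have "continuous_on UNIV f" using d by (meson DERIV_isCont continuous_at_imp_continuous_on)
    then show "continuous_on UNIV (\<lambda>x. complex_of_real (f x))" by (intro continuous_intros)
    show "continuous_on UNIV (\<lambda>x. complex_of_real (f' x))" by (intro continuous_intros cont)
  qed (use decay in auto)
  then show ?thesis by simp
qed

text \<open>The integrand is the derivative of \<open>hermite m x * hermite n x\<close>, a function
  with decay.\<close>

lemma hermite_product_ibp:
  "(\<integral>x. sqrt 2 * sqrt (real m) * (hermite (m - 1) x * hermite n x) + sqrt 2 * sqrt (real n) * (hermite m x * hermite (n - 1) x)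
     - 2 * (x * (hermite m x * hermite n x)) \<partial>lborel) = 0"
proof -
  let ?g = "\<lambda>x. sqrt 2 * sqrt (real m) * (hermite (m - 1) x * hermite n x) + sqrt 2 * sqrt (real n) * (hermite m x * hermite (n - 1) x)
     - 2 * (x * (hermite m x * hermite n x))"
  obtain A where A: "A \<ge> 0" "\<And>x. \<bar>x ^ 0 * (hermite m x * hermite n x)\<bar> \<le> A * (1 / (1 + \<bar>x\<bar>) ^ 2)"
    using hermite_product_decay[of 0 m n] by blast
  obtain B where B: "B \<ge> 0" "\<And>x. \<bar>x ^ 0 * (hermite (m - 1) x * hermite n x)\<bar> \<le> B * (1 / (1 + \<bar>x\<bar>) ^ 2)"
    using hermite_product_decay[of 0 "m - 1" n] by blast
  obtain C where C: "C \<ge> 0" "\<And>x. \<bar>x ^ 0 * (hermite m x * hermite (n - 1) x)\<bar> \<le> C * (1 / (1 + \<bar>x\<bar>) ^ 2)"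
    using hermite_product_decay[of 0 m "n - 1"] by blast
  obtain D where D: "D \<ge> 0" "\<And>x. \<bar>x ^ 1 * (hermite m x * hermite n x)\<bar> \<le> D * (1 / (1 + \<bar>x\<bar>) ^ 2)"
    using hermite_product_decay[of 1 m n] by blast
  let ?K = "A + (sqrt 2 * sqrt (real m) * B + sqrt 2 * sqrt (real n) * C + 2 * D)"
  show ?thesis
  proof (rule integral_deriv_eq_0_real[where f = "\<lambda>x. hermite m x * hermite n x" and K = ?K])
    fix x
    show "((\<lambda>x. hermite m x * hermite n x) has_real_derivative ?g x) (at x)"
      by (rule derivative_eq_intros hermite_deriv refl)+ (simp add: algebra_simps)
    let ?e = "1 / (1 + \<bar>x\<bar>) ^ 2"
    have e: "0 \<le> ?e" by simp
    have "\<bar>hermite m x * hermite n x\<bar> \<le> A * ?e" using A(2)[of x] by simp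
    also have "... \<le> ?K * ?e" using A B C D e by (intro mult_right_mono) auto
    finally show "\<bar>hermite m x * hermite n x\<bar> \<le> ?K * ?e" .
    have "\<bar>?g x\<bar> \<le> \<bar>sqrt 2 * sqrt (real m) * (hermite (m - 1) x * hermite n x)\<bar> +
        \<bar>sqrt 2 * sqrt (real n) * (hermite m x * hermite (n - 1) x)\<bar> + \<bar>2 * (x * (hermite m x * hermite n x))\<bar>" by linarith
    also have "... = sqrt 2 * sqrt (real m) * \<bar>hermite (m - 1) x * hermite n x\<bar> +
        sqrt 2 * sqrt (real n) * \<bar>hermite m x * hermite (n - 1) x\<bar> + 2 * \<bar>x * (hermite m x * hermite n x)\<bar>" by (simp add: abs_mult)
    also have "... \<le> sqrt 2 * sqrt (real m) * (B * ?e) + sqrt 2 * sqrt (real n) * (C * ?e) + 2 * (D * ?e)"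
      using B(2)[of x] C(2)[of x] D(2)[of x] by (intro add_mono mult_left_mono) auto
    also have "... = (sqrt 2 * sqrt (real m) * B + sqrt 2 * sqrt (real n) * C + 2 * D) * ?e" by (simp add: algebra_simps)
    also have "... \<le> ?K * ?e" using A e by (intro mult_right_mono) auto
    finally show "\<bar>?g x\<bar> \<le> ?K * ?e" .
  qed (intro continuous_intros hermite_continuous)
qed

text \<open>The recurrence expresses the left side through the first moment of the product, and
  \<open>hermite_product_ibp\<close> expresses this moment through products with one index lowered.
  The terms with \<open>n - 1\<close> cancel.\<close>

lemma hermite_product_integral_step:
  "sqrt (real (Suc n)) * (\<integral>x. hermite m x * hermite (Suc n) x \<partial>lborel) =
     sqrt (real m) * (\<integral>x. hermite (m - 1) x * hermite n x \<partial>lborel)"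
proof -
  have X: "2 * (\<integral>x. x * (hermite m x * hermite n x) \<partial>lborel) =
     sqrt 2 * sqrt (real m) * (\<integral>x. hermite (m - 1) x * hermite n x \<partial>lborel) +
     sqrt 2 * sqrt (real n) * (\<integral>x. hermite m x * hermite (n - 1) x \<partial>lborel)"
    using hermite_product_ibp[of m n] by (simp add: integrable_hermite_product0 integrable_hermite_product1)
  have "sqrt (real (Suc n)) * (\<integral>x. hermite m x * hermite (Suc n) x \<partial>lborel) =
      (\<integral>x. hermite m x * (sqrt (real (Suc n)) * hermite (Suc n) x) \<partial>lborel)"
    by (subst integral_mult_right_zero[symmetric]) (simp add: mult_ac)
  also have "... = (\<integral>x. sqrt 2 * (x * (hermite m x * hermite n x)) - sqrt (real n) * (hermite m x * hermite (n - 1) x) \<partial>lborel)"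
    unfolding hermite_Suc by (simp add: algebra_simps)
  also have "... = sqrt 2 * (\<integral>x. x * (hermite m x * hermite n x) \<partial>lborel) - sqrt (real n) * (\<integral>x. hermite m x * hermite (n - 1) x \<partial>lborel)"
    by (simp add: integrable_hermite_product0 integrable_hermite_product1)
  also have "sqrt 2 * (\<integral>x. x * (hermite m x * hermite n x) \<partial>lborel) = (sqrt 2 / 2) * (2 * (\<integral>x. x * (hermite m x * hermite n x) \<partial>lborel))"
    by simp
  also have "... = sqrt (real m) * (\<integral>x. hermite (m - 1) x * hermite n x \<partial>lborel) + sqrt (real n) * (\<integral>x. hermite m x * hermite (n - 1) x \<partial>lborel)"
    unfolding X by (simp add: algebra_simps sqrt_mult_self_left)
  finally show ?thesis by simp
qed

text \<open>\<open>hermite_product_integral_step\<close> lowers both indices at once, which reduces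
  everything to \<open>n = 0\<close>. There the diagonal case is a normal density, and for positive
  \<open>m\<close> the same step with the roles exchanged has the coefficient
  \<open>sqrt 0\<close>.\<close>

lemma hermite_orthonormal: "(\<integral>x. hermite m x * hermite n x \<partial>lborel) = (if m = n then 1 else 0)"
proof (induction n arbitrary: m)
  case 0
  show ?case
  proof (cases m)
    case 0
    have "hermite 0 x * hermite 0 x = normal_density 0 (1 / sqrt 2) x" for x
    proof -
      have "pi powr (- (1/4)) * pi powr (- (1/4)) = 1 / sqrt pi" by (simp add: powr_add[symmetric] powr_minus_divide powr_half_sqrt)
      moreover have "hermite 0 x * hermite 0 x = (pi powr (- (1/4)) * pi powr (- (1/4))) * (exp (- x\<^sup>2 / 2) * exp (- x\<^sup>2 / 2))"
        by (simp add: mult_ac)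
      ultimately have "hermite 0 x * hermite 0 x = 1 / sqrt pi * (exp (- x\<^sup>2 / 2) * exp (- x\<^sup>2 / 2))" by (simp only:)
      also have "exp (- x\<^sup>2 / 2) * exp (- x\<^sup>2 / 2) = exp (- x\<^sup>2)" by (simp add: exp_add[symmetric])
      finally show ?thesis by (simp add: normal_density_def power_divide)
    qed
    then show ?thesis using 0 by simp
  next
    case (Suc j)
    have "sqrt (real (Suc j)) * (\<integral>x. hermite 0 x * hermite (Suc j) x \<partial>lborel) = 0" using hermite_product_integral_step[of j 0] by simp
    then show ?thesis using Suc by (simp add: mult.commute del: hermite.simps)
  qed
next
  case (Suc n)
  have "sqrt (real (Suc n)) * (\<integral>x. hermite m x * hermite (Suc n) x \<partial>lborel) = sqrt (real m) * (if m - 1 = n then 1 else 0)"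
    unfolding hermite_product_integral_step Suc.IH ..
  also have "... = sqrt (real (Suc n)) * (if m = Suc n then 1 else 0)" by (cases m) auto
  finally show ?case by (simp del: hermite.simps)
qed

text \<open>A one-dimensional Sobolev estimate. The function
  \<open>(t - x - 1) * (hermite n t)\<^sup>2\<close> vanishes at \<open>x + 1\<close> and is the
  negative of the desired square at \<open>x\<close>, so its derivative integrates to that square
  over the unit interval. The derivative is at most twice the square of the function plus the square
  of its derivative, and orthonormality evaluates the integrals over the line:
  \<open>2 + n + (n + 1)\<close>.\<close>

lemma hermite_sup_square: "(hermite n x)\<^sup>2 \<le> 2 * real n + 3"
proof -
  let ?h = "hermite n" and ?a = "hermite (n - 1)" and ?c = "hermite (Suc n)"
  define h' where "h' t = sqrt 2 * sqrt (real n) * ?a t - t * ?h t" for t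
  let ?f = "\<lambda>t. (?h t)\<^sup>2 + (t - x - 1) * (2 * ?h t * h' t)"
  let ?G = "\<lambda>t. 2 * (?h t * ?h t) + real n * (?a t * ?a t) + real (Suc n) * (?c t * ?c t)"
  have cont: "continuous_on UNIV ?f" unfolding h'_def by (intro continuous_intros hermite_continuous)
  have FTC: "(\<integral>t. ?f t * indicator {x..x + 1} t \<partial>lborel) = (x + 1 - x - 1) * (?h (x + 1))\<^sup>2 - (x - x - 1) * (?h x)\<^sup>2"
  proof (rule integral_FTC_Icc_real)
    fix t
    show "((\<lambda>t. (t - x - 1) * (?h t)\<^sup>2) has_real_derivative ?f t) (at t)"
      unfolding h'_def by (rule derivative_eq_intros hermite_deriv refl)+ (simp add: algebra_simps)
    show "isCont ?f t" using cont continuous_on_eq_continuous_at by blast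
  qed auto
  have le: "?f t * indicator {x..x + 1} t \<le> ?G t" for t
  proof (cases "t \<in> {x..x + 1}")
    case True
    have "h' t = (sqrt (real n) * ?a t - sqrt (real (Suc n)) * ?c t) / sqrt 2"
      unfolding h'_def hermite_deriv_ladder by (simp add: real_sqrt_divide diff_divide_distrib)
    then have "(h' t)\<^sup>2 = (sqrt (real n) * ?a t - sqrt (real (Suc n)) * ?c t)\<^sup>2 / 2" by (simp add: power_divide)
    \<comment> \<open>The square of a difference is at most twice the sum of the squares, because
      the square of the sum is nonnegative.\<close>
    also have "... \<le> (2 * (sqrt (real n) * ?a t)\<^sup>2 + 2 * (sqrt (real (Suc n)) * ?c t)\<^sup>2) / 2"
      using sum_squares_ge_zero[of "sqrt (real n) * ?a t + sqrt (real (Suc n)) * ?c t" 0]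
      by (intro divide_right_mono) (auto simp: power2_eq_square algebra_simps)
    also have "... = real n * (?a t)\<^sup>2 + real (Suc n) * (?c t)\<^sup>2" by (simp add: power_mult_distrib)
    finally have h'2: "(h' t)\<^sup>2 \<le> real n * (?a t)\<^sup>2 + real (Suc n) * (?c t)\<^sup>2" .
    have "(t - x - 1) * (2 * ?h t * h' t) \<le> \<bar>t - x - 1\<bar> * \<bar>2 * ?h t * h' t\<bar>" by (simp add: abs_mult[symmetric])
    also have "... \<le> 1 * \<bar>2 * ?h t * h' t\<bar>" using True by (intro mult_right_mono) auto
    also have "... \<le> (?h t)\<^sup>2 + (h' t)\<^sup>2" using sum_squares_bound[of "\<bar>?h t\<bar>" "\<bar>h' t\<bar>"] by (simp add: abs_mult)
    finally show ?thesis using True h'2 by (simp add: power2_eq_square)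
  qed simp
  have "(?h x)\<^sup>2 = (\<integral>t. ?f t * indicator {x..x + 1} t \<partial>lborel)" unfolding FTC by simp
  also have "... \<le> (\<integral>t. ?G t \<partial>lborel)"
  proof (rule integral_mono)
    have "integrable lborel (\<lambda>t. indicator {x..x + 1} t *\<^sub>R ?f t)"
      by (rule borel_integrable_compact) (auto intro: continuous_on_subset[OF cont])
    then show "integrable lborel (\<lambda>t. ?f t * indicator {x..x + 1} t)" by (simp add: mult.commute)
    show "integrable lborel ?G" by (intro Bochner_Integration.integrable_add integrable_mult_right integrable_hermite_product0)
  qed (rule le)
  also have "... = 2 + real n * 1 + real (Suc n)" by (simp add: integrable_hermite_product0 hermite_orthonormal del: hermite.simps)
  finally show ?thesis by simp
qed

lemma hermite_sup: "\<bar>hermite n x\<bar> \<le> 3 * (1 + real n)"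
proof -
  have "\<bar>hermite n x\<bar>\<^sup>2 \<le> 2 * real n + 3" using hermite_sup_square by simp
  also have "... \<le> (3 * (1 + real n))\<^sup>2" by (simp add: power2_eq_square algebra_simps)
  finally show ?thesis by (rule power2_le_imp_le) auto
qed

section \<open>Hermite functions in several variables\<close>

text \<open>A product over the coordinates rather than a sum: sup bounds of product functions
  multiply, \<open>1 / weight \<alpha> ^ 2\<close> is summable as a product of one-dimensional
  series, and applying the oscillators of all coordinates gains one power of it.\<close>

definition weight :: "'n::finite mindex \<Rightarrow> real" where
  "weight \<alpha> = (\<Prod>i\<in>UNIV. 1 + real (\<alpha> i))"

lemma prod_upd:
  fixes g :: "'n::finite \<Rightarrow> 'c \<Rightarrow> 'b::comm_monoid_mult"
  shows "(\<Prod>k\<in>UNIV. g k ((\<alpha>(i := m)) k)) = g i m * (\<Prod>k\<in>UNIV - {i}. g k (\<alpha> k))"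
  by (subst prod.remove[of UNIV i]) (auto intro!: prod.cong)

lemma prod_split:
  fixes g :: "'n::finite \<Rightarrow> 'b::comm_monoid_mult"
  shows "(\<Prod>k\<in>UNIV. g k) = g i * (\<Prod>k\<in>UNIV - {i}. g k)" by (rule prod.remove) auto

lemma weight_ge_1: "weight \<alpha> \<ge> 1" unfolding weight_def by (intro prod_ge_1) auto

lemma weight_pos: "weight \<alpha> > 0" using weight_ge_1[of \<alpha>] by linarith

lemma weight_ge: "1 + real (\<alpha> i) \<le> weight \<alpha>"
proof -
  have "(1 + real (\<alpha> i)) * 1 \<le> (1 + real (\<alpha> i)) * (\<Prod>k\<in>UNIV - {i}. 1 + real (\<alpha> k))" by (intro mult_left_mono prod_ge_1) auto
  then show ?thesis unfolding weight_def prod_split[of _ i] by simp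
qed

text \<open>A ladder operator replaces a single index by at most its successor; this is the bound on
  target weights that \<open>lc_cost_poly_boundedI\<close> asks for.\<close>

lemma weight_upd_le:
  assumes "m \<le> Suc (\<alpha> i)" shows "weight (\<alpha>(i := m)) \<le> 2 * weight \<alpha> ^ 2"
proof -
  have "weight (\<alpha>(i := m)) = (1 + real m) * (\<Prod>k\<in>UNIV - {i}. 1 + real (\<alpha> k))" unfolding weight_def by (rule prod_upd)
  also have "... \<le> (2 * (1 + real (\<alpha> i))) * ((1 + real (\<alpha> i)) * (\<Prod>k\<in>UNIV - {i}. 1 + real (\<alpha> k)))"
  proof (rule mult_mono)
    show "(\<Prod>k\<in>UNIV - {i}. 1 + real (\<alpha> k)) \<le> (1 + real (\<alpha> i)) * (\<Prod>k\<in>UNIV - {i}. 1 + real (\<alpha> k))"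
      using mult_right_mono[of 1 "1 + real (\<alpha> i)" "\<Prod>k\<in>UNIV - {i}. 1 + real (\<alpha> k)", OF _ prod_nonneg] by simp
  qed (use assms in \<open>auto intro!: prod_nonneg\<close>)
  also have "(1 + real (\<alpha> i)) * (\<Prod>k\<in>UNIV - {i}. 1 + real (\<alpha> k)) = weight \<alpha>" unfolding weight_def by (rule prod_split[symmetric])
  also have "2 * (1 + real (\<alpha> i)) * weight \<alpha> \<le> 2 * weight \<alpha> * weight \<alpha>"
    using weight_ge[of \<alpha> i] weight_pos[of \<alpha>] by (intro mult_right_mono) auto
  finally show ?thesis by (simp only: power2_eq_square mult.assoc)
qed

definition hermite_fun :: "'n::finite mindex \<Rightarrow> real^'n \<Rightarrow> complex" where
  "hermite_fun \<alpha> x = of_real (\<Prod>i\<in>UNIV. hermite (\<alpha> i) (x $ i))"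

lemma hermite_fun_upd:
  "hermite_fun (\<alpha>(i := m)) x = of_real (hermite m (x $ i) * (\<Prod>k\<in>UNIV - {i}. hermite (\<alpha> k) (x $ k)))"
  unfolding hermite_fun_def by (subst prod_upd[of "\<lambda>k n. hermite n (x $ k)" \<alpha> i m]) simp

lemma hermite_fun_split:
  "hermite_fun \<alpha> x = of_real (hermite (\<alpha> i) (x $ i) * (\<Prod>k\<in>UNIV - {i}. hermite (\<alpha> k) (x $ k)))"
  using hermite_fun_upd[of \<alpha> i "\<alpha> i" x] by simp

definition axis_index :: "real^'n \<Rightarrow> 'n::finite" where
  "axis_index b = (THE i. b = axis i 1)"

lemma axis_index_axis [simp]: "axis_index (axis i 1) = i" by (simp add: axis_index_def axis_eq_axis)

text \<open>The raising and lowering entries of the position operator. At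
  \<open>\<alpha> i = 0\<close> the lowered index is \<open>\<alpha>\<close> itself, with
  coefficient 0.\<close>

definition hermite_mult_list :: "real^'n \<Rightarrow> 'n mindex \<Rightarrow> (complex \<times> 'n mindex) list" where
  "hermite_mult_list b \<alpha> = (let i = axis_index b in
     [(of_real (sqrt (real (Suc (\<alpha> i)) / 2)), \<alpha>(i := Suc (\<alpha> i))), (of_real (sqrt (real (\<alpha> i) / 2)), \<alpha>(i := \<alpha> i - 1))])"

definition hermite_deriv_list :: "real^'n \<Rightarrow> 'n mindex \<Rightarrow> (complex \<times> 'n mindex) list" where
  "hermite_deriv_list b \<alpha> = (let i = axis_index b in
     [(of_real (sqrt (real (\<alpha> i) / 2)), \<alpha>(i := \<alpha> i - 1)), (- of_real (sqrt (real (Suc (\<alpha> i)) / 2)), \<alpha>(i := Suc (\<alpha> i)))])"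

lemma hermite_fun_mult:
  assumes b: "b \<in> Basis"
  shows "of_real (x \<bullet> b) * hermite_fun \<alpha> x = lc_eval hermite_fun (hermite_mult_list b \<alpha>) x"
proof -
  obtain i where b: "b = axis i 1" using b by (auto simp: Basis_vec_eq)
  let ?R = "\<Prod>k\<in>UNIV - {i}. hermite (\<alpha> k) (x $ k)"
  have "(x $ i) * (hermite (\<alpha> i) (x $ i) * ?R) = (x $ i * hermite (\<alpha> i) (x $ i)) * ?R" by simp
  also have "... = sqrt (real (Suc (\<alpha> i)) / 2) * (hermite (Suc (\<alpha> i)) (x $ i) * ?R) + sqrt (real (\<alpha> i) / 2) * (hermite (\<alpha> i - 1) (x $ i) * ?R)"
    unfolding hermite_mult_ladder by (simp only: distrib_right mult.assoc)
  finally have "of_real (x $ i) * hermite_fun \<alpha> x = complex_of_real \<dots>"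
    unfolding hermite_fun_split[of \<alpha> x i] of_real_mult[symmetric] by (simp only:)
  then show ?thesis unfolding b hermite_mult_list_def Let_def axis_index_axis
    by (simp only: lc_simps hermite_fun_upd inner_axis fst_conv snd_conv of_real_add of_real_mult inner_real_def mult_1_right add_0_right)
qed

lemma hermite_fun_has_dir_deriv:
  assumes b: "b \<in> Basis"
  shows "has_dir_deriv b (hermite_fun \<alpha>) (lc_eval hermite_fun (hermite_deriv_list b \<alpha>) x) x"
proof -
  obtain i where b: "b = axis i 1" using b by (auto simp: Basis_vec_eq)
  let ?R = "\<Prod>k\<in>UNIV - {i}. hermite (\<alpha> k) (x $ k)"
  let ?d = "sqrt (real (\<alpha> i) / 2) * hermite (\<alpha> i - 1) (x $ i) - sqrt (real (Suc (\<alpha> i)) / 2) * hermite (Suc (\<alpha> i)) (x $ i)"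
  have line: "hermite_fun \<alpha> (x + t *\<^sub>R b) = of_real (hermite (\<alpha> i) (x $ i + t) * ?R)" for t
    unfolding hermite_fun_split[of \<alpha> _ i] b by (simp add: axis_def)
  have "((\<lambda>t. hermite (\<alpha> i) (x $ i + t)) has_real_derivative ?d) (at 0)"
    using DERIV_shift[of "hermite (\<alpha> i)" ?d 0 "x $ i"] hermite_deriv[of "\<alpha> i" "x $ i"]
    unfolding hermite_deriv_ladder by (simp add: add.commute)
  then have "((\<lambda>t. hermite (\<alpha> i) (x $ i + t) * ?R) has_real_derivative ?d * ?R) (at 0)" by (rule DERIV_cmult_right)
  then have "has_dir_deriv b (hermite_fun \<alpha>) (of_real (?d * ?R)) x" unfolding line by (rule has_vector_derivative_of_real)
  also have "of_real (?d * ?R) = lc_eval hermite_fun (hermite_deriv_list b \<alpha>) x"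
    unfolding b hermite_deriv_list_def Let_def axis_index_axis by (simp add: hermite_fun_upd algebra_simps del: hermite.simps)
  finally show ?thesis .
qed

lemma sqrt_le_weight: "sqrt (real (Suc (\<alpha> i)) / 2) \<le> weight \<alpha>" "sqrt (real (\<alpha> i) / 2) \<le> weight \<alpha>"
proof -
  have w: "1 + real (\<alpha> i) \<le> weight \<alpha>" "0 \<le> weight \<alpha>" using weight_ge[of \<alpha> i] weight_pos[of \<alpha>] by auto
  have "weight \<alpha> \<le> (weight \<alpha>)\<^sup>2" using weight_ge_1[of \<alpha>] by (rule self_le_power) simp
  then have "real (Suc (\<alpha> i)) / 2 \<le> (weight \<alpha>)\<^sup>2" "real (\<alpha> i) / 2 \<le> (weight \<alpha>)\<^sup>2" using w by auto
  then show "sqrt (real (Suc (\<alpha> i)) / 2) \<le> weight \<alpha>" "sqrt (real (\<alpha> i) / 2) \<le> weight \<alpha>" using w(2) by (auto intro: real_le_lsqrt)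
qed

lemma weight_le_square: "weight \<alpha> \<le> 2 * weight \<alpha> ^ 2"
  using mult_left_mono[of 1 "2 * weight \<alpha>" "weight \<alpha>"] weight_ge_1[of \<alpha>] by (simp add: power2_eq_square)

lemma hermite_lists_cost:
  "poly_bounded weight (\<lambda>\<alpha>. lc_cost weight M (hermite_mult_list b \<alpha>))"
  "poly_bounded weight (\<lambda>\<alpha>. lc_cost weight M (hermite_deriv_list b \<alpha>))"
proof -
  have h: "poly_bounded weight (\<lambda>\<alpha>. 2 * weight \<alpha> ^ 2)" by (intro poly_bounded_cmult poly_bounded_power weight_ge_1) auto
  have coeff: "cmod (of_real (sqrt (real (Suc (\<alpha> i)) / 2))) \<le> 2 * weight \<alpha> ^ 2"
    "cmod (of_real (sqrt (real (\<alpha> i) / 2))) \<le> 2 * weight \<alpha> ^ 2" for \<alpha> :: "'a mindex" and i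
    unfolding norm_of_real using sqrt_le_weight[of \<alpha> i] weight_le_square[of \<alpha>] by auto
  show "poly_bounded weight (\<lambda>\<alpha>. lc_cost weight M (hermite_mult_list b \<alpha>))"
  proof (rule lc_cost_poly_boundedI[OF weight_ge_1 _ h])
    show "poly_bounded weight (\<lambda>\<alpha>. real (length (hermite_mult_list b \<alpha>)))"
      using poly_bounded_const[where w = weight and c = 2, OF weight_ge_1] by (simp add: hermite_mult_list_def Let_def)
    show "cmod a \<le> 2 * weight \<alpha> ^ 2 \<and> weight \<beta> \<le> 2 * weight \<alpha> ^ 2" if "(a, \<beta>) \<in> set (hermite_mult_list b \<alpha>)" for a \<alpha> \<beta>
      using that weight_upd_le[of _ \<alpha> "axis_index b"] coeff[of \<alpha> "axis_index b"] by (auto simp: hermite_mult_list_def Let_def)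
  qed auto
  show "poly_bounded weight (\<lambda>\<alpha>. lc_cost weight M (hermite_deriv_list b \<alpha>))"
  proof (rule lc_cost_poly_boundedI[OF weight_ge_1 _ h])
    show "poly_bounded weight (\<lambda>\<alpha>. real (length (hermite_deriv_list b \<alpha>)))"
      using poly_bounded_const[where w = weight and c = 2, OF weight_ge_1] by (simp add: hermite_deriv_list_def Let_def)
    show "cmod a \<le> 2 * weight \<alpha> ^ 2 \<and> weight \<beta> \<le> 2 * weight \<alpha> ^ 2" if "(a, \<beta>) \<in> set (hermite_deriv_list b \<alpha>)" for a \<alpha> \<beta>
      using that weight_upd_le[of _ \<alpha> "axis_index b"] coeff[of \<alpha> "axis_index b"] by (auto simp: hermite_deriv_list_def Let_def)
  qed auto
qed

lemma hermite_fun_continuous: "continuous_on UNIV (hermite_fun \<alpha>)" unfolding hermite_fun_def[abs_def]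
  by (intro continuous_intros continuous_on_compose2[OF hermite_continuous]) auto

lemma cmod_hermite_fun_le:
  fixes \<alpha> :: "'n::finite mindex"
  shows "cmod (hermite_fun \<alpha> x) \<le> 3 ^ CARD('n) * weight \<alpha> ^ 1"
proof -
  have "cmod (hermite_fun \<alpha> x) = (\<Prod>i\<in>UNIV. \<bar>hermite (\<alpha> i) (x $ i)\<bar>)" unfolding hermite_fun_def norm_of_real by (rule abs_prod)
  also have "... \<le> (\<Prod>i\<in>(UNIV::'n set). 3 * (1 + real (\<alpha> i)))" by (intro prod_mono conjI hermite_sup) auto
  also have "... = 3 ^ CARD('n) * weight \<alpha> ^ 1" unfolding prod.distrib weight_def by simp
  finally show ?thesis .
qed

lemma
  fixes \<alpha> :: "'n::finite mindex"
  shows hermite_fun_schwartz: "hermite_fun \<alpha> \<in> S_funs"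
    and poly_bounded_snorm_hermite: "poly_bounded weight (\<lambda>\<alpha> :: 'n mindex. snorm UNIV m (hermite_fun \<alpha>))"
  using schwartz_ladder_family[OF open_UNIV UNIV_not_empty weight_ge_1 hermite_fun_continuous cmod_hermite_fun_le
      hermite_fun_has_dir_deriv hermite_fun_mult hermite_lists_cost(2,1)] by simp_all

lemma hermite_fun_orthonormal:
  fixes \<alpha> \<beta> :: "'n::finite mindex"
  shows "(\<integral>x. hermite_fun \<alpha> x * hermite_fun \<beta> x \<partial>lborel) = (if \<alpha> = \<beta> then 1 else 0)"
proof -
  have "(\<integral>x. hermite_fun \<alpha> x * hermite_fun \<beta> x \<partial>lborel) =
     (\<integral>x. complex_of_real (\<Prod>i\<in>UNIV. hermite (\<alpha> i) (x $ i) * hermite (\<beta> i) (x $ i)) \<partial>lborel)"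
    by (simp add: hermite_fun_def prod.distrib)
  also have "... = complex_of_real (\<Prod>i\<in>UNIV. \<integral>x. hermite (\<alpha> i) x * hermite (\<beta> i) x \<partial>lborel)"
    using lborel_prod_vec(2)[of "\<lambda>i x. hermite (\<alpha> i) x * hermite (\<beta> i) x"] integrable_hermite_product0 by (simp del: of_real_prod)
  also have "... = (if \<alpha> = \<beta> then 1 else 0)" by (auto simp: hermite_orthonormal fun_eq_iff)
  finally show ?thesis .
qed

section \<open>Hermite coefficients and their decay\<close>

text \<open>A bilinear pairing without conjugation; the functions
  \<open>hermite_fun \<alpha>\<close> are real valued, so it agrees with the inner product.\<close>

definition hcoeff :: "'n::finite mindex \<Rightarrow> (real^'n \<Rightarrow> complex) \<Rightarrow> complex" where
  "hcoeff \<alpha> f = (\<integral>x. f x * hermite_fun \<alpha> x \<partial>lborel)"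

lemma schwartz_mult_integrable:
  assumes "f \<in> S_funs" "g \<in> S_funs"
  shows "integrable lborel (\<lambda>x. f x * g x)"
  by (rule schwartz_product_integrable[OF assms(1) schwartz_borel[OF assms(2)] schwartz_bounded[OF assms(2)]])

lemma cmod_hcoeff_le:
  fixes f :: "real^'n \<Rightarrow> complex"
  shows "\<exists>C\<ge>0. \<exists>m. \<forall>f\<in>S_funs. \<forall>\<alpha>::'n mindex. cmod (hcoeff \<alpha> f) \<le> C * weight \<alpha> * snorm UNIV m f"
proof -
  let ?w = "\<lambda>x::real^'n. decay x"
  let ?m = "2 * DIM(real^'n)"
  let ?C = "(\<integral>x. ?w x \<partial>lborel) * 3 ^ CARD('n)"
  have "cmod (hcoeff \<alpha> f) \<le> ?C * weight \<alpha> * snorm UNIV ?m f"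
    if f: "f \<in> S_funs" for f and \<alpha> :: "'n mindex"
  proof -
    have "cmod (hcoeff \<alpha> f) \<le> (\<integral>x. cmod (f x * hermite_fun \<alpha> x) \<partial>lborel)" unfolding hcoeff_def by (rule integral_norm_bound)
    also have "... \<le> (\<integral>x. (snorm UNIV ?m f * (3 ^ CARD('n) * weight \<alpha> ^ 1)) * ?w x \<partial>lborel)"
      by (intro integral_mono integrable_norm schwartz_mult_integrable f hermite_fun_schwartz integrable_mult_right
          integrable_weight schwartz_product_decay cmod_hermite_fun_le)
    finally show ?thesis unfolding Bochner_Integration.integral_mult_right_zero by (simp add: mult_ac)
  qed
  moreover have "?C \<ge> 0" by (intro mult_nonneg_nonneg integral_nonneg_AE) auto
  ultimately show ?thesis by blast
qed

lemma hcoeff_add: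
  assumes "f \<in> S_funs" "g \<in> S_funs"
  shows "hcoeff \<alpha> (\<lambda>x. f x + g x) = hcoeff \<alpha> f + hcoeff \<alpha> g" unfolding hcoeff_def distrib_right
  by (intro Bochner_Integration.integral_add schwartz_mult_integrable assms hermite_fun_schwartz)

lemma hcoeff_scale: "hcoeff \<alpha> (\<lambda>x. c * f x) = c * hcoeff \<alpha> f" unfolding hcoeff_def mult.assoc by simp

lemma hcoeff_minus:
  assumes "f \<in> S_funs" "g \<in> S_funs"
  shows "hcoeff \<alpha> (f - g) = hcoeff \<alpha> f - hcoeff \<alpha> g" unfolding fun_minus_eq
  using hcoeff_add[OF assms(1) schwartz_scale(1)[OF open_UNIV assms(2)], of \<alpha> "-1"] hcoeff_scale[of \<alpha> "-1" g] by simp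

text \<open>One coordinate of the harmonic oscillator: position squared minus the second derivative.
  It is spelled as a composition of operators already known to act on the Schwartz space.\<close>

definition oscillator :: "'n::finite \<Rightarrow> (real^'n \<Rightarrow> complex) \<Rightarrow> (real^'n \<Rightarrow> complex)" where
  "oscillator i f = (\<lambda>x. of_real (x \<bullet> axis i 1) * (of_real (x \<bullet> axis i 1) * f x) + (-1) * dir_deriv (axis i 1) (dir_deriv (axis i 1) f) x)"

lemma axis_Basis: "(axis i 1 :: real^'n) \<in> Basis" by (simp add: Basis_vec_eq)

lemma oscillator_schwartz:
  fixes f :: "real^'n \<Rightarrow> complex"
  assumes f: "f \<in> S_funs"
  shows "oscillator i f \<in> S_funs" unfolding oscillator_def
  by (intro schwartz_add schwartz_coord_mult schwartz_scale schwartz_dir_deriv axis_Basis open_UNIV f)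

lemma snorm_oscillator_le:
  "\<exists>C\<ge>0. \<forall>f\<in>schwartz_functions (UNIV :: (real^'n) set). snorm UNIV m (oscillator i f) \<le> C * snorm UNIV (Suc (Suc m)) f"
proof -
  let ?N = "\<lambda>m. real (card (blists m :: (real^'n) list set))"
  let ?b = "axis i 1 :: real^'n"
  let ?C = "?N m * ((1 + real m) * (?N (Suc m) * (1 + real (Suc m)))) + ?N m * ?N (Suc m)"
  have "snorm UNIV m (oscillator i f) \<le> ?C * snorm UNIV (Suc (Suc m)) f" if f: "f \<in> S_funs" for f :: "real^'n \<Rightarrow> complex"
  proof -
    have 1: "(\<lambda>x. of_real (x \<bullet> ?b) * f x) \<in> S_funs" "dir_deriv ?b f \<in> S_funs"
      by (intro schwartz_coord_mult schwartz_dir_deriv axis_Basis f)+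
    have 2: "(\<lambda>x. of_real (x \<bullet> ?b) * (of_real (x \<bullet> ?b) * f x)) \<in> S_funs"
      "dir_deriv ?b (dir_deriv ?b f) \<in> S_funs" by (intro schwartz_coord_mult schwartz_dir_deriv axis_Basis f)+
    have "snorm UNIV m (oscillator i f) \<le> snorm UNIV m (\<lambda>x. of_real (x \<bullet> ?b) * (of_real (x \<bullet> ?b) * f x)) +
        snorm UNIV m (\<lambda>x. (-1) * dir_deriv ?b (dir_deriv ?b f) x)"
      unfolding oscillator_def by (intro snorm_add schwartz_scale 2 open_UNIV UNIV_not_empty)
    also have "snorm UNIV m (\<lambda>x. of_real (x \<bullet> ?b) * (of_real (x \<bullet> ?b) * f x)) \<le>
        ?N m * ((1 + real m) * snorm UNIV (Suc m) (\<lambda>x. of_real (x \<bullet> ?b) * f x))" by (intro schwartz_coord_mult 1 axis_Basis)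
    also have "... \<le> ?N m * ((1 + real m) * (?N (Suc m) * ((1 + real (Suc m)) * snorm UNIV (Suc (Suc m)) f)))"
      by (intro mult_left_mono schwartz_coord_mult f axis_Basis) auto
    also have "snorm UNIV m (\<lambda>x. (-1) * dir_deriv ?b (dir_deriv ?b f) x) \<le> cmod (-1) * snorm UNIV m (dir_deriv ?b (dir_deriv ?b f))"
      by (intro snorm_scale_le open_UNIV UNIV_not_empty 2)
    also have "snorm UNIV m (dir_deriv ?b (dir_deriv ?b f)) \<le> ?N m * snorm UNIV (Suc m) (dir_deriv ?b f)"
      by (intro schwartz_dir_deriv 1 axis_Basis)
    also have "... \<le> ?N m * (?N (Suc m) * snorm UNIV (Suc (Suc m)) f)" by (intro mult_left_mono schwartz_dir_deriv f axis_Basis) auto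
    finally show ?thesis by (simp add: algebra_simps)
  qed
  moreover have "?C \<ge> 0" by simp
  ultimately show ?thesis by blast
qed

lemma hermite_fun_dir_deriv: "b \<in> Basis \<Longrightarrow> dir_deriv b (hermite_fun \<alpha>) x = lc_eval hermite_fun (hermite_deriv_list b \<alpha>) x"
  by (rule dir_deriv_eqI[OF hermite_fun_has_dir_deriv])

text \<open>In position squared minus second derivative the terms that move the index by two cancel.
  The terms that return to \<open>n = \<alpha> i\<close> add up to
  \<open>2 * ((n + 1) / 2) + 2 * (n / 2)\<close>.\<close>

lemma hermite_fun_oscillator:
  "oscillator i (hermite_fun \<alpha>) x = (2 * of_nat (\<alpha> i) + 1) * hermite_fun \<alpha> x"
proof -
  let ?b = "axis i 1"
  let ?n = "\<alpha> i" and ?R = "\<Prod>k\<in>UNIV - {i}. hermite (\<alpha> k) (x $ k)"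
  have lc: "has_dir_deriv ?b (lc_eval hermite_fun ts) (\<Sum>(a, \<beta>)\<leftarrow>ts. a * lc_eval hermite_fun (hermite_deriv_list ?b \<beta>) x) x" for ts
    by (induction ts) (auto intro!: has_vector_derivative_add has_vector_derivative_mult_right hermite_fun_has_dir_deriv axis_Basis)
  have "dir_deriv ?b (hermite_fun \<alpha>) = lc_eval hermite_fun (hermite_deriv_list ?b \<alpha>)"
    using hermite_fun_dir_deriv[OF axis_Basis] by blast
  then have D2: "dir_deriv ?b (dir_deriv ?b (hermite_fun \<alpha>)) x = lc_eval hermite_fun (lc_bind (hermite_deriv_list ?b) (hermite_deriv_list ?b \<alpha>)) x"
    unfolding lc_eval_bind by (simp add: dir_deriv_eqI[OF lc])
  have M2: "of_real (x \<bullet> ?b) * (of_real (x \<bullet> ?b) * hermite_fun \<alpha> x) = lc_eval hermite_fun (lc_bind (hermite_mult_list ?b) (hermite_mult_list ?b \<alpha>)) x"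
  proof -
    have "of_real (x \<bullet> ?b) * lc_eval hermite_fun ts x = lc_eval hermite_fun (lc_bind (hermite_mult_list ?b) ts) x" for ts
      unfolding lc_eval_bind by (induction ts) (auto simp: hermite_fun_mult[OF axis_Basis, symmetric] algebra_simps)
    then show ?thesis unfolding hermite_fun_mult[OF axis_Basis] .
  qed
  define s where "s n = complex_of_real (sqrt (real n / 2))" for n
  have ss: "s n * (s n * c) = of_nat n / 2 * c" for n c unfolding s_def mult.assoc[symmetric] of_real_mult[symmetric] by simp
  have s_Suc: "complex_of_real (sqrt ((1 + real n) / 2)) = s (Suc n)" for n by (simp add: s_def)
  \<comment> \<open>Lowering and then raising returns to \<open>\<alpha>\<close>, except at index 0,
    where truncation leads to 1; there the coefficient \<open>s 0\<close> vanishes.\<close>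
  have upd0: "s ?n * (s (Suc (?n - 1)) * hermite_fun (\<alpha>(i := Suc (?n - 1))) x) = of_nat ?n / 2 * hermite_fun \<alpha> x"
  proof (cases "?n")
    case 0
    then show ?thesis by (simp add: s_def)
  next
    case (Suc j)
    then have "\<alpha>(i := Suc j) = \<alpha>" by auto
    then show ?thesis unfolding Suc diff_Suc_1 by (simp only: ss)
  qed
  have "oscillator i (hermite_fun \<alpha>) x =
    2 * (s (Suc ?n) * (s (Suc ?n) * hermite_fun \<alpha> x)) + 2 * (s ?n * (s (Suc (?n - 1)) * hermite_fun (\<alpha>(i := Suc (?n - 1))) x))"
    unfolding oscillator_def D2 M2
    by (simp add: hermite_mult_list_def hermite_deriv_list_def s_def[symmetric] s_Suc Let_def algebra_simps)
  also have "... = (2 * of_nat (\<alpha> i) + 1) * hermite_fun \<alpha> x" unfolding ss upd0 by (simp add: algebra_simps)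
  finally show ?thesis .
qed

text \<open>The oscillator is symmetric for the bilinear pairing: two integrations by parts move the
  second derivative to the Hermite function, which is an eigenfunction.\<close>

lemma hcoeff_oscillator:
  assumes f: "f \<in> S_funs"
  shows "hcoeff \<alpha> (oscillator i f) = (2 * of_nat (\<alpha> i) + 1) * hcoeff \<alpha> f"
proof -
  let ?b = "axis i 1" and ?h = "hermite_fun \<alpha>"
  note h = hermite_fun_schwartz[where \<alpha> = \<alpha>]
  note f1 = schwartz_dir_deriv(1)[OF f axis_Basis[of i]] and h1 = schwartz_dir_deriv(1)[OF h axis_Basis[of i]]
  note f2 = schwartz_dir_deriv(1)[OF f1 axis_Basis[of i]] and h2 = schwartz_dir_deriv(1)[OF h1 axis_Basis[of i]]
  have hm: "(\<lambda>x. of_real (x \<bullet> ?b) * (of_real (x \<bullet> ?b) * ?h x)) \<in> S_funs" by (intro schwartz_coord_mult axis_Basis h)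
  have fm: "(\<lambda>x. of_real (x \<bullet> ?b) * (of_real (x \<bullet> ?b) * f x)) \<in> S_funs" by (intro schwartz_coord_mult axis_Basis f)
  have ibp: "(\<integral>x. dir_deriv ?b (dir_deriv ?b f) x * ?h x \<partial>lborel) = (\<integral>x. f x * dir_deriv ?b (dir_deriv ?b ?h) x \<partial>lborel)"
    using integration_by_parts[OF f1 h axis_Basis[of i]] integration_by_parts[OF f h1 axis_Basis[of i]] by simp
  have "hcoeff \<alpha> (oscillator i f) = (\<integral>x. (of_real (x \<bullet> ?b) * (of_real (x \<bullet> ?b) * f x)) * ?h x - dir_deriv ?b (dir_deriv ?b f) x * ?h x \<partial>lborel)"
    unfolding hcoeff_def oscillator_def by (simp add: algebra_simps)
  also have "... = (\<integral>x. (of_real (x \<bullet> ?b) * (of_real (x \<bullet> ?b) * f x)) * ?h x \<partial>lborel) - (\<integral>x. f x * dir_deriv ?b (dir_deriv ?b ?h) x \<partial>lborel)"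
    unfolding ibp[symmetric] by (intro Bochner_Integration.integral_diff schwartz_mult_integrable fm f2 h)
  also have "(\<integral>x. (of_real (x \<bullet> ?b) * (of_real (x \<bullet> ?b) * f x)) * ?h x \<partial>lborel) = (\<integral>x. f x * (of_real (x \<bullet> ?b) * (of_real (x \<bullet> ?b) * ?h x)) \<partial>lborel)"
    by (simp add: mult_ac)
  also have "... - (\<integral>x. f x * dir_deriv ?b (dir_deriv ?b ?h) x \<partial>lborel) = (\<integral>x. f x * (of_real (x \<bullet> ?b) * (of_real (x \<bullet> ?b) * ?h x)) - f x * dir_deriv ?b (dir_deriv ?b ?h) x \<partial>lborel)"
    by (intro Bochner_Integration.integral_diff[symmetric] schwartz_mult_integrable hm h2 f)
  also have "... = (\<integral>x. f x * oscillator i ?h x \<partial>lborel)" unfolding oscillator_def by (simp add: algebra_simps)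
  also have "... = (\<integral>x. (2 * of_nat (\<alpha> i) + 1) * (f x * ?h x) \<partial>lborel)" unfolding hermite_fun_oscillator by (simp add: mult_ac)
  finally show ?thesis unfolding hcoeff_def by simp
qed

text \<open>One application of an oscillator multiplies the coefficient by at least
  \<open>1 + \<alpha> i\<close> in modulus and costs two orders of the norm of \<open>f\<close>.
  Running through all coordinates gains one power of \<open>weight\<close>.\<close>

lemma hcoeff_decay:
  "\<exists>C\<ge>0. \<exists>m. \<forall>f\<in>S_funs. \<forall>\<alpha>::'n::finite mindex. cmod (hcoeff \<alpha> f) * weight \<alpha> ^ k \<le> C * snorm UNIV m f"
proof -
  define dec where "dec v \<longleftrightarrow> (\<exists>C\<ge>0. \<exists>m. \<forall>f\<in>S_funs. \<forall>\<alpha>::'n mindex. cmod (hcoeff \<alpha> f) * v \<alpha> \<le> C * snorm UNIV m f)" for v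
  have step: "dec (\<lambda>\<alpha>. (1 + real (\<alpha> i)) * v \<alpha>)" if v: "dec v" "\<And>\<alpha>. v \<alpha> \<ge> 0" for v i
  proof -
    obtain C m where C: "C \<ge> 0" "\<And>f \<alpha>. f \<in> S_funs \<Longrightarrow> cmod (hcoeff \<alpha> f) * v \<alpha> \<le> C * snorm UNIV m f" using v unfolding dec_def by blast
    obtain D where D: "D \<ge> 0" "\<And>f. f \<in> S_funs \<Longrightarrow> snorm UNIV m (oscillator i f) \<le> D * snorm UNIV (Suc (Suc m)) f"
      using snorm_oscillator_le[of m i] by blast
    have "cmod (hcoeff \<alpha> f) * ((1 + real (\<alpha> i)) * v \<alpha>) \<le> (C * D) * snorm UNIV (Suc (Suc m)) f"
      if f: "f \<in> S_funs" for f \<alpha>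
    proof -
      have "(2 * of_nat (\<alpha> i) + 1 :: complex) = of_nat (2 * \<alpha> i + 1)" by simp
      then have "cmod (2 * of_nat (\<alpha> i) + 1) = real (2 * \<alpha> i + 1)" by (simp only: norm_of_nat)
      then have "1 + real (\<alpha> i) \<le> cmod (2 * of_nat (\<alpha> i) + 1)" by simp
      then have "cmod (hcoeff \<alpha> f) * ((1 + real (\<alpha> i)) * v \<alpha>) \<le> cmod (hcoeff \<alpha> f) * (cmod (2 * of_nat (\<alpha> i) + 1) * v \<alpha>)"
        by (intro mult_left_mono mult_right_mono v) auto
      also have "... = cmod (hcoeff \<alpha> (oscillator i f)) * v \<alpha>" unfolding hcoeff_oscillator[OF f] norm_mult by simp
      also have "... \<le> C * snorm UNIV m (oscillator i f)" by (rule C(2)[OF oscillator_schwartz[OF f]])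
      also have "... \<le> C * (D * snorm UNIV (Suc (Suc m)) f)" by (intro mult_left_mono D f C)
      finally show ?thesis by simp
    qed
    then show ?thesis unfolding dec_def using C D by (intro exI[of _ "C * D"] conjI exI[of _ "Suc (Suc m)"]) auto
  qed
  have prod: "dec (\<lambda>\<alpha>. (\<Prod>i\<in>I. 1 + real (\<alpha> i)) * v \<alpha>)" if v: "dec v" "\<And>\<alpha>. v \<alpha> \<ge> 0" and "finite I" for v I using \<open>finite I\<close>
  proof (induction I rule: finite_induct)
    case (insert i I)
    have "dec (\<lambda>\<alpha>. (1 + real (\<alpha> i)) * ((\<Prod>i\<in>I. 1 + real (\<alpha> i)) * v \<alpha>))"
      by (rule step[OF insert.IH]) (auto intro!: mult_nonneg_nonneg prod_nonneg v)
    then show ?case using insert.hyps by (simp add: mult.assoc)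
  qed (use v in simp)
  \<comment> \<open>The induction starts one power below zero, because the direct estimate
    \<open>cmod_hcoeff_le\<close> grows linearly in \<open>weight\<close>. One additional round
    makes up for it at the end.\<close>
  have "dec (\<lambda>\<alpha>. weight \<alpha> ^ k * (1 / weight \<alpha>))" for k
  proof (induction k)
    case 0
    obtain C m where C: "C \<ge> 0" "\<forall>f\<in>S_funs. \<forall>\<alpha>::'n mindex. cmod (hcoeff \<alpha> f) \<le> C * weight \<alpha> * snorm UNIV m f"
      using cmod_hcoeff_le by blast
    have "cmod (hcoeff \<alpha> f) * (weight \<alpha> ^ 0 * (1 / weight \<alpha>)) \<le> C * snorm UNIV m f"
      if "f \<in> S_funs" for f and \<alpha> :: "'n mindex" using C(2) that weight_pos[of \<alpha>] by (simp add: pos_divide_le_eq mult_ac)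
    then show ?case unfolding dec_def using C(1) by blast
  next
    case (Suc k)
    have "dec (\<lambda>\<alpha>. (\<Prod>i\<in>UNIV. 1 + real (\<alpha> i)) * (weight \<alpha> ^ k * (1 / weight \<alpha>)))"
      by (rule prod[OF Suc _ finite_class.finite_UNIV]) (intro mult_nonneg_nonneg zero_le_power divide_nonneg_nonneg less_imp_le[OF weight_pos] zero_le_one finite_class.finite_UNIV)
    then show ?case by (simp add: weight_def[symmetric] mult.assoc)
  qed
  from this[of "Suc k"] have "dec (\<lambda>\<alpha>. weight \<alpha> ^ Suc k * (1 / weight \<alpha>))" .
  moreover have "weight \<alpha> ^ Suc k * (1 / weight \<alpha>) = weight \<alpha> ^ k" for \<alpha> :: "'n mindex" using weight_pos[of \<alpha>] by simp
  ultimately show ?thesis unfolding dec_def by (simp only:)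
qed

section \<open>Hermite expansions\<close>

definition hermite_span :: "(real^'n \<Rightarrow> complex) \<Rightarrow> bool" where
  "hermite_span g \<longleftrightarrow> (\<exists>ts. \<forall>x. g x = lc_eval hermite_fun ts x)"

lemma hermite_span_add: "hermite_span f \<Longrightarrow> hermite_span g \<Longrightarrow> hermite_span (\<lambda>x. f x + g x)"
  unfolding hermite_span_def by (metis lc_simps(7))

lemma hermite_span_scale: "hermite_span f \<Longrightarrow> hermite_span (\<lambda>x. c * f x)" unfolding hermite_span_def by (metis lc_map_simps(1))

lemma hermite_span_sum: "finite I \<Longrightarrow> (\<And>i. i \<in> I \<Longrightarrow> hermite_span (f i)) \<Longrightarrow> hermite_span (\<lambda>x. \<Sum>i\<in>I. f i x)"
proof (induction I rule: finite_induct)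
  case empty
  show ?case unfolding hermite_span_def by (intro exI[of _ "[]"]) simp
next
  case (insert i I)
  then show ?case using hermite_span_add[of "f i" "\<lambda>x. \<Sum>i\<in>I. f i x"] by simp
qed

lemma hermite_span_coord:
  assumes "hermite_span f" "b \<in> Basis"
  shows "hermite_span (\<lambda>x. of_real (x \<bullet> b) * f x)"
proof -
  obtain ts where ts: "\<And>x. f x = lc_eval hermite_fun ts x" using assms(1) by (auto simp: hermite_span_def)
  have "of_real (x \<bullet> b) * lc_eval hermite_fun ts x = lc_eval hermite_fun (lc_bind (hermite_mult_list b) ts) x" for x
    unfolding lc_eval_bind by (induction ts) (auto simp: hermite_fun_mult[OF assms(2), symmetric] algebra_simps)
  then show ?thesis unfolding hermite_span_def using ts by auto
qed

text \<open>The span is stable under multiplication by coordinates, hence by the linear form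
  \<open>x \<bullet> y\<close>. The functions obtained are the terms of the exponential series times
  the Gaussian.\<close>

lemma hermite_span_power:
  "hermite_span (\<lambda>x. of_real (x \<bullet> y) ^ n * hermite_fun (\<lambda>_. 0) x)"
proof (induction n)
  case 0
  show ?case unfolding hermite_span_def by (intro exI[of _ "[(1, \<lambda>_. 0)]"]) simp
next
  case (Suc n)
  let ?g = "\<lambda>x. of_real (x \<bullet> y) ^ n * hermite_fun (\<lambda>_. 0) x"
  have "hermite_span (\<lambda>x. \<Sum>b\<in>Basis. of_real (y \<bullet> b) * (of_real (x \<bullet> b) * ?g x))"
    by (intro hermite_span_sum hermite_span_scale hermite_span_coord Suc) auto
  moreover have "(\<Sum>b\<in>Basis. of_real (y \<bullet> b) * (of_real (x \<bullet> b) * ?g x)) = of_real (x \<bullet> y) ^ Suc n * hermite_fun (\<lambda>_. 0) x" for x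
  proof -
    have "complex_of_real (x \<bullet> y) = (\<Sum>b\<in>Basis. of_real (y \<bullet> b) * of_real (x \<bullet> b))" by (subst euclidean_inner) (simp add: mult.commute)
    then show ?thesis by (simp add: sum_distrib_right mult.assoc)
  qed
  ultimately show ?case by simp
qed

lemma integral_hermite_span_eq_0:
  assumes f: "f \<in> S_funs" and 0: "\<And>\<alpha>. hcoeff \<alpha> f = 0" and g: "hermite_span g"
  shows "(\<integral>x. f x * g x \<partial>lborel) = 0"
proof -
  obtain ts where ts: "\<And>x. g x = lc_eval hermite_fun ts x" using g by (auto simp: hermite_span_def)
  have "integrable lborel (\<lambda>x. f x * lc_eval hermite_fun ts x) \<and> (\<integral>x. f x * lc_eval hermite_fun ts x \<partial>lborel) = 0"
  proof (induction ts)
    case (Cons t ts)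
    have *: "(\<lambda>x. f x * lc_eval hermite_fun (t # ts) x) = (\<lambda>x. fst t * (f x * hermite_fun (snd t) x) + f x * lc_eval hermite_fun ts x)"
      by (auto simp: algebra_simps)
    have i: "integrable lborel (\<lambda>x. fst t * (f x * hermite_fun (snd t) x))"
      by (intro integrable_mult_right schwartz_mult_integrable f hermite_fun_schwartz)
    show ?case unfolding * using Cons i 0[of "snd t"] by (simp add: hcoeff_def)
  qed simp
  then show ?thesis by (simp add: ts)
qed

lemma hermite_fun_0:
  "hermite_fun (\<lambda>_. 0) x = of_real ((pi powr (- (1/4))) ^ CARD('n) * exp (- (norm x)\<^sup>2 / 2))" for x :: "real^'n"
proof -
  have "(\<Prod>i\<in>UNIV. hermite 0 (x $ i)) = (pi powr (- (1/4))) ^ CARD('n) * exp (\<Sum>i\<in>UNIV. - (x $ i)\<^sup>2 / 2)"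
    by (simp add: prod.distrib exp_sum)
  also have "(\<Sum>i\<in>UNIV. - (x $ i)\<^sup>2 / 2) = - (norm x)\<^sup>2 / 2" unfolding power2_norm_eq_inner inner_vec_def
    by (simp add: sum_negf power2_eq_square flip: sum_divide_distrib)
  finally show ?thesis by (simp add: hermite_fun_def)
qed

text \<open>Expanding the exponential gives integrals of \<open>f\<close> against the Hermite span,
  which vanish. The partial sums are at most \<open>exp \<bar>x \<bullet> y\<bar>\<close>, hence at
  most \<open>exp ((norm x)\<^sup>2 / 2 + (norm y)\<^sup>2 / 2)\<close>; the Gaussian cancels
  exactly the growth in \<open>x\<close>, and the decay of \<open>f\<close> makes the majorant
  integrable.\<close>

lemma fourier_transform_eq_0:
  fixes f :: "real^'n \<Rightarrow> complex"
  assumes f: "f \<in> S_funs" and 0: "\<And>\<alpha>. hcoeff \<alpha> f = 0"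
  shows "(\<integral>x. f x * hermite_fun (\<lambda>_. 0) x * exp (\<i> * of_real (x \<bullet> y)) \<partial>lborel) = 0"
proof -
  let ?h = "hermite_fun (\<lambda>_. 0) :: real^'n \<Rightarrow> complex"
  define s where "s n x = f x * ?h x * (\<Sum>k<n. (\<i> * of_real (x \<bullet> y)) ^ k /\<^sub>R fact k)" for n x
  let ?C = "(pi powr (- (1/4))) ^ CARD('n)"
  let ?w = "\<lambda>x::real^'n. snorm UNIV (2 * DIM(real^'n)) f * (?C * exp ((norm y)\<^sup>2 / 2)) * decay x"
  have [measurable]: "f \<in> borel_measurable borel" "?h \<in> borel_measurable borel" by (intro schwartz_borel f hermite_fun_schwartz)+
  have "(\<lambda>n. \<integral>x. s n x \<partial>lborel) \<longlonglongrightarrow> (\<integral>x. f x * ?h x * exp (\<i> * of_real (x \<bullet> y)) \<partial>lborel)"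
  proof (rule integral_dominated_convergence[where w = ?w])
    show "s n \<in> borel_measurable lborel" for n unfolding s_def by measurable
    show "integrable lborel ?w" by (intro integrable_mult_right integrable_weight)
    show "AE x in lborel. (\<lambda>n. s n x) \<longlonglongrightarrow> f x * ?h x * exp (\<i> * of_real (x \<bullet> y))"
      unfolding s_def by (intro AE_I2 tendsto_intros) (use exp_converges[unfolded sums_def] in blast)
    show "AE x in lborel. norm (s n x) \<le> ?w x" for n
    proof (intro AE_I2)
      fix x
      have "cmod (\<Sum>k<n. (\<i> * of_real (x \<bullet> y)) ^ k /\<^sub>R fact k) \<le> (\<Sum>k<n. \<bar>x \<bullet> y\<bar> ^ k /\<^sub>R fact k)"
        by (rule sum_norm_le) (simp add: norm_power norm_mult divide_inverse)
      also have "... \<le> exp \<bar>x \<bullet> y\<bar>" unfolding exp_def by (intro sum_le_suminf summable_exp_generic) auto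
      also have "... \<le> exp ((norm x)\<^sup>2 / 2 + (norm y)\<^sup>2 / 2)"
      proof -
        have "\<bar>x \<bullet> y\<bar> \<le> norm x * norm y" by (rule Cauchy_Schwarz_ineq2)
        also have "... \<le> (norm x)\<^sup>2 / 2 + (norm y)\<^sup>2 / 2" using sum_squares_bound[of "norm x" "norm y"] by simp
        finally show ?thesis by simp
      qed
      finally have le: "cmod (\<Sum>k<n. (\<i> * of_real (x \<bullet> y)) ^ k /\<^sub>R fact k) \<le> exp ((norm x)\<^sup>2 / 2 + (norm y)\<^sup>2 / 2)" .
      have "cmod (?h x * (\<Sum>k<n. (\<i> * of_real (x \<bullet> y)) ^ k /\<^sub>R fact k)) \<le>
          (?C * exp (- (norm x)\<^sup>2 / 2)) * exp ((norm x)\<^sup>2 / 2 + (norm y)\<^sup>2 / 2)"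
        unfolding norm_mult by (intro mult_mono le) (simp_all add: hermite_fun_0 norm_mult norm_power del: of_real_power of_real_mult of_real_exp)
      also have "... = ?C * exp ((norm y)\<^sup>2 / 2)" by (simp add: mult_exp_exp)
      finally show "norm (s n x) \<le> ?w x"
        using schwartz_product_decay[OF f, of "\<lambda>_. ?h x * (\<Sum>k<n. (\<i> * of_real (x \<bullet> y)) ^ k /\<^sub>R fact k)" "?C * exp ((norm y)\<^sup>2 / 2)" x]
        unfolding s_def by (simp add: mult.assoc)
    qed
  qed measurable
  moreover have "(\<integral>x. s n x \<partial>lborel) = 0" for n
  proof -
    have "hermite_span (\<lambda>x. \<Sum>k<n. (\<i> ^ k /\<^sub>R fact k) * (of_real (x \<bullet> y) ^ k * ?h x))"
      by (intro hermite_span_sum hermite_span_scale hermite_span_power) auto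
    from integral_hermite_span_eq_0[OF f 0 this]
    show ?thesis unfolding s_def by (simp add: sum_distrib_left power_mult_distrib mult_ac scaleR_conv_of_real)
  qed
  ultimately show ?thesis by (simp add: LIMSEQ_const_iff)
qed

section \<open>Uniqueness of the Fourier transform\<close>

definition gauss :: "'a::euclidean_space \<Rightarrow> real" where
  "gauss x = (\<Prod>b\<in>Basis. std_normal_density (x \<bullet> b))"

lemma gauss_eq: "gauss x = (1 / sqrt (2 * pi)) ^ DIM('a) * exp (- (norm x)\<^sup>2 / 2)" for x :: "'a::euclidean_space"
proof -
  have "gauss x = (1 / sqrt (2 * pi)) ^ DIM('a) * exp (\<Sum>b\<in>Basis. - (x \<bullet> b)\<^sup>2 / 2)"
    unfolding gauss_def std_normal_density_def prod.distrib by (simp add: exp_sum)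
  also have "(\<Sum>b\<in>Basis. - (x \<bullet> b)\<^sup>2 / 2) = - (norm x)\<^sup>2 / 2"
    unfolding power2_norm_eq_inner euclidean_inner[of x x] by (simp add: sum_negf sum_divide_distrib power2_eq_square)
  finally show ?thesis .
qed

lemma gauss_nonneg: "0 \<le> gauss x" unfolding gauss_def by (intro prod_nonneg) auto

lemma gauss_measurable [measurable]: "gauss \<in> borel_measurable borel" unfolding gauss_def[abs_def] by measurable

lemma integrable_gauss: "integrable lborel gauss" and integral_gauss: "(\<integral>x. gauss x \<partial>lborel) = 1"
  using lborel_prod_Basis[of "\<lambda>_. std_normal_density"] by (simp_all add: gauss_def[abs_def] integral_normal_density)

text \<open>The characteristic function of the standard normal distribution, rewritten as an
  integral over Lebesgue measure.\<close>

lemma fourier_std_normal: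
  "integrable lborel (\<lambda>x. of_real (std_normal_density x) * exp (\<i> * of_real (t * x)))"
  "(\<integral>x. of_real (std_normal_density x) * exp (\<i> * of_real (t * x)) \<partial>lborel) = complex_of_real (exp (- (t\<^sup>2) / 2))"
proof -
  have "integrable lborel (\<lambda>x. complex_of_real (std_normal_density x))" by simp
  then show "integrable lborel (\<lambda>x. of_real (std_normal_density x) * exp (\<i> * of_real (t * x)))"
    by (rule Bochner_Integration.integrable_bound) (auto simp: norm_mult)
  have "char std_normal_distribution t = (\<integral>x. std_normal_density x *\<^sub>R iexp (t * x) \<partial>lborel)"
    unfolding char_def by (rule integral_density) auto
  then show "(\<integral>x. of_real (std_normal_density x) * exp (\<i> * of_real (t * x)) \<partial>lborel) = complex_of_real (exp (- (t\<^sup>2) / 2))"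
    unfolding char_std_normal_distribution by (simp add: scaleR_conv_of_real)
qed

lemma fourier_gauss:
  fixes v :: "'a::euclidean_space"
  shows "(\<integral>u. of_real (gauss u) * exp (\<i> * of_real (v \<bullet> u)) \<partial>lborel) = complex_of_real (exp (- (norm v)\<^sup>2 / 2))"
proof -
  let ?f = "\<lambda>b x. of_real (std_normal_density x) * exp (\<i> * of_real ((v \<bullet> b) * x))"
  have "of_real (gauss u) * exp (\<i> * of_real (v \<bullet> u)) = (\<Prod>b\<in>Basis. ?f b (u \<bullet> b))" for u
    unfolding gauss_def prod.distrib euclidean_inner[of v u] by (simp add: sum_distrib_left exp_sum)
  then have "(\<integral>u. of_real (gauss u) * exp (\<i> * of_real (v \<bullet> u)) \<partial>lborel) = (\<Prod>b\<in>Basis. \<integral>x. ?f b x \<partial>lborel)"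
    using lborel_prod_Basis(2)[of ?f] fourier_std_normal(1) by simp
  also have "... = (\<Prod>b\<in>Basis. complex_of_real (exp (- ((v \<bullet> b)\<^sup>2) / 2)))" unfolding fourier_std_normal(2) ..
  also have "... = complex_of_real (exp (\<Sum>b\<in>Basis. - ((v \<bullet> b)\<^sup>2) / 2))" by (simp add: exp_sum)
  also have "(\<Sum>b\<in>Basis. - ((v \<bullet> b)\<^sup>2) / 2) = - (norm v)\<^sup>2 / 2"
    unfolding power2_norm_eq_inner euclidean_inner[of v v] by (simp add: sum_negf sum_divide_distrib power2_eq_square)
  finally show ?thesis .
qed

text \<open>The Gaussian is its own Fourier transform up to a constant. Inserting this and
  exchanging the integrals leaves Fourier integrals of \<open>G\<close>, which vanish.\<close>

lemma integral_gauss_eq_0: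
  fixes G :: "'a::euclidean_space \<Rightarrow> complex"
  assumes G: "integrable lborel G" and 0: "\<And>y. (\<integral>x. G x * exp (\<i> * of_real (x \<bullet> y)) \<partial>lborel) = 0"
  shows "(\<integral>x. G x * of_real (gauss x) \<partial>lborel) = 0"
proof -
  have [measurable]: "G \<in> borel_measurable borel" using G by (auto dest: borel_measurable_integrable)
  let ?F = "\<lambda>v u. G v * (of_real (gauss u) * exp (\<i> * of_real (v \<bullet> u)))"
  have nF: "norm (?F v u) = norm (G v) * gauss u" for v u by (simp add: norm_mult gauss_nonneg)
  have int: "integrable (lborel \<Otimes>\<^sub>M lborel) (case_prod ?F)"
  proof (rule lborel_pair.Fubini_integrable)
    show "case_prod ?F \<in> borel_measurable (lborel \<Otimes>\<^sub>M lborel)" by measurable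
    show "integrable lborel (\<lambda>v. \<integral>u. norm (case (v, u) of (v, u) \<Rightarrow> ?F v u) \<partial>lborel)"
      using integrable_norm[OF G] by (simp add: nF integral_gauss)
    show "AE v in lborel. integrable lborel (\<lambda>u. case (v, u) of (v, u) \<Rightarrow> ?F v u)"
    proof (intro AE_I2)
      fix v
      have "integrable lborel (\<lambda>u. norm (G v) * gauss u)" by (intro integrable_mult_right integrable_gauss)
      then show "integrable lborel (\<lambda>u. case (v, u) of (v, u) \<Rightarrow> ?F v u)"
        by (rule Bochner_Integration.integrable_bound) (auto simp: norm_mult gauss_nonneg)
    qed
  qed
  have "0 = (\<integral>u. (\<integral>v. ?F v u \<partial>lborel) \<partial>lborel)"
  proof -
    have "(\<integral>v. ?F v u \<partial>lborel) = of_real (gauss u) * (\<integral>v. G v * exp (\<i> * of_real (v \<bullet> u)) \<partial>lborel)" for u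
      by (subst integral_mult_right_zero[symmetric]) (simp add: mult_ac)
    then show ?thesis by (simp add: 0)
  qed
  also have "... = (\<integral>v. (\<integral>u. ?F v u \<partial>lborel) \<partial>lborel)" by (rule lborel_pair.Fubini_integral[OF int])
  also have "... = (\<integral>v. G v * complex_of_real (exp (- (norm v)\<^sup>2 / 2)) \<partial>lborel)" by (simp add: fourier_gauss)
  finally have "(\<integral>v. G v * complex_of_real (exp (- (norm v)\<^sup>2 / 2)) \<partial>lborel) = 0" by simp
  moreover have "G x * of_real (gauss x) = of_real ((1 / sqrt (2 * pi)) ^ DIM('a)) * (G x * complex_of_real (exp (- (norm x)\<^sup>2 / 2)))" for x
    unfolding gauss_eq by (simp only: of_real_mult mult_ac)
  ultimately show ?thesis by (simp only: Bochner_Integration.integral_mult_right_zero mult_zero_right)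
qed

lemma integral_affine_eq_0:
  fixes g :: "'a::euclidean_space \<Rightarrow> complex"
  assumes t: "t \<noteq> 0" and [measurable]: "g \<in> borel_measurable borel" and 0: "(\<integral>x. g x \<partial>lborel) = 0"
  shows "(\<integral>x. g (z + t *\<^sub>R x) \<partial>lborel) = 0"
proof -
  have "(\<integral>x. g x \<partial>lborel) = (\<integral>x. g x \<partial>density (distr lborel borel (\<lambda>x. z + t *\<^sub>R x)) (\<lambda>_. ennreal (\<bar>t\<bar> ^ DIM('a))))"
    using lborel_affine[OF t, of z] by simp
  also have "... = (\<integral>x. \<bar>t\<bar> ^ DIM('a) *\<^sub>R g x \<partial>distr lborel borel (\<lambda>x. z + t *\<^sub>R x))" by (rule integral_density) auto
  also have "... = \<bar>t\<bar> ^ DIM('a) *\<^sub>R (\<integral>x. g (z + t *\<^sub>R x) \<partial>lborel)" by (simp add: integral_distr)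
  finally show ?thesis using 0 t by simp
qed

lemma integrable_affine:
  fixes g :: "'a::euclidean_space \<Rightarrow> complex"
  assumes t: "t \<noteq> 0" and g: "integrable lborel g"
  shows "integrable lborel (\<lambda>x. g (z + t *\<^sub>R x))"
proof -
  have [measurable]: "g \<in> borel_measurable borel" using g by (auto dest: borel_measurable_integrable)
  have "integrable (density (distr lborel borel (\<lambda>x. z + t *\<^sub>R x)) (\<lambda>_. ennreal (\<bar>t\<bar> ^ DIM('a)))) g"
    using lborel_affine[OF t, of z] g by simp
  then have "integrable (distr lborel borel (\<lambda>x. z + t *\<^sub>R x)) (\<lambda>x. \<bar>t\<bar> ^ DIM('a) *\<^sub>R g x)" by (subst (asm) integrable_density) auto
  then have i: "integrable lborel (\<lambda>x. \<bar>t\<bar> ^ DIM('a) *\<^sub>R g (z + t *\<^sub>R x))" by (simp add: integrable_distr_eq)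
  have "integrable lborel (\<lambda>x. (1 / \<bar>t\<bar> ^ DIM('a)) *\<^sub>R (\<bar>t\<bar> ^ DIM('a) *\<^sub>R g (z + t *\<^sub>R x)))" by (rule integrable_scaleR_right) (rule i)
  moreover have "(\<lambda>x. (1 / \<bar>t\<bar> ^ DIM('a)) *\<^sub>R (\<bar>t\<bar> ^ DIM('a) *\<^sub>R g (z + t *\<^sub>R x))) = (\<lambda>x. g (z + t *\<^sub>R x))" using t by simp
  ultimately show ?thesis by (simp only:)
qed

text \<open>Gaussians shrinking to the point \<open>z\<close> act as an approximate identity: the
  averages of \<open>F\<close> against them vanish by \<open>integral_gauss_eq_0\<close>, and they
  tend to \<open>F z\<close> by continuity and dominated convergence.\<close>

lemma fourier_injective:
  fixes F :: "'a::euclidean_space \<Rightarrow> complex"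
  assumes F: "integrable lborel F" and cont: "continuous_on UNIV F" and B: "\<And>x. cmod (F x) \<le> B"
    and 0: "\<And>y. (\<integral>x. F x * exp (\<i> * of_real (x \<bullet> y)) \<partial>lborel) = 0"
  shows "F z = 0"
proof -
  have [measurable]: "F \<in> borel_measurable borel" by (rule borel_measurable_continuous_onI[OF cont])
  define t where "t n = inverse (real (Suc n))" for n
  have t: "t n \<noteq> 0" for n by (simp add: t_def)
  have t0: "t \<longlonglongrightarrow> 0" unfolding t_def by (rule LIMSEQ_inverse_real_of_nat)
  have "(\<integral>x. F (z + t n *\<^sub>R x) * of_real (gauss x) \<partial>lborel) = 0" for n
  proof (rule integral_gauss_eq_0[OF integrable_affine[OF t F]])
    fix y
    let ?g = "\<lambda>x. F x * exp (\<i> * of_real (x \<bullet> ((1 / t n) *\<^sub>R y)))"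
    have "(\<integral>x. ?g (z + t n *\<^sub>R x) \<partial>lborel) = 0" by (rule integral_affine_eq_0[OF t _ 0]) measurable
    \<comment> \<open>Translating and dilating the argument changes the frequency from
      \<open>y\<close> to \<open>y / t n\<close> and produces a phase that does not depend on
      \<open>x\<close>.\<close>
    moreover have "F (z + t n *\<^sub>R x) * exp (\<i> * of_real (x \<bullet> y)) = exp (- \<i> * of_real (z \<bullet> ((1 / t n) *\<^sub>R y))) * ?g (z + t n *\<^sub>R x)" for x
    proof -
      have "(z + t n *\<^sub>R x) \<bullet> ((1 / t n) *\<^sub>R y) = z \<bullet> ((1 / t n) *\<^sub>R y) + x \<bullet> y"
        using t[of n] by (simp add: inner_add_left add_divide_distrib)
      then have "exp (\<i> * of_real ((z + t n *\<^sub>R x) \<bullet> ((1 / t n) *\<^sub>R y))) = exp (\<i> * of_real (z \<bullet> ((1 / t n) *\<^sub>R y))) * exp (\<i> * of_real (x \<bullet> y))"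
        by (simp only: of_real_add distrib_left exp_add)
      then show ?thesis by (simp add: mult.left_commute[of _ "F _"] mult.assoc[symmetric] exp_add[symmetric] del: inner_scaleR_right)
    qed
    ultimately show "(\<integral>x. F (z + t n *\<^sub>R x) * exp (\<i> * of_real (x \<bullet> y)) \<partial>lborel) = 0"
      by (simp only: Bochner_Integration.integral_mult_right_zero mult_zero_right)
  qed
  moreover have "(\<lambda>n. \<integral>x. F (z + t n *\<^sub>R x) * of_real (gauss x) \<partial>lborel) \<longlonglongrightarrow> (\<integral>x. F z * of_real (gauss x) \<partial>(lborel :: 'a measure))"
  proof (rule integral_dominated_convergence[where w = "\<lambda>x::'a. B * gauss x"])
    show "integrable lborel (\<lambda>x::'a. B * gauss x)" by (intro integrable_mult_right integrable_gauss)
    show "AE x in lborel :: 'a measure. (\<lambda>n. F (z + t n *\<^sub>R x) * of_real (gauss x)) \<longlonglongrightarrow> F z * of_real (gauss x)"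
    proof (intro AE_I2 tendsto_intros)
      fix x
      have "(\<lambda>n. z + t n *\<^sub>R x) \<longlonglongrightarrow> z + 0 *\<^sub>R x" by (intro tendsto_intros t0)
      then have "(\<lambda>n. z + t n *\<^sub>R x) \<longlonglongrightarrow> z" by simp
      moreover have "isCont F z" using cont continuous_on_eq_continuous_at by blast
      ultimately show "(\<lambda>n. F (z + t n *\<^sub>R x)) \<longlonglongrightarrow> F z" by (rule isCont_tendsto_compose[rotated])
    qed
    show "AE x in lborel. norm (F (z + t n *\<^sub>R x) * of_real (gauss x)) \<le> B * gauss x" for n
      using B by (intro AE_I2) (simp add: norm_mult gauss_nonneg mult_right_mono)
  qed measurable
  ultimately have "(\<integral>x. F z * of_real (gauss x) \<partial>(lborel :: 'a measure)) = 0" by (simp add: LIMSEQ_const_iff)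
  moreover have "(\<integral>x. gauss x \<partial>(lborel :: 'a measure)) = 1" by (rule integral_gauss)
  ultimately show ?thesis by simp
qed

text \<open>The product of \<open>f\<close> with the ground state has vanishing Fourier transform,
  so it is 0 everywhere; the ground state is a Gaussian and has no zeros.\<close>

lemma hermite_complete:
  fixes f :: "real^'n \<Rightarrow> complex"
  assumes f: "f \<in> S_funs" and 0: "\<And>\<alpha>. hcoeff \<alpha> f = 0"
  shows "f = (\<lambda>x. 0)"
proof
  fix z
  let ?h = "hermite_fun (\<lambda>_. 0) :: real^'n \<Rightarrow> complex"
  have h: "?h \<in> S_funs" by (rule hermite_fun_schwartz)
  have "f z * ?h z = 0"
  proof (rule fourier_injective[OF schwartz_mult_integrable[OF f h]])
    show "continuous_on UNIV (\<lambda>x. f x * ?h x)" by (intro continuous_intros schwartz_continuous f h)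
    show "cmod (f x * ?h x) \<le> snorm UNIV 0 f * snorm UNIV 0 ?h" for x
      unfolding norm_mult by (intro mult_mono schwartz_bounded f h snorm_nonneg) auto
  qed (rule fourier_transform_eq_0[OF f 0])
  moreover have "?h z \<noteq> 0" unfolding hermite_fun_0 by simp
  ultimately show "f z = 0" by simp
qed

section \<open>Rapidly decreasing coefficients and Hermite series\<close>

text \<open>Every finite set of multi-indices lies in a box, and over a box the sum factors into
  one-dimensional partial sums.\<close>

lemma summable_weight:
  "(\<lambda>\<alpha>::'n::finite mindex. 1 / weight \<alpha> ^ 2) summable_on UNIV"
proof (rule nonneg_bdd_above_summable_on)
  have s: "summable (\<lambda>k. 1 / (1 + real k) ^ 2)"
    using summable_Suc_iff[of "\<lambda>k. inverse (real k ^ 2)"] inverse_power_summable[of 2, where 'a = real]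
    by (simp add: inverse_eq_divide add.commute)
  let ?S = "\<Sum>k. 1 / (1 + real k) ^ 2"
  have "sum (\<lambda>\<alpha>. 1 / weight \<alpha> ^ 2) A \<le> ?S ^ CARD('n)" if A: "finite A" for A :: "'n mindex set"
  proof -
    obtain N where N: "\<And>\<alpha> i. \<alpha> \<in> A \<Longrightarrow> \<alpha> i < N"
    proof -
      have "finite ((\<lambda>(\<alpha>, i). \<alpha> i) ` (A \<times> UNIV))" using A by auto
      then obtain N where "\<forall>n\<in>(\<lambda>(\<alpha>, i). \<alpha> i) ` (A \<times> UNIV). n < N" using finite_nat_set_iff_bounded by blast
      then show ?thesis by (intro that) auto
    qed
    have "sum (\<lambda>\<alpha>. 1 / weight \<alpha> ^ 2) A \<le> sum (\<lambda>\<alpha>. 1 / weight \<alpha> ^ 2) (Pi\<^sub>E (UNIV :: 'n set) (\<lambda>_. {..<N}))"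
      by (rule sum_mono2) (auto intro!: finite_PiE simp: N)
    also have "... = (\<Sum>\<alpha>\<in>Pi\<^sub>E UNIV (\<lambda>_. {..<N}). \<Prod>i\<in>(UNIV :: 'n set). 1 / (1 + real (\<alpha> i)) ^ 2)"
      unfolding weight_def by (simp add: prod_dividef prod_power_distrib)
    also have "... = (\<Prod>i\<in>(UNIV :: 'n set). \<Sum>k<N. 1 / (1 + real k) ^ 2)" by (rule prod_sum_PiE[symmetric]) auto
    also have "... \<le> (\<Prod>i\<in>(UNIV :: 'n set). ?S)" by (intro prod_mono conjI sum_nonneg sum_le_suminf s) auto
    finally show ?thesis by simp
  qed
  then show "bdd_above (sum (\<lambda>\<alpha>::'n mindex. 1 / weight \<alpha> ^ 2) ` {F. F \<subseteq> UNIV \<and> finite F})" by (auto simp: bdd_above_def)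
qed (simp add: weight_pos less_imp_le)

lemma infinite_multi_indices: "infinite (UNIV :: 'n::finite mindex set)"
proof
  assume "finite (UNIV :: 'n mindex set)"
  then have "finite (range (\<lambda>k (_::'n). k :: nat))" by (rule finite_subset[rotated]) simp
  moreover have "inj (\<lambda>k (_::'n). k :: nat)" by (auto simp: inj_def fun_eq_iff)
  ultimately show False using finite_imageD infinite_UNIV_nat by blast
qed

lemma snorm_scale_le_UNIV: "f \<in> S_funs \<Longrightarrow> snorm UNIV m (\<lambda>x. c * f x) \<le> cmod c * snorm UNIV m f" by (rule snorm_scale_le) auto

text \<open>\<open>C\<close> and \<open>k\<close> depend on the norm and on the family, but not on
  the coefficients. This uniformity is what later gives continuity and convergence of
  multipliers.\<close>

lemma rapid_coeff_summable:
  fixes \<Phi> :: "'i \<Rightarrow> 'a::euclidean_space \<Rightarrow> complex"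
  assumes w1: "\<And>i. w i \<ge> 1" and ws: "(\<lambda>i. 1 / w i ^ 2) summable_on UNIV" and \<Phi>: "\<And>\<alpha>. \<Phi> \<alpha> \<in> S_funs" and pb: "poly_bounded w (\<lambda>\<alpha>. snorm UNIV m (\<Phi> \<alpha>))"
  shows "\<exists>C\<ge>0. \<exists>k. \<forall>c K. (\<forall>\<alpha>. cmod (c \<alpha>) * w \<alpha> ^ k \<le> K) \<longrightarrow>
     (\<lambda>\<alpha>. snorm UNIV m (\<lambda>x. c \<alpha> * \<Phi> \<alpha> x)) summable_on UNIV \<and> (\<Sum>\<^sub>\<infinity>\<alpha>. snorm UNIV m (\<lambda>x. c \<alpha> * \<Phi> \<alpha> x)) \<le> C * K"
proof -
  obtain B M where B: "B \<ge> 0" "\<And>\<alpha>. snorm UNIV m (\<Phi> \<alpha>) \<le> B * w \<alpha> ^ M" using pb by (auto simp: poly_bounded_def)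
  let ?S = "\<Sum>\<^sub>\<infinity>\<alpha>::'i. 1 / w \<alpha> ^ 2"
  have S: "?S \<ge> 0" by (intro infsum_nonneg) (simp add: order_trans[OF zero_le_one w1])
  \<comment> \<open>In the exponent \<open>M + 2\<close>, the part \<open>M\<close> pays for the
    growth of the norms and the 2 for summability.\<close>
  have "(\<lambda>\<alpha>. snorm UNIV m (\<lambda>x. c \<alpha> * \<Phi> \<alpha> x)) summable_on UNIV \<and> (\<Sum>\<^sub>\<infinity>\<alpha>. snorm UNIV m (\<lambda>x. c \<alpha> * \<Phi> \<alpha> x)) \<le> B * ?S * K"
    if c: "\<forall>\<alpha>. cmod (c \<alpha>) * w \<alpha> ^ (M + 2) \<le> K" for c K
  proof -
    have le: "snorm UNIV m (\<lambda>x. c \<alpha> * \<Phi> \<alpha> x) \<le> (B * K) * (1 / w \<alpha> ^ 2)" for \<alpha>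
    proof -
      have w: "w \<alpha> > 0" using w1[of \<alpha>] by linarith
      have "snorm UNIV m (\<lambda>x. c \<alpha> * \<Phi> \<alpha> x) \<le> cmod (c \<alpha>) * (B * w \<alpha> ^ M)"
        by (rule order_trans[OF snorm_scale_le_UNIV[OF \<Phi>] mult_left_mono[OF B(2)]]) auto
      also have "... = B * (cmod (c \<alpha>) * w \<alpha> ^ (M + 2)) * (1 / w \<alpha> ^ 2)" using w by (simp add: power_add field_simps power2_eq_square)
      also have "... \<le> B * K * (1 / w \<alpha> ^ 2)" using c B(1) w by (intro mult_right_mono mult_left_mono) auto
      finally show ?thesis .
    qed
    have s2: "(\<lambda>\<alpha>::'i. (B * K) * (1 / w \<alpha> ^ 2)) summable_on UNIV" by (intro summable_on_cmult_right ws)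
    have s1: "(\<lambda>\<alpha>. snorm UNIV m (\<lambda>x. c \<alpha> * \<Phi> \<alpha> x)) summable_on UNIV"
      by (rule summable_on_comparison_test[OF s2 le]) (intro snorm_nonneg schwartz_scale \<Phi> open_UNIV UNIV_not_empty)
    have "(\<Sum>\<^sub>\<infinity>\<alpha>. snorm UNIV m (\<lambda>x. c \<alpha> * \<Phi> \<alpha> x)) \<le> (\<Sum>\<^sub>\<infinity>\<alpha>::'i. (B * K) * (1 / w \<alpha> ^ 2))" by (rule infsum_mono[OF s1 s2 le])
    also have "... = B * ?S * K" unfolding infsum_cmult_right' by (simp only: mult_ac)
    finally show ?thesis using s1 by blast
  qed
  then show ?thesis using B(1) S by (intro exI[of _ "B * ?S"] conjI exI[of _ "M + 2"]) auto
qed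

definition rapid :: "('i \<Rightarrow> real) \<Rightarrow> ('i \<Rightarrow> complex) \<Rightarrow> bool" where
  "rapid w c \<longleftrightarrow> (\<forall>k. \<exists>K. \<forall>\<alpha>. cmod (c \<alpha>) * w \<alpha> ^ k \<le> K)"

lemma rapid_summable:
  assumes "\<And>i. w i \<ge> 1" "(\<lambda>i. 1 / w i ^ 2) summable_on UNIV" "rapid w c" "\<And>\<alpha>. \<Phi> \<alpha> \<in> S_funs" "poly_bounded w (\<lambda>\<alpha>. snorm UNIV m (\<Phi> \<alpha>))"
  shows "(\<lambda>\<alpha>. snorm UNIV m (\<lambda>x. c \<alpha> * \<Phi> \<alpha> x)) summable_on UNIV"
  using rapid_coeff_summable[OF assms(1,2,4,5)] assms(3) unfolding rapid_def by metis

lemma rapid_hcoeff: "f \<in> S_funs \<Longrightarrow> rapid weight (\<lambda>\<alpha>. hcoeff \<alpha> f)" unfolding rapid_def using hcoeff_decay by metis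

lemma functional_lborel:
  fixes f g :: "'a::euclidean_space \<Rightarrow> complex"
  assumes "f \<in> borel_measurable borel" "g \<in> S_funs"
  shows "functional UNIV f g = (\<integral>x. f x * g x \<partial>lborel)"
proof -
  have "(\<lambda>x. f x * g x) \<in> borel_measurable lborel" using assms(1) schwartz_borel[OF assms(2)] by measurable
  then show ?thesis using assms(2) by (simp add: functional_def lebesgue_on_UNIV_eq integral_completion)
qed

lemma functional_schwartz_dual:
  fixes f :: "'a::euclidean_space \<Rightarrow> complex"
  assumes f: "f \<in> S_funs"
  shows "functional UNIV f \<in> dual_vectors S_space"
proof (rule functional_dual[where k = 0])
  show "f \<in> borel_measurable (lebesgue_on UNIV)" by (rule schwartz_measurable[OF open_UNIV f])
  show "integrable (lebesgue_on UNIV) (\<lambda>x. cmod (f x) * (1 / (1 + norm x) ^ 0))"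
    using integrable_norm[OF schwartz_integrable[OF f]] by (simp add: lebesgue_on_UNIV_eq integrable_completion)
qed auto

lemma functional_hermite: "f \<in> S_funs \<Longrightarrow> functional UNIV (hermite_fun \<alpha>) f = hcoeff \<alpha> f"
  using functional_lborel[OF schwartz_borel[OF hermite_fun_schwartz]] by (simp add: hcoeff_def mult.commute)

text \<open>Rapid decay against polynomial growth makes the series summable in every norm. Its
  coefficients are recovered by applying the third claim to integration against a Hermite function
  and using orthonormality.\<close>

lemma hermite_series:
  fixes c :: "'n::finite mindex \<Rightarrow> complex"
  assumes c: "rapid weight c"
  shows "(\<lambda>x. \<Sum>\<^sub>\<infinity>\<alpha>. c \<alpha> * hermite_fun \<alpha> x) \<in> S_funs"
    "hcoeff \<beta> (\<lambda>x. \<Sum>\<^sub>\<infinity>\<alpha>. c \<alpha> * hermite_fun \<alpha> x) = c \<beta>"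
    "T \<in> dual_vectors S_space \<Longrightarrow> ((\<lambda>\<alpha>. c \<alpha> * T (hermite_fun \<alpha>)) has_sum T (\<lambda>x. \<Sum>\<^sub>\<infinity>\<alpha>. c \<alpha> * hermite_fun \<alpha> x)) UNIV"
proof -
  have F: "(\<lambda>x. c \<alpha> * hermite_fun \<alpha> x) \<in> S_funs" for \<alpha> by (intro schwartz_scale hermite_fun_schwartz open_UNIV)
  have S: "(\<lambda>\<alpha>. snorm UNIV m (\<lambda>x. c \<alpha> * hermite_fun \<alpha> x)) summable_on UNIV" for m
    by (rule rapid_summable[OF weight_ge_1 summable_weight c hermite_fun_schwartz poly_bounded_snorm_hermite])
  show 1: "(\<lambda>x. \<Sum>\<^sub>\<infinity>\<alpha>. c \<alpha> * hermite_fun \<alpha> x) \<in> S_funs" by (rule schwartz_infsum(1)[OF infinite_multi_indices F S])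
  show 3: "((\<lambda>\<alpha>. c \<alpha> * T (hermite_fun \<alpha>)) has_sum T (\<lambda>x. \<Sum>\<^sub>\<infinity>\<alpha>. c \<alpha> * hermite_fun \<alpha> x)) UNIV"
    if "T \<in> dual_vectors S_space" for T
    using dual_has_sum[OF infinite_multi_indices F S that] dual_vectorsD(2)[OF that] by (simp add: hermite_fun_schwartz)
  have "((\<lambda>\<alpha>. c \<alpha> * (if \<alpha> = \<beta> then 1 else 0)) has_sum hcoeff \<beta> (\<lambda>x. \<Sum>\<^sub>\<infinity>\<alpha>. c \<alpha> * hermite_fun \<alpha> x)) UNIV"
    using 3[OF functional_schwartz_dual[OF hermite_fun_schwartz[of \<beta>]]]
    by (simp add: functional_hermite 1 hermite_fun_schwartz) (simp add: hcoeff_def hermite_fun_orthonormal)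
  moreover have "((\<lambda>\<alpha>. c \<alpha> * (if \<alpha> = \<beta> then 1 else 0)) has_sum c \<beta>) UNIV" by (rule has_sum_finite_neutralI[of "{\<beta>}"]) auto
  ultimately show "hcoeff \<beta> (\<lambda>x. \<Sum>\<^sub>\<infinity>\<alpha>. c \<alpha> * hermite_fun \<alpha> x) = c \<beta>" using has_sum_unique by blast
qed

text \<open>The series and \<open>f\<close> have the same coefficients, so
  \<open>hermite_complete\<close> applies to their difference.\<close>

lemma hermite_expansion:
  fixes f :: "real^'n \<Rightarrow> complex"
  assumes f: "f \<in> S_funs"
  shows "(\<lambda>x. \<Sum>\<^sub>\<infinity>\<alpha>. hcoeff \<alpha> f * hermite_fun \<alpha> x) = f"
proof -
  let ?F = "\<lambda>x. \<Sum>\<^sub>\<infinity>\<alpha>. hcoeff \<alpha> f * hermite_fun \<alpha> x"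
  note H = hermite_series[OF rapid_hcoeff[OF f]]
  have "?F - f = (\<lambda>x. 0)"
    by (rule hermite_complete[OF schwartz_minus(1)[OF open_UNIV H(1) f]]) (simp add: hcoeff_minus[OF H(1) f] H(2))
  then show ?thesis by (auto simp: fun_eq_iff)
qed

section \<open>Laguerre functions\<close>

fun laguerre :: "nat \<Rightarrow> real \<Rightarrow> real" where
  "laguerre 0 x = 1"
| "laguerre (Suc 0) x = 1 - x"
| "laguerre (Suc (Suc n)) x = ((2 * real (Suc n) + 1 - x) * laguerre (Suc n) x - real (Suc n) * laguerre n x) / real (Suc (Suc n))"

lemma laguerre_rec: "real (Suc n) * laguerre (Suc n) x = (2 * real n + 1 - x) * laguerre n x - real n * laguerre (n - 1) x"
  by (cases n) auto

text \<open>Both identities are proved together: the differentiated recurrence contains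
  \<open>x\<close> times a derivative, and the second identity at the previous index removes it.
  Writing the derivative as a sum of lower polynomials keeps the coefficients free of
  \<open>x\<close>, as a ladder requires.\<close>

lemma laguerre_deriv_aux:
  "(laguerre n has_real_derivative - (\<Sum>k<n. laguerre k x)) (at x) \<and>
   x * (- (\<Sum>k<n. laguerre k x)) = real n * (laguerre n x - laguerre (n - 1) x)"
proof (induction n rule: less_induct)
  case (less n)
  consider "n = 0" | "n = 1" | m where "n = Suc (Suc m)" by (metis One_nat_def not0_implies_Suc)
  then show ?case
  proof cases
    case 1
    have "laguerre 0 = (\<lambda>x. 1)" by (auto simp: fun_eq_iff)
    then show ?thesis using 1 by simp
  next
    case 2
    have "laguerre (Suc 0) = (\<lambda>x. 1 - x)" by (auto simp: fun_eq_iff)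
    moreover have "((\<lambda>x. 1 - x) has_real_derivative - 1) (at x)" by (auto intro!: derivative_eq_intros)
    ultimately show ?thesis using 2 by simp
  next
    case 3
    define S where "S j = (\<Sum>k<j. laguerre k x)" for j
    have d: "(laguerre (Suc m) has_real_derivative - S (Suc m)) (at x)" "(laguerre m has_real_derivative - S m) (at x)"
      and e: "x * (- S (Suc m)) = real (Suc m) * (laguerre (Suc m) x - laguerre m x)"
      using less[of "Suc m"] less[of m] 3 by (auto simp: S_def)
    have S1: "S (Suc m) = S m + laguerre m x" and S2: "S (Suc (Suc m)) = S (Suc m) + laguerre (Suc m) x" by (auto simp: S_def)
    let ?c = "real (Suc (Suc m))"
    let ?D = "(- laguerre (Suc m) x + (2 * real (Suc m) + 1 - x) * (- S (Suc m))) - real (Suc m) * (- S m)"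
    have "((\<lambda>x. ((2 * real (Suc m) + 1 - x) * laguerre (Suc m) x - real (Suc m) * laguerre m x) / ?c) has_real_derivative ?D / ?c) (at x)"
      by (intro DERIV_cdivide) (auto intro!: derivative_eq_intros d simp: algebra_simps)
    moreover have "laguerre (Suc (Suc m)) = (\<lambda>x. ((2 * real (Suc m) + 1 - x) * laguerre (Suc m) x - real (Suc m) * laguerre m x) / ?c)"
      by (auto simp: fun_eq_iff)
    moreover have "?D = ?c * (- S (Suc (Suc m)))"
    proof -
      have "?D = - laguerre (Suc m) x - (2 * real (Suc m) + 1) * S (Suc m) - (x * (- S (Suc m))) + real (Suc m) * S m"
        by (simp add: algebra_simps)
      also have "... = - laguerre (Suc m) x - (2 * real (Suc m) + 1) * S (Suc m) - real (Suc m) * (laguerre (Suc m) x - laguerre m x) + real (Suc m) * (S (Suc m) - laguerre m x)"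
        unfolding e using S1 by simp
      also have "... = ?c * (- (S (Suc m) + laguerre (Suc m) x))" by (simp add: algebra_simps)
      finally show ?thesis unfolding S2 .
    qed
    ultimately have "(laguerre (Suc (Suc m)) has_real_derivative - S (Suc (Suc m))) (at x)" by simp
    moreover have "x * (- S (Suc (Suc m))) = ?c * (laguerre (Suc (Suc m)) x - laguerre (Suc m) x)"
    proof -
      have "x * (- S (Suc (Suc m))) = real (Suc m) * (laguerre (Suc m) x - laguerre m x) - x * laguerre (Suc m) x"
        unfolding S2 e[symmetric] by (simp add: algebra_simps)
      also have "... = ((2 * real (Suc m) + 1 - x) * laguerre (Suc m) x - real (Suc m) * laguerre m x) - ?c * laguerre (Suc m) x"
        by (simp add: algebra_simps)
      also have "(2 * real (Suc m) + 1 - x) * laguerre (Suc m) x - real (Suc m) * laguerre m x = ?c * laguerre (Suc (Suc m)) x"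
        using laguerre_rec[of "Suc m" x] by simp
      finally show ?thesis by (simp only: right_diff_distrib)
    qed
    ultimately show ?thesis using 3 by (simp add: S_def del: laguerre.simps)
  qed
qed

definition laguerre_fun1 :: "nat \<Rightarrow> real \<Rightarrow> real" where
  "laguerre_fun1 n x = laguerre n x * exp (- x / 2)"

lemma laguerre_fun1_deriv:
  "(laguerre_fun1 n has_real_derivative - (1/2) * laguerre_fun1 n x - (\<Sum>k<n. laguerre_fun1 k x)) (at x)"
proof -
  have d: "(laguerre n has_real_derivative - (\<Sum>k<n. laguerre k x)) (at x)" using laguerre_deriv_aux by blast
  have "((\<lambda>x. laguerre n x * exp (- x / 2)) has_real_derivative (- (\<Sum>k<n. laguerre k x)) * exp (- x / 2) + (exp (- x / 2) * (- 1 / 2)) * laguerre n x) (at x)"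
    by (rule DERIV_mult[OF d]) (auto intro!: derivative_eq_intros)
  then show ?thesis unfolding laguerre_fun1_def[abs_def] by (rule DERIV_cong) (simp add: sum_distrib_right)
qed

lemma laguerre_fun1_mult:
  "x * laguerre_fun1 n x = (2 * real n + 1) * laguerre_fun1 n x - real (Suc n) * laguerre_fun1 (Suc n) x - real n * laguerre_fun1 (n - 1) x"
proof -
  have "x * laguerre n x = (2 * real n + 1) * laguerre n x - real (Suc n) * laguerre (Suc n) x - real n * laguerre (n - 1) x"
    unfolding laguerre_rec by (simp add: algebra_simps)
  then have "x * laguerre n x * exp (- x / 2) = ((2 * real n + 1) * laguerre n x - real (Suc n) * laguerre (Suc n) x - real n * laguerre (n - 1) x) * exp (- x / 2)"
    by (simp only:)
  then show ?thesis unfolding laguerre_fun1_def by (simp only: left_diff_distrib mult.assoc)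
qed

lemma laguerre_fun1_continuous: "continuous_on UNIV (laguerre_fun1 n)"
  using laguerre_fun1_deriv by (meson DERIV_isCont continuous_at_imp_continuous_on)

text \<open>Defined on the whole space, so that continuity up to the boundary of the orthant is
  immediate. Its restriction \<open>laguerre_fun\<close> is 0 outside the orthant, as membership in
  \<open>schwartz orthant\<close> demands.\<close>

definition laguerre_ext :: "'n::finite mindex \<Rightarrow> real^'n \<Rightarrow> complex" where
  "laguerre_ext \<alpha> x = of_real (\<Prod>i\<in>UNIV. laguerre_fun1 (\<alpha> i) (x $ i))"

definition laguerre_fun :: "'n::finite mindex \<Rightarrow> real^'n \<Rightarrow> complex" where
  "laguerre_fun \<alpha> x = (if x \<in> orthant then laguerre_ext \<alpha> x else 0)"

lemma laguerre_ext_upd: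
  "laguerre_ext (\<alpha>(i := m)) x = of_real (laguerre_fun1 m (x $ i) * (\<Prod>k\<in>UNIV - {i}. laguerre_fun1 (\<alpha> k) (x $ k)))"
  unfolding laguerre_ext_def by (subst prod_upd[of "\<lambda>k n. laguerre_fun1 n (x $ k)" \<alpha> i m]) simp

lemma laguerre_ext_split:
  "laguerre_ext \<alpha> x = of_real (laguerre_fun1 (\<alpha> i) (x $ i) * (\<Prod>k\<in>UNIV - {i}. laguerre_fun1 (\<alpha> k) (x $ k)))"
  using laguerre_ext_upd[of \<alpha> i "\<alpha> i" x] by simp

definition laguerre_mult_list :: "real^'n \<Rightarrow> 'n mindex \<Rightarrow> (complex \<times> 'n mindex) list" where
  "laguerre_mult_list b \<alpha> = (let i = axis_index b in
     [(of_real (2 * real (\<alpha> i) + 1), \<alpha>), (of_real (- real (Suc (\<alpha> i))), \<alpha>(i := Suc (\<alpha> i))),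
      (of_real (- real (\<alpha> i)), \<alpha>(i := \<alpha> i - 1))])"

text \<open>The combination has \<open>\<alpha> i + 1\<close> entries, a length that grows with the
  index but is still at most \<open>weight \<alpha>\<close>.\<close>

definition laguerre_deriv_list :: "real^'n \<Rightarrow> 'n mindex \<Rightarrow> (complex \<times> 'n mindex) list" where
  "laguerre_deriv_list b \<alpha> = (let i = axis_index b in
     (of_real (- (1/2)), \<alpha>) # map (\<lambda>k. (- 1, \<alpha>(i := k))) [0..<\<alpha> i])"

lemma laguerre_ext_mult:
  assumes b: "b \<in> Basis"
  shows "of_real (x \<bullet> b) * laguerre_ext \<alpha> x = lc_eval laguerre_ext (laguerre_mult_list b \<alpha>) x"
proof -
  obtain i where b: "b = axis i 1" using b by (auto simp: Basis_vec_eq)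
  let ?R = "\<Prod>k\<in>UNIV - {i}. laguerre_fun1 (\<alpha> k) (x $ k)"
  let ?n = "\<alpha> i" and ?x = "x $ i"
  have "?x * (laguerre_fun1 ?n ?x * ?R) = (?x * laguerre_fun1 ?n ?x) * ?R" by simp
  also have "... = (2 * real ?n + 1) * (laguerre_fun1 ?n ?x * ?R) + - real (Suc ?n) * (laguerre_fun1 (Suc ?n) ?x * ?R) + - real ?n * (laguerre_fun1 (?n - 1) ?x * ?R)"
    unfolding laguerre_fun1_mult by (simp only: left_diff_distrib distrib_right mult.assoc mult_minus_left diff_conv_add_uminus)
  finally have "of_real ?x * laguerre_ext \<alpha> x = complex_of_real \<dots>"
    unfolding laguerre_ext_split[of \<alpha> x i] of_real_mult[symmetric] by (simp only:)
  then show ?thesis unfolding b laguerre_mult_list_def Let_def axis_index_axis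
    by (simp only: lc_simps laguerre_ext_upd laguerre_ext_split[of \<alpha> x i] inner_axis fst_conv snd_conv of_real_add of_real_mult inner_real_def mult_1_right add_0_right add.assoc)
qed

lemma lc_eval_map_upt: "lc_eval \<Phi> (map (\<lambda>k. (c, f k)) [0..<n]) x = (\<Sum>k<n. c * \<Phi> (f k) x)"
  by (simp add: lc_eval_def comp_def interv_sum_list_conv_sum_set_nat atLeast0LessThan)

lemma laguerre_ext_has_dir_deriv:
  assumes b: "b \<in> Basis"
  shows "has_dir_deriv b (laguerre_ext \<alpha>) (lc_eval laguerre_ext (laguerre_deriv_list b \<alpha>) x) x"
proof -
  obtain i where b: "b = axis i 1" using b by (auto simp: Basis_vec_eq)
  let ?R = "\<Prod>k\<in>UNIV - {i}. laguerre_fun1 (\<alpha> k) (x $ k)"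
  let ?n = "\<alpha> i" and ?x = "x $ i"
  let ?d = "- (1/2) * laguerre_fun1 ?n ?x - (\<Sum>k<?n. laguerre_fun1 k ?x)"
  have line: "laguerre_ext \<alpha> (x + t *\<^sub>R b) = of_real (laguerre_fun1 (\<alpha> i) (x $ i + t) * ?R)" for t
    unfolding laguerre_ext_split[of \<alpha> _ i] b by (simp add: axis_def)
  have "((\<lambda>t. laguerre_fun1 ?n (?x + t)) has_real_derivative ?d) (at 0)"
    using DERIV_shift[of "laguerre_fun1 ?n" ?d 0 ?x] laguerre_fun1_deriv[of ?n ?x] by (simp add: add.commute)
  then have "((\<lambda>t. laguerre_fun1 ?n (?x + t) * ?R) has_real_derivative ?d * ?R) (at 0)" by (rule DERIV_cmult_right)
  then have "has_dir_deriv b (laguerre_ext \<alpha>) (of_real (?d * ?R)) x" unfolding line by (rule has_vector_derivative_of_real)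
  also have "of_real (?d * ?R) = lc_eval laguerre_ext (laguerre_deriv_list b \<alpha>) x"
  proof -
    have "?d * ?R = - (1/2) * (laguerre_fun1 ?n ?x * ?R) + (\<Sum>k<?n. - 1 * (laguerre_fun1 k ?x * ?R))"
      by (simp add: left_diff_distrib sum_distrib_right sum_negf)
    then show ?thesis unfolding b laguerre_deriv_list_def Let_def axis_index_axis
      by (simp only: lc_simps lc_eval_map_upt laguerre_ext_upd laguerre_ext_split[of \<alpha> x i] fst_conv snd_conv of_real_add of_real_mult of_real_sum of_real_minus of_real_1)
  qed
  finally show ?thesis .
qed

lemma laguerre_lists_cost:
  "poly_bounded weight (\<lambda>\<alpha>. lc_cost weight M (laguerre_mult_list b \<alpha>))"
  "poly_bounded weight (\<lambda>\<alpha>. lc_cost weight M (laguerre_deriv_list b \<alpha>))"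
proof -
  have h: "poly_bounded weight (\<lambda>\<alpha>. 3 * weight \<alpha> ^ 2)" by (intro poly_bounded_cmult poly_bounded_power weight_ge_1) auto
  have w2: "weight \<alpha> \<le> weight \<alpha> ^ 2" for \<alpha> :: "'a mindex" using weight_ge_1[of \<alpha>] by (rule self_le_power) simp
  have coeff: "2 * real (\<alpha> i) + 1 \<le> 3 * weight \<alpha> ^ 2" "real (Suc (\<alpha> i)) \<le> 3 * weight \<alpha> ^ 2" "real (\<alpha> i) \<le> 3 * weight \<alpha> ^ 2"
    "1 \<le> 3 * weight \<alpha> ^ 2" "weight \<alpha> \<le> 3 * weight \<alpha> ^ 2" for \<alpha> :: "'a mindex" and i
    using weight_ge[of \<alpha> i] w2[of \<alpha>] weight_ge_1[of \<alpha>] by linarith+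
  have upd: "weight (\<alpha>(i := m)) \<le> 3 * weight \<alpha> ^ 2" if "m \<le> Suc (\<alpha> i)" for \<alpha> :: "'a mindex" and i m
    using weight_upd_le[of m \<alpha> i, OF that] zero_le_power2[of "weight \<alpha>"] by linarith
  show "poly_bounded weight (\<lambda>\<alpha>. lc_cost weight M (laguerre_mult_list b \<alpha>))"
  proof (rule lc_cost_poly_boundedI[OF weight_ge_1 _ h])
    show "poly_bounded weight (\<lambda>\<alpha>. real (length (laguerre_mult_list b \<alpha>)))"
      using poly_bounded_const[where w = weight and c = 3, OF weight_ge_1] by (simp add: laguerre_mult_list_def Let_def)
    show "cmod a \<le> 3 * weight \<alpha> ^ 2 \<and> weight \<beta> \<le> 3 * weight \<alpha> ^ 2" if "(a, \<beta>) \<in> set (laguerre_mult_list b \<alpha>)" for a \<alpha> \<beta>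
    proof -
      let ?i = "axis_index b"
      from that consider "a = of_real (2 * real (\<alpha> ?i) + 1)" "\<beta> = \<alpha>" | "a = of_real (- real (Suc (\<alpha> ?i)))" "\<beta> = \<alpha>(?i := Suc (\<alpha> ?i))"
        | "a = of_real (- real (\<alpha> ?i))" "\<beta> = \<alpha>(?i := \<alpha> ?i - 1)" unfolding laguerre_mult_list_def Let_def by force
      then show ?thesis
      proof cases
        case 1
        then show ?thesis using coeff(1)[of \<alpha> ?i] coeff(5)[of \<alpha>] by (simp only: norm_of_real) simp
      next
        case 2
        then show ?thesis using coeff(2)[of \<alpha> ?i] upd[of "Suc (\<alpha> ?i)" \<alpha> ?i] by (simp only: norm_of_real) simp
      next
        case 3
        then show ?thesis using coeff(3)[of \<alpha> ?i] upd[of "\<alpha> ?i - 1" \<alpha> ?i] by (simp only: norm_of_real) simp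
      qed
    qed
  qed auto
  show "poly_bounded weight (\<lambda>\<alpha>. lc_cost weight M (laguerre_deriv_list b \<alpha>))"
  proof (rule lc_cost_poly_boundedI[OF weight_ge_1 _ h])
    show "poly_bounded weight (\<lambda>\<alpha>. real (length (laguerre_deriv_list b \<alpha>)))"
      by (rule poly_bounded_mono[OF poly_bounded_power[of weight 1]])
        (use weight_ge[of _ "axis_index b"] in \<open>simp add: laguerre_deriv_list_def Let_def add.commute\<close>)
    show "cmod a \<le> 3 * weight \<alpha> ^ 2 \<and> weight \<beta> \<le> 3 * weight \<alpha> ^ 2" if "(a, \<beta>) \<in> set (laguerre_deriv_list b \<alpha>)" for a \<alpha> \<beta>
    proof -
      let ?i = "axis_index b"
      from that consider "a = of_real (- (1/2))" "\<beta> = \<alpha>" | k where "a = - 1" "\<beta> = \<alpha>(?i := k)" "k < \<alpha> ?i"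
        unfolding laguerre_deriv_list_def Let_def by force
      then show ?thesis
      proof cases
        case 1
        then show ?thesis using coeff(4)[of \<alpha>] coeff(5)[of \<alpha>] by (simp only: norm_of_real) simp
      next
        case 2
        then show ?thesis using coeff(4)[of \<alpha>] upd[of k \<alpha> ?i] by simp
      qed
    qed
  qed auto
qed

lemma laguerre_ext_continuous: "continuous_on UNIV (laguerre_ext \<alpha>)" unfolding laguerre_ext_def[abs_def]
  by (intro continuous_intros continuous_on_compose2[OF laguerre_fun1_continuous]) auto

lemma open_orthant: "open (orthant :: (real^'n) set)"
proof -
  have "orthant = (\<Inter>i. {x::real^'n. 0 < x $ i})" by (auto simp: orthant_def)
  moreover have "open (\<Inter>i. {x::real^'n. 0 < x $ i})"
    by (intro open_INT open_Collect_less continuous_intros ballI finite_class.finite_UNIV)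
  ultimately show ?thesis by (simp only:)
qed

lemma orthant_nonempty: "(orthant :: (real^'n) set) \<noteq> {}"
proof -
  have "(\<chi> i. 1) \<in> (orthant :: (real^'n) set)" by (simp add: orthant_def)
  then show ?thesis by blast
qed

text \<open>The sup bound enters as a hypothesis, to be discharged by
  \<open>laguerre_fun1_bound\<close> once Laguerre functions are recognised as diagonal Wigner
  functions.\<close>

lemma laguerre_fun_family:
  assumes sup: "\<And>n x. x \<ge> 0 \<Longrightarrow> \<bar>laguerre_fun1 n x\<bar> \<le> 1"
  shows "laguerre_fun (\<alpha> :: 'n::finite mindex) \<in> schwartz_functions orthant"
    "poly_bounded weight (\<lambda>\<alpha> :: 'n mindex. snorm orthant m (laguerre_fun \<alpha>))"
proof -
  have le: "cmod (laguerre_ext \<alpha> x) \<le> 1 * weight \<alpha> ^ 0" if "x \<in> orthant" for \<alpha> :: "'n mindex" and x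
  proof -
    have "cmod (laguerre_ext \<alpha> x) = (\<Prod>i\<in>UNIV. \<bar>laguerre_fun1 (\<alpha> i) (x $ i)\<bar>)"
      unfolding laguerre_ext_def norm_of_real by (rule abs_prod)
    also have "... \<le> (\<Prod>i\<in>(UNIV :: 'n set). 1)" using that by (intro prod_mono conjI sup) (auto simp: orthant_def less_imp_le)
    finally show ?thesis by simp
  qed
  have eq: "laguerre_fun \<alpha> = (\<lambda>x. if x \<in> orthant then laguerre_ext \<alpha> x else 0)" for \<alpha> :: "'n mindex" by (auto simp: laguerre_fun_def)
  show "laguerre_fun \<alpha> \<in> schwartz_functions orthant"
    "poly_bounded weight (\<lambda>\<alpha> :: 'n mindex. snorm orthant m (laguerre_fun \<alpha>))" unfolding eq
    by (rule schwartz_ladder_family[OF open_orthant orthant_nonempty weight_ge_1 laguerre_ext_continuous le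
      laguerre_ext_has_dir_deriv laguerre_ext_mult laguerre_lists_cost(2,1)]; assumption)+
qed

section \<open>Wigner transforms of Hermite functions\<close>

text \<open>The Wigner transform of two Hermite functions in one phase plane, without its
  normalising constant; conjugation has no effect on real functions.\<close>

definition wig :: "nat \<Rightarrow> nat \<Rightarrow> real \<Rightarrow> real \<Rightarrow> complex" where
  "wig m n x \<xi> = (\<integral>p. exp (- \<i> * of_real (\<xi> * p)) * of_real (hermite m (x + p / 2) * hermite n (x - p / 2)) \<partial>lborel)"

lemma hermite_shift_decay:
  "\<exists>K\<ge>0. \<forall>p. \<bar>hermite m (x + p / 2) * hermite n (x - p / 2)\<bar> \<le> K * (1 / (1 + \<bar>p\<bar>) ^ 2)"
proof -
  obtain A where A: "A \<ge> 0" "\<And>y. \<bar>hermite m y\<bar> \<le> A * (1 / (1 + \<bar>y\<bar>) ^ 2)" using hermite_decay by blast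
  obtain B where B: "B \<ge> 0" "\<And>y. \<bar>hermite n y\<bar> \<le> B" using hermite_bounded by blast
  let ?c = "(2 * (1 + \<bar>x\<bar>)) ^ 2"
  have "\<bar>hermite m (x + p / 2) * hermite n (x - p / 2)\<bar> \<le> (A * ?c * B) * (1 / (1 + \<bar>p\<bar>) ^ 2)" for p
  proof -
    \<comment> \<open>By the triangle inequality \<open>\<bar>p\<bar> \<le> 2 * \<bar>x\<bar> + 2 *
      \<bar>x + p / 2\<bar>\<close>, so decay in the shifted argument is decay in \<open>p\<close>,
      with a constant that depends on \<open>x\<close>.\<close>
    have "1 + \<bar>p\<bar> \<le> (2 * (1 + \<bar>x\<bar>)) * (1 + \<bar>x + p / 2\<bar>)"
    proof -
      have "\<bar>p\<bar> / 2 \<le> \<bar>x\<bar> + \<bar>x + p / 2\<bar>" by linarith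
      moreover have "0 \<le> \<bar>x\<bar> * \<bar>x + p / 2\<bar>" by simp
      ultimately show ?thesis by (simp only: distrib_left distrib_right mult_1_left mult_1_right mult.assoc)
    qed
    then have "(1 + \<bar>p\<bar>) ^ 2 \<le> ?c * (1 + \<bar>x + p / 2\<bar>) ^ 2" unfolding power_mult_distrib[symmetric] by (rule power_mono) auto
    then have "1 / (1 + \<bar>x + p / 2\<bar>) ^ 2 \<le> ?c * (1 / (1 + \<bar>p\<bar>) ^ 2)" by (simp add: divide_simps add_nonneg_eq_0_iff)
    then have "A * (1 / (1 + \<bar>x + p / 2\<bar>) ^ 2) \<le> A * (?c * (1 / (1 + \<bar>p\<bar>) ^ 2))" using A(1) by (rule mult_left_mono)
    then have "\<bar>hermite m (x + p / 2)\<bar> \<le> A * (?c * (1 / (1 + \<bar>p\<bar>) ^ 2))" using A(2)[of "x + p / 2"] by linarith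
    then have "\<bar>hermite m (x + p / 2)\<bar> * \<bar>hermite n (x - p / 2)\<bar> \<le> (A * (?c * (1 / (1 + \<bar>p\<bar>) ^ 2))) * B"
      using A(1) by (intro mult_mono B) auto
    then show ?thesis by (simp only: abs_mult mult_ac)
  qed
  moreover have "A * ?c * B \<ge> 0" using A B by simp
  ultimately show ?thesis by blast
qed

lemma wig_integrable:
  "integrable lborel (\<lambda>p. exp (- \<i> * of_real (\<xi> * p)) * complex_of_real (hermite m (x + p / 2) * hermite n (x - p / 2)))"
proof -
  obtain K where K: "\<And>p. \<bar>hermite m (x + p / 2) * hermite n (x - p / 2)\<bar> \<le> K * (1 / (1 + \<bar>p\<bar>) ^ 2)" using hermite_shift_decay by blast
  show ?thesis
  proof (rule integrable_of_decay[where K = K])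
    show "(\<lambda>p. exp (- \<i> * of_real (\<xi> * p)) * complex_of_real (hermite m (x + p / 2) * hermite n (x - p / 2))) \<in> borel_measurable borel"
      by measurable
    show "cmod (exp (- \<i> * of_real (\<xi> * p)) * complex_of_real (hermite m (x + p / 2) * hermite n (x - p / 2))) \<le> K * decay p" for p
      using K[of p] by (simp only: norm_mult norm_of_real norm_exp_eq_Re) simp
  qed
qed

abbreviation hsqrt :: "nat \<Rightarrow> real" where
  "hsqrt n \<equiv> sqrt (real n / 2)"

abbreviation hs :: "nat \<Rightarrow> complex" where "hs n \<equiv> complex_of_real (hsqrt n)"

lemma hs_self: "hs n * (hs n * c) = of_nat n / 2 * c" unfolding mult.assoc[symmetric] of_real_mult[symmetric] by simp

text \<open>\<open>2 * x\<close> is the sum of the two arguments \<open>x + p / 2\<close> and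
  \<open>x - p / 2\<close>, and the position ladder applies to each factor.\<close>

lemma wig_mult_x:
  "2 * of_real x * wig m n x \<xi> = hsqrt (Suc m) * wig (Suc m) n x \<xi> + hsqrt m * wig (m - 1) n x \<xi> +
     (hsqrt (Suc n) * wig m (Suc n) x \<xi> + hsqrt n * wig m (n - 1) x \<xi>)"
proof -
  let ?E = "\<lambda>p. exp (- \<i> * of_real (\<xi> * p))"
  let ?H = "\<lambda>a b p. complex_of_real (hermite a (x + p / 2) * hermite b (x - p / 2))"
  have pt: "2 * of_real x * (?E p * ?H m n p) = hs (Suc m) * (?E p * ?H (Suc m) n p) + hs m * (?E p * ?H (m - 1) n p) +
     (hs (Suc n) * (?E p * ?H m (Suc n) p) + hs n * (?E p * ?H m (n - 1) p))" for p
  proof -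
    let ?u = "x + p / 2" and ?v = "x - p / 2"
    have "2 * x * (hermite m ?u * hermite n ?v) = (?u * hermite m ?u) * hermite n ?v + hermite m ?u * (?v * hermite n ?v)"
      by (simp add: algebra_simps del: hermite.simps)
    also have "... = hsqrt (Suc m) * (hermite (Suc m) ?u * hermite n ?v) + hsqrt m * (hermite (m - 1) ?u * hermite n ?v) +
       (hsqrt (Suc n) * (hermite m ?u * hermite (Suc n) ?v) + hsqrt n * (hermite m ?u * hermite (n - 1) ?v))"
      unfolding hermite_mult_ladder by (simp only: distrib_left distrib_right mult_ac)
    finally have "complex_of_real (2 * x * (hermite m ?u * hermite n ?v)) = of_real \<dots>" by (simp only:)
    then have "?E p * (2 * of_real x * ?H m n p) = ?E p * (hs (Suc m) * ?H (Suc m) n p + hs m * ?H (m - 1) n p +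
       (hs (Suc n) * ?H m (Suc n) p + hs n * ?H m (n - 1) p))" by (simp only: of_real_mult of_real_add of_real_numeral)
    then show ?thesis by (simp only: distrib_left mult_ac)
  qed
  have "2 * of_real x * wig m n x \<xi> = (\<integral>p. 2 * of_real x * (?E p * ?H m n p) \<partial>lborel)"
    unfolding wig_def by (rule integral_mult_right_zero[symmetric])
  also have "... = hs (Suc m) * wig (Suc m) n x \<xi> + hs m * wig (m - 1) n x \<xi> +
     (hs (Suc n) * wig m (Suc n) x \<xi> + hs n * wig m (n - 1) x \<xi>)" unfolding pt wig_def
    by (simp only: Bochner_Integration.integral_add Bochner_Integration.integrable_add integral_mult_right_zero integrable_mult_right wig_integrable)
  finally show ?thesis .
qed

lemma hermite_deriv':
  "(hermite n has_real_derivative hsqrt n * hermite (n - 1) x - hsqrt (Suc n) * hermite (Suc n) x) (at x)"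
  using hermite_deriv[of n x] unfolding hermite_deriv_ladder .

text \<open>Multiplication by \<open>\<xi>\<close> is a derivative of the exponential in
  \<open>p\<close>; integration by parts moves it to the Hermite factors, where the derivative
  ladder applies.\<close>

lemma wig_mult_xi:
  "2 * \<i> * of_real \<xi> * wig m n x \<xi> = hsqrt m * wig (m - 1) n x \<xi> - hsqrt (Suc m) * wig (Suc m) n x \<xi> -
     (hsqrt n * wig m (n - 1) x \<xi> - hsqrt (Suc n) * wig m (Suc n) x \<xi>)"
proof -
  let ?E = "\<lambda>p. exp (- \<i> * of_real (\<xi> * p))"
  let ?H = "\<lambda>a b p. complex_of_real (hermite a (x + p / 2) * hermite b (x - p / 2))"
  define F where "F a b p = ?E p * ?H a b p" for a b p
  \<comment> \<open>The derivative of \<open>F m n\<close> in \<open>p\<close>: the exponential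
    contributes the first term, and the two Hermite factors contribute ladder terms with the inner
    derivatives \<open>1/2\<close> and \<open>- 1/2\<close>.\<close>
  let ?F' = "\<lambda>p. - \<i> * of_real \<xi> * F m n p + (1/2) * (hs m * F (m - 1) n p - hs (Suc m) * F (Suc m) n p -
     (hs n * F m (n - 1) p - hs (Suc n) * F m (Suc n) p))"
  have int: "integrable lborel (F a b)" for a b unfolding F_def[abs_def] by (rule wig_integrable)
  have wig: "integral\<^sup>L lborel (F a b) = wig a b x \<xi>" for a b unfolding F_def[abs_def] wig_def ..
  have dec: "\<exists>K\<ge>0. \<forall>p. cmod (F a b p) \<le> K * decay p" for a b
    using hermite_shift_decay[of a x b] unfolding F_def norm_mult norm_exp_eq_Re by (simp add: abs_mult norm_mult)
  obtain K where K: "\<And>a b. K a b \<ge> 0" "\<And>a b p. cmod (F a b p) \<le> K a b * decay p" using dec by metis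
  let ?K = "\<bar>\<xi>\<bar> * K m n + (1/2) * (hsqrt m * K (m - 1) n + hsqrt (Suc m) * K (Suc m) n + (hsqrt n * K m (n - 1) + hsqrt (Suc n) * K m (Suc n)))"
  have cont: "continuous_on UNIV (F a b)" for a b unfolding F_def[abs_def]
    by (intro continuous_intros continuous_on_compose2[OF hermite_continuous]) auto
  have "(\<integral>p. ?F' p \<partial>lborel) = 0"
  proof (rule integral_dir_deriv_eq_0[where b = 1 and f = "F m n" and K = "max (K m n) ?K"])
    fix p :: real
    let ?u = "x + p / 2" and ?v = "x - p / 2"
    let ?dm = "hsqrt m * hermite (m - 1) ?u - hsqrt (Suc m) * hermite (Suc m) ?u"
    let ?dn = "hsqrt n * hermite (n - 1) ?v - hsqrt (Suc n) * hermite (Suc n) ?v"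
    have d1: "((\<lambda>t. hermite m (x + (p + t) / 2)) has_real_derivative ?dm * (1/2)) (at 0)"
      by (rule DERIV_chain'[where f = "\<lambda>t. x + (p + t) / 2" and g = "hermite m", rotated])
        (use hermite_deriv'[of m ?u] in \<open>auto intro!: derivative_eq_intros simp del: hermite.simps\<close>)
    have d2: "((\<lambda>t. hermite n (x - (p + t) / 2)) has_real_derivative ?dn * (- 1/2)) (at 0)"
      by (rule DERIV_chain'[where f = "\<lambda>t. x - (p + t) / 2" and g = "hermite n", rotated])
        (use hermite_deriv'[of n ?v] in \<open>auto intro!: derivative_eq_intros simp del: hermite.simps\<close>)
    have "((\<lambda>t. hermite m (x + (p + t) / 2) * hermite n (x - (p + t) / 2)) has_real_derivative
        (?dm * (1/2)) * hermite n (x - (p + 0) / 2) + (?dn * (- 1/2)) * hermite m (x + (p + 0) / 2)) (at 0)"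
      by (rule DERIV_mult[OF d1 d2])
    from has_vector_derivative_of_real[OF this, where 'a = complex]
    have dH: "((\<lambda>t. ?H m n (p + t)) has_vector_derivative
        of_real ((?dm * (1/2)) * hermite n (x - (p + 0) / 2) + (?dn * (- 1/2)) * hermite m (x + (p + 0) / 2))) (at 0)" .
    have dE: "((\<lambda>t. ?E (p + t)) has_vector_derivative (- \<i> * of_real \<xi> * ?E p)) (at 0)"
    proof -
      have "((\<lambda>t. - \<i> * of_real (\<xi> * (p + t))) has_vector_derivative - \<i> * of_real \<xi>) (at 0)" by (auto intro!: derivative_eq_intros)
      moreover have "(exp has_field_derivative exp (- \<i> * of_real (\<xi> * (p + 0)))) (at (- \<i> * of_real (\<xi> * (p + 0))))"
        by (rule DERIV_exp)
      ultimately have "(exp \<circ> (\<lambda>t. - \<i> * of_real (\<xi> * (p + t))) has_vector_derivative - \<i> * of_real \<xi> * exp (- \<i> * of_real (\<xi> * (p + 0)))) (at 0)"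
        by (rule field_vector_diff_chain_at)
      then show ?thesis by (simp add: comp_def)
    qed
    from has_vector_derivative_mult[OF dE dH]
    show "has_dir_deriv 1 (F m n) (?F' p) p" unfolding F_def by (simp add: algebra_simps del: hermite.simps)
  next
    show "cmod (F m n p) \<le> max (K m n) ?K * decay p" for p by (rule order_trans[OF K(2) mult_right_mono]) auto
    show "cmod (?F' p) \<le> max (K m n) ?K * decay p" for p
    proof -
      let ?e = "decay p"
      have "cmod (?F' p) \<le> cmod (- \<i> * of_real \<xi> * F m n p) + cmod ((1/2) * (hs m * F (m - 1) n p - hs (Suc m) * F (Suc m) n p -
          (hs n * F m (n - 1) p - hs (Suc n) * F m (Suc n) p)))" by (rule norm_triangle_ineq)
      also have "... \<le> \<bar>\<xi>\<bar> * cmod (F m n p) + (1/2) * ((hsqrt m * cmod (F (m - 1) n p) + hsqrt (Suc m) * cmod (F (Suc m) n p)) +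
          (hsqrt n * cmod (F m (n - 1) p) + hsqrt (Suc n) * cmod (F m (Suc n) p)))"
      proof -
        have tri: "cmod (hs a * X - hs b * Y) \<le> hsqrt a * cmod X + hsqrt b * cmod Y" for a b X Y
          by (rule order_trans[OF norm_triangle_ineq4]) (simp add: norm_mult)
        have "cmod (hs m * F (m - 1) n p - hs (Suc m) * F (Suc m) n p -
          (hs n * F m (n - 1) p - hs (Suc n) * F m (Suc n) p)) \<le>
          (hsqrt m * cmod (F (m - 1) n p) + hsqrt (Suc m) * cmod (F (Suc m) n p)) +
          (hsqrt n * cmod (F m (n - 1) p) + hsqrt (Suc n) * cmod (F m (Suc n) p))"
          by (rule order_trans[OF norm_triangle_ineq4 add_mono[OF tri tri]])
        then show ?thesis by (simp add: norm_mult)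
      qed
      also have "... \<le> \<bar>\<xi>\<bar> * (K m n * ?e) + (1/2) * ((hsqrt m * (K (m - 1) n * ?e) + hsqrt (Suc m) * (K (Suc m) n * ?e)) +
          (hsqrt n * (K m (n - 1) * ?e) + hsqrt (Suc n) * (K m (Suc n) * ?e)))" by (intro add_mono mult_left_mono K) auto
      also have "... = ?K * ?e" by (simp only: distrib_left distrib_right mult.assoc)
      also have "... \<le> max (K m n) ?K * ?e" by (intro mult_right_mono) auto
      finally show ?thesis .
    qed
  qed (auto intro!: continuous_intros cont)
  also have "(\<integral>p. ?F' p \<partial>lborel) = - \<i> * of_real \<xi> * wig m n x \<xi> + (1/2) * (hs m * wig (m - 1) n x \<xi> - hs (Suc m) * wig (Suc m) n x \<xi> -
     (hs n * wig m (n - 1) x \<xi> - hs (Suc n) * wig m (Suc n) x \<xi>))"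
    by (simp only: Bochner_Integration.integral_add Bochner_Integration.integral_diff Bochner_Integration.integrable_add
        Bochner_Integration.integrable_diff integral_mult_right_zero integrable_mult_right int wig)
  finally have "\<i> * of_real \<xi> * wig m n x \<xi> = (1/2) * (hs m * wig (m - 1) n x \<xi> - hs (Suc m) * wig (Suc m) n x \<xi> -
     (hs n * wig m (n - 1) x \<xi> - hs (Suc n) * wig m (Suc n) x \<xi>))" by (simp add: algebra_simps)
  then show ?thesis by (simp add: mult_ac)
qed

text \<open>In the complex coordinate \<open>x - \<i> * \<xi>\<close> half of the ladder terms
  cancel: multiplication by it raises the first index or lowers the second. In \<open>wig_z\<close>
  the conjugate coordinate exchanges the roles. These two recurrences together with
  \<open>wig_0_0\<close> determine every \<open>wig m n\<close>, and the later proofs are inductions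
  along them.\<close>

lemma wig_zbar: "(of_real x - \<i> * of_real \<xi>) * wig m n x \<xi> = hsqrt (Suc m) * wig (Suc m) n x \<xi> + hsqrt n * wig m (n - 1) x \<xi>"
proof -
  have "2 * ((of_real x - \<i> * of_real \<xi>) * wig m n x \<xi>) = 2 * of_real x * wig m n x \<xi> - 2 * \<i> * of_real \<xi> * wig m n x \<xi>"
    by (simp add: algebra_simps)
  also have "... = 2 * (hsqrt (Suc m) * wig (Suc m) n x \<xi> + hsqrt n * wig m (n - 1) x \<xi>)"
    unfolding wig_mult_x wig_mult_xi by (simp add: algebra_simps)
  finally show ?thesis by (simp only: mult_left_cancel[OF zero_neq_numeral[symmetric]])
qed

lemma wig_z: "(of_real x + \<i> * of_real \<xi>) * wig m n x \<xi> = hsqrt (Suc n) * wig m (Suc n) x \<xi> + hsqrt m * wig (m - 1) n x \<xi>"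
proof -
  have "2 * ((of_real x + \<i> * of_real \<xi>) * wig m n x \<xi>) = 2 * of_real x * wig m n x \<xi> + 2 * \<i> * of_real \<xi> * wig m n x \<xi>"
    by (simp add: algebra_simps)
  also have "... = 2 * (hsqrt (Suc n) * wig m (Suc n) x \<xi> + hsqrt m * wig (m - 1) n x \<xi>)"
    unfolding wig_mult_x wig_mult_xi by (simp add: algebra_simps)
  finally show ?thesis by (simp only: mult_left_cancel[OF zero_neq_numeral[symmetric]])
qed

lemma wig_0_0: "wig 0 0 x \<xi> = of_real (2 * exp (- (x\<^sup>2 + \<xi>\<^sup>2)))"
proof -
  let ?E = "\<lambda>p. exp (- \<i> * of_real (\<xi> * p))"
  have c: "pi powr (- (1/4)) * pi powr (- (1/4)) = 1 / sqrt pi" by (simp add: powr_add[symmetric] powr_minus_divide powr_half_sqrt)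
  \<comment> \<open>Rescaling \<open>p\<close> by \<open>sqrt 2\<close> turns the product of the two
    Gaussians into a multiple of a standard normal density in \<open>p\<close>, whose Fourier
    transform is known.\<close>
  have "wig 0 0 x \<xi> = sqrt 2 *\<^sub>R (\<integral>p. ?E (0 + sqrt 2 * p) * of_real (hermite 0 (x + (0 + sqrt 2 * p) / 2) * hermite 0 (x - (0 + sqrt 2 * p) / 2)) \<partial>lborel)"
    unfolding wig_def
    using lborel_integral_real_affine[of "sqrt 2" "\<lambda>p. ?E p * complex_of_real (hermite 0 (x + p / 2) * hermite 0 (x - p / 2))" 0]
    by (simp del: hermite.simps)
  also have "(\<lambda>p. ?E (0 + sqrt 2 * p) * complex_of_real (hermite 0 (x + (0 + sqrt 2 * p) / 2) * hermite 0 (x - (0 + sqrt 2 * p) / 2))) =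
      (\<lambda>p. of_real (sqrt 2 * exp (- x\<^sup>2)) * (of_real (std_normal_density p) * exp (\<i> * of_real (- (sqrt 2 * \<xi>) * p))))"
  proof
    fix p
    have "hermite 0 (x + (0 + sqrt 2 * p) / 2) * hermite 0 (x - (0 + sqrt 2 * p) / 2) =
      (pi powr (- (1/4)) * pi powr (- (1/4))) * (exp (- (x + sqrt 2 * p / 2)\<^sup>2 / 2) * exp (- (x - sqrt 2 * p / 2)\<^sup>2 / 2))" by simp
    also have "exp (- (x + sqrt 2 * p / 2)\<^sup>2 / 2) * exp (- (x - sqrt 2 * p / 2)\<^sup>2 / 2) = exp (- x\<^sup>2 + - p\<^sup>2 / 2)"
      unfolding mult_exp_exp by (simp add: power2_sum power2_diff power_mult_distrib power_divide field_simps)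
    also have "... = exp (- x\<^sup>2) * exp (- p\<^sup>2 / 2)" by (rule exp_add)
    finally have "hermite 0 (x + (0 + sqrt 2 * p) / 2) * hermite 0 (x - (0 + sqrt 2 * p) / 2) = sqrt 2 * exp (- x\<^sup>2) * std_normal_density p"
      unfolding c std_normal_density_def by (simp add: real_sqrt_mult)
    then show "?E (0 + sqrt 2 * p) * complex_of_real (hermite 0 (x + (0 + sqrt 2 * p) / 2) * hermite 0 (x - (0 + sqrt 2 * p) / 2)) =
      of_real (sqrt 2 * exp (- x\<^sup>2)) * (of_real (std_normal_density p) * exp (\<i> * of_real (- (sqrt 2 * \<xi>) * p)))"
      by (simp add: mult_ac del: hermite.simps)
  qed
  also have "(\<integral>p. of_real (sqrt 2 * exp (- x\<^sup>2)) * (of_real (std_normal_density p) * exp (\<i> * of_real (- (sqrt 2 * \<xi>) * p))) \<partial>lborel) =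
      of_real (sqrt 2 * exp (- x\<^sup>2)) * complex_of_real (exp (- ((- (sqrt 2 * \<xi>))\<^sup>2) / 2))"
    unfolding integral_mult_right_zero fourier_std_normal(2) ..
  also have "exp (- ((- (sqrt 2 * \<xi>))\<^sup>2) / 2) = exp (- \<xi>\<^sup>2)" by (simp add: power_mult_distrib)
  also have "sqrt 2 *\<^sub>R (complex_of_real (sqrt 2 * exp (- x\<^sup>2)) * complex_of_real (exp (- \<xi>\<^sup>2))) = of_real ((sqrt 2 * sqrt 2) * (exp (- x\<^sup>2) * exp (- \<xi>\<^sup>2)))"
    by (simp add: scaleR_conv_of_real del: real_sqrt_mult_self)
  also have "(sqrt 2 * sqrt 2) * (exp (- x\<^sup>2) * exp (- \<xi>\<^sup>2)) = 2 * exp (- (x\<^sup>2 + \<xi>\<^sup>2))" by (simp add: mult_exp_exp)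
  finally show ?thesis .
qed

text \<open>The product of the two Hermite factors is at most half the sum of their squares, and the
  argument scaled by \<open>1/2\<close> turns a normalised square into one of integral 2. The bound
  is uniform in the indices and in the point.\<close>

lemma wig_bound: "cmod (wig m n x \<xi>) \<le> 2"
proof -
  have sq: "integrable lborel (\<lambda>p. (hermite k (x + c * p))\<^sup>2)" "(\<integral>p. (hermite k (x + c * p))\<^sup>2 \<partial>lborel) = 2" if "\<bar>c\<bar> = 1/2" for k c
  proof -
    have i: "integrable lborel (\<lambda>p. (hermite k p)\<^sup>2)" "(\<integral>p. (hermite k p)\<^sup>2 \<partial>lborel) = 1"
      using integrable_hermite_product0[of k k] hermite_orthonormal[of k k] by (simp_all add: power2_eq_square)
    have c: "c \<noteq> 0" using that by auto
    show "integrable lborel (\<lambda>p. (hermite k (x + c * p))\<^sup>2)" by (rule lborel_integrable_real_affine[OF i(1) c])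
    have "1 = \<bar>c\<bar> *\<^sub>R (\<integral>p. (hermite k (x + c * p))\<^sup>2 \<partial>lborel)"
      using lborel_integral_real_affine[OF c, of "\<lambda>p. (hermite k p)\<^sup>2" x] i(2) by simp
    then show "(\<integral>p. (hermite k (x + c * p))\<^sup>2 \<partial>lborel) = 2" using that by simp
  qed
  have "cmod (wig m n x \<xi>) \<le> (\<integral>p. cmod (exp (- \<i> * of_real (\<xi> * p)) * complex_of_real (hermite m (x + p / 2) * hermite n (x - p / 2))) \<partial>lborel)"
    unfolding wig_def by (rule integral_norm_bound)
  also have "... \<le> (\<integral>p. (1/2) * ((hermite m (x + (1/2) * p))\<^sup>2 + (hermite n (x + (- 1/2) * p))\<^sup>2) \<partial>lborel)"
  proof (rule integral_mono)
    show "integrable lborel (\<lambda>p. cmod (exp (- \<i> * of_real (\<xi> * p)) * complex_of_real (hermite m (x + p / 2) * hermite n (x - p / 2))))"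
      by (intro integrable_norm wig_integrable)
    show "integrable lborel (\<lambda>p. (1/2) * ((hermite m (x + (1/2) * p))\<^sup>2 + (hermite n (x + (- 1/2) * p))\<^sup>2))"
      by (intro integrable_mult_right Bochner_Integration.integrable_add sq) auto
    fix p
    have "cmod (exp (- \<i> * of_real (\<xi> * p)) * complex_of_real (hermite m (x + p / 2) * hermite n (x - p / 2))) = \<bar>hermite m (x + p / 2)\<bar> * \<bar>hermite n (x - p / 2)\<bar>"
      by (simp add: norm_mult abs_mult)
    also have "... \<le> (1/2) * (\<bar>hermite m (x + p / 2)\<bar>\<^sup>2 + \<bar>hermite n (x - p / 2)\<bar>\<^sup>2)"
      using sum_squares_bound[of "\<bar>hermite m (x + p / 2)\<bar>" "\<bar>hermite n (x - p / 2)\<bar>"] by simp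
    finally show "cmod (exp (- \<i> * of_real (\<xi> * p)) * complex_of_real (hermite m (x + p / 2) * hermite n (x - p / 2))) \<le>
       (1/2) * ((hermite m (x + (1/2) * p))\<^sup>2 + (hermite n (x + (- 1/2) * p))\<^sup>2)" by simp
  qed
  also have "... = 2" using sq[of "1/2"] sq[of "- 1/2"] by simp
  finally show ?thesis .
qed

lemma hs_Suc_neq_0: "hs (Suc n) \<noteq> 0" by simp

text \<open>The derivative in the direction with coordinates \<open>Re u\<close> and
  \<open>Im u\<close>. A function \<open>wig m n\<close> is a Gaussian times a polynomial in the
  complex coordinate and its conjugate: the first two terms differentiate the polynomial, the last
  one the Gaussian.\<close>

definition wig_dir :: "nat \<Rightarrow> nat \<Rightarrow> complex \<Rightarrow> real \<Rightarrow> real \<Rightarrow> complex" where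
  "wig_dir m n u x \<xi> = 2 * cnj u * hs m * wig (m - 1) n x \<xi> + 2 * u * hs n * wig m (n - 1) x \<xi>
     - 2 * (Re u * x + Im u * \<xi>) * wig m n x \<xi>"

lemma has_vector_derivative_divide_const:
  fixes f :: "real \<Rightarrow> complex"
  assumes "(f has_vector_derivative D) F" shows "((\<lambda>t. f t / c) has_vector_derivative D / c) F"
  using has_vector_derivative_mult_left[OF assms, of "1 / c"] by simp

text \<open>Induction along the recurrences from the explicit Gaussian takes the place of
  differentiation under the integral. Each step divides by a nonzero \<open>hs (Suc k)\<close>, and
  the product rule reproduces the formula one index higher.\<close>

lemma wig_has_deriv:
  "((\<lambda>t. wig m n (x + t * Re u) (\<xi> + t * Im u)) has_vector_derivative wig_dir m n u x \<xi>) (at 0)"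
proof (induction m arbitrary: n rule: less_induct)
  case (less m)
  define X where "X t = x + t * Re u" for t
  define Y where "Y t = \<xi> + t * Im u" for t
  define z where "z = of_real x + \<i> * of_real \<xi>"
  define zb where "zb = of_real x - \<i> * of_real \<xi>"
  define W where "W m n = wig m n x \<xi>" for m n
  have XY0: "X 0 = x" "Y 0 = \<xi>" by (auto simp: X_def Y_def)
  have u_eq: "of_real (Re u) + \<i> * of_real (Im u) = u" "of_real (Re u) - \<i> * of_real (Im u) = cnj u" by (auto simp: complex_eq_iff)
  \<comment> \<open>Expresses the term coming from the Gaussian through the complex coordinate and
    its conjugate, to which the recurrences apply.\<close>
  have R: "2 * complex_of_real (Re u * x + Im u * \<xi>) = cnj u * z + u * zb" by (simp add: z_def zb_def complex_eq_iff)
  have dir: "wig_dir m n u x \<xi> = 2 * cnj u * hs m * W (m - 1) n + 2 * u * hs n * W m (n - 1) - (cnj u * z + u * zb) * W m n" for m n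
    unfolding wig_dir_def R[symmetric] W_def by simp
  have zW: "z * W m n = hs (Suc n) * W m (Suc n) + hs m * W (m - 1) n" for m n unfolding z_def W_def by (rule wig_z)
  have zbW: "zb * W m n = hs (Suc m) * W (Suc m) n + hs n * W m (n - 1)" for m n unfolding zb_def W_def by (rule wig_zbar)
  have dX: "((\<lambda>t. of_real (X t) + \<i> * of_real (Y t)) has_vector_derivative u) (at 0)"
    using u_eq(1) unfolding X_def Y_def by (auto intro!: derivative_eq_intros)
  have dXb: "((\<lambda>t. of_real (X t) - \<i> * of_real (Y t)) has_vector_derivative cnj u) (at 0)"
    using u_eq(2) unfolding X_def Y_def by (auto intro!: derivative_eq_intros)
  show ?case
  proof (cases m)
    case 0
    have "((\<lambda>t. wig 0 n (X t) (Y t)) has_vector_derivative wig_dir 0 n u x \<xi>) (at 0)" for n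
    proof (induction n)
      case 0
      have "((\<lambda>t. 2 * exp (- ((X t)\<^sup>2 + (Y t)\<^sup>2))) has_real_derivative
         2 * (exp (- ((X 0)\<^sup>2 + (Y 0)\<^sup>2)) * - (2 * (X 0) * Re u + 2 * (Y 0) * Im u))) (at 0)"
        unfolding X_def Y_def by (auto intro!: derivative_eq_intros simp: algebra_simps)
      from has_vector_derivative_of_real[OF this, where 'a = complex]
      show ?case unfolding wig_0_0 wig_dir_def XY0 by (simp add: wig_0_0 algebra_simps)
    next
      case (Suc n)
      have eq: "wig 0 (Suc n) a b = ((of_real a + \<i> * of_real b) * wig 0 n a b) / hs (Suc n)" for a b
        unfolding wig_z using hs_Suc_neq_0[of n] by simp
      have "((\<lambda>t. ((of_real (X t) + \<i> * of_real (Y t)) * wig 0 n (X t) (Y t)) / hs (Suc n)) has_vector_derivative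
         ((of_real (X 0) + \<i> * of_real (Y 0)) * wig_dir 0 n u x \<xi> + u * wig 0 n (X 0) (Y 0)) / hs (Suc n)) (at 0)"
        by (rule has_vector_derivative_divide_const[OF has_vector_derivative_mult[OF dX Suc]])
      then have "((\<lambda>t. wig 0 (Suc n) (X t) (Y t)) has_vector_derivative (z * wig_dir 0 n u x \<xi> + u * W 0 n) / hs (Suc n)) (at 0)"
        unfolding eq[symmetric] XY0 z_def[symmetric] W_def[symmetric] .
      moreover have "z * wig_dir 0 n u x \<xi> + u * W 0 n = wig_dir 0 (Suc n) u x \<xi> * hs (Suc n)"
      proof -
        \<comment> \<open>For \<open>n = 0\<close> both sides vanish. Otherwise the recurrence leads
          back to index \<open>n\<close>, and the two equal square roots combine to
          \<open>n / 2\<close>.\<close>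
        have 1: "hs n * (z * W 0 (n - 1)) = of_nat n / 2 * W 0 n" by (cases n) (simp_all add: zW hs_self del: of_nat_Suc)
        have "z * wig_dir 0 n u x \<xi> + u * W 0 n = 2 * u * (hs n * (z * W 0 (n - 1))) - (cnj u * z + u * zb) * (z * W 0 n) + u * W 0 n"
          unfolding dir by (simp add: algebra_simps)
        also have "... = 2 * u * (of_nat (Suc n) / 2 * W 0 n) - (cnj u * z + u * zb) * (hs (Suc n) * W 0 (Suc n))"
          unfolding 1 unfolding zW by (simp add: algebra_simps)
        also have "... = 2 * u * (hs (Suc n) * (hs (Suc n) * W 0 n)) - (cnj u * z + u * zb) * (hs (Suc n) * W 0 (Suc n))"
          unfolding hs_self ..
        also have "... = wig_dir 0 (Suc n) u x \<xi> * hs (Suc n)" unfolding dir by (simp add: algebra_simps)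
        finally show ?thesis .
      qed
      ultimately show ?case using hs_Suc_neq_0[of n] by simp
    qed
    then show ?thesis using 0 by (simp add: X_def Y_def)
  next
    case (Suc k)
    have IH: "((\<lambda>t. wig k n (X t) (Y t)) has_vector_derivative wig_dir k n u x \<xi>) (at 0)" for n
      using less[of k n] Suc by (simp add: X_def Y_def)
    have eq: "wig (Suc k) n a b = ((of_real a - \<i> * of_real b) * wig k n a b - hs n * wig k (n - 1) a b) / hs (Suc k)" for a b
      unfolding wig_zbar using hs_Suc_neq_0[of k] by simp
    have "((\<lambda>t. ((of_real (X t) - \<i> * of_real (Y t)) * wig k n (X t) (Y t) - hs n * wig k (n - 1) (X t) (Y t)) / hs (Suc k)) has_vector_derivative
       (((of_real (X 0) - \<i> * of_real (Y 0)) * wig_dir k n u x \<xi> + cnj u * wig k n (X 0) (Y 0)) - hs n * wig_dir k (n - 1) u x \<xi>) / hs (Suc k)) (at 0)"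
      by (intro has_vector_derivative_divide_const has_vector_derivative_diff has_vector_derivative_mult[OF dXb IH] has_vector_derivative_mult_right IH)
    then have "((\<lambda>t. wig (Suc k) n (X t) (Y t)) has_vector_derivative
        ((zb * wig_dir k n u x \<xi> + cnj u * W k n) - hs n * wig_dir k (n - 1) u x \<xi>) / hs (Suc k)) (at 0)"
      unfolding eq[symmetric] XY0 zb_def[symmetric] W_def[symmetric] .
    moreover have "(zb * wig_dir k n u x \<xi> + cnj u * W k n) - hs n * wig_dir k (n - 1) u x \<xi> = wig_dir (Suc k) n u x \<xi> * hs (Suc k)"
    proof -
      let ?r = "cnj u * z + u * zb"
      have 1: "hs k * (zb * W (k - 1) n - hs n * W (k - 1) (n - 1)) = of_nat k / 2 * W k n"
        by (cases k) (simp_all add: zbW hs_self del: of_nat_Suc)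
      have 2: "hs n * (zb * W k (n - 1) - hs (n - 1) * W k (n - 1 - 1)) = hs n * (hs (Suc k) * W (Suc k) (n - 1))" by (simp add: zbW)
      have 3: "zb * W k n - hs n * W k (n - 1) = hs (Suc k) * W (Suc k) n" by (simp add: zbW)
      have "(zb * wig_dir k n u x \<xi> + cnj u * W k n) - hs n * wig_dir k (n - 1) u x \<xi> =
         2 * cnj u * (hs k * (zb * W (k - 1) n - hs n * W (k - 1) (n - 1))) + cnj u * W k n
         + 2 * u * (hs n * (zb * W k (n - 1) - hs (n - 1) * W k (n - 1 - 1))) - ?r * (zb * W k n - hs n * W k (n - 1))"
        unfolding dir by (simp add: algebra_simps)
      also have "... = 2 * cnj u * (of_nat (Suc k) / 2 * W k n) + 2 * u * (hs n * (hs (Suc k) * W (Suc k) (n - 1))) - ?r * (hs (Suc k) * W (Suc k) n)"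
        unfolding 1 2 3 by (simp add: algebra_simps)
      also have "... = 2 * cnj u * (hs (Suc k) * (hs (Suc k) * W k n)) + 2 * u * (hs n * (hs (Suc k) * W (Suc k) (n - 1))) - ?r * (hs (Suc k) * W (Suc k) n)"
        unfolding hs_self ..
      also have "... = wig_dir (Suc k) n u x \<xi> * hs (Suc k)" unfolding dir by (simp add: algebra_simps)
      finally show ?thesis .
    qed
    ultimately show ?thesis using Suc hs_Suc_neq_0[of k] by (simp add: X_def Y_def)
  qed
qed

text \<open>The recurrences absorb the coordinates in the last term of \<open>wig_dir\<close>, so
  that the derivative becomes a combination with coefficients free of \<open>x\<close> and
  \<open>\<xi>\<close>.\<close>

lemma wig_dir_ladder:
  "wig_dir m n u x \<xi> = cnj u * (hs m * wig (m - 1) n x \<xi> - hs (Suc n) * wig m (Suc n) x \<xi>) + u * (hs n * wig m (n - 1) x \<xi> - hs (Suc m) * wig (Suc m) n x \<xi>)"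
proof -
  have "2 * complex_of_real (Re u * x + Im u * \<xi>) = cnj u * (of_real x + \<i> * of_real \<xi>) + u * (of_real x - \<i> * of_real \<xi>)"
    by (simp add: complex_eq_iff)
  then have "2 * complex_of_real (Re u * x + Im u * \<xi>) * wig m n x \<xi> =
      cnj u * ((of_real x + \<i> * of_real \<xi>) * wig m n x \<xi>) + u * ((of_real x - \<i> * of_real \<xi>) * wig m n x \<xi>)"
    by (simp only: distrib_right mult.assoc)
  then show ?thesis unfolding wig_dir_def wig_z wig_zbar by (simp add: algebra_simps)
qed

text \<open>Rotation multiplies \<open>x + \<i> * \<xi>\<close> by \<open>cis \<theta>\<close> and
  its conjugate by the inverse, and \<open>wig 0 0\<close> is invariant; the recurrences carry the
  phase along. Powers stand on both sides because \<open>n - m\<close> may be negative.\<close>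

lemma wig_rotate:
  fixes \<theta> x \<xi> :: real defines "x' \<equiv> cos \<theta> * x - sin \<theta> * \<xi>" and "\<xi>' \<equiv> sin \<theta> * x + cos \<theta> * \<xi>"
  shows "cis \<theta> ^ m * wig m n x' \<xi>' = cis \<theta> ^ n * wig m n x \<xi>"
proof -
  have z': "of_real x' + \<i> * of_real \<xi>' = cis \<theta> * (of_real x + \<i> * of_real \<xi>)" by (simp add: x'_def \<xi>'_def complex_eq_iff)
  have zb': "cis \<theta> * (of_real x' - \<i> * of_real \<xi>') = of_real x - \<i> * of_real \<xi>"
  proof -
    have "of_real x' - \<i> * of_real \<xi>' = cnj (of_real x' + \<i> * of_real \<xi>')" by simp
    also have "... = cis (- \<theta>) * (of_real x - \<i> * of_real \<xi>)" unfolding z' by (simp add: cis_cnj)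
    finally show ?thesis by (simp add: mult.assoc[symmetric] cis_mult)
  qed
  have sq: "x'\<^sup>2 + \<xi>'\<^sup>2 = x\<^sup>2 + \<xi>\<^sup>2"
  proof -
    have "x'\<^sup>2 + \<xi>'\<^sup>2 = ((cos \<theta>)\<^sup>2 + (sin \<theta>)\<^sup>2) * (x\<^sup>2 + \<xi>\<^sup>2)" unfolding x'_def \<xi>'_def by algebra
    then show ?thesis by simp
  qed
  have base: "wig 0 n x' \<xi>' = cis \<theta> ^ n * wig 0 n x \<xi>" for n
  proof (induction n)
    case 0
    show ?case unfolding wig_0_0 sq by simp
  next
    case (Suc n)
    have "hs (Suc n) * wig 0 (Suc n) x' \<xi>' = (of_real x' + \<i> * of_real \<xi>') * wig 0 n x' \<xi>'" unfolding wig_z by simp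
    also have "... = cis \<theta> ^ Suc n * ((of_real x + \<i> * of_real \<xi>) * wig 0 n x \<xi>)" unfolding z' Suc by (simp only: power_Suc mult_ac)
    also have "... = hs (Suc n) * (cis \<theta> ^ Suc n * wig 0 (Suc n) x \<xi>)" unfolding wig_z by simp
    finally show ?case by (simp only: mult_left_cancel[OF hs_Suc_neq_0])
  qed
  show ?thesis
  proof (induction m arbitrary: n)
    case 0
    then show ?case using base by simp
  next
    case (Suc m)
    \<comment> \<open>At \<open>n = 0\<close> the exponent \<open>n - 1\<close> is truncated, but
      \<open>hs 0\<close> is 0.\<close>
    have n1: "cis \<theta> * (hs n * cis \<theta> ^ (n - 1)) = hs n * cis \<theta> ^ n" by (cases n) simp_all
    have "hs (Suc m) * (cis \<theta> ^ Suc m * wig (Suc m) n x' \<xi>') =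
        cis \<theta> ^ Suc m * ((of_real x' - \<i> * of_real \<xi>') * wig m n x' \<xi>' - hs n * wig m (n - 1) x' \<xi>')"
      unfolding wig_zbar by (simp add: algebra_simps)
    also have "... = (cis \<theta> * (of_real x' - \<i> * of_real \<xi>')) * (cis \<theta> ^ m * wig m n x' \<xi>') - cis \<theta> * hs n * (cis \<theta> ^ m * wig m (n - 1) x' \<xi>')"
      by (simp add: algebra_simps)
    also have "... = (of_real x - \<i> * of_real \<xi>) * (cis \<theta> ^ n * wig m n x \<xi>) - cis \<theta> * (hs n * cis \<theta> ^ (n - 1)) * wig m (n - 1) x \<xi>"
      unfolding zb' Suc.IH by (simp only: mult.assoc)
    also have "... = cis \<theta> ^ n * ((of_real x - \<i> * of_real \<xi>) * wig m n x \<xi> - hs n * wig m (n - 1) x \<xi>)"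
      unfolding n1 by (simp add: algebra_simps)
    also have "... = hs (Suc m) * (cis \<theta> ^ n * wig (Suc m) n x \<xi>)" unfolding wig_zbar by (simp add: algebra_simps)
    finally show ?case by (simp only: mult_left_cancel[OF hs_Suc_neq_0])
  qed
qed

text \<open>Applying both recurrences in turn to \<open>wig n n\<close> multiplies it by the squared
  radius and leads back to the diagonal. The result is the Laguerre recurrence in
  \<open>2 * (x\<^sup>2 + \<xi>\<^sup>2)\<close>, up to alternating signs.\<close>

lemma wig_diagonal: "wig n n x \<xi> = of_real (2 * (- 1) ^ n * laguerre_fun1 n (2 * (x\<^sup>2 + \<xi>\<^sup>2)))"
proof -
  define \<rho> where "\<rho> = 2 * (x\<^sup>2 + \<xi>\<^sup>2)"
  define W where "W m n = wig m n x \<xi>" for m n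
  define z where "z = of_real x + \<i> * of_real \<xi>"
  define zb where "zb = of_real x - \<i> * of_real \<xi>"
  have zW: "z * W m n = hs (Suc n) * W m (Suc n) + hs m * W (m - 1) n" for m n unfolding z_def W_def by (rule wig_z)
  have zbW: "zb * W m n = hs (Suc m) * W (Suc m) n + hs n * W m (n - 1)" for m n unfolding zb_def W_def by (rule wig_zbar)
  have zz: "zb * z = of_real \<rho> / 2" unfolding z_def zb_def \<rho>_def by (simp add: complex_eq_iff power2_eq_square)
  have rec: "of_nat (Suc n) * W (Suc n) (Suc n) = (of_real \<rho> - 2 * of_nat n - 1) * W n n - of_nat n * W (n - 1) (n - 1)" for n
  proof -
    have a: "hs n * (zb * W (n - 1) n) = of_nat n / 2 * W n n + of_nat n / 2 * W (n - 1) (n - 1)"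
      by (cases n) (simp_all add: zbW distrib_left hs_self del: of_nat_Suc)
    have b: "hs (Suc n) * (zb * W n (Suc n)) = of_nat (Suc n) / 2 * W (Suc n) (Suc n) + of_nat (Suc n) / 2 * W n n"
      by (simp add: zbW distrib_left hs_self del: of_nat_Suc)
    have "zb * (z * W n n) = hs (Suc n) * (zb * W n (Suc n)) + hs n * (zb * W (n - 1) n)" unfolding zW by (simp add: algebra_simps)
    also have "... = of_nat (Suc n) / 2 * W (Suc n) (Suc n) + of_nat (Suc n) / 2 * W n n + (of_nat n / 2 * W n n + of_nat n / 2 * W (n - 1) (n - 1))"
      unfolding a b ..
    finally have "of_real \<rho> / 2 * W n n = \<dots>" unfolding mult.assoc[symmetric] zz .
    from arg_cong[OF this, of "\<lambda>c. 2 * c"]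
    have "of_real \<rho> * W n n = of_nat (Suc n) * W (Suc n) (Suc n) + of_nat (Suc n) * W n n + (of_nat n * W n n + of_nat n * W (n - 1) (n - 1))"
      by (simp add: distrib_left del: of_nat_Suc)
    then show ?thesis by (simp add: algebra_simps)
  qed
  have "W n n = of_real (2 * (- 1) ^ n * laguerre_fun1 n \<rho>)" for n
  proof (induction n rule: less_induct)
    case (less n)
    show ?case
    proof (cases n)
      case 0
      then show ?thesis by (simp add: W_def wig_0_0 laguerre_fun1_def \<rho>_def)
    next
      case (Suc k)
      have IH: "W k k = of_real (2 * (- 1) ^ k * laguerre_fun1 k \<rho>)" using less Suc by simp
      have IH': "of_nat k * W (k - 1) (k - 1) = of_real (- (real k * (2 * (- 1) ^ k * laguerre_fun1 (k - 1) \<rho>)))"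
      proof (cases k)
        case (Suc j)
        have "W j j = of_real (2 * (- 1) ^ j * laguerre_fun1 j \<rho>)" by (rule less) (use \<open>n = Suc k\<close> Suc in simp)
        then show ?thesis using Suc by simp
      qed simp
      have L: "real (Suc k) * laguerre_fun1 (Suc k) \<rho> = (2 * real k + 1 - \<rho>) * laguerre_fun1 k \<rho> - real k * laguerre_fun1 (k - 1) \<rho>"
        using laguerre_fun1_mult[of \<rho> k] by (simp add: algebra_simps)
      have "of_nat (Suc k) * W (Suc k) (Suc k) = (of_real \<rho> - 2 * of_nat k - 1) * of_real (2 * (- 1) ^ k * laguerre_fun1 k \<rho>) - of_real (- (real k * (2 * (- 1) ^ k * laguerre_fun1 (k - 1) \<rho>)))"
        unfolding rec IH' unfolding IH ..
      also have "... = of_real (- (2 * (- 1) ^ k) * ((2 * real k + 1 - \<rho>) * laguerre_fun1 k \<rho> - real k * laguerre_fun1 (k - 1) \<rho>))"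
        by (simp add: algebra_simps)
      also have "... = of_nat (Suc k) * of_real (2 * (- 1) ^ Suc k * laguerre_fun1 (Suc k) \<rho>)" unfolding L[symmetric] by simp
      finally have "of_nat (Suc k) * W (Suc k) (Suc k) = of_nat (Suc k) * complex_of_real (2 * (- 1) ^ Suc k * laguerre_fun1 (Suc k) \<rho>)" .
      then show ?thesis unfolding Suc by (simp only: mult_left_cancel[OF of_nat_neq_0])
    qed
  qed
  then show ?thesis by (simp add: W_def \<rho>_def)
qed

text \<open>Every \<open>x \<ge> 0\<close> is the Laguerre argument of a point of the phase plane,
  for instance of \<open>(sqrt (x / 2), 0)\<close>. The factor 2 in \<open>wig_diagonal\<close>
  cancels the bound 2 of \<open>wig_bound\<close>.\<close>

lemma laguerre_fun1_bound:
  assumes "x \<ge> 0" shows "\<bar>laguerre_fun1 n x\<bar> \<le> 1"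
proof -
  have "cmod (wig n n (sqrt (x / 2)) 0) \<le> 2" by (rule wig_bound)
  then show ?thesis unfolding wig_diagonal using assms by (simp add: norm_mult norm_power)
qed

lemma laguerre_fun_schwartz: "laguerre_fun \<alpha> \<in> schwartz_functions orthant"
  and poly_bounded_snorm_laguerre: "poly_bounded weight (\<lambda>\<alpha>. snorm orthant m (laguerre_fun \<alpha>))"
  by (rule laguerre_fun_family; rule laguerre_fun1_bound; assumption)+

section \<open>Products over the phase planes\<close>

definition wig_fun :: "'n::finite mindex \<times> 'n mindex \<Rightarrow> (real^'n) \<times> (real^'n) \<Rightarrow> complex" where
  "wig_fun \<iota> z = (\<Prod>i\<in>UNIV. wig (fst \<iota> i) (snd \<iota> i) (fst z $ i) (snd z $ i))"

definition weight2 :: "'n::finite mindex \<times> 'n mindex \<Rightarrow> real" where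
  "weight2 \<iota> = weight (fst \<iota>) * weight (snd \<iota>)"

lemma weight2_ge_1: "weight2 \<iota> \<ge> 1"
  unfolding weight2_def using mult_mono[OF weight_ge_1[of "fst \<iota>"] weight_ge_1[of "snd \<iota>"]] weight_pos[of "fst \<iota>"] by simp

lemma wig_fun_split:
  "wig_fun (\<alpha>(i := a), \<beta>(i := b)) z = wig a b (fst z $ i) (snd z $ i) * (\<Prod>k\<in>UNIV - {i}. wig (\<alpha> k) (\<beta> k) (fst z $ k) (snd z $ k))"
  unfolding wig_fun_def by (subst prod.remove[of UNIV i]) (auto intro!: prod.cong)

text \<open>The common shape of multiplication and differentiation in the \<open>i\<close>-th phase plane.\<close>

definition ladder4 :: "'n::finite \<Rightarrow> complex \<times> complex \<times> complex \<times> complex \<Rightarrow> 'n mindex \<times> ('n mindex)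
    \<Rightarrow> (complex \<times> ('n mindex \<times> 'n mindex)) list" where
  "ladder4 i = (\<lambda>(a1, a2, a3, a4) (\<alpha>, \<beta>).
     [(a1 * hs (Suc (\<alpha> i)), (\<alpha>(i := Suc (\<alpha> i)), \<beta>)), (a2 * hs (\<alpha> i), (\<alpha>(i := \<alpha> i - 1), \<beta>)),
      (a3 * hs (Suc (\<beta> i)), (\<alpha>, \<beta>(i := Suc (\<beta> i)))), (a4 * hs (\<beta> i), (\<alpha>, \<beta>(i := \<beta> i - 1)))])"

lemma lc_eval_ladder4:
  "lc_eval wig_fun (ladder4 i (a1, a2, a3, a4) (\<alpha>, \<beta>)) z =
    (a1 * (hs (Suc (\<alpha> i)) * wig (Suc (\<alpha> i)) (\<beta> i) (fst z $ i) (snd z $ i)) + a2 * (hs (\<alpha> i) * wig (\<alpha> i - 1) (\<beta> i) (fst z $ i) (snd z $ i))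
     + (a3 * (hs (Suc (\<beta> i)) * wig (\<alpha> i) (Suc (\<beta> i)) (fst z $ i) (snd z $ i)) + a4 * (hs (\<beta> i) * wig (\<alpha> i) (\<beta> i - 1) (fst z $ i) (snd z $ i))))
    * (\<Prod>k\<in>UNIV - {i}. wig (\<alpha> k) (\<beta> k) (fst z $ k) (snd z $ k))"
proof -
  have "wig_fun (\<alpha>(i := a), \<beta>) z = wig a (\<beta> i) (fst z $ i) (snd z $ i) * (\<Prod>k\<in>UNIV - {i}. wig (\<alpha> k) (\<beta> k) (fst z $ k) (snd z $ k))" for a
    using wig_fun_split[of \<alpha> i a \<beta> "\<beta> i" z] by simp
  moreover have "wig_fun (\<alpha>, \<beta>(i := b)) z = wig (\<alpha> i) b (fst z $ i) (snd z $ i) * (\<Prod>k\<in>UNIV - {i}. wig (\<alpha> k) (\<beta> k) (fst z $ k) (snd z $ k))" for b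
    using wig_fun_split[of \<alpha> i "\<alpha> i" \<beta> b z] by simp
  ultimately show ?thesis
    unfolding ladder4_def by (simp only: prod.case lc_simps fst_conv snd_conv add_0_right distrib_right mult.assoc add.assoc)
qed

text \<open>The coefficients are those of \<open>wig_mult_x\<close> divided by 2 and of
  \<open>wig_mult_xi\<close> divided by \<open>2 * \<i>\<close>. The test on \<open>snd b\<close>
  separates position from momentum basis vectors.\<close>

definition wig_mult_list :: "(real^'n) \<times> (real^'n) \<Rightarrow> 'n mindex \<times> 'n mindex \<Rightarrow> (complex \<times> ('n mindex \<times> 'n mindex)) list" where
  "wig_mult_list b = (if snd b = 0 then ladder4 (axis_index (fst b)) (1/2, 1/2, 1/2, 1/2)
     else ladder4 (axis_index (snd b)) (\<i>/2, -\<i>/2, -\<i>/2, \<i>/2))"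

text \<open>The coefficients are those of \<open>wig_dir_ladder\<close> for the directions 1 and
  \<open>\<i>\<close>.\<close>

definition wig_deriv_list :: "(real^'n) \<times> (real^'n) \<Rightarrow> 'n mindex \<times> 'n mindex \<Rightarrow> (complex \<times> ('n mindex \<times> 'n mindex)) list" where
  "wig_deriv_list b = (if snd b = 0 then ladder4 (axis_index (fst b)) (-1, 1, -1, 1)
     else ladder4 (axis_index (snd b)) (-\<i>, -\<i>, \<i>, \<i>))"

lemma Basis_phase_space_cases:
  assumes "b \<in> (Basis :: ((real^'n) \<times> (real^'n)) set)"
  obtains i where "b = (axis i 1, 0)" | i where "b = (0, axis i 1)" using assms by (auto simp: Basis_prod_def Basis_vec_eq)

lemma wig_fun_mult:
  assumes b: "b \<in> Basis"
  shows "of_real (z \<bullet> b) * wig_fun \<iota> z = lc_eval wig_fun (wig_mult_list b \<iota>) z"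
proof -
  obtain \<alpha> \<beta> where \<iota>: "\<iota> = (\<alpha>, \<beta>)" by (cases \<iota>)
  show ?thesis
  proof (cases rule: Basis_phase_space_cases[OF b])
    case (1 i)
    let ?x = "fst z $ i" and ?y = "snd z $ i"
    have zb: "z \<bullet> b = ?x" unfolding 1 by (simp add: inner_prod_def inner_axis)
    have L: "wig_mult_list b (\<alpha>, \<beta>) = ladder4 i (1/2, 1/2, 1/2, 1/2) (\<alpha>, \<beta>)" unfolding 1 by (simp add: wig_mult_list_def)
    have "of_real ?x * wig (\<alpha> i) (\<beta> i) ?x ?y = (1/2) * (2 * of_real ?x * wig (\<alpha> i) (\<beta> i) ?x ?y)" by simp
    then show ?thesis unfolding zb L lc_eval_ladder4 \<iota> using wig_fun_split[of \<alpha> i "\<alpha> i" \<beta> "\<beta> i" z]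
      unfolding wig_mult_x by (simp only: fun_upd_triv mult.assoc[symmetric] distrib_left)
  next
    case (2 i)
    let ?x = "fst z $ i" and ?y = "snd z $ i"
    have zb: "z \<bullet> b = ?y" unfolding 2 by (simp add: inner_prod_def inner_axis)
    have ax: "axis i (1::real) \<noteq> 0" by (simp add: axis_eq_0_iff)
    have L: "wig_mult_list b (\<alpha>, \<beta>) = ladder4 i (\<i>/2, -\<i>/2, -\<i>/2, \<i>/2) (\<alpha>, \<beta>)" unfolding 2 by (simp add: wig_mult_list_def ax)
    have "of_real ?y * wig (\<alpha> i) (\<beta> i) ?x ?y = (-\<i>/2) * (2 * \<i> * of_real ?y * wig (\<alpha> i) (\<beta> i) ?x ?y)" by simp
    then have "of_real ?y * wig (\<alpha> i) (\<beta> i) ?x ?y =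
      \<i>/2 * (hs (Suc (\<alpha> i)) * wig (Suc (\<alpha> i)) (\<beta> i) ?x ?y) + (-\<i>/2) * (hs (\<alpha> i) * wig (\<alpha> i - 1) (\<beta> i) ?x ?y)
     + ((-\<i>/2) * (hs (Suc (\<beta> i)) * wig (\<alpha> i) (Suc (\<beta> i)) ?x ?y) + \<i>/2 * (hs (\<beta> i) * wig (\<alpha> i) (\<beta> i - 1) ?x ?y))"
      unfolding wig_mult_xi by (simp add: algebra_simps)
    then show ?thesis unfolding zb L lc_eval_ladder4 \<iota> using wig_fun_split[of \<alpha> i "\<alpha> i" \<beta> "\<beta> i" z]
      by (simp only: fun_upd_triv mult.assoc[symmetric])
  qed
qed

lemma wig_fun_has_dir_deriv:
  assumes b: "b \<in> Basis"
  shows "has_dir_deriv b (wig_fun \<iota>) (lc_eval wig_fun (wig_deriv_list b \<iota>) z) z"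
proof -
  obtain \<alpha> \<beta> where \<iota>: "\<iota> = (\<alpha>, \<beta>)" by (cases \<iota>)
  let ?R = "\<lambda>i z. \<Prod>k\<in>UNIV - {i}. wig (\<alpha> k) (\<beta> k) (fst z $ k) (snd z $ k)"
  have split: "wig_fun \<iota> z = wig (\<alpha> i) (\<beta> i) (fst z $ i) (snd z $ i) * ?R i z" for i z
    unfolding \<iota> using wig_fun_split[of \<alpha> i "\<alpha> i" \<beta> "\<beta> i" z] by simp
  \<comment> \<open>A basis vector moves a single phase plane, so the remaining factors are constant
    along the line.\<close>
  have main: "has_dir_deriv b (wig_fun \<iota>) (wig_dir (\<alpha> i) (\<beta> i) u (fst z $ i) (snd z $ i) * ?R i z) z"
    if "\<And>k. fst b $ k = (if k = i then Re u else 0)" "\<And>k. snd b $ k = (if k = i then Im u else 0)" for i u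
  proof -
    have "wig_fun \<iota> (z + t *\<^sub>R b) = wig (\<alpha> i) (\<beta> i) (fst z $ i + t * Re u) (snd z $ i + t * Im u) * ?R i z" for t
      unfolding split[of _ i] by (simp add: that)
    then show ?thesis
      using has_vector_derivative_mult_left[OF wig_has_deriv[of "\<alpha> i" "\<beta> i" "fst z $ i" u "snd z $ i"], of "?R i z"] by simp
  qed
  show ?thesis
  proof (cases rule: Basis_phase_space_cases[OF b])
    case (1 i)
    have L: "wig_deriv_list b \<iota> = ladder4 i (-1, 1, -1, 1) (\<alpha>, \<beta>)" unfolding 1 \<iota> by (simp add: wig_deriv_list_def)
    have "has_dir_deriv b (wig_fun \<iota>) (wig_dir (\<alpha> i) (\<beta> i) 1 (fst z $ i) (snd z $ i) * ?R i z) z"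
      by (rule main) (simp_all add: 1 axis_def)
    then show ?thesis unfolding L lc_eval_ladder4 wig_dir_ladder by (simp add: algebra_simps)
  next
    case (2 i)
    have ax: "axis i (1::real) \<noteq> 0" by (simp add: axis_eq_0_iff)
    have L: "wig_deriv_list b \<iota> = ladder4 i (-\<i>, -\<i>, \<i>, \<i>) (\<alpha>, \<beta>)" unfolding 2 \<iota> by (simp add: wig_deriv_list_def ax)
    have "has_dir_deriv b (wig_fun \<iota>) (wig_dir (\<alpha> i) (\<beta> i) \<i> (fst z $ i) (snd z $ i) * ?R i z) z"
      by (rule main) (simp_all add: 2 axis_def)
    then show ?thesis unfolding L lc_eval_ladder4 wig_dir_ladder by (simp add: algebra_simps)
  qed
qed

lemma ladder4_cost:
  fixes i :: "'n::finite"
  assumes a: "cmod a1 \<le> 1" "cmod a2 \<le> 1" "cmod a3 \<le> 1" "cmod a4 \<le> 1"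
  shows "poly_bounded weight2 (\<lambda>\<iota>. lc_cost weight2 M (ladder4 i (a1, a2, a3, a4) \<iota>))"
proof (rule lc_cost_poly_boundedI[OF weight2_ge_1])
  show "poly_bounded weight2 (\<lambda>\<iota>. 2 * weight2 \<iota> ^ 2)" by (intro poly_bounded_cmult poly_bounded_power weight2_ge_1) auto
  show "poly_bounded weight2 (\<lambda>\<iota>. real (length (ladder4 i (a1, a2, a3, a4) \<iota>)))"
    using poly_bounded_const[where w = weight2 and c = 4, OF weight2_ge_1] by (simp add: ladder4_def case_prod_unfold)
  fix \<iota> \<kappa> :: "'n mindex \<times> 'n mindex" and a
  assume mem: "(a, \<kappa>) \<in> set (ladder4 i (a1, a2, a3, a4) \<iota>)"
  obtain \<alpha> \<beta> where \<iota>: "\<iota> = (\<alpha>, \<beta>)" by (cases \<iota>)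
  have A: "1 \<le> weight \<alpha>" and B: "1 \<le> weight \<beta>" by (rule weight_ge_1)+
  have sq: "weight2 \<iota> \<le> 2 * weight2 \<iota> ^ 2" using self_le_power[OF weight2_ge_1[of \<iota>], of 2] weight2_ge_1[of \<iota>] by simp
  have wA: "weight \<alpha> \<le> weight2 \<iota>" unfolding \<iota> weight2_def using mult_left_mono[OF B, of "weight \<alpha>"] A by simp
  have wB: "weight \<beta> \<le> weight2 \<iota>" unfolding \<iota> weight2_def using mult_right_mono[OF A, of "weight \<beta>"] B by simp
  have coeff: "cmod (c * hs k) \<le> 2 * weight2 \<iota> ^ 2" if "cmod c \<le> 1" "hsqrt k \<le> weight2 \<iota>" for c k
  proof -
    have "cmod (c * hs k) = cmod c * hsqrt k" by (simp add: norm_mult)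
    also have "... \<le> 1 * weight2 \<iota>" using that weight2_ge_1[of \<iota>] by (intro mult_mono) auto
    finally show ?thesis using sq by linarith
  qed
  have h1: "hsqrt (Suc (\<alpha> i)) \<le> weight2 \<iota>" "hsqrt (\<alpha> i) \<le> weight2 \<iota>" using sqrt_le_weight[of \<alpha> i] wA by linarith+
  have h2: "hsqrt (Suc (\<beta> i)) \<le> weight2 \<iota>" "hsqrt (\<beta> i) \<le> weight2 \<iota>" using sqrt_le_weight[of \<beta> i] wB by linarith+
  have u1: "weight2 (\<alpha>(i := m), \<beta>) \<le> 2 * weight2 \<iota> ^ 2" if "m \<le> Suc (\<alpha> i)" for m
  proof -
    have "weight2 (\<alpha>(i := m), \<beta>) \<le> (2 * weight \<alpha> ^ 2) * weight \<beta>"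
      unfolding weight2_def using B by (auto intro!: mult_right_mono weight_upd_le that)
    also have "... \<le> (2 * weight \<alpha> ^ 2) * weight \<beta> ^ 2" using self_le_power[OF B, of 2] by (intro mult_left_mono) auto
    finally show ?thesis unfolding \<iota> weight2_def by (simp add: power_mult_distrib)
  qed
  have u2: "weight2 (\<alpha>, \<beta>(i := m)) \<le> 2 * weight2 \<iota> ^ 2" if "m \<le> Suc (\<beta> i)" for m
  proof -
    have "weight2 (\<alpha>, \<beta>(i := m)) \<le> weight \<alpha> * (2 * weight \<beta> ^ 2)"
      unfolding weight2_def using A by (auto intro!: mult_left_mono weight_upd_le that)
    also have "... \<le> weight \<alpha> ^ 2 * (2 * weight \<beta> ^ 2)" using self_le_power[OF A, of 2] by (intro mult_right_mono) auto
    finally show ?thesis unfolding \<iota> weight2_def by (simp add: power_mult_distrib)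
  qed
  from mem consider "a = a1 * hs (Suc (\<alpha> i))" "\<kappa> = (\<alpha>(i := Suc (\<alpha> i)), \<beta>)" | "a = a2 * hs (\<alpha> i)" "\<kappa> = (\<alpha>(i := \<alpha> i - 1), \<beta>)"
    | "a = a3 * hs (Suc (\<beta> i))" "\<kappa> = (\<alpha>, \<beta>(i := Suc (\<beta> i)))" | "a = a4 * hs (\<beta> i)" "\<kappa> = (\<alpha>, \<beta>(i := \<beta> i - 1))"
    unfolding \<iota> ladder4_def prod.case list.set insert_iff prod.inject empty_iff by blast
  then show "cmod a \<le> 2 * weight2 \<iota> ^ 2 \<and> weight2 \<kappa> \<le> 2 * weight2 \<iota> ^ 2"
  proof cases
    case 1
    show ?thesis unfolding 1 by (intro conjI coeff a h1 u1) simp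
  next
    case 2
    show ?thesis unfolding 2 by (intro conjI coeff a h1 u1) simp
  next
    case 3
    show ?thesis unfolding 3 by (intro conjI coeff a h2 u2) simp
  next
    case 4
    show ?thesis unfolding 4 by (intro conjI coeff a h2 u2) simp
  qed
qed auto

lemma wig_lists_cost:
  "poly_bounded weight2 (\<lambda>\<iota>. lc_cost weight2 M (wig_mult_list b \<iota>))"
  "poly_bounded weight2 (\<lambda>\<iota>. lc_cost weight2 M (wig_deriv_list b \<iota>))" unfolding wig_mult_list_def wig_deriv_list_def
  by (cases "snd b = 0"; simp add: ladder4_cost norm_divide)+

lemma wig_continuous: "continuous_on UNIV (\<lambda>p. wig m n (fst p) (snd p))"
proof (induction m arbitrary: n)
  case 0
  show ?case
  proof (induction n)
    case 0
    show ?case unfolding wig_0_0 by (intro continuous_intros)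
  next
    case (Suc n)
    have "wig 0 (Suc n) a b = ((of_real a + \<i> * of_real b) * wig 0 n a b) / hs (Suc n)" for a b
      unfolding wig_z using hs_Suc_neq_0[of n] by simp
    then show ?case using Suc hs_Suc_neq_0[of n] by (simp only:) (intro continuous_intros; simp)
  qed
next
  case (Suc m)
  have "wig (Suc m) n a b = ((of_real a - \<i> * of_real b) * wig m n a b - hs n * wig m (n - 1) a b) / hs (Suc m)" for a b
    unfolding wig_zbar using hs_Suc_neq_0[of m] by simp
  then show ?case using Suc[of n] Suc[of "n - 1"] hs_Suc_neq_0[of m] by (simp only:) (intro continuous_intros; simp)
qed

lemma wig_fun_continuous: "continuous_on UNIV (wig_fun \<iota>)"
proof -
  have "continuous_on UNIV (\<lambda>z. wig m n (fst z $ i) (snd z $ i))" for m n and i :: 'a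
    using continuous_on_compose2[OF wig_continuous[of m n], of UNIV "\<lambda>z. (fst z $ i, snd z $ i)"] by (simp add: continuous_intros)
  then show ?thesis unfolding wig_fun_def[abs_def] by (intro continuous_intros)
qed

lemma cmod_wig_fun_le:
  fixes \<iota> :: "'n::finite mindex \<times> 'n mindex"
  shows "cmod (wig_fun \<iota> z) \<le> 2 ^ CARD('n) * weight2 \<iota> ^ 0"
proof -
  have "cmod (wig_fun \<iota> z) \<le> (\<Prod>i\<in>(UNIV :: 'n set). 2)"
    unfolding wig_fun_def prod_norm[symmetric] by (intro prod_mono conjI wig_bound) auto
  then show ?thesis by simp
qed

lemma
  fixes \<iota> :: "'n::finite mindex \<times> 'n mindex"
  shows wig_fun_schwartz: "wig_fun \<iota> \<in> S_funs"
    and poly_bounded_snorm_wig: "poly_bounded weight2 (\<lambda>\<iota> :: 'n mindex \<times> ('n mindex). snorm UNIV m (wig_fun \<iota>))"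
  using schwartz_ladder_family[OF open_UNIV UNIV_not_empty weight2_ge_1 wig_fun_continuous cmod_wig_fun_le
      wig_fun_has_dir_deriv wig_fun_mult wig_lists_cost(2,1)] by simp_all

section \<open>The Wigner transform as a bilinear form\<close>

text \<open>Bilinear in \<open>f\<close> and \<open>g\<close>, because the conjugation inside
  \<open>wigner\<close> cancels the one inserted by \<open>weyl\<close>; the constant is left
  out.\<close>

definition wig_form :: "real^'n \<Rightarrow> real^'n \<Rightarrow> (real^'n \<Rightarrow> complex) \<Rightarrow> (real^'n \<Rightarrow> complex) \<Rightarrow> complex" where
  "wig_form x \<xi> f g = (\<integral>p. exp (- \<i> * of_real (\<xi> \<bullet> p)) * (f (x + p /\<^sub>R 2) * g (x - p /\<^sub>R 2)) \<partial>lborel)"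

text \<open>Decay is taken from \<open>f\<close> and only boundedness from \<open>g\<close>. The
  bound is a product of norms, so it serves for continuity in either argument.\<close>

lemma wig_form_estimate:
  fixes f g :: "real^'n \<Rightarrow> complex"
  assumes f: "f \<in> S_funs" and g: "g \<in> S_funs"
  shows "integrable lborel (\<lambda>p. exp (- \<i> * of_real (\<xi> \<bullet> p)) * (f (x + p /\<^sub>R 2) * g (x - p /\<^sub>R 2)))"
    "cmod (wig_form x \<xi> f g) \<le> (\<integral>p. decay (x + p /\<^sub>R 2) \<partial>lborel) *
       (snorm UNIV (2 * DIM(real^'n)) f * snorm UNIV 0 g)"
proof -
  have [measurable]: "f \<in> borel_measurable borel" "g \<in> borel_measurable borel" by (intro schwartz_borel f g)+
  let ?K = "2 * DIM(real^'n)"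
  let ?w = "\<lambda>p. 1 / (1 + norm (x + p /\<^sub>R 2)) ^ ?K"
  have "integrable lborel (\<lambda>p::real^'n. complex_of_real (1 / (1 + norm p) ^ ?K))"
    unfolding complex_of_real_integrable_eq by (rule integrable_weight)
  then have "integrable lborel (\<lambda>p. complex_of_real (1 / (1 + norm (x + (1/2) *\<^sub>R p)) ^ ?K))"
    using integrable_affine[of "1/2" "\<lambda>p::real^'n. complex_of_real (1 / (1 + norm p) ^ ?K)" x] by simp
  then have w: "integrable lborel ?w" unfolding complex_of_real_integrable_eq by (simp add: inverse_eq_divide)
  have w': "integrable lborel (\<lambda>p. ?w p * (snorm UNIV ?K f * snorm UNIV 0 g))" by (intro integrable_mult_left w)
  have le: "cmod (exp (- \<i> * of_real (\<xi> \<bullet> p)) * (f (x + p /\<^sub>R 2) * g (x - p /\<^sub>R 2))) \<le> ?w p * (snorm UNIV ?K f * snorm UNIV 0 g)" for p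
  proof -
    have "cmod (exp (- \<i> * of_real (\<xi> \<bullet> p)) * (f (x + p /\<^sub>R 2) * g (x - p /\<^sub>R 2))) = cmod (f (x + p /\<^sub>R 2)) * cmod (g (x - p /\<^sub>R 2))"
      by (simp add: norm_mult)
    also have "... \<le> (snorm UNIV ?K f * ?w p) * snorm UNIV 0 g"
      by (intro mult_mono schwartz_decay f g schwartz_bounded mult_nonneg_nonneg snorm_nonneg UNIV_not_empty) auto
    finally show ?thesis by (simp only: mult_ac)
  qed
  show i: "integrable lborel (\<lambda>p. exp (- \<i> * of_real (\<xi> \<bullet> p)) * (f (x + p /\<^sub>R 2) * g (x - p /\<^sub>R 2)))"
  proof (rule Bochner_Integration.integrable_bound[OF w'])
    show "AE p in lborel. norm (exp (- \<i> * of_real (\<xi> \<bullet> p)) * (f (x + p /\<^sub>R 2) * g (x - p /\<^sub>R 2))) \<le> norm (?w p * (snorm UNIV ?K f * snorm UNIV 0 g))"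
      unfolding real_norm_def by (intro AE_I2 order_trans[OF le abs_ge_self])
  qed measurable
  have "cmod (wig_form x \<xi> f g) \<le> (\<integral>p. cmod (exp (- \<i> * of_real (\<xi> \<bullet> p)) * (f (x + p /\<^sub>R 2) * g (x - p /\<^sub>R 2))) \<partial>lborel)"
    unfolding wig_form_def by (rule integral_norm_bound)
  also have "... \<le> (\<integral>p. ?w p * (snorm UNIV ?K f * snorm UNIV 0 g) \<partial>lborel)" by (intro integral_mono integrable_norm i w' le)
  also have "... = (\<integral>p. ?w p \<partial>lborel) * (snorm UNIV ?K f * snorm UNIV 0 g)" by (rule Bochner_Integration.integral_mult_left_zero)
  finally show "cmod (wig_form x \<xi> f g) \<le> (\<integral>p. ?w p \<partial>lborel) * (snorm UNIV ?K f * snorm UNIV 0 g)" .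
qed

lemma wigner_eq_wig_form:
  fixes f g :: "real^'n \<Rightarrow> complex"
  assumes f: "f \<in> S_funs" and g: "g \<in> S_funs"
  shows "wigner f (\<lambda>x. cnj (g x)) (x, \<xi>) = of_real ((2 * pi) powr (- (real CARD('n) / 2))) * wig_form x \<xi> f g"
proof -
  have "(\<lambda>p. exp (- \<i> * of_real (\<xi> \<bullet> p)) * (f (x + p /\<^sub>R 2) * g (x - p /\<^sub>R 2))) \<in> borel_measurable lborel"
    using wig_form_estimate(1)[OF f g] by (rule borel_measurable_integrable)
  then show ?thesis unfolding wigner_def wig_form_def by (simp add: integral_completion mult.assoc)
qed

text \<open>The exponential and both Hermite functions factor over the coordinates, so the integral
  is a product of integrals over single coordinates of \<open>p\<close>.\<close>

lemma wig_form_hermite: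
  "wig_form x \<xi> (hermite_fun \<alpha>) (hermite_fun \<beta>) = wig_fun (\<alpha>, \<beta>) (x, \<xi>)"
proof -
  let ?f = "\<lambda>i p. exp (- \<i> * of_real (\<xi> $ i * p)) * complex_of_real (hermite (\<alpha> i) (x $ i + p / 2) * hermite (\<beta> i) (x $ i - p / 2))"
  have "exp (- \<i> * of_real (\<xi> \<bullet> p)) * (hermite_fun \<alpha> (x + p /\<^sub>R 2) * hermite_fun \<beta> (x - p /\<^sub>R 2)) = (\<Prod>i\<in>UNIV. ?f i (p $ i))" for p
  proof -
    have "exp (- \<i> * of_real (\<xi> \<bullet> p)) = (\<Prod>i\<in>UNIV. exp (- \<i> * of_real (\<xi> $ i * p $ i)))"
      unfolding inner_vec_def inner_real_def of_real_sum sum_distrib_left exp_sum[OF finite_class.finite_UNIV] ..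
    moreover have "hermite_fun \<alpha> (x + p /\<^sub>R 2) = (\<Prod>i\<in>UNIV. of_real (hermite (\<alpha> i) (x $ i + p $ i / 2)))"
      "hermite_fun \<beta> (x - p /\<^sub>R 2) = (\<Prod>i\<in>UNIV. of_real (hermite (\<beta> i) (x $ i - p $ i / 2)))" by (simp_all add: hermite_fun_def)
    ultimately show ?thesis by (simp only: prod.distrib of_real_mult)
  qed
  then show ?thesis unfolding wig_form_def wig_fun_def wig_def using lborel_prod_vec(2)[of ?f, OF wig_integrable] by simp
qed

section \<open>Radial functions on phase space\<close>

lemma nn_integral_lborel_pair:
  fixes f :: "'a::euclidean_space \<times> 'b::euclidean_space \<Rightarrow> ennreal"
  assumes f: "f \<in> borel_measurable borel"
  shows "(\<integral>\<^sup>+z. f z \<partial>lborel) = (\<integral>\<^sup>+x. \<integral>\<^sup>+y. f (x, y) \<partial>lborel \<partial>lborel)"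
    "(\<integral>\<^sup>+z. f z \<partial>lborel) = (\<integral>\<^sup>+y. \<integral>\<^sup>+x. f (x, y) \<partial>lborel \<partial>lborel)"
proof -
  have f': "f \<in> borel_measurable (lborel \<Otimes>\<^sub>M lborel)" using f by (simp add: lborel_prod)
  show "(\<integral>\<^sup>+z. f z \<partial>lborel) = (\<integral>\<^sup>+x. \<integral>\<^sup>+y. f (x, y) \<partial>lborel \<partial>lborel)" using lborel.nn_integral_fst[OF f'] by (simp add: lborel_prod)
  show "(\<integral>\<^sup>+z. f z \<partial>lborel) = (\<integral>\<^sup>+y. \<integral>\<^sup>+x. f (x, y) \<partial>lborel \<partial>lborel)"
    using lborel_pair.nn_integral_snd[OF f'] by (simp add: lborel_prod)
qed

text \<open>Phase space lists all positions before all momenta, whereas a factor belongs to one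
  position and one momentum. Tonelli in the momenta and then in the positions regroups them.\<close>

lemma nn_integral_prod_planes:
  fixes f :: "'n::finite \<Rightarrow> real \<times> real \<Rightarrow> ennreal"
  assumes f: "\<And>i. f i \<in> borel_measurable borel"
  shows "(\<integral>\<^sup>+z. (\<Prod>i\<in>UNIV. f i (fst z $ i, snd z $ i)) \<partial>(lborel :: ((real^'n) \<times> (real^'n)) measure)) = (\<Prod>i\<in>UNIV. \<integral>\<^sup>+p. f i p \<partial>lborel)"
proof -
  have [measurable]: "f i \<in> borel_measurable (borel \<Otimes>\<^sub>M borel)" for i using f[of i] by (simp add: borel_prod)
  have m: "(\<lambda>z. f i (fst z $ i, snd z $ i)) \<in> borel_measurable (borel :: ((real^'n) \<times> (real^'n)) measure)" for i
    by (rule measurable_compose[OF _ f]) (intro borel_measurable_continuous_onI continuous_intros)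
  have mp: "(\<lambda>z. \<Prod>i\<in>UNIV. f i (fst z $ i, snd z $ i)) \<in> borel_measurable (borel :: ((real^'n) \<times> (real^'n)) measure)"
    by (rule borel_measurable_prod_ennreal) (rule m)
  have "(\<integral>\<^sup>+z. (\<Prod>i\<in>UNIV. f i (fst z $ i, snd z $ i)) \<partial>(lborel :: ((real^'n) \<times> (real^'n)) measure)) =
      (\<integral>\<^sup>+x. \<integral>\<^sup>+y. (\<Prod>i\<in>UNIV. f i (x $ i, y $ i)) \<partial>lborel \<partial>(lborel :: (real^'n) measure))"
    using nn_integral_lborel_pair(1)[OF mp] by simp
  also have "... = (\<integral>\<^sup>+x. (\<Prod>i\<in>UNIV. \<integral>\<^sup>+y. f i (x $ i, y) \<partial>lborel) \<partial>(lborel :: (real^'n) measure))"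
  proof (rule nn_integral_cong)
    fix x :: "real^'n"
    show "(\<integral>\<^sup>+y. (\<Prod>i\<in>UNIV. f i (x $ i, y $ i)) \<partial>(lborel :: (real^'n) measure)) = (\<Prod>i\<in>UNIV. \<integral>\<^sup>+y. f i (x $ i, y) \<partial>lborel)"
      by (rule nn_integral_lborel_prod_vec[where f = "\<lambda>i y. f i (x $ i, y)"]) measurable
  qed
  also have "... = (\<Prod>i\<in>UNIV. \<integral>\<^sup>+x. \<integral>\<^sup>+y. f i (x, y) \<partial>lborel \<partial>lborel)"
    by (rule nn_integral_lborel_prod_vec[where f = "\<lambda>i x. \<integral>\<^sup>+y. f i (x, y) \<partial>lborel"]) measurable
  also have "... = (\<Prod>i\<in>UNIV. \<integral>\<^sup>+p. f i p \<partial>lborel)" by (simp add: nn_integral_lborel_pair(1)[OF f])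
  finally show ?thesis .
qed

text \<open>A disc of radius \<open>sqrt (a / 2)\<close>, empty for negative \<open>a\<close>. Its
  area is linear in \<open>a\<close>, which is why twice the squared radius maps area to a multiple
  of length; the multiple is \<open>pi / 2\<close>.\<close>

lemma emeasure_disc:
  "emeasure lborel {p :: real \<times> real. 2 * ((fst p)\<^sup>2 + (snd p)\<^sup>2) \<le> a} = ennreal (pi / 2 * max a 0)"
proof (cases "a < 0")
  case True
  have "{p :: real \<times> real. 2 * ((fst p)\<^sup>2 + (snd p)\<^sup>2) \<le> a} = {}" using True by (auto simp: not_le intro: less_le_trans[OF True])
  then show ?thesis using True by simp
next
  case False
  have "{p :: real \<times> real. 2 * ((fst p)\<^sup>2 + (snd p)\<^sup>2) \<le> a} = cball 0 (sqrt (a / 2))"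
  proof (intro set_eqI)
    fix p :: "real \<times> real"
    have "norm p = sqrt ((fst p)\<^sup>2 + (snd p)\<^sup>2)" by (simp add: norm_prod_def)
    then show "p \<in> {p. 2 * ((fst p)\<^sup>2 + (snd p)\<^sup>2) \<le> a} \<longleftrightarrow> p \<in> cball 0 (sqrt (a / 2))" by (simp add: field_simps)
  qed
  then have "emeasure lborel {p :: real \<times> real. 2 * ((fst p)\<^sup>2 + (snd p)\<^sup>2) \<le> a} = ennreal (unit_ball_vol (real DIM(real \<times> real)) * sqrt (a / 2) ^ DIM(real \<times> real))"
    using False by (simp add: emeasure_cball del: DIM_prod)
  also have "... = ennreal (pi / 2 * max a 0)" using False by (simp add: unit_ball_vol_2 power2_eq_square[symmetric] mult.commute)
  finally show ?thesis .
qed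

definition v2 :: "(real^'n) \<times> (real^'n) \<Rightarrow> real^'n" where
  "v2 z = 2 *\<^sub>R vmap z"

lemma v2_nth [simp]: "v2 z $ i = 2 * ((fst z $ i)\<^sup>2 + (snd z $ i)\<^sup>2)" by (simp add: v2_def vmap_def case_prod_unfold)

lemma v2_measurable [measurable]: "v2 \<in> borel_measurable borel"
proof -
  have "continuous_on UNIV (\<lambda>z :: (real^'n) \<times> (real^'n). \<chi> i. 2 * ((fst z $ i)\<^sup>2 + (snd z $ i)\<^sup>2))" by (intro continuous_intros)
  then have "(\<lambda>z :: (real^'n) \<times> (real^'n). \<chi> i. 2 * ((fst z $ i)\<^sup>2 + (snd z $ i)\<^sup>2)) \<in> borel_measurable borel"
    by (rule borel_measurable_continuous_onI)
  moreover have eq: "v2 = (\<lambda>z :: (real^'n) \<times> (real^'n). \<chi> i. 2 * ((fst z $ i)\<^sup>2 + (snd z $ i)\<^sup>2))"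
    by (auto simp: fun_eq_iff vec_eq_iff)
  ultimately show ?thesis unfolding eq by blast
qed

lemma orthant_borel [measurable]: "orthant \<in> sets borel" by (rule borel_open[OF open_orthant])

text \<open>Each phase plane contributes the area of a disc, which is linear in the squared radius.\<close>

lemma distr_v2:
  "distr (lborel :: ((real^'n) \<times> (real^'n)) measure) borel v2 =
     density lborel (\<lambda>\<rho>. ennreal ((pi / 2) ^ CARD('n)) * indicator orthant \<rho>)" (is "?M = ?N")
proof (rule measure_eqI_generator_eq)
  \<comment> \<open>Lower boxes generate the Borel sets, are stable under intersection, and have a
    measure of product form on both sides.\<close>
  let ?E = "range (\<lambda>a::real^'n. {..a})"
  show "Int_stable ?E"
  proof (rule Int_stableI)
    fix A B assume "A \<in> ?E" "B \<in> ?E"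
    then obtain a b where ab: "A = {..a}" "B = {..b}" by auto
    have "{..a} \<inter> {..b} = {..(\<chi> i. min (a $ i) (b $ i))}" by (auto simp: less_eq_vec_def)
    then show "A \<inter> B \<in> ?E" using ab by blast
  qed
  show "?E \<subseteq> Pow UNIV" by simp
  have val: "emeasure ?M {..a} = (\<Prod>i\<in>UNIV. ennreal (pi / 2 * max (a $ i) 0))" for a
  proof -
    have disc: "{p :: real \<times> real. 2 * ((fst p)\<^sup>2 + (snd p)\<^sup>2) \<le> c} \<in> sets borel" for c
      by (intro borel_closed closed_Collect_le continuous_intros)
    have "emeasure ?M {..a} = emeasure lborel (v2 -` {..a})"
      by (subst emeasure_distr) (use borel_closed[OF closed_eucl_atMost, of a] in auto)
    also have "... = (\<integral>\<^sup>+z. indicator (v2 -` {..a}) z \<partial>lborel)"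
      by (rule nn_integral_indicator[symmetric]) (use measurable_sets[OF v2_measurable borel_closed[OF closed_eucl_atMost, of a]] in simp)
    also have "... = (\<integral>\<^sup>+z. (\<Prod>i\<in>UNIV. indicator {p. 2 * ((fst p)\<^sup>2 + (snd p)\<^sup>2) \<le> a $ i} (fst z $ i, snd z $ i)) \<partial>lborel)"
      by (intro nn_integral_cong) (auto simp: indicator_def less_eq_vec_def prod_zero_iff)
    also have "... = (\<Prod>i\<in>UNIV. \<integral>\<^sup>+p. indicator {p. 2 * ((fst p)\<^sup>2 + (snd p)\<^sup>2) \<le> a $ i} p \<partial>lborel)"
      by (rule nn_integral_prod_planes) (rule borel_measurable_indicator[OF disc])
    also have "... = (\<Prod>i\<in>UNIV. ennreal (pi / 2 * max (a $ i) 0))"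
      by (intro prod.cong refl) (simp only: nn_integral_indicator sets_lborel disc emeasure_disc)
    finally show ?thesis .
  qed
  show "emeasure ?M X = emeasure ?N X" if "X \<in> ?E" for X
  proof -
    from that obtain a where X: "X = {..a}" by auto
    have "emeasure ?N X = (\<integral>\<^sup>+\<rho>. (ennreal ((pi / 2) ^ CARD('n)) * indicator orthant \<rho>) * indicator X \<rho> \<partial>lborel)"
      unfolding X by (rule emeasure_density) auto
    \<comment> \<open>Inside the orthant the box becomes the condition
      \<open>0 < \<rho> $ i \<le> a $ i\<close> in each coordinate, so the integrand has product
      form.\<close>
    also have "... = (\<integral>\<^sup>+\<rho>. (\<Prod>i\<in>(UNIV::'n set). ennreal (pi / 2) * indicator {0<..a $ i} (\<rho> $ i)) \<partial>lborel)"
    proof (intro nn_integral_cong)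
      fix \<rho> :: "real^'n"
      have "(\<Prod>i\<in>(UNIV::'n set). indicator {0<..a $ i} (\<rho> $ i) :: ennreal) = indicator orthant \<rho> * indicator X \<rho>"
        unfolding X by (auto simp: indicator_def less_eq_vec_def orthant_def prod_zero_iff)
      moreover have "ennreal ((pi / 2) ^ CARD('n)) = (\<Prod>i\<in>(UNIV::'n set). ennreal (pi / 2))" by (simp add: ennreal_power)
      ultimately show "(ennreal ((pi / 2) ^ CARD('n)) * indicator orthant \<rho>) * indicator X \<rho> = (\<Prod>i\<in>(UNIV::'n set). ennreal (pi / 2) * indicator {0<..a $ i} (\<rho> $ i))"
        by (simp add: prod.distrib mult.assoc)
    qed
    also have "... = (\<Prod>i\<in>(UNIV::'n set). \<integral>\<^sup>+r. ennreal (pi / 2) * indicator {0<..a $ i} r \<partial>lborel)"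
      by (rule nn_integral_lborel_prod_vec) measurable
    also have "... = (\<Prod>i\<in>UNIV. ennreal (pi / 2 * max (a $ i) 0))"
    proof (intro prod.cong refl)
      fix i
      have "(\<integral>\<^sup>+r. ennreal (pi / 2) * indicator {0<..a $ i} r \<partial>lborel) = ennreal (pi / 2) * emeasure lborel {0<..a $ i}"
        by (rule nn_integral_cmult_indicator) simp
      also have "emeasure lborel {0<..a $ i} = ennreal (max (a $ i) 0)" by (cases "0 \<le> a $ i") (auto simp: max_def)
      finally show "(\<integral>\<^sup>+r. ennreal (pi / 2) * indicator {0<..a $ i} r \<partial>lborel) = ennreal (pi / 2 * max (a $ i) 0)"
        by (simp only: ennreal_mult'[OF pi_half_ge_zero])
    qed
    finally show ?thesis unfolding X val ..
  qed
  have sets: "sets borel = sigma_sets UNIV ?E" by (subst borel_eq_atMost) simp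
  show "sets ?M = sigma_sets UNIV ?E" using sets by simp
  show "sets ?N = sigma_sets UNIV ?E" using sets by simp
  show "range (\<lambda>k. {..(\<chi> i. real k) :: real^'n}) \<subseteq> ?E" by auto
  show "(\<Union>k. {..(\<chi> i. real k) :: real^'n}) = UNIV"
  proof (intro set_eqI iffI UNIV_I)
    fix x :: "real^'n"
    obtain k where k: "norm x \<le> real k" using real_arch_simple by blast
    have "x \<le> (\<chi> i. real k)" using component_le_norm_cart[of x] k by (auto simp: less_eq_vec_def intro: order_trans[OF abs_ge_self] order_trans)
    then show "x \<in> (\<Union>k. {..(\<chi> i. real k)})" by auto
  qed
  show "emeasure ?M {..(\<chi> i. real k)} \<noteq> \<infinity>" for k unfolding val by (simp add: ennreal_prod_eq_top power_eq_top_ennreal)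
qed

lemma integral_v2:
  fixes \<phi> :: "real^'n \<Rightarrow> complex"
  assumes [measurable]: "\<phi> \<in> borel_measurable borel"
  shows "(\<integral>z. \<phi> (v2 z) \<partial>lborel) = of_real ((pi / 2) ^ CARD('n)) * (\<integral>\<rho>. indicator orthant \<rho> *\<^sub>R \<phi> \<rho> \<partial>lborel)"
proof -
  have "(\<integral>z. \<phi> (v2 z) \<partial>lborel) = (\<integral>\<rho>. \<phi> \<rho> \<partial>distr lborel borel v2)" by (rule integral_distr[symmetric]) auto
  also have "... = (\<integral>\<rho>. \<phi> \<rho> \<partial>density lborel (\<lambda>\<rho>. ennreal ((pi / 2) ^ CARD('n) * indicator orthant \<rho>)))"
    unfolding distr_v2 by (simp add: ennreal_mult ennreal_indicator)
  also have "... = (\<integral>\<rho>. ((pi / 2) ^ CARD('n) * indicator orthant \<rho>) *\<^sub>R \<phi> \<rho> \<partial>lborel)" by (rule integral_density) auto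
  also have "... = (\<integral>\<rho>. of_real ((pi / 2) ^ CARD('n)) * (indicator orthant \<rho> *\<^sub>R \<phi> \<rho>) \<partial>lborel)"
    by (simp add: scaleR_conv_of_real mult_ac)
  also have "... = of_real ((pi / 2) ^ CARD('n)) * (\<integral>\<rho>. indicator orthant \<rho> *\<^sub>R \<phi> \<rho> \<partial>lborel)" by (rule integral_mult_right_zero)
  finally show ?thesis .
qed

text \<open>Null sets pull back to null sets under \<open>v2\<close>, and almost every point is
  mapped into the open orthant. A symbol known almost everywhere on the orthant therefore determines
  its radial function almost everywhere.\<close>

lemma AE_v2:
  fixes P :: "real^'n \<Rightarrow> bool"
  assumes P: "AE \<rho> in lborel. \<rho> \<in> orthant \<longrightarrow> P \<rho>"
  shows "AE z in lborel. v2 z \<in> orthant \<and> P (v2 z)"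
proof -
  obtain N where N': "{\<rho> \<in> space lborel. \<not> (\<rho> \<in> orthant \<longrightarrow> P \<rho>)} \<subseteq> N" "emeasure lborel N = 0" "N \<in> sets lborel" by (rule AE_E[OF P])
  have N: "N \<in> null_sets lborel" "{\<rho>. \<not> (\<rho> \<in> orthant \<longrightarrow> P \<rho>)} \<subseteq> N" using N' by (simp_all add: null_sets_def)
  have Nb [measurable]: "N \<in> sets borel" using N(1) by (simp add: null_sets_def)
  have "AE \<rho> in lborel. \<rho> \<notin> N" by (rule AE_not_in[OF N(1)])
  then have "AE \<rho> in (density lborel (\<lambda>\<rho>. ennreal ((pi / 2) ^ CARD('n)) * indicator orthant \<rho>)). \<rho> \<in> orthant \<and> \<rho> \<notin> N"
    by (subst AE_density) (auto simp: indicator_def elim!: eventually_mono split: if_splits)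
  then have "AE \<rho> in distr lborel borel v2. \<rho> \<in> orthant \<and> \<rho> \<notin> N" unfolding distr_v2 .
  then have "AE z in lborel. v2 z \<in> orthant \<and> v2 z \<notin> N" by (subst (asm) AE_distr_iff) auto
  then show ?thesis by (rule eventually_mono) (use N(2) in auto)
qed

section \<open>Rotations of a phase plane\<close>

text \<open>A shear translates one group of variables by an amount that depends on the other group,
  so its invariance of measure reduces to Tonelli and translation invariance. Rotations are
  assembled from shears.\<close>

definition shear1 :: "'n::finite \<Rightarrow> real \<Rightarrow> (real^'n) \<times> (real^'n) \<Rightarrow> (real^'n) \<times> (real^'n)" where
  "shear1 i a z = (fst z + (a * snd z $ i) *\<^sub>R axis i 1, snd z)"

definition shear2 :: "'n::finite \<Rightarrow> real \<Rightarrow> (real^'n) \<times> (real^'n) \<Rightarrow> (real^'n) \<times> (real^'n)" where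
  "shear2 i a z = (fst z, snd z + (a * fst z $ i) *\<^sub>R axis i 1)"

lemma shear_measurable [measurable]: "shear1 i a \<in> borel_measurable borel" "shear2 i a \<in> borel_measurable borel"
  unfolding shear1_def[abs_def] shear2_def[abs_def] by (intro borel_measurable_continuous_onI continuous_intros)+

lemma nn_integral_translate:
  fixes f :: "'a::euclidean_space \<Rightarrow> ennreal"
  assumes "f \<in> borel_measurable borel"
  shows "(\<integral>\<^sup>+x. f (x + c) \<partial>lborel) = (\<integral>\<^sup>+x. f x \<partial>lborel)"
proof -
  have "(\<integral>\<^sup>+x. f x \<partial>lborel) = (\<integral>\<^sup>+x. f x \<partial>distr lborel borel ((+) c))" by (simp add: lborel_distr_plus)
  also have "... = (\<integral>\<^sup>+x. f (c + x) \<partial>lborel)" using assms by (intro nn_integral_distr) auto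
  finally show ?thesis by (simp add: add.commute)
qed

lemma nn_integral_shear:
  fixes f :: "(real^'n) \<times> (real^'n) \<Rightarrow> ennreal"
  assumes f [measurable]: "f \<in> borel_measurable borel"
  shows "(\<integral>\<^sup>+z. f (shear1 i a z) \<partial>lborel) = (\<integral>\<^sup>+z. f z \<partial>lborel)"
    "(\<integral>\<^sup>+z. f (shear2 i a z) \<partial>lborel) = (\<integral>\<^sup>+z. f z \<partial>lborel)"
proof -
  have sec1: "(\<lambda>x. f (x, y)) \<in> borel_measurable borel" for y
    by (rule measurable_compose[OF _ f]) (intro borel_measurable_continuous_onI continuous_intros)
  have sec2: "(\<lambda>y. f (x, y)) \<in> borel_measurable borel" for x
    by (rule measurable_compose[OF _ f]) (intro borel_measurable_continuous_onI continuous_intros)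
  have "(\<integral>\<^sup>+z. f (shear1 i a z) \<partial>lborel) = (\<integral>\<^sup>+y. \<integral>\<^sup>+x. f (shear1 i a (x, y)) \<partial>lborel \<partial>lborel)"
    by (rule nn_integral_lborel_pair(2)) measurable
  also have "... = (\<integral>\<^sup>+y. \<integral>\<^sup>+x. f (x, y) \<partial>lborel \<partial>lborel)"
    unfolding shear1_def fst_conv snd_conv by (intro nn_integral_cong nn_integral_translate sec1)
  also have "... = (\<integral>\<^sup>+z. f z \<partial>lborel)" by (rule nn_integral_lborel_pair(2)[symmetric]) measurable
  finally show "(\<integral>\<^sup>+z. f (shear1 i a z) \<partial>lborel) = (\<integral>\<^sup>+z. f z \<partial>lborel)" .
  have "(\<integral>\<^sup>+z. f (shear2 i a z) \<partial>lborel) = (\<integral>\<^sup>+x. \<integral>\<^sup>+y. f (shear2 i a (x, y)) \<partial>lborel \<partial>lborel)"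
    by (rule nn_integral_lborel_pair(1)) measurable
  also have "... = (\<integral>\<^sup>+x. \<integral>\<^sup>+y. f (x, y) \<partial>lborel \<partial>lborel)"
    unfolding shear2_def fst_conv snd_conv by (intro nn_integral_cong nn_integral_translate sec2)
  also have "... = (\<integral>\<^sup>+z. f z \<partial>lborel)" by (rule nn_integral_lborel_pair(1)[symmetric]) measurable
  finally show "(\<integral>\<^sup>+z. f (shear2 i a z) \<partial>lborel) = (\<integral>\<^sup>+z. f z \<partial>lborel)" .
qed

text \<open>Three shears compose to the rotation of the \<open>i\<close>-th plane when
  \<open>sin \<theta> \<noteq> 0\<close>; the outer coefficient is minus the tangent of half the
  angle.\<close>

definition plane_rotation :: "'n::finite \<Rightarrow> real \<Rightarrow> (real^'n) \<times> (real^'n) \<Rightarrow> (real^'n) \<times> (real^'n)" where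
  "plane_rotation i \<theta> = shear1 i (- (1 - cos \<theta>) / sin \<theta>) \<circ> shear2 i (sin \<theta>) \<circ> shear1 i (- (1 - cos \<theta>) / sin \<theta>)"

lemma plane_rotation_measurable [measurable]: "plane_rotation i \<theta> \<in> borel_measurable borel"
  unfolding plane_rotation_def comp_def by measurable

lemma plane_rotation_nth:
  assumes s: "sin \<theta> \<noteq> 0"
  shows "fst (plane_rotation i \<theta> z) $ k = (if k = i then cos \<theta> * fst z $ i - sin \<theta> * snd z $ i else fst z $ k)"
    "snd (plane_rotation i \<theta> z) $ k = (if k = i then sin \<theta> * fst z $ i + cos \<theta> * snd z $ i else snd z $ k)"
proof -
  let ?a = "- (1 - cos \<theta>) / sin \<theta>"
  have a1: "?a * sin \<theta> = cos \<theta> - 1" using s by simp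
  have a2: "?a * (1 + cos \<theta>) = - sin \<theta>"
  proof -
    have "(1 - cos \<theta>) * (1 + cos \<theta>) = sin \<theta> * sin \<theta>" using sin_cos_squared_add[of \<theta>] by (simp add: power2_eq_square algebra_simps)
    then show ?thesis using s by (simp add: field_simps)
  qed
  define x where "x = fst z $ i"
  define y where "y = snd z $ i"
  have 1: "y + sin \<theta> * (x + ?a * y) = sin \<theta> * x + cos \<theta> * y"
  proof -
    have "y + sin \<theta> * (x + ?a * y) = y + sin \<theta> * x + (?a * sin \<theta>) * y" by (simp only: distrib_left mult_ac add_ac)
    then show ?thesis unfolding a1 by (simp add: algebra_simps)
  qed
  have 2: "x + ?a * y + ?a * (sin \<theta> * x + cos \<theta> * y) = cos \<theta> * x - sin \<theta> * y"
  proof -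
    have "x + ?a * y + ?a * (sin \<theta> * x + cos \<theta> * y) = x + (?a * sin \<theta>) * x + (?a * (1 + cos \<theta>)) * y"
      by (simp only: distrib_left distrib_right mult_1_right mult.assoc add.assoc add.left_commute)
    then show ?thesis unfolding a1 a2 by (simp add: algebra_simps)
  qed
  have r: "plane_rotation i \<theta> z = (fst z + (?a * y) *\<^sub>R axis i 1 + (?a * (y + sin \<theta> * (x + ?a * y))) *\<^sub>R axis i 1, snd z + (sin \<theta> * (x + ?a * y)) *\<^sub>R axis i 1)"
    unfolding plane_rotation_def comp_def shear1_def shear2_def fst_conv snd_conv x_def y_def by (simp add: axis_def)
  show "fst (plane_rotation i \<theta> z) $ k = (if k = i then cos \<theta> * fst z $ i - sin \<theta> * snd z $ i else fst z $ k)"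
    unfolding r 1 using 2 by (auto simp: axis_def x_def[symmetric] y_def[symmetric])
  show "snd (plane_rotation i \<theta> z) $ k = (if k = i then sin \<theta> * fst z $ i + cos \<theta> * snd z $ i else snd z $ k)"
    unfolding r using 1 by (auto simp: axis_def x_def[symmetric] y_def[symmetric])
qed

text \<open>Each of the three shears preserves the measure, whatever its coefficient.\<close>

lemma distr_plane_rotation: "distr lborel borel (plane_rotation i \<theta>) = lborel"
proof (rule measure_eqI)
  fix A assume "A \<in> sets (distr lborel borel (plane_rotation i \<theta>))"
  then have [measurable]: "A \<in> sets borel" by simp
  have "emeasure (distr lborel borel (plane_rotation i \<theta>)) A = (\<integral>\<^sup>+z. indicator A z \<partial>distr lborel borel (plane_rotation i \<theta>))" by simp
  also have "... = (\<integral>\<^sup>+z. indicator A (plane_rotation i \<theta> z) \<partial>lborel)" by (rule nn_integral_distr) auto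
  also have "... = (\<integral>\<^sup>+z. indicator A (shear1 i (- (1 - cos \<theta>) / sin \<theta>) (shear2 i (sin \<theta>) z)) \<partial>lborel)"
    unfolding plane_rotation_def comp_def
    by (rule nn_integral_shear(1)[where f = "\<lambda>z. indicator A (shear1 i (- (1 - cos \<theta>) / sin \<theta>) (shear2 i (sin \<theta>) z))"]) measurable
  also have "... = (\<integral>\<^sup>+z. indicator A (shear1 i (- (1 - cos \<theta>) / sin \<theta>) z) \<partial>lborel)"
    by (rule nn_integral_shear(2)[where f = "\<lambda>z. indicator A (shear1 i (- (1 - cos \<theta>) / sin \<theta>) z)"]) measurable
  also have "... = (\<integral>\<^sup>+z. indicator A z \<partial>lborel)" by (rule nn_integral_shear(1)) measurable
  finally show "emeasure (distr lborel borel (plane_rotation i \<theta>)) A = emeasure lborel A" by simp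
qed simp

lemma v2_plane_rotation:
  assumes "sin \<theta> \<noteq> 0" shows "v2 (plane_rotation i \<theta> z) = v2 z"
proof -
  have "(cos \<theta> * x - sin \<theta> * y)\<^sup>2 + (sin \<theta> * x + cos \<theta> * y)\<^sup>2 = x\<^sup>2 + y\<^sup>2" for x y :: real
  proof -
    have "(cos \<theta> * x - sin \<theta> * y)\<^sup>2 + (sin \<theta> * x + cos \<theta> * y)\<^sup>2 = ((cos \<theta>)\<^sup>2 + (sin \<theta>)\<^sup>2) * (x\<^sup>2 + y\<^sup>2)" by algebra
    then show ?thesis by simp
  qed
  then have "v2 (plane_rotation i \<theta> z) $ k = v2 z $ k" for k
    by (cases "k = i") (simp_all only: v2_nth plane_rotation_nth[OF assms] if_True if_False refl)
  then show ?thesis by (simp only: vec_eq_iff simp_thms)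
qed

lemma wig_fun_plane_rotation:
  assumes "sin \<theta> \<noteq> 0"
  shows "cis \<theta> ^ \<alpha> i * wig_fun (\<alpha>, \<beta>) (plane_rotation i \<theta> z) = cis \<theta> ^ \<beta> i * wig_fun (\<alpha>, \<beta>) z"
proof -
  let ?z = "plane_rotation i \<theta> z"
  let ?R = "\<lambda>z. \<Prod>k\<in>UNIV - {i}. wig (\<alpha> k) (\<beta> k) (fst z $ k) (snd z $ k)"
  have split: "wig_fun (\<alpha>, \<beta>) z = wig (\<alpha> i) (\<beta> i) (fst z $ i) (snd z $ i) * ?R z" for z
    using wig_fun_split[of \<alpha> i "\<alpha> i" \<beta> "\<beta> i" z] by simp
  have R: "?R ?z = ?R z" by (intro prod.cong refl) (simp add: plane_rotation_nth[OF assms])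
  have "cis \<theta> ^ \<alpha> i * wig (\<alpha> i) (\<beta> i) (fst ?z $ i) (snd ?z $ i) = cis \<theta> ^ \<beta> i * wig (\<alpha> i) (\<beta> i) (fst z $ i) (snd z $ i)"
    using wig_rotate[of \<theta> "\<alpha> i" "\<beta> i" "fst z $ i" "snd z $ i"] by (simp add: plane_rotation_nth[OF assms])
  then show ?thesis unfolding split[of ?z] split[of z] R mult.assoc[symmetric] by (simp only:)
qed

text \<open>Rotating a plane in which the indices differ preserves the measure and the radial
  factor, so the integral equals itself times a phase different from 1.\<close>

lemma integral_radial_off_diagonal:
  fixes \<phi> :: "real^'n \<Rightarrow> complex" and \<alpha> \<beta> :: "'n mindex"
  assumes [measurable]: "\<phi> \<in> borel_measurable borel" and ne: "\<alpha> \<noteq> \<beta>"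
  shows "(\<integral>z. \<phi> (v2 z) * wig_fun (\<alpha>, \<beta>) z \<partial>lborel) = 0"
proof -
  obtain i where i: "\<alpha> i \<noteq> \<beta> i" using ne by auto
  define d where "d = real (\<alpha> i) - real (\<beta> i)"
  have d1: "1 \<le> \<bar>d\<bar>" unfolding d_def using i by linarith
  \<comment> \<open>With this angle the relative phase is \<open>cis (pi / 2)\<close> or
    \<open>cis (- (pi / 2))\<close>, neither of which is 1. As \<open>\<bar>d\<bar> \<ge> 1\<close>,
    the angle lies between 0 and \<open>pi / 2\<close>, so its sine does not vanish.\<close>
  define \<theta> where "\<theta> = pi / (2 * \<bar>d\<bar>)"
  have \<theta>: "0 < \<theta>" "\<theta> \<le> pi / 2" unfolding \<theta>_def using d1 by (auto simp: field_simps)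
  then have s: "sin \<theta> \<noteq> 0" using sin_gt_zero[of \<theta>] pi_gt_zero by (smt (verit) field_sum_of_halves)
  have [measurable]: "wig_fun (\<alpha>, \<beta>) \<in> borel_measurable borel" by (rule borel_measurable_continuous_onI[OF wig_fun_continuous])
  let ?F = "\<lambda>z. \<phi> (v2 z) * wig_fun (\<alpha>, \<beta>) z"
  let ?I = "\<integral>z. ?F z \<partial>lborel"
  have "?I = (\<integral>z. ?F z \<partial>distr lborel borel (plane_rotation i \<theta>))" by (simp add: distr_plane_rotation)
  also have "... = (\<integral>z. ?F (plane_rotation i \<theta> z) \<partial>lborel)" by (rule integral_distr) auto
  finally have "cis \<theta> ^ \<alpha> i * ?I = (\<integral>z. cis \<theta> ^ \<alpha> i * ?F (plane_rotation i \<theta> z) \<partial>lborel)" by simp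
  also have "... = (\<integral>z. cis \<theta> ^ \<beta> i * ?F z \<partial>lborel)" by (intro Bochner_Integration.integral_cong refl)
      (simp only: v2_plane_rotation[OF s] mult.left_commute[of _ "\<phi> _"] wig_fun_plane_rotation[OF s])
  finally have "cis \<theta> ^ \<alpha> i * ?I = cis \<theta> ^ \<beta> i * ?I" by simp
  moreover have "cis \<theta> ^ \<alpha> i \<noteq> cis \<theta> ^ \<beta> i"
  proof
    assume "cis \<theta> ^ \<alpha> i = cis \<theta> ^ \<beta> i"
    then have "cis (real (\<alpha> i) * \<theta>) = cis (real (\<beta> i) * \<theta>)" unfolding Complex.DeMoivre .
    then have "cis (real (\<alpha> i) * \<theta>) * cis (- (real (\<beta> i) * \<theta>)) = cis (real (\<beta> i) * \<theta>) * cis (- (real (\<beta> i) * \<theta>))" by simp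
    then have "cis (d * \<theta>) = 1" by (simp add: cis_mult d_def algebra_simps)
    moreover have "d * \<theta> = pi / 2 \<or> d * \<theta> = - (pi / 2)" unfolding \<theta>_def using d1 by (cases "d > 0") (auto simp: field_simps)
    ultimately have "cis (pi / 2) = 1 \<or> cis (- (pi / 2)) = 1" by metis
    then show False by (simp add: cis.ctr complex_eq_iff)
  qed
  ultimately show ?thesis by simp
qed

section \<open>Expansion of Wigner transforms in \<open>wig_fun\<close>\<close>

lemma summable_weight2: "(\<lambda>\<iota>::'n::finite mindex \<times> ('n mindex). 1 / weight2 \<iota> ^ 2) summable_on UNIV"
proof -
  let ?f = "\<lambda>\<alpha>::'n mindex. 1 / weight \<alpha> ^ 2"
  have S: "(?f has_sum infsum ?f UNIV) UNIV" using has_sum_infsum[OF summable_weight] .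
  have "(\<lambda>\<iota>::'n mindex \<times> ('n mindex). 1 / weight2 \<iota> ^ 2) summable_on Sigma UNIV (\<lambda>_. UNIV)"
  proof (rule summable_on_SigmaI)
    show "((\<lambda>\<beta>. 1 / weight2 (\<alpha>, \<beta>) ^ 2) has_sum ?f \<alpha> * infsum ?f UNIV) UNIV" for \<alpha> :: "'n mindex"
      using has_sum_cmult_right[OF S, of "?f \<alpha>"] by (simp add: weight2_def power_mult_distrib)
    show "(\<lambda>\<alpha>. ?f \<alpha> * infsum ?f UNIV) summable_on UNIV" by (rule summable_on_cmult_left[OF summable_weight])
  qed simp
  then show ?thesis by simp
qed

lemma infinite_pairs: "infinite (UNIV :: ('n::finite mindex \<times> 'n mindex) set)"
  using infinite_multi_indices[where 'n = 'n] by (simp add: finite_prod)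

lemma rapid_pairs:
  assumes a: "rapid weight a" and b: "rapid weight b"
  shows "rapid weight2 (\<lambda>\<iota>. \<kappa> * (a (fst \<iota>) * b (snd \<iota>)))" unfolding rapid_def
proof
  fix k
  obtain K1 where K1: "\<And>\<alpha>. cmod (a \<alpha>) * weight \<alpha> ^ k \<le> K1" using a unfolding rapid_def by blast
  obtain K2 where K2: "\<And>\<alpha>. cmod (b \<alpha>) * weight \<alpha> ^ k \<le> K2" using b unfolding rapid_def by blast
  have "cmod (\<kappa> * (a (fst \<iota>) * b (snd \<iota>))) * weight2 \<iota> ^ k \<le> cmod \<kappa> * (K1 * K2)" for \<iota>
  proof -
    have "0 \<le> cmod (b (snd \<iota>)) * weight (snd \<iota>) ^ k" "0 \<le> cmod (a (fst \<iota>)) * weight (fst \<iota>) ^ k"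
      using weight_pos[of "fst \<iota>"] weight_pos[of "snd \<iota>"] by simp_all
    then have "(cmod (a (fst \<iota>)) * weight (fst \<iota>) ^ k) * (cmod (b (snd \<iota>)) * weight (snd \<iota>) ^ k) \<le> K1 * K2"
      using K1[of "fst \<iota>"] by (intro mult_mono K1 K2) linarith+
    then have "cmod \<kappa> * ((cmod (a (fst \<iota>)) * weight (fst \<iota>) ^ k) * (cmod (b (snd \<iota>)) * weight (snd \<iota>) ^ k)) \<le> cmod \<kappa> * (K1 * K2)"
      by (rule mult_left_mono) simp
    then show ?thesis by (simp add: norm_mult weight2_def power_mult_distrib mult_ac)
  qed
  then show "\<exists>K. \<forall>\<iota>. cmod (\<kappa> * (a (fst \<iota>) * b (snd \<iota>))) * weight2 \<iota> ^ k \<le> K" by blast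
qed

text \<open>At a fixed point of phase space the form is continuous in each argument, so Hermite
  series can be inserted by \<open>hermite_series\<close>, one argument at a time.\<close>

lemma wig_form_dual:
  fixes f g :: "real^'n \<Rightarrow> complex"
  shows "g \<in> S_funs \<Longrightarrow> (\<lambda>f. if f \<in> S_funs then wig_form x \<xi> f g else 0) \<in> dual_vectors S_space"
    "f \<in> S_funs \<Longrightarrow> (\<lambda>g. if g \<in> S_funs then wig_form x \<xi> f g else 0) \<in> dual_vectors S_space"
proof -
  let ?I = "\<integral>p. decay (x + p /\<^sub>R 2) \<partial>lborel"
  note U = open_UNIV UNIV_not_empty
  have cl: "f \<in> S_funs \<Longrightarrow> g \<in> S_funs \<Longrightarrow> (\<lambda>x. f x + g x) \<in> S_funs"
      "f \<in> S_funs \<Longrightarrow> (\<lambda>x. c * f x) \<in> S_funs" for f g :: "real^'n \<Rightarrow> complex" and c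
    by (rule schwartz_add(1)[OF open_UNIV], assumption+) (rule schwartz_scale(1)[OF open_UNIV])
  { fix g :: "real^'n \<Rightarrow> complex" assume g: "g \<in> S_funs"
    have "wig_form x \<xi> (\<lambda>y. f1 y + f2 y) g = wig_form x \<xi> f1 g + wig_form x \<xi> f2 g"
      if "f1 \<in> S_funs" "f2 \<in> S_funs" for f1 f2 unfolding wig_form_def distrib_right distrib_left
      by (intro Bochner_Integration.integral_add wig_form_estimate(1) that g)
    moreover have "wig_form x \<xi> (\<lambda>y. c * f1 y) g = c * wig_form x \<xi> f1 g" for f1 c
      unfolding wig_form_def mult.assoc mult.left_commute[of _ c] by (rule integral_mult_right_zero)
    moreover have "cmod (wig_form x \<xi> f1 g) \<le> (?I * snorm UNIV 0 g) * snorm UNIV (2 * DIM(real^'n)) f1"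
      if "f1 \<in> S_funs" for f1 using wig_form_estimate(2)[OF that g, of x \<xi>] by (simp add: mult_ac)
    ultimately show "(\<lambda>f. if f \<in> S_funs then wig_form x \<xi> f g else 0) \<in> dual_vectors S_space"
      by (intro dual_schwartzI[OF U, where K = "?I * snorm UNIV 0 g" and m = "2 * DIM(real^'n)"]) (simp_all add: cl) }
  { fix f :: "real^'n \<Rightarrow> complex" assume f: "f \<in> S_funs"
    have "wig_form x \<xi> f (\<lambda>y. g1 y + g2 y) = wig_form x \<xi> f g1 + wig_form x \<xi> f g2"
      if "g1 \<in> S_funs" "g2 \<in> S_funs" for g1 g2 unfolding wig_form_def distrib_left
      by (intro Bochner_Integration.integral_add wig_form_estimate(1) that f)
    moreover have "wig_form x \<xi> f (\<lambda>y. c * g1 y) = c * wig_form x \<xi> f g1" for g1 c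
      unfolding wig_form_def mult.left_commute[of _ c] by (rule integral_mult_right_zero)
    moreover have "cmod (wig_form x \<xi> f g1) \<le> (?I * snorm UNIV (2 * DIM(real^'n)) f) * snorm UNIV 0 g1"
      if "g1 \<in> S_funs" for g1 using wig_form_estimate(2)[OF f that, of x \<xi>] by (simp add: mult_ac)
    ultimately show "(\<lambda>g. if g \<in> S_funs then wig_form x \<xi> f g else 0) \<in> dual_vectors S_space"
      by (intro dual_schwartzI[OF U, where K = "?I * snorm UNIV (2 * DIM(real^'n)) f" and m = 0]) (simp_all add: cl) }
qed

text \<open>The mechanism of \<open>hermite_series\<close> over pairs of multi-indices: rapid decay
  in \<open>weight2\<close> beats the polynomial growth of the norms of
  \<open>wig_fun\<close>.\<close>

lemma rapid_wig_series:
  fixes c :: "'n::finite mindex \<times> 'n mindex \<Rightarrow> complex"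
  assumes c: "rapid weight2 c"
  shows "(\<lambda>z. \<Sum>\<^sub>\<infinity>\<iota>. c \<iota> * wig_fun \<iota> z) \<in> S_funs"
    "(\<lambda>\<iota>. c \<iota> * wig_fun \<iota> z) summable_on UNIV"
    "T \<in> dual_vectors S_space \<Longrightarrow> ((\<lambda>\<iota>. c \<iota> * T (wig_fun \<iota>)) has_sum T (\<lambda>z. \<Sum>\<^sub>\<infinity>\<iota>. c \<iota> * wig_fun \<iota> z)) UNIV"
proof -
  have F: "(\<lambda>z. c \<iota> * wig_fun \<iota> z) \<in> S_funs" for \<iota> by (rule schwartz_scale(1)[OF open_UNIV wig_fun_schwartz])
  have S: "(\<lambda>\<iota>. snorm UNIV m (\<lambda>z. c \<iota> * wig_fun \<iota> z)) summable_on UNIV" for m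
    by (rule rapid_summable[where w = weight2, OF weight2_ge_1 summable_weight2 c wig_fun_schwartz poly_bounded_snorm_wig])
  show "(\<lambda>z. \<Sum>\<^sub>\<infinity>\<iota>. c \<iota> * wig_fun \<iota> z) \<in> S_funs" by (rule schwartz_infsum(1)[OF infinite_pairs F S])
  show "(\<lambda>\<iota>. c \<iota> * wig_fun \<iota> z) summable_on UNIV"
  proof (rule abs_summable_summable)
    have "[] \<in> lists (Basis :: ((real^'n) \<times> (real^'n)) set)" by (rule lists.Nil)
    from schwartz_infsum(2)[OF infinite_pairs F S this, of z]
    show "(\<lambda>\<iota>. norm (c \<iota> * wig_fun \<iota> z)) summable_on UNIV" by (simp only: partial_deriv_def foldr.simps id_apply)
  qed
  assume T: "T \<in> dual_vectors S_space"
  have "T (\<lambda>z. c \<iota> * wig_fun \<iota> z) = c \<iota> * T (wig_fun \<iota>)" for \<iota> by (rule dual_vectorsD(2)[OF T]) (simp add: wig_fun_schwartz)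
  then show "((\<lambda>\<iota>. c \<iota> * T (wig_fun \<iota>)) has_sum T (\<lambda>z. \<Sum>\<^sub>\<infinity>\<iota>. c \<iota> * wig_fun \<iota> z)) UNIV"
    using dual_has_sum[OF infinite_pairs F S T] by simp
qed

text \<open>Expanding \<open>f\<close> and then \<open>g\<close> gives an iterated sum. Rapid decay
  of both coefficient families makes the sum over pairs summable, which merges the two sums.\<close>

lemma wig_form_expansion:
  fixes f g :: "real^'n \<Rightarrow> complex"
  assumes f: "f \<in> S_funs" and g: "g \<in> S_funs"
  shows "wig_form x \<xi> f g = (\<Sum>\<^sub>\<infinity>\<iota>. hcoeff (fst \<iota>) f * hcoeff (snd \<iota>) g * wig_fun \<iota> (x, \<xi>))"
proof -
  have 1: "((\<lambda>\<alpha>. hcoeff \<alpha> f * wig_form x \<xi> (hermite_fun \<alpha>) g) has_sum wig_form x \<xi> f g) UNIV"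
    using hermite_series(3)[OF rapid_hcoeff[OF f] wig_form_dual(1)[OF g, of x \<xi>]] hermite_expansion[OF f] f
    by (simp add: hermite_fun_schwartz)
  have 2: "((\<lambda>\<beta>. hcoeff \<beta> g * wig_fun (\<alpha>, \<beta>) (x, \<xi>)) has_sum wig_form x \<xi> (hermite_fun \<alpha>) g) UNIV" for \<alpha>
    using hermite_series(3)[OF rapid_hcoeff[OF g] wig_form_dual(2)[OF hermite_fun_schwartz, of x \<xi> \<alpha>]] hermite_expansion[OF g] g
    by (simp add: hermite_fun_schwartz wig_form_hermite)
  let ?F = "\<lambda>\<iota>. hcoeff (fst \<iota>) f * hcoeff (snd \<iota>) g * wig_fun \<iota> (x, \<xi>)"
  have s: "?F summable_on UNIV"
    using rapid_wig_series(2)[OF rapid_pairs[OF rapid_hcoeff[OF f] rapid_hcoeff[OF g], of 1], of "(x, \<xi>)"] by simp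
  have "wig_form x \<xi> f g = (\<Sum>\<^sub>\<infinity>\<alpha>. hcoeff \<alpha> f * wig_form x \<xi> (hermite_fun \<alpha>) g)" by (rule infsumI[OF 1, symmetric])
  also have "... = (\<Sum>\<^sub>\<infinity>\<alpha>. \<Sum>\<^sub>\<infinity>\<beta>. ?F (\<alpha>, \<beta>))"
  proof (rule infsum_cong)
    fix \<alpha> :: "'n mindex"
    show "hcoeff \<alpha> f * wig_form x \<xi> (hermite_fun \<alpha>) g = (\<Sum>\<^sub>\<infinity>\<beta>. ?F (\<alpha>, \<beta>))"
      using infsumI[OF has_sum_cmult_right[OF 2, of "hcoeff \<alpha> f"]] by (simp add: mult.assoc)
  qed
  also have "... = infsum ?F (Sigma UNIV (\<lambda>_. UNIV))" by (rule infsum_Sigma_banach) (use s in simp)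
  finally show ?thesis by simp
qed

text \<open>The pointwise double series converges in the Schwartz space over phase space, so a
  continuous functional may be applied term by term.\<close>

lemma wigner_expansion:
  fixes f g :: "real^'n \<Rightarrow> complex"
  assumes f: "f \<in> S_funs" and g: "g \<in> S_funs"
    and T: "T \<in> dual_vectors S_space"
  shows "((\<lambda>\<iota>. of_real ((2 * pi) powr (- (real CARD('n) / 2))) * (hcoeff (fst \<iota>) f * hcoeff (snd \<iota>) g) * T (wig_fun \<iota>)) has_sum
     T (wigner f (\<lambda>x. cnj (g x)))) UNIV"
proof -
  let ?\<kappa> = "of_real ((2 * pi) powr (- (real CARD('n) / 2))) :: complex"
  have "wigner f (\<lambda>x. cnj (g x)) = (\<lambda>z. \<Sum>\<^sub>\<infinity>\<iota>. ?\<kappa> * (hcoeff (fst \<iota>) f * hcoeff (snd \<iota>) g) * wig_fun \<iota> z)"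
  proof
    fix z :: "(real^'n) \<times> (real^'n)"
    obtain x \<xi> where z: "z = (x, \<xi>)" by (cases z)
    have "wigner f (\<lambda>x. cnj (g x)) z = ?\<kappa> * (\<Sum>\<^sub>\<infinity>\<iota>. hcoeff (fst \<iota>) f * hcoeff (snd \<iota>) g * wig_fun \<iota> z)"
      unfolding z wigner_eq_wig_form[OF f g] wig_form_expansion[OF f g] ..
    also have "... = (\<Sum>\<^sub>\<infinity>\<iota>. ?\<kappa> * (hcoeff (fst \<iota>) f * hcoeff (snd \<iota>) g * wig_fun \<iota> z))" by (rule infsum_cmult_right'[symmetric])
    finally show "wigner f (\<lambda>x. cnj (g x)) z = (\<Sum>\<^sub>\<infinity>\<iota>. ?\<kappa> * (hcoeff (fst \<iota>) f * hcoeff (snd \<iota>) g) * wig_fun \<iota> z)"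
      by (simp only: mult.assoc)
  qed
  then show ?thesis using rapid_wig_series(3)[OF rapid_pairs[OF rapid_hcoeff[OF f] rapid_hcoeff[OF g], of ?\<kappa>] T] by (simp only:)
qed

section \<open>Radial symbols as tempered functions\<close>

lemma integrable_lebesgue_on:
  fixes f :: "'a::euclidean_space \<Rightarrow> 'b::{banach, second_countable_topology}"
  assumes "integrable lborel f" "S \<in> sets lebesgue"
  shows "integrable (lebesgue_on S) f"
proof -
  have "integrable lebesgue f" using assms(1) integrable_completion[of f lborel] borel_measurable_integrable[OF assms(1)] by blast
  then show ?thesis using assms(2) by (simp add: integrable_restrict_space integrable_mult_indicator)
qed

lemma inverse_weight_measurable:
  "(\<lambda>x::'a::euclidean_space. 1 / (1 + norm x) ^ k) \<in> borel_measurable borel" by measurable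

lemma mult_le_sum_squares:
  fixes x y :: real
  shows "x * y \<le> x\<^sup>2 + y\<^sup>2"
proof -
  have "2 * (x * y) \<le> x\<^sup>2 + y\<^sup>2" using sum_squares_bound[of x y] by (simp only: mult.assoc)
  moreover have "0 \<le> x\<^sup>2 + y\<^sup>2" by simp
  ultimately show ?thesis by linarith
qed

text \<open>The hypothesis is square integrability, while a pairing wants an integrable first power.
  For \<open>s / p\<close> and \<open>b\<close> both square integrable, the product is dominated by
  \<open>(s / p)\<^sup>2 + b\<^sup>2\<close>.\<close>

lemma polynomially_L2_decay:
  fixes \<sigma> :: "real^'n \<Rightarrow> complex"
  assumes \<sigma>: "polynomially_L2 \<sigma>"
  shows "\<exists>k. integrable (lebesgue_on orthant) (\<lambda>\<rho>. cmod (\<sigma> \<rho>) * (1 / (1 + norm \<rho>) ^ k))"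
proof -
  obtain n :: "'n mindex" where m: "\<sigma> \<in> borel_measurable (lebesgue_on orthant)"
    and L: "L2_on orthant (\<lambda>\<rho>. \<sigma> \<rho> / of_real (\<Prod>l\<in>UNIV. (1 + \<rho> $ l) ^ n l))" using \<sigma> unfolding polynomially_L2_def by blast
  let ?P = "\<lambda>\<rho>::real^'n. \<Prod>l\<in>UNIV. (1 + \<rho> $ l) ^ n l"
  let ?D = "DIM(real^'n)"
  define N where "N = (\<Sum>l\<in>UNIV. n l)"
  have sets: "orthant \<in> sets (lebesgue :: (real^'n) measure)" by (simp add: borel_open[OF open_orthant])
  have I1: "integrable (lebesgue_on orthant) (\<lambda>\<rho>. (cmod (\<sigma> \<rho> / of_real (?P \<rho>)))\<^sup>2)" using L unfolding L2_on_def by blast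
  have I2: "integrable (lebesgue_on orthant) (\<lambda>\<rho>::real^'n. 1 / (1 + norm \<rho>) ^ (2 * ?D))"
    by (rule integrable_lebesgue_on[OF integrable_weight sets])
  have w: "(\<lambda>\<rho>::real^'n. 1 / (1 + norm \<rho>) ^ k) \<in> borel_measurable (lebesgue_on orthant)" for k
    by (intro measurable_restrict_space1 measurable_completion) (use inverse_weight_measurable in simp)
  \<comment> \<open>\<open>N\<close> powers dominate the polynomial of the hypothesis; the other
    \<open>?D\<close> powers form a square-integrable weight.\<close>
  have "integrable (lebesgue_on orthant) (\<lambda>\<rho>. cmod (\<sigma> \<rho>) * (1 / (1 + norm \<rho>) ^ (N + ?D)))"
  proof (rule Bochner_Integration.integrable_bound[OF Bochner_Integration.integrable_add[OF I1 I2]])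
    show "(\<lambda>\<rho>. cmod (\<sigma> \<rho>) * (1 / (1 + norm \<rho>) ^ (N + ?D))) \<in> borel_measurable (lebesgue_on orthant)"
      by (intro borel_measurable_times w measurable_compose[OF m borel_measurable_norm])
    show "AE \<rho> in lebesgue_on orthant. norm (cmod (\<sigma> \<rho>) * (1 / (1 + norm \<rho>) ^ (N + ?D)))
        \<le> norm ((cmod (\<sigma> \<rho> / of_real (?P \<rho>)))\<^sup>2 + 1 / (1 + norm \<rho>) ^ (2 * ?D))"
    proof (rule AE_I2)
      fix \<rho> :: "real^'n" assume "\<rho> \<in> space (lebesgue_on orthant)"
      then have pos: "0 < \<rho> $ l" for l by (simp add: orthant_def)
      have pos1: "0 < 1 + \<rho> $ l" for l using pos[of l] by linarith
      have P1: "?P \<rho> > 0" by (intro prod_pos zero_less_power pos1)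
      have "?P \<rho> \<le> (\<Prod>l\<in>UNIV. (1 + norm \<rho>) ^ n l)"
        using pos component_le_norm_cart[of \<rho>] by (intro prod_mono conjI power_mono zero_le_power) (auto simp: less_imp_le intro: order_trans[OF abs_ge_self] add_nonneg_nonneg)
      then have P2: "?P \<rho> \<le> (1 + norm \<rho>) ^ N" by (simp only: N_def power_sum)
      define s where "s = cmod (\<sigma> \<rho>)"
      define p where "p = ?P \<rho>"
      define b where "b = 1 / (1 + norm \<rho>) ^ ?D"
      have q: "0 < (1 + norm \<rho>) ^ N" "0 \<le> s" "0 \<le> b" by (simp_all add: s_def b_def zero_less_power add_pos_nonneg)
      have "s * (1 / (1 + norm \<rho>) ^ (N + ?D)) = s * (1 / (1 + norm \<rho>) ^ N) * b" unfolding b_def by (simp add: power_add)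
      also have "... \<le> s * (1 / p) * b"
        using P1 P2 q by (intro mult_right_mono mult_left_mono divide_left_mono mult_pos_pos) (simp_all add: p_def)
      also have "... \<le> (s / p)\<^sup>2 + b\<^sup>2" using mult_le_sum_squares[of "s / p" b] by simp
      also have "b\<^sup>2 = 1 / (1 + norm \<rho>) ^ (2 * ?D)"
        unfolding b_def by (simp add: power_divide power_mult mult.commute flip: power_mult)
      also have "s / p = cmod (\<sigma> \<rho> / of_real (?P \<rho>))"
        unfolding s_def p_def norm_divide norm_of_real using P1 by (simp only: abs_of_pos)
      finally have "s * (1 / (1 + norm \<rho>) ^ (N + ?D)) \<le> (cmod (\<sigma> \<rho> / of_real (?P \<rho>)))\<^sup>2 + 1 / (1 + norm \<rho>) ^ (2 * ?D)" .
      moreover have "0 \<le> s * (1 / (1 + norm \<rho>) ^ (N + ?D))" using q by simp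
      ultimately show "norm (cmod (\<sigma> \<rho>) * (1 / (1 + norm \<rho>) ^ (N + ?D)))
        \<le> norm ((cmod (\<sigma> \<rho> / of_real (?P \<rho>)))\<^sup>2 + 1 / (1 + norm \<rho>) ^ (2 * ?D))" unfolding s_def real_norm_def by linarith
    qed
  qed
  then show ?thesis by blast
qed

text \<open>Composition with \<open>v2\<close> and the image-measure formula are used for Borel
  functions, whereas a symbol is Lebesgue measurable on the orthant. Real and imaginary part are
  replaced separately.\<close>

lemma borel_representative:
  fixes f :: "'a::euclidean_space \<Rightarrow> complex"
  assumes f: "f \<in> borel_measurable (lebesgue_on U)" and U: "U \<in> sets lebesgue"
  shows "\<exists>f'. f' \<in> borel_measurable borel \<and> (AE x in lborel. x \<in> U \<longrightarrow> f x = f' x)"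
proof -
  let ?g = "\<lambda>x. indicator U x *\<^sub>R f x"
  have g: "?g \<in> borel_measurable lebesgue" using f U by (subst (asm) borel_measurable_restrict_space_iff) auto
  obtain u where u: "u \<in> borel_measurable lborel" "AE x in lborel. Re (?g x) = u x"
    using completion_ex_borel_measurable_real[of "\<lambda>x. Re (?g x)" lborel] measurable_compose[OF g borel_measurable_Re] by blast
  obtain v where v: "v \<in> borel_measurable lborel" "AE x in lborel. Im (?g x) = v x"
    using completion_ex_borel_measurable_real[of "\<lambda>x. Im (?g x)" lborel] measurable_compose[OF g borel_measurable_Im] by blast
  have "AE x in lborel. x \<in> U \<longrightarrow> f x = Complex (u x) (v x)" using u(2) v(2) by eventually_elim (auto simp: complex_eq_iff)
  moreover have "(\<lambda>x. Complex (u x) (v x)) \<in> borel_measurable borel" using u(1) v(1) by (simp add: borel_measurable_complex_iff)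
  ultimately show ?thesis by blast
qed

lemma integrable_v2:
  fixes \<phi> :: "real^'n \<Rightarrow> real"
  assumes [measurable]: "\<phi> \<in> borel_measurable borel"
    and int: "integrable lborel (\<lambda>\<rho>. indicator orthant \<rho> *\<^sub>R \<phi> \<rho>)"
  shows "integrable lborel (\<lambda>z. \<phi> (v2 z))"
proof -
  have "integrable (density lborel (\<lambda>\<rho>. ennreal ((pi / 2) ^ CARD('n) * indicator orthant \<rho>))) \<phi> \<longleftrightarrow>
      integrable lborel (\<lambda>\<rho>. ((pi / 2) ^ CARD('n) * indicator orthant \<rho>) *\<^sub>R \<phi> \<rho>)" by (rule integrable_density) auto
  moreover have "integrable lborel (\<lambda>\<rho>. (pi / 2) ^ CARD('n) * (indicator orthant \<rho> *\<^sub>R \<phi> \<rho>))" by (intro integrable_mult_right int)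
  ultimately have "integrable (density lborel (\<lambda>\<rho>. ennreal ((pi / 2) ^ CARD('n) * indicator orthant \<rho>))) \<phi>" by (simp add: mult.assoc)
  then have "integrable (distr lborel borel v2) \<phi>" unfolding distr_v2 by (simp add: ennreal_mult ennreal_indicator)
  then show ?thesis by (subst (asm) integrable_distr_eq) auto
qed

lemma radial_v2: "radial \<sigma> z = \<sigma> (v2 z)" by (simp add: radial_def v2_def)

lemma norm_v2_le:
  fixes z :: "(real^'a) \<times> (real^'a)"
  shows "1 + norm (v2 z) \<le> 2 * (1 + norm z)\<^sup>2"
proof -
  have "norm (v2 z) \<le> (\<Sum>i\<in>UNIV. \<bar>v2 z $ i\<bar>)" by (rule norm_le_l1_cart)
  also have "... = 2 * ((norm (fst z))\<^sup>2 + (norm (snd z))\<^sup>2)"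
  proof -
    have n: "(norm x)\<^sup>2 = (\<Sum>i\<in>UNIV. (x $ i)\<^sup>2)" for x :: "real^'a" by (simp add: norm_vec_def L2_set_def sum_nonneg)
    show ?thesis unfolding n by (simp add: sum.distrib sum_distrib_left distrib_left)
  qed
  also have "... = 2 * (norm z)\<^sup>2" by (cases z) (simp add: norm_Pair)
  finally have "norm (v2 z) \<le> 2 * (norm z)\<^sup>2" .
  moreover have "(1 + norm z)\<^sup>2 = 1 + (norm z)\<^sup>2 + 2 * 1 * norm z" by (simp add: power2_sum)
  ultimately show ?thesis using norm_ge_zero[of z] by linarith
qed

lemma polynomially_L2_repr:
  fixes \<sigma> :: "real^'n \<Rightarrow> complex"
  assumes \<sigma>: "polynomially_L2 \<sigma>"
  shows "\<exists>\<sigma>'. \<sigma>' \<in> borel_measurable borel \<and> (AE \<rho> in lborel. \<rho> \<in> orthant \<longrightarrow> \<sigma> \<rho> = \<sigma>' \<rho>)"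
  using \<sigma> unfolding polynomially_L2_def by (intro borel_representative) (auto simp: borel_open[OF open_orthant])

text \<open>The weighted integral on the orthant is carried to phase space by \<open>v2\<close>. As
  \<open>v2\<close> grows quadratically, the exponent \<open>k\<close> becomes
  \<open>2 * k\<close>.\<close>

lemma radial_decay:
  fixes \<sigma> :: "real^'n \<Rightarrow> complex"
  assumes \<sigma>: "polynomially_L2 \<sigma>"
  shows "radial \<sigma> \<in> borel_measurable lebesgue"
    "\<exists>k. integrable lebesgue (\<lambda>z. cmod (radial \<sigma> z) * (1 / (1 + norm z) ^ k))"
proof -
  obtain \<sigma>' where [measurable]: "\<sigma>' \<in> borel_measurable borel" and AE: "AE \<rho> in lborel. \<rho> \<in> orthant \<longrightarrow> \<sigma> \<rho> = \<sigma>' \<rho>"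
    using polynomially_L2_repr[OF \<sigma>] by blast
  have "AE z in lborel. v2 z \<in> orthant \<and> \<sigma> (v2 z) = \<sigma>' (v2 z)" by (rule AE_v2[OF AE])
  then have AE': "AE z in lborel. \<sigma>' (v2 z) = radial \<sigma> z" by eventually_elim (simp add: radial_v2)
  have mb: "(\<lambda>z. \<sigma>' (v2 z)) \<in> borel_measurable borel" by measurable
  then have "(\<lambda>z. \<sigma>' (v2 z)) \<in> borel_measurable lebesgue" by (intro measurable_completion) simp
  \<comment> \<open>A Lebesgue measurable function need not stay measurable when composed with
    \<open>v2\<close>. It agrees almost everywhere with a Borel composition, and that is enough for
    the completed measure.\<close>
  then show m: "radial \<sigma> \<in> borel_measurable lebesgue" by (rule borel_measurable_AE[OF _ AE_completion[OF AE']])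
  obtain k where k: "integrable (lebesgue_on orthant) (\<lambda>\<rho>. cmod (\<sigma> \<rho>) * (1 / (1 + norm \<rho>) ^ k))"
    using polynomially_L2_decay[OF \<sigma>] by blast
  let ?h = "\<lambda>\<rho>::real^'n. indicator orthant \<rho> *\<^sub>R (cmod (\<sigma>' \<rho>) * (1 / (1 + norm \<rho>) ^ k))"
  have hb: "?h \<in> borel_measurable borel" by measurable
  have "integrable lebesgue (\<lambda>\<rho>. indicator orthant \<rho> *\<^sub>R (cmod (\<sigma> \<rho>) * (1 / (1 + norm \<rho>) ^ k)))"
    using k by (subst (asm) integrable_restrict_space) (auto simp: borel_open[OF open_orthant])
  moreover have "?h \<in> borel_measurable lebesgue" by (rule measurable_completion) (use hb in simp)
  moreover have "AE \<rho> in lebesgue. indicator orthant \<rho> *\<^sub>R (cmod (\<sigma> \<rho>) * (1 / (1 + norm \<rho>) ^ k)) = ?h \<rho>"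
    by (rule AE_completion) (use AE in \<open>eventually_elim, auto simp: indicator_def\<close>)
  ultimately have "integrable lebesgue ?h" by (rule integrable_cong_AE_imp)
  then have "integrable lborel ?h" using integrable_completion[of ?h lborel] hb by simp
  then have I: "integrable lborel (\<lambda>z. cmod (\<sigma>' (v2 z)) * (1 / (1 + norm (v2 z)) ^ k))"
    by (intro integrable_v2[where \<phi> = "\<lambda>\<rho>. cmod (\<sigma>' \<rho>) * (1 / (1 + norm \<rho>) ^ k)"]) measurable
  let ?r = "\<lambda>z. cmod (\<sigma>' (v2 z)) * (1 / (1 + norm z) ^ (2 * k))"
  have rb: "?r \<in> borel_measurable borel" by measurable
  have "integrable lborel ?r"
  proof (rule Bochner_Integration.integrable_bound)
    show "integrable lborel (\<lambda>z. 2 ^ k * (cmod (\<sigma>' (v2 z)) * (1 / (1 + norm (v2 z)) ^ k)))" by (intro integrable_mult_right I)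
    show "?r \<in> borel_measurable lborel" using rb by simp
    show "AE z in lborel. norm (?r z) \<le> norm (2 ^ k * (cmod (\<sigma>' (v2 z)) * (1 / (1 + norm (v2 z)) ^ k)))"
    proof (rule AE_I2)
      fix z :: "(real^'n) \<times> (real^'n)"
      have p: "0 < 1 + norm z" "0 < 1 + norm (v2 z)" by (simp_all add: add_pos_nonneg)
      have "(1 + norm (v2 z)) ^ k \<le> (2 * (1 + norm z)\<^sup>2) ^ k" by (rule power_mono[OF norm_v2_le]) simp
      then have "(1 + norm (v2 z)) ^ k \<le> 2 ^ k * (1 + norm z) ^ (2 * k)" by (simp only: power_mult_distrib power_mult)
      then have "1 / (1 + norm z) ^ (2 * k) \<le> 2 ^ k * (1 / (1 + norm (v2 z)) ^ k)" using p by (simp add: field_simps)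
      then have "?r z \<le> cmod (\<sigma>' (v2 z)) * (2 ^ k * (1 / (1 + norm (v2 z)) ^ k))" by (rule mult_left_mono) simp
      moreover have "0 \<le> ?r z" by simp
      ultimately show "norm (?r z) \<le> norm (2 ^ k * (cmod (\<sigma>' (v2 z)) * (1 / (1 + norm (v2 z)) ^ k)))"
        unfolding real_norm_def mult.left_commute[of _ "2 ^ k"] by linarith
    qed
  qed
  then have "integrable lebesgue ?r" using integrable_completion[of ?r lborel] rb by simp
  moreover have "(\<lambda>z. cmod (radial \<sigma> z) * (1 / (1 + norm z) ^ (2 * k))) \<in> borel_measurable lebesgue"
    by (intro borel_measurable_times measurable_compose[OF m borel_measurable_norm] measurable_completion) (use inverse_weight_measurable in simp)
  moreover have "AE z in lebesgue. ?r z = cmod (radial \<sigma> z) * (1 / (1 + norm z) ^ (2 * k))"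
    by (rule AE_completion) (use AE' in \<open>eventually_elim, simp\<close>)
  ultimately have "integrable lebesgue (\<lambda>z. cmod (radial \<sigma> z) * (1 / (1 + norm z) ^ (2 * k)))" by (rule integrable_cong_AE_imp)
  then show "\<exists>k. integrable lebesgue (\<lambda>z. cmod (radial \<sigma> z) * (1 / (1 + norm z) ^ k))" by blast
qed

lemma functional_radial_dual:
  assumes \<sigma>: "polynomially_L2 \<sigma>"
  shows "functional UNIV (radial \<sigma>) \<in> dual_vectors S_space" "tempered_function (radial \<sigma>)"
proof -
  obtain k where k: "integrable lebesgue (\<lambda>z. cmod (radial \<sigma> z) * (1 / (1 + norm z) ^ k))" using radial_decay(2)[OF \<sigma>] by blast
  have L: "lebesgue_on UNIV = lebesgue" by (rule lebesgue_on_UNIV_eq)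
  show 1: "functional UNIV (radial \<sigma>) \<in> dual_vectors S_space"
    by (rule functional_dual[OF open_UNIV UNIV_not_empty, where k = k]) (use k radial_decay(1)[OF \<sigma>] in \<open>simp_all only: L\<close>)
  have "integrable lebesgue (\<lambda>z. radial \<sigma> z * g z)" if "g \<in> S_funs" for g
    using schwartz_pairing(1)[OF open_UNIV _ _ that, of "radial \<sigma>" k] k radial_decay(1)[OF \<sigma>] by (simp only: L)
  then show "tempered_function (radial \<sigma>)" using 1 by (simp add: tempered_function_def)
qed

lemma functional_orthant_dual:
  assumes \<sigma>: "polynomially_L2 \<sigma>"
  shows "functional orthant \<sigma> \<in> dual_vectors (schwartz orthant)"
    "\<exists>C\<ge>0. \<exists>k. \<forall>g\<in>schwartz_functions orthant. cmod (functional orthant \<sigma> g) \<le> C * snorm orthant k g"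
proof -
  obtain k where k: "integrable (lebesgue_on orthant) (\<lambda>\<rho>. cmod (\<sigma> \<rho>) * (1 / (1 + norm \<rho>) ^ k))"
    using polynomially_L2_decay[OF \<sigma>] by blast
  have m: "\<sigma> \<in> borel_measurable (lebesgue_on orthant)" using \<sigma> by (simp add: polynomially_L2_def)
  show "functional orthant \<sigma> \<in> dual_vectors (schwartz orthant)" by (rule functional_dual[OF open_orthant orthant_nonempty m k])
  let ?I = "\<integral>\<rho>. cmod (\<sigma> \<rho>) * (1 / (1 + norm \<rho>) ^ k) \<partial>(lebesgue_on orthant)"
  have "0 \<le> ?I" by (intro integral_nonneg_AE AE_I2) simp
  moreover have "\<forall>g\<in>schwartz_functions orthant. cmod (functional orthant \<sigma> g) \<le> ?I * snorm orthant k g"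
    using schwartz_pairing(2)[OF open_orthant m k] by (simp add: functional_def)
  ultimately show "\<exists>C\<ge>0. \<exists>k. \<forall>g\<in>schwartz_functions orthant. cmod (functional orthant \<sigma> g) \<le> C * snorm orthant k g" by blast
qed

lemma wig_fun_diagonal:
  fixes \<alpha> :: "'n::finite mindex"
  shows "wig_fun (\<alpha>, \<alpha>) z = 2 ^ CARD('n) * (- 1) ^ (\<Sum>i\<in>UNIV. \<alpha> i) * laguerre_ext \<alpha> (v2 z)"
proof -
  have "wig_fun (\<alpha>, \<alpha>) z = (\<Prod>i\<in>UNIV. 2 * (- 1) ^ \<alpha> i * of_real (laguerre_fun1 (\<alpha> i) (v2 z $ i)))"
    unfolding wig_fun_def fst_conv snd_conv wig_diagonal v2_nth by (intro prod.cong refl) simp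
  then show ?thesis by (simp add: prod.distrib laguerre_ext_def power_sum)
qed

text \<open>Off the diagonal the rotation argument applies. On the diagonal
  \<open>wig_fun_diagonal\<close> contributes the sign and \<open>2 ^ CARD('n)\<close>, the image
  measure contributes \<open>(pi / 2) ^ CARD('n)\<close>, and together they leave
  \<open>pi ^ CARD('n)\<close>.\<close>

lemma functional_radial_wig:
  fixes \<sigma> :: "real^'n \<Rightarrow> complex"
  assumes \<sigma>: "polynomially_L2 \<sigma>"
  shows "functional UNIV (radial \<sigma>) (wig_fun (\<alpha>, \<beta>)) =
    (if \<alpha> = \<beta> then of_real pi ^ CARD('n) * (- 1) ^ (\<Sum>i\<in>UNIV. \<alpha> i) * functional orthant \<sigma> (laguerre_fun \<alpha>) else 0)"
proof -
  obtain \<sigma>' where [measurable]: "\<sigma>' \<in> borel_measurable borel" and AE: "AE \<rho> in lborel. \<rho> \<in> orthant \<longrightarrow> \<sigma> \<rho> = \<sigma>' \<rho>"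
    using polynomially_L2_repr[OF \<sigma>] by blast
  have "AE z in lborel. v2 z \<in> orthant \<and> \<sigma> (v2 z) = \<sigma>' (v2 z)" by (rule AE_v2[OF AE])
  then have "AE z in lborel. radial \<sigma> z = \<sigma>' (v2 z)" by eventually_elim (simp add: radial_v2)
  then have AE': "AE z in lebesgue. radial \<sigma> z = \<sigma>' (v2 z)" by (rule AE_completion)
  have wm [measurable]: "wig_fun \<iota> \<in> borel_measurable borel" for \<iota> :: "'n mindex \<times> 'n mindex"
    by (rule borel_measurable_continuous_onI[OF wig_fun_continuous])
  have lm [measurable]: "laguerre_ext \<alpha> \<in> borel_measurable borel" for \<alpha> :: "'n mindex"
    by (rule borel_measurable_continuous_onI[OF laguerre_ext_continuous])
  have mb: "(\<lambda>z. \<sigma>' (v2 z) * wig_fun (\<alpha>, \<beta>) z) \<in> borel_measurable borel" by measurable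
  have wl: "wig_fun (\<alpha>, \<beta>) \<in> borel_measurable lebesgue" by (rule measurable_completion) (use wm in simp)
  have "functional UNIV (radial \<sigma>) (wig_fun (\<alpha>, \<beta>)) = (\<integral>z. radial \<sigma> z * wig_fun (\<alpha>, \<beta>) z \<partial>lebesgue)"
    by (simp add: functional_def wig_fun_schwartz lebesgue_on_UNIV_eq)
  also have "... = (\<integral>z. \<sigma>' (v2 z) * wig_fun (\<alpha>, \<beta>) z \<partial>lebesgue)"
  proof (rule integral_cong_AE)
    show "(\<lambda>z. radial \<sigma> z * wig_fun (\<alpha>, \<beta>) z) \<in> borel_measurable lebesgue"
      by (rule borel_measurable_times[OF radial_decay(1)[OF \<sigma>] wl])
    show "(\<lambda>z. \<sigma>' (v2 z) * wig_fun (\<alpha>, \<beta>) z) \<in> borel_measurable lebesgue" by (rule measurable_completion) (use mb in simp)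
    show "AE z in lebesgue. radial \<sigma> z * wig_fun (\<alpha>, \<beta>) z = \<sigma>' (v2 z) * wig_fun (\<alpha>, \<beta>) z" using AE' by eventually_elim (simp only:)
  qed
  also have "... = (\<integral>z. \<sigma>' (v2 z) * wig_fun (\<alpha>, \<beta>) z \<partial>lborel)" by (rule integral_completion) (use mb in simp)
  finally have 1: "functional UNIV (radial \<sigma>) (wig_fun (\<alpha>, \<beta>)) = (\<integral>z. \<sigma>' (v2 z) * wig_fun (\<alpha>, \<beta>) z \<partial>lborel)" .
  show ?thesis
  proof (cases "\<alpha> = \<beta>")
    case False
    then show ?thesis unfolding 1 by (subst integral_radial_off_diagonal) auto
  next
    case True
    let ?C = "2 ^ CARD('n) * (- 1) ^ (\<Sum>i\<in>UNIV. \<alpha> i) :: complex"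
    let ?h = "\<lambda>\<rho>. indicator orthant \<rho> *\<^sub>R (\<sigma>' \<rho> * laguerre_ext \<alpha> \<rho>)"
    let ?h' = "\<lambda>\<rho>. indicator orthant \<rho> *\<^sub>R (\<sigma> \<rho> * laguerre_fun \<alpha> \<rho>)"
    have hb: "?h \<in> borel_measurable borel" by measurable
    have "(\<integral>z. \<sigma>' (v2 z) * wig_fun (\<alpha>, \<beta>) z \<partial>lborel) = (\<integral>z. ?C * (\<sigma>' (v2 z) * laguerre_ext \<alpha> (v2 z)) \<partial>lborel)"
      using True by (simp only: wig_fun_diagonal mult.left_commute[of "\<sigma>' _"])
    also have "... = ?C * (\<integral>z. \<sigma>' (v2 z) * laguerre_ext \<alpha> (v2 z) \<partial>lborel)" by (rule integral_mult_right_zero)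
    also have "(\<integral>z. \<sigma>' (v2 z) * laguerre_ext \<alpha> (v2 z) \<partial>lborel) = of_real ((pi / 2) ^ CARD('n)) * (\<integral>\<rho>. ?h \<rho> \<partial>lborel)"
      by (rule integral_v2[where \<phi> = "\<lambda>\<rho>. \<sigma>' \<rho> * laguerre_ext \<alpha> \<rho>"]) measurable
    also have "(\<integral>\<rho>. ?h \<rho> \<partial>lborel) = (\<integral>\<rho>. ?h \<rho> \<partial>lebesgue)" by (rule integral_completion[symmetric]) (use hb in simp)
    also have "... = (\<integral>\<rho>. ?h' \<rho> \<partial>lebesgue)"
    proof (rule integral_cong_AE)
      show hl: "?h \<in> borel_measurable lebesgue" by (rule measurable_completion) (use hb in simp)
      have "AE \<rho> in lborel. ?h \<rho> = ?h' \<rho>" using AE by eventually_elim (auto simp: indicator_def laguerre_fun_def)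
      then show ae: "AE \<rho> in lebesgue. ?h \<rho> = ?h' \<rho>" by (rule AE_completion)
      show "?h' \<in> borel_measurable lebesgue" by (rule borel_measurable_AE[OF hl ae])
    qed
    also have "... = (\<integral>\<rho>. \<sigma> \<rho> * laguerre_fun \<alpha> \<rho> \<partial>(lebesgue_on orthant))"
      by (rule integral_restrict_space[symmetric]) (simp add: borel_open[OF open_orthant])
    also have "... = functional orthant \<sigma> (laguerre_fun \<alpha>)" by (simp add: functional_def laguerre_fun_schwartz)
    also have "?C * (of_real ((pi / 2) ^ CARD('n)) * functional orthant \<sigma> (laguerre_fun \<alpha>)) =
        of_real pi ^ CARD('n) * (- 1) ^ (\<Sum>i\<in>UNIV. \<alpha> i) * functional orthant \<sigma> (laguerre_fun \<alpha>)" by (simp add: power_divide)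
    finally show ?thesis unfolding 1 using True by (simp only: if_True simp_thms)
  qed
qed

section \<open>Hermite multipliers\<close>

abbreviation rapid_real :: "('i \<Rightarrow> real) \<Rightarrow> ('i \<Rightarrow> real) \<Rightarrow> bool" where
  "rapid_real w \<gamma> \<equiv> rapid w (\<lambda>i. complex_of_real (\<gamma> i))"

lemma rapid_of_real_iff:
  assumes "\<And>i. 0 \<le> \<gamma> i"
  shows "rapid_real w \<gamma> \<longleftrightarrow> (\<forall>k. \<exists>K. \<forall>i. \<gamma> i * w i ^ k \<le> K)" unfolding rapid_def norm_of_real abs_of_nonneg[OF assms] ..

lemma rapid_poly_mult:
  assumes w: "\<And>i. w i \<ge> 1" and c: "rapid w c" and pb: "poly_bounded w (\<lambda>i. cmod (l i))"
  shows "rapid w (\<lambda>i. l i * c i)" unfolding rapid_def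
proof
  fix k
  obtain C M where C: "C \<ge> 0" "\<And>i. cmod (l i) \<le> C * w i ^ M" using pb unfolding poly_bounded_def by blast
  obtain K where K: "\<And>i. cmod (c i) * w i ^ (M + k) \<le> K" using c unfolding rapid_def by blast
  have "cmod (l i * c i) * w i ^ k \<le> C * K" for i
  proof -
    have "0 \<le> w i" using w[of i] by linarith
    then have "cmod (l i) * (cmod (c i) * w i ^ k) \<le> (C * w i ^ M) * (cmod (c i) * w i ^ k)" by (intro mult_right_mono C(2)) simp
    also have "... = C * (cmod (c i) * w i ^ (M + k))" by (simp only: power_add mult_ac)
    also have "... \<le> C * K" by (rule mult_left_mono[OF K C(1)])
    finally show ?thesis by (simp only: norm_mult mult.assoc)
  qed
  then show "\<exists>K. \<forall>i. cmod (l i * c i) * w i ^ k \<le> K" by blast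
qed

lemma rapid_weight_mult:
  assumes w: "\<And>i. w i \<ge> 1" and c: "rapid_real w \<gamma>" and \<gamma>: "\<And>i. 0 \<le> \<gamma> i"
  shows "rapid w (\<lambda>i. complex_of_real (\<gamma> i * w i ^ k))" "0 \<le> \<gamma> i * w i ^ k"
proof -
  have p: "0 \<le> \<gamma> i * w i ^ k" for i using w[of i] \<gamma>[of i] by simp
  show "0 \<le> \<gamma> i * w i ^ k" by (rule p)
  have "\<exists>K. \<forall>i. (\<gamma> i * w i ^ k) * w i ^ m \<le> K" for m
  proof -
    obtain K where "\<And>i. \<gamma> i * w i ^ (k + m) \<le> K" using c unfolding rapid_of_real_iff[OF \<gamma>] by blast
    then show ?thesis by (auto simp only: power_add mult.assoc)
  qed
  then show "rapid w (\<lambda>i. complex_of_real (\<gamma> i * w i ^ k))" unfolding rapid_of_real_iff[OF p] by blast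
qed

text \<open>The bridge from sequences to strong topologies: rapid decay of \<open>\<gamma>\<close>
  beats the polynomial growth of every norm, so the scaled family is an admissible test set.\<close>

lemma rapid_family_bounded:
  fixes U :: "'a::euclidean_space set"
  assumes w: "\<And>i. w i \<ge> 1" and U: "open U" "U \<noteq> {}" and \<Phi>: "\<And>i. \<Phi> i \<in> schwartz_functions U"
    and pb: "\<And>m. poly_bounded w (\<lambda>i. snorm U m (\<Phi> i))"
    and \<gamma>: "\<And>i. 0 \<le> \<gamma> i" and r: "rapid_real w \<gamma>"
  shows "bounded_in (schwartz U) (range (\<lambda>i x. complex_of_real (\<gamma> i) * \<Phi> i x))" unfolding bounded_in_schwartz_iff[OF U]
proof (intro conjI allI)
  show "range (\<lambda>i x. complex_of_real (\<gamma> i) * \<Phi> i x) \<subseteq> schwartz_functions U" using schwartz_scale(1)[OF U(1) \<Phi>] by blast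
  fix m
  obtain C M where C: "C \<ge> 0" "\<And>i. snorm U m (\<Phi> i) \<le> C * w i ^ M" using pb unfolding poly_bounded_def by blast
  obtain K where K: "\<And>i. \<gamma> i * w i ^ M \<le> K" using r unfolding rapid_of_real_iff[OF \<gamma>] by blast
  have "snorm U m (\<lambda>x. complex_of_real (\<gamma> i) * \<Phi> i x) \<le> C * K" for i
  proof -
    have "snorm U m (\<lambda>x. complex_of_real (\<gamma> i) * \<Phi> i x) \<le> \<gamma> i * snorm U m (\<Phi> i)"
      using snorm_scale_le[OF U \<Phi>[of i], of m "complex_of_real (\<gamma> i)"] \<gamma>[of i] by simp
    also have "... \<le> \<gamma> i * (C * w i ^ M)" by (rule mult_left_mono[OF C(2) \<gamma>])
    also have "... = C * (\<gamma> i * w i ^ M)" by (simp only: mult_ac)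
    also have "... \<le> C * K" by (rule mult_left_mono[OF K C(1)])
    finally show ?thesis .
  qed
  then show "bdd_above (snorm U m ` range (\<lambda>i x. complex_of_real (\<gamma> i) * \<Phi> i x))" by (intro bdd_aboveI[of _ "C * K"]) auto
qed

lemma strong_dual_seminorm_ge:
  assumes "fun_lcs E" "bounded_in E B" "f \<in> B" "T \<in> dual_vectors E"
  shows "cmod (T f) \<le> (SUP f\<in>B. cmod (T f))" by (rule cSUP_upper[OF assms(3) dual_bdd[OF assms(1,4,2)]])

lemmas S_lcs = fun_lcs_schwartz[OF open_UNIV UNIV_not_empty]
lemmas S_dual_lcs = fun_lcs_strong_dual[OF S_lcs]

section \<open>Eigenvalues and multipliers on the Schwartz space\<close>

text \<open>One of the two equal powers of \<open>2 * pi\<close> belongs to \<open>weyl\<close>, the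
  other to \<open>wigner\<close>; the rest comes from \<open>functional_radial_wig\<close>. The
  modulus does not depend on \<open>\<alpha>\<close>.\<close>

definition weyl_const :: "'n::finite mindex \<Rightarrow> complex" where
  "weyl_const \<alpha> = of_real ((2 * pi) powr (- (real CARD('n) / 2))) ^ 2 * (of_real pi ^ CARD('n) * (- 1) ^ (\<Sum>i\<in>UNIV. \<alpha> i))"

definition weyl_eigenvalue :: "(real^'n \<Rightarrow> complex) \<Rightarrow> 'n mindex \<Rightarrow> complex" where
  "weyl_eigenvalue \<sigma> \<alpha> = weyl_const \<alpha> * functional orthant \<sigma> (laguerre_fun \<alpha>)"

lemma cmod_weyl_const:
  "cmod (weyl_const (\<alpha> :: 'n::finite mindex)) = ((2 * pi) powr (- (real CARD('n) / 2))) ^ 2 * pi ^ CARD('n)"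
  by (simp add: weyl_const_def norm_mult norm_power)

lemma poly_bounded_weyl_eigenvalue:
  assumes \<sigma>: "polynomially_L2 \<sigma>"
  shows "poly_bounded weight (\<lambda>\<alpha>. cmod (weyl_eigenvalue \<sigma> \<alpha>))"
proof -
  obtain C k where C: "C \<ge> 0" "\<And>g. g \<in> schwartz_functions orthant \<Longrightarrow> cmod (functional orthant \<sigma> g) \<le> C * snorm orthant k g"
    using functional_orthant_dual(2)[OF \<sigma>] by blast
  let ?K = "((2 * pi) powr (- (real CARD('a) / 2))) ^ 2 * pi ^ CARD('a)"
  have "poly_bounded weight (\<lambda>\<alpha>::'a mindex. (?K * C) * snorm orthant k (laguerre_fun \<alpha>))"
    by (rule poly_bounded_cmult[OF weight_ge_1 poly_bounded_snorm_laguerre]) (intro mult_nonneg_nonneg C(1), simp_all)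
  moreover have "cmod (weyl_eigenvalue \<sigma> \<alpha>) \<le> (?K * C) * snorm orthant k (laguerre_fun \<alpha>)" for \<alpha>
    unfolding weyl_eigenvalue_def norm_mult cmod_weyl_const mult.assoc[of ?K] by (intro mult_left_mono C(2) laguerre_fun_schwartz) simp
  ultimately show ?thesis by (rule poly_bounded_mono)
qed

text \<open>The double sum of \<open>wigner_expansion\<close> loses all terms off the diagonal. What
  remains is symmetric in \<open>f\<close> and \<open>g\<close>, which makes the operator equal to
  its transpose.\<close>

lemma weyl_expansion:
  fixes f g :: "real^'n \<Rightarrow> complex"
  assumes \<sigma>: "polynomially_L2 \<sigma>" and f: "f \<in> S_funs" and g: "g \<in> S_funs"
  shows "((\<lambda>\<alpha>. weyl_eigenvalue \<sigma> \<alpha> * (hcoeff \<alpha> f * hcoeff \<alpha> g)) has_sum weyl (functional UNIV (radial \<sigma>)) f g) UNIV"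
proof -
  let ?\<kappa> = "of_real ((2 * pi) powr (- (real CARD('n) / 2))) :: complex"
  let ?T = "functional UNIV (radial \<sigma>)"
  let ?F = "\<lambda>\<iota>. ?\<kappa> * (?\<kappa> * (hcoeff (fst \<iota>) f * hcoeff (snd \<iota>) g) * ?T (wig_fun \<iota>))"
  let ?d = "\<lambda>\<alpha>::'n mindex. (\<alpha>, \<alpha>)"
  have "(?F has_sum ?\<kappa> * ?T (wigner f (\<lambda>x. cnj (g x)))) UNIV"
    by (rule has_sum_cmult_right[OF wigner_expansion[OF f g functional_radial_dual(1)[OF \<sigma>]]])
  then have "(?F has_sum weyl ?T f g) UNIV" using g by (simp add: weyl_def)
  then have "(?F has_sum weyl ?T f g) (range ?d)"
  proof (subst has_sum_cong_neutral[where T = UNIV and g = ?F])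
    fix \<iota> assume "\<iota> \<in> UNIV - range ?d"
    then obtain \<alpha> \<beta> where "\<iota> = (\<alpha>, \<beta>)" "\<alpha> \<noteq> \<beta>" by (cases \<iota>) auto
    then show "?F \<iota> = 0" by (simp add: functional_radial_wig[OF \<sigma>])
  qed auto
  then have "((?F \<circ> ?d) has_sum weyl ?T f g) UNIV" by (subst has_sum_reindex[symmetric]) (auto simp: inj_on_def)
  moreover have "?F \<circ> ?d = (\<lambda>\<alpha>. weyl_eigenvalue \<sigma> \<alpha> * (hcoeff \<alpha> f * hcoeff \<alpha> g))"
    by (simp add: fun_eq_iff functional_radial_wig[OF \<sigma>] weyl_eigenvalue_def weyl_const_def power2_eq_square mult_ac)
  ultimately show ?thesis by (simp only:)
qed

text \<open>The second claim is Parseval's identity for the bilinear pairing, by inserting the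
  Hermite series of \<open>g\<close>.\<close>

lemma functional_pairing:
  fixes f g :: "real^'n \<Rightarrow> complex"
  assumes f: "f \<in> S_funs" and g: "g \<in> S_funs"
  shows "functional UNIV f (hermite_fun \<alpha>) = hcoeff \<alpha> f"
    "((\<lambda>\<alpha>. hcoeff \<alpha> f * hcoeff \<alpha> g) has_sum functional UNIV f g) UNIV"
proof -
  show 1: "functional UNIV f (hermite_fun \<alpha>) = hcoeff \<alpha> f" for \<alpha>
    by (simp add: functional_lborel[OF schwartz_borel[OF f] hermite_fun_schwartz] hcoeff_def)
  show "((\<lambda>\<alpha>. hcoeff \<alpha> f * hcoeff \<alpha> g) has_sum functional UNIV f g) UNIV"
    using hermite_series(3)[OF rapid_hcoeff[OF g] functional_schwartz_dual[OF f]] by (simp add: 1 hermite_expansion[OF g] mult.commute)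
qed

lemma hermite_ext:
  fixes f g :: "real^'n \<Rightarrow> complex"
  assumes f: "f \<in> S_funs" and g: "g \<in> S_funs" and eq: "\<And>\<alpha>. hcoeff \<alpha> f = hcoeff \<alpha> g"
  shows "f = g"
proof -
  have "f = (\<lambda>x. \<Sum>\<^sub>\<infinity>\<alpha>. hcoeff \<alpha> f * hermite_fun \<alpha> x)" by (rule hermite_expansion[OF f, symmetric])
  also have "... = g" unfolding eq by (rule hermite_expansion[OF g])
  finally show ?thesis .
qed

definition multiplier :: "('n::finite mindex \<Rightarrow> complex) \<Rightarrow> (real^'n \<Rightarrow> complex) \<Rightarrow> (real^'n \<Rightarrow> complex)" where
  "multiplier l f = (if f \<in> S_funs
     then (\<lambda>x. \<Sum>\<^sub>\<infinity>\<alpha>. (l \<alpha> * hcoeff \<alpha> f) * hermite_fun \<alpha> x) else (\<lambda>x. 0))"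

abbreviation multiplier_symbol :: "('n::finite mindex \<Rightarrow> complex) \<Rightarrow> bool" where
  "multiplier_symbol l \<equiv> poly_bounded weight (\<lambda>\<alpha>. cmod (l \<alpha>))"

lemma multiplier_symbol_diff:
  assumes "multiplier_symbol l" "multiplier_symbol l'"
  shows "multiplier_symbol (\<lambda>\<alpha>. l \<alpha> - l' \<alpha>)"
  by (rule poly_bounded_mono[OF poly_bounded_add[OF weight_ge_1 assms]]) (rule norm_triangle_ineq4)

lemma multiplier_schwartz:
  fixes f :: "real^'n \<Rightarrow> complex"
  assumes l: "multiplier_symbol l" and f: "f \<in> S_funs"
  shows "multiplier l f \<in> S_funs"
    "hcoeff \<alpha> (multiplier l f) = l \<alpha> * hcoeff \<alpha> f"
    "T \<in> dual_vectors S_space \<Longrightarrow> ((\<lambda>\<alpha>. l \<alpha> * hcoeff \<alpha> f * T (hermite_fun \<alpha>)) has_sum T (multiplier l f)) UNIV"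
  using hermite_series[OF rapid_poly_mult[OF weight_ge_1 rapid_hcoeff[OF f] l]] f by (simp_all add: multiplier_def)

text \<open>\<open>C\<close> and \<open>k\<close> depend on the norm alone, not on the symbol or the
  function. For one symbol this yields continuity, for differences of symbols it yields
  convergence.\<close>

lemma snorm_multiplier:
  "\<exists>C\<ge>0. \<exists>k. \<forall>(l :: 'n::finite mindex \<Rightarrow> complex) f K. multiplier_symbol l \<longrightarrow> f \<in> S_funs \<longrightarrow>
     (\<forall>\<alpha>. cmod (l \<alpha> * hcoeff \<alpha> f) * weight \<alpha> ^ k \<le> K) \<longrightarrow> snorm UNIV m (multiplier l f) \<le> C * K"
proof -
  obtain C k where C: "C \<ge> 0" and k: "\<And>c K. (\<And>\<alpha>::'n mindex. cmod (c \<alpha>) * weight \<alpha> ^ k \<le> K) \<Longrightarrow>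
      (\<Sum>\<^sub>\<infinity>\<alpha>. snorm UNIV m (\<lambda>x. c \<alpha> * hermite_fun \<alpha> x)) \<le> C * K"
    using rapid_coeff_summable[OF weight_ge_1 summable_weight hermite_fun_schwartz poly_bounded_snorm_hermite, of m] by blast
  define N where "N = real (card (blists m :: (real^'n) list set))"
  have "snorm UNIV m (multiplier l f) \<le> (N * C) * K"
    if l: "multiplier_symbol l" and f: "f \<in> S_funs" and K: "\<And>\<alpha>. cmod (l \<alpha> * hcoeff \<alpha> f) * weight \<alpha> ^ k \<le> K"
    for l :: "'n mindex \<Rightarrow> complex" and f K
  proof -
    have r: "rapid weight (\<lambda>\<alpha>. l \<alpha> * hcoeff \<alpha> f)" by (rule rapid_poly_mult[OF weight_ge_1 rapid_hcoeff[OF f] l])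
    have "snorm UNIV m (multiplier l f) = snorm UNIV m (\<lambda>x. \<Sum>\<^sub>\<infinity>\<alpha>. (l \<alpha> * hcoeff \<alpha> f) * hermite_fun \<alpha> x)"
      using f by (simp add: multiplier_def)
    also have "... \<le> N * (\<Sum>\<^sub>\<infinity>\<alpha>. snorm UNIV m (\<lambda>x. (l \<alpha> * hcoeff \<alpha> f) * hermite_fun \<alpha> x))" unfolding N_def
      by (rule snorm_infsum_le[OF infinite_multi_indices])
        (rule schwartz_scale(1)[OF open_UNIV hermite_fun_schwartz],
         rule rapid_summable[OF weight_ge_1 summable_weight r hermite_fun_schwartz poly_bounded_snorm_hermite])
    also have "... \<le> N * (C * K)" by (intro mult_left_mono k K) (simp add: N_def)
    finally show ?thesis by (simp only: mult.assoc)
  qed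
  moreover have "0 \<le> N * C" using C by (simp add: N_def)
  ultimately show ?thesis by (intro exI[of _ "N * C"] exI[of _ k]) blast
qed

text \<open>Linearity is read off from Hermite coefficients, which determine a Schwartz function.
  For continuity, additional decay of the coefficients pays for the growth of the symbol.\<close>

lemma multiplier_lin:
  fixes l :: "'n::finite mindex \<Rightarrow> complex"
  assumes l: "multiplier_symbol l"
  shows "multiplier l \<in> lin_vectors S_space S_space"
proof (rule lin_schwartzI[OF open_UNIV UNIV_not_empty open_UNIV UNIV_not_empty])
  note H = multiplier_schwartz(1,2)[OF l]
  note add = schwartz_add(1)[OF open_UNIV] and scale = schwartz_scale(1)[OF open_UNIV]
  show "multiplier l f \<in> S_funs" if "f \<in> S_funs" for f by (rule H(1)[OF that])
  show "multiplier l (\<lambda>x. f x + g x) = (\<lambda>x. multiplier l f x + multiplier l g x)"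
    if f: "f \<in> S_funs" and g: "g \<in> S_funs" for f g by (rule hermite_ext[OF H(1)[OF add[OF f g]] add[OF H(1)[OF f] H(1)[OF g]]])
      (simp only: H(2)[OF add[OF f g]] H(2)[OF f] H(2)[OF g] hcoeff_add[OF f g] hcoeff_add[OF H(1)[OF f] H(1)[OF g]] distrib_left)
  show "multiplier l (\<lambda>x. c * f x) = (\<lambda>x. c * multiplier l f x)"
    if f: "f \<in> S_funs" for f c by (rule hermite_ext[OF H(1)[OF scale[OF f]] scale[OF H(1)[OF f]]])
      (simp only: H(2)[OF scale[OF f]] H(2)[OF f] hcoeff_scale mult.left_commute)
  show "multiplier l f = (\<lambda>x. 0)" if "f \<notin> S_funs" for f using that by (simp add: multiplier_def)
  fix m
  obtain C k where C: "C \<ge> 0" and k: "\<And>f K. f \<in> S_funs \<Longrightarrow>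
     (\<And>\<alpha>. cmod (l \<alpha> * hcoeff \<alpha> f) * weight \<alpha> ^ k \<le> K) \<Longrightarrow> snorm UNIV m (multiplier l f) \<le> C * K"
    using snorm_multiplier[where 'n = 'n, of m] l by blast
  obtain C1 M where C1: "C1 \<ge> 0" "\<And>\<alpha>. cmod (l \<alpha>) \<le> C1 * weight \<alpha> ^ M" using l unfolding poly_bounded_def by blast
  obtain C2 m' where C2: "C2 \<ge> 0" "\<And>f \<alpha>. f \<in> S_funs \<Longrightarrow> cmod (hcoeff (\<alpha>::'n mindex) f) * weight \<alpha> ^ (M + k) \<le> C2 * snorm UNIV m' f"
    using hcoeff_decay[where 'n = 'n, of "M + k"] by blast
  have "snorm UNIV m (multiplier l f) \<le> (C * (C1 * C2)) * snorm UNIV m' f" if f: "f \<in> S_funs" for f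
  proof -
    have "cmod (l \<alpha> * hcoeff \<alpha> f) * weight \<alpha> ^ k \<le> C1 * (C2 * snorm UNIV m' f)" for \<alpha>
    proof -
      have "cmod (l \<alpha>) * (cmod (hcoeff \<alpha> f) * weight \<alpha> ^ k) \<le> (C1 * weight \<alpha> ^ M) * (cmod (hcoeff \<alpha> f) * weight \<alpha> ^ k)"
        using weight_pos[of \<alpha>] by (intro mult_right_mono C1(2)) simp
      also have "... = C1 * (cmod (hcoeff \<alpha> f) * weight \<alpha> ^ (M + k))" by (simp only: power_add mult_ac)
      also have "... \<le> C1 * (C2 * snorm UNIV m' f)" by (rule mult_left_mono[OF C2(2)[OF f] C1(1)])
      finally show ?thesis by (simp only: norm_mult mult.assoc)
    qed
    from k[OF f this] show ?thesis by (simp only: mult.assoc)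
  qed
  then show "\<exists>K m'. \<forall>f\<in>S_funs. snorm UNIV m (multiplier l f) \<le> K * snorm UNIV m' f" by blast
qed

text \<open>Reduces convergence of multipliers to estimates for one multiplier whose symbol is a
  difference.\<close>

lemma multiplier_diff:
  assumes l: "multiplier_symbol l" "multiplier_symbol l'"
  shows "multiplier l f - multiplier l' f = multiplier (\<lambda>\<alpha>. l \<alpha> - l' \<alpha>) f"
proof (cases "f \<in> S_funs")
  case True
  note H = multiplier_schwartz(1,2)[OF l(1) True] and H' = multiplier_schwartz(1,2)[OF l(2) True]
    and D = multiplier_schwartz(1,2)[OF multiplier_symbol_diff[OF l] True]
  show ?thesis by (rule hermite_ext[OF schwartz_minus(1)[OF open_UNIV H(1) H'(1)] D(1)])
      (simp only: hcoeff_minus[OF H(1) H'(1)] H(2) H'(2) D(2) left_diff_distrib)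
qed (auto simp: multiplier_def)

section \<open>Multipliers on the dual and density of Hermite sums\<close>

text \<open>The transpose of \<open>multiplier l\<close>. For Weyl eigenvalues it extends the
  operator on functions because the diagonal form is symmetric; see
  \<open>functional_multiplier\<close>.\<close>

definition dual_multiplier :: "('n::finite mindex \<Rightarrow> complex) \<Rightarrow> ((real^'n \<Rightarrow> complex) \<Rightarrow> complex) \<Rightarrow> ((real^'n \<Rightarrow> complex) \<Rightarrow> complex)" where
  "dual_multiplier l T = (if T \<in> dual_vectors S_space then T \<circ> multiplier l else (\<lambda>g. 0))"

lemma dual_multiplier_lin:
  fixes l :: "'n::finite mindex \<Rightarrow> complex"
  assumes l: "multiplier_symbol l"
  shows "dual_multiplier l \<in> lin_vectors S_dual S_dual"
proof -
  let ?A = "multiplier l"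
  note A = multiplier_lin[OF l]
  note D = fun_lcsD(3,4)[OF S_dual_lcs, simplified]
  have Av: "?A f \<in> vectors S_space" for f by (rule lin_vectors_into[OF A S_lcs S_lcs])
  have into: "T \<circ> ?A \<in> dual_vectors S_space" if T: "T \<in> dual_vectors S_space" for T unfolding dual_vectors_def
  proof (intro CollectI conjI ballI allI impI)
    show "(T \<circ> ?A) (\<lambda>x. f x + g x) = (T \<circ> ?A) f + (T \<circ> ?A) g" if "f \<in> vectors S_space" "g \<in> vectors S_space" for f g
      unfolding comp_def lin_vectorsD(1)[OF A that] by (rule dual_vectorsD(1)[OF T Av Av])
    show "(T \<circ> ?A) (\<lambda>x. c * f x) = c * (T \<circ> ?A) f" if "f \<in> vectors S_space" for f c
      unfolding comp_def lin_vectorsD(2)[OF A that] by (rule dual_vectorsD(2)[OF T Av])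
    show "continuous_map (lcs_topology S_space) euclidean (T \<circ> ?A)"
      by (rule continuous_map_compose[OF lin_vectorsD(3)[OF A] dual_vectorsD(3)[OF T]])
    show "(T \<circ> ?A) f = 0" if "f \<notin> vectors S_space" for f
    proof -
      have "T (\<lambda>x. 0 * 0) = 0 * T (\<lambda>x. 0)" by (rule dual_vectorsD(2)[OF T fun_lcsD(2)[OF S_lcs]])
      then show ?thesis unfolding comp_def lin_vectorsD(4)[OF A that] by simp
    qed
  qed
  show ?thesis unfolding lin_vectors_def
  proof (intro CollectI conjI ballI allI impI)
    show "dual_multiplier l (\<lambda>x. T x + T' x) = (\<lambda>y. dual_multiplier l T y + dual_multiplier l T' y)"
      if "T \<in> vectors S_dual" "T' \<in> vectors S_dual" for T T' using that D(1)[of T T'] by (simp add: dual_multiplier_def comp_def)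
    show "dual_multiplier l (\<lambda>x. c * T x) = (\<lambda>y. c * dual_multiplier l T y)" if "T \<in> vectors S_dual" for T c
      using that D(2)[of T c] by (simp add: dual_multiplier_def comp_def)
    show "dual_multiplier l T = (\<lambda>y. 0)" if "T \<notin> vectors S_dual" for T using that by (simp add: dual_multiplier_def)
    show "continuous_map (lcs_topology S_dual) (lcs_topology S_dual) (dual_multiplier l)"
    proof (rule continuous_map_lcsI[OF S_dual_lcs S_dual_lcs])
      show "dual_multiplier l T \<in> vectors S_dual" if "T \<in> vectors S_dual" for T using that into by (simp add: dual_multiplier_def)
      show "dual_multiplier l (T - T') = dual_multiplier l T - dual_multiplier l T'" if "T \<in> vectors S_dual" "T' \<in> vectors S_dual" for T T'
        using that fun_lcs_minus[OF S_dual_lcs that] by (simp add: dual_multiplier_def fun_eq_iff)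
      fix q assume "q \<in> seminorms (S_dual :: ((real^'n \<Rightarrow> complex) \<Rightarrow> complex) lcs)"
      then obtain B :: "(real^'n \<Rightarrow> complex) set" where q: "q = (\<lambda>T. SUP f\<in>B. cmod (T f))" and B: "bounded_in S_space B" "B \<noteq> {}"
        by (auto simp: strong_dual_def)
      \<comment> \<open>The operator maps bounded sets to bounded sets, so the seminorm over
        \<open>B\<close> of the transposed functional is itself a seminorm of the dual, taken over
        the image of \<open>B\<close>.\<close>
      have "bounded_in S_space (?A ` B)" unfolding bounded_in_def
      proof (intro conjI ballI)
        show "?A ` B \<subseteq> vectors S_space" using Av by blast
        show "bdd_above (p ` ?A ` B)" if "p \<in> seminorms S_space" for p
          using lin_bdd[OF S_lcs S_lcs A B(1) that] by (simp only: image_image)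
      qed
      then have "(\<lambda>T. SUP f\<in>?A ` B. cmod (T f)) \<in> seminorms S_dual" using B(2) by (auto simp: strong_dual_def)
      moreover have "\<forall>T\<in>vectors S_dual. q (dual_multiplier l T) \<le> 1 * (\<Sum>p\<in>{\<lambda>T. SUP f\<in>?A ` B. cmod (T f)}. p T)"
        by (simp add: q dual_multiplier_def image_image)
      ultimately show "\<exists>P C. finite P \<and> P \<subseteq> seminorms S_dual \<and> C \<ge> 0 \<and> (\<forall>T\<in>vectors S_dual. q (dual_multiplier l T) \<le> C * (\<Sum>p\<in>P. p T))"
        by (intro exI[of _ "{\<lambda>T. SUP f\<in>?A ` B. cmod (T f)}"] exI[of _ 1]) auto
    qed
  qed
qed

lemma strong_dual_seminormI:
  "bounded_in E B \<Longrightarrow> B \<noteq> {} \<Longrightarrow> (\<lambda>T. SUP f\<in>B. cmod (T f)) \<in> seminorms (strong_dual E)" by (auto simp: strong_dual_def)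

text \<open>The pointwise supremum inherits the bound for each power of the weight, because these
  bounds are uniform over \<open>X\<close>.\<close>

lemma sup_rapid:
  fixes a :: "'x \<Rightarrow> 'i \<Rightarrow> real"
  assumes w: "\<And>i. w i \<ge> 1" and X: "X \<noteq> {}" and a: "\<And>x i. 0 \<le> a x i"
    and b: "\<And>k. \<exists>M. \<forall>x\<in>X. \<forall>i. a x i * w i ^ k \<le> M"
  shows "\<exists>c. (\<forall>i. 0 \<le> c i) \<and> (\<forall>x\<in>X. \<forall>i. a x i \<le> c i) \<and> rapid_real w c"
proof -
  define c where "c i = (SUP x\<in>X. a x i)" for i
  have bdd: "bdd_above ((\<lambda>x. a x i) ` X)" for i
  proof -
    obtain M where "\<And>x i. x \<in> X \<Longrightarrow> a x i * w i ^ 0 \<le> M" using b[of 0] by blast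
    then show ?thesis by (intro bdd_aboveI[of _ M]) auto
  qed
  have le: "a x i \<le> c i" if "x \<in> X" for x i unfolding c_def by (rule cSUP_upper[OF that bdd])
  have nn: "0 \<le> c i" for i
  proof -
    obtain x where "x \<in> X" using X by blast
    then show ?thesis using a[of x i] le[of x i] by linarith
  qed
  have "\<exists>K. \<forall>i. c i * w i ^ k \<le> K" for k
  proof -
    obtain M where M: "\<And>x i. x \<in> X \<Longrightarrow> a x i * w i ^ k \<le> M" using b[of k] by blast
    have "c i * w i ^ k \<le> M" for i
    proof -
      have p: "0 < w i ^ k" using w[of i] by (intro zero_less_power) linarith
      have "c i \<le> M / w i ^ k" unfolding c_def using M p by (intro cSUP_least X) (simp add: pos_le_divide_eq)
      then show ?thesis using p by (simp add: pos_le_divide_eq)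
    qed
    then show ?thesis by blast
  qed
  then have "rapid_real w c" by (simp only: rapid_of_real_iff[of c, OF nn] simp_thms)
  then show ?thesis using le nn by (intro exI[of _ c] conjI allI ballI)
qed

text \<open>The constants of \<open>hcoeff_decay\<close> do not depend on the function, so one
  rapidly decreasing majorant serves a whole bounded set.\<close>

lemma hcoeff_sup:
  fixes B :: "(real^'n \<Rightarrow> complex) set"
  assumes B: "bounded_in S_space B" "B \<noteq> {}"
  shows "\<exists>\<gamma>. (\<forall>\<alpha>. 0 \<le> \<gamma> \<alpha>) \<and> (\<forall>f\<in>B. \<forall>\<alpha>. cmod (hcoeff \<alpha> f) \<le> \<gamma> \<alpha>) \<and> rapid_real weight \<gamma>"
proof (rule sup_rapid[OF weight_ge_1 B(2)])
  have B': "B \<subseteq> S_funs" "\<And>m. bdd_above (snorm UNIV m ` B)"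
    using B(1) unfolding bounded_in_schwartz_iff[OF open_UNIV UNIV_not_empty] by simp_all
  fix k
  obtain C m where C: "C \<ge> 0" "\<And>f \<alpha>. f \<in> S_funs \<Longrightarrow> cmod (hcoeff (\<alpha>::'n mindex) f) * weight \<alpha> ^ k \<le> C * snorm UNIV m f"
    using hcoeff_decay[where 'n = 'n, of k] by blast
  obtain M where M: "\<And>f. f \<in> B \<Longrightarrow> snorm UNIV m f \<le> M" using B'(2)[of m] unfolding bdd_above_def by blast
  have "cmod (hcoeff \<alpha> f) * weight \<alpha> ^ k \<le> C * M" if "f \<in> B" for f \<alpha>
    using C(2)[of f \<alpha>] B'(1) that mult_left_mono[OF M[OF that] C(1)] by (meson order_trans subsetD)
  then show "\<exists>M. \<forall>f\<in>B. \<forall>\<alpha>. cmod (hcoeff \<alpha> f) * weight \<alpha> ^ k \<le> M" by blast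
qed simp

text \<open>For every \<open>k\<close> the functions
  \<open>\<gamma> \<alpha> * weight \<alpha> ^ k\<close> times \<open>hermite_fun \<alpha>\<close>
  form a bounded set, on which a bounded set of functionals is uniformly bounded.\<close>

lemma dual_hermite_sup:
  fixes \<B> :: "((real^'n \<Rightarrow> complex) \<Rightarrow> complex) set"
  assumes \<B>: "bounded_in S_dual \<B>" "\<B> \<noteq> {}" and \<gamma>: "\<And>\<alpha>. 0 \<le> \<gamma> \<alpha>" and r: "rapid_real weight \<gamma>"
  shows "\<exists>c. (\<forall>\<alpha>. 0 \<le> c \<alpha>) \<and> (\<forall>T\<in>\<B>. \<forall>\<alpha>. \<gamma> \<alpha> * cmod (T (hermite_fun \<alpha>)) \<le> c \<alpha>) \<and> rapid_real weight c"
proof (rule sup_rapid[OF weight_ge_1 \<B>(2)])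
  fix k
  let ?\<gamma> = "\<lambda>\<alpha>. \<gamma> \<alpha> * weight \<alpha> ^ k"
  let ?B = "range (\<lambda>\<alpha> x. complex_of_real (?\<gamma> \<alpha>) * hermite_fun \<alpha> x)"
  have B: "bounded_in S_space ?B"
    by (rule rapid_family_bounded[OF weight_ge_1 open_UNIV UNIV_not_empty hermite_fun_schwartz poly_bounded_snorm_hermite])
      (rule rapid_weight_mult[OF weight_ge_1 r \<gamma>])+
  have "(\<lambda>T. SUP f\<in>?B. cmod (T f)) \<in> seminorms S_dual" by (rule strong_dual_seminormI[OF B]) simp
  then have "bdd_above ((\<lambda>T. SUP f\<in>?B. cmod (T f)) ` \<B>)" by (rule bspec[OF conjunct2[OF \<B>(1)[unfolded bounded_in_def]]])
  then obtain M where M: "\<And>T. T \<in> \<B> \<Longrightarrow> (SUP f\<in>?B. cmod (T f)) \<le> M" by (rule bdd_above.E) blast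
  have "(\<gamma> \<alpha> * cmod (T (hermite_fun \<alpha>))) * weight \<alpha> ^ k \<le> M" if T: "T \<in> \<B>" for T \<alpha>
  proof -
    have T': "T \<in> dual_vectors S_space" using \<B>(1) T by (auto simp: bounded_in_def)
    have "cmod (T (\<lambda>x. complex_of_real (?\<gamma> \<alpha>) * hermite_fun \<alpha> x)) \<le> M"
      by (rule order_trans[OF strong_dual_seminorm_ge[OF S_lcs B _ T'] M[OF T]]) blast
    moreover have "T (\<lambda>x. complex_of_real (?\<gamma> \<alpha>) * hermite_fun \<alpha> x) = complex_of_real (?\<gamma> \<alpha>) * T (hermite_fun \<alpha>)"
      by (rule dual_vectorsD(2)[OF T']) (simp add: hermite_fun_schwartz)
    ultimately show ?thesis
      using rapid_weight_mult(2)[OF weight_ge_1 r \<gamma>, of \<alpha> k] by (simp only: norm_mult norm_of_real abs_of_nonneg mult_ac)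
  qed
  then show "\<exists>M. \<forall>T\<in>\<B>. \<forall>\<alpha>. (\<gamma> \<alpha> * cmod (T (hermite_fun \<alpha>))) * weight \<alpha> ^ k \<le> M" by blast
qed (simp add: \<gamma>)

text \<open>Singletons are bounded sets, so evaluation at a test function is dominated by a seminorm
  of the strong dual.\<close>

lemma limitin_strong_dual_pointwise:
  assumes E: "fun_lcs E" and lim: "limitin (lcs_topology (strong_dual E)) Ts T F" and g: "g \<in> vectors E"
  shows "((\<lambda>j. Ts j g) \<longlongrightarrow> T g) F"
proof (rule tendstoI)
  fix e :: real assume e: "e > 0"
  have "(\<lambda>T. SUP f\<in>{g}. cmod (T f)) \<in> seminorms (strong_dual E)" by (rule strong_dual_seminormI[OF bounded_in_sing[OF E g]]) simp
  then have "eventually (\<lambda>j. (SUP f\<in>{g}. cmod ((Ts j - T) f)) < e) F"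
    using lim e unfolding limitin_lcs_iff[OF fun_lcs_triangle[OF fun_lcs_strong_dual[OF E]]] by (blast intro: eventually_mono)
  then show "eventually (\<lambda>j. dist (Ts j g) (T g) < e) F" by eventually_elim (simp add: dist_norm)
qed

lemma functional_sum_hermite:
  fixes f :: "real^'n \<Rightarrow> complex"
  assumes I: "finite I" and f: "f \<in> S_funs"
  shows "(\<lambda>x. \<Sum>\<alpha>\<in>I. c \<alpha> * hermite_fun \<alpha> x) \<in> S_funs"
    "functional UNIV (\<lambda>x. \<Sum>\<alpha>\<in>I. c \<alpha> * hermite_fun \<alpha> x) f = (\<Sum>\<alpha>\<in>I. c \<alpha> * hcoeff \<alpha> f)"
proof -
  show F: "(\<lambda>x. \<Sum>\<alpha>\<in>I. c \<alpha> * hermite_fun \<alpha> x) \<in> S_funs"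
    by (rule conjunct1[OF schwartz_sum[OF open_UNIV I]]) (rule schwartz_scale(1)[OF open_UNIV hermite_fun_schwartz])
  have "functional UNIV (\<lambda>x. \<Sum>\<alpha>\<in>I. c \<alpha> * hermite_fun \<alpha> x) f = functional UNIV f (\<lambda>x. \<Sum>\<alpha>\<in>I. c \<alpha> * hermite_fun \<alpha> x)"
    using F f by (simp add: functional_def mult.commute)
  also have "... = (\<Sum>\<alpha>\<in>I. c \<alpha> * functional UNIV f (hermite_fun \<alpha>))"
    by (rule dual_sum[OF functional_schwartz_dual[OF f] open_UNIV I]) (rule hermite_fun_schwartz)
  finally show "functional UNIV (\<lambda>x. \<Sum>\<alpha>\<in>I. c \<alpha> * hermite_fun \<alpha> x) f = (\<Sum>\<alpha>\<in>I. c \<alpha> * hcoeff \<alpha> f)"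
    by (simp only: functional_pairing(1)[OF f hermite_fun_schwartz])
qed

text \<open>With \<open>\<gamma>\<close> a common majorant of the coefficients on a bounded set
  \<open>B\<close>, the remainder is at most a tail of the sum of
  \<open>\<gamma> \<alpha> * cmod (T (hermite_fun \<alpha>))\<close>, uniformly on
  \<open>B\<close>.\<close>

lemma hermite_dual_expansion:
  fixes T :: "(real^'n \<Rightarrow> complex) \<Rightarrow> complex"
  assumes T: "T \<in> dual_vectors S_space"
  shows "limitin (lcs_topology S_dual) (\<lambda>I. functional UNIV (\<lambda>x. \<Sum>\<alpha>\<in>I. T (hermite_fun \<alpha>) * hermite_fun \<alpha> x)) T (finite_subsets_at_top UNIV)"
proof -
  let ?G = "\<lambda>I. functional UNIV (\<lambda>x. \<Sum>\<alpha>\<in>I. T (hermite_fun \<alpha>) * hermite_fun \<alpha> x)"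
  note iff = limitin_lcs_iff[OF fun_lcs_triangle[OF S_dual_lcs]]
  show ?thesis unfolding iff
  proof (intro conjI ballI allI impI)
    show "T \<in> vectors S_dual" using T by simp
    fix q e assume q: "q \<in> seminorms (S_dual :: ((real^'n \<Rightarrow> complex) \<Rightarrow> complex) lcs)" and e: "e > (0::real)"
    obtain B :: "(real^'n \<Rightarrow> complex) set" where q: "q = (\<lambda>T. SUP f\<in>B. cmod (T f))" and B: "bounded_in S_space B" "B \<noteq> {}"
      using q by (auto simp: strong_dual_def)
    obtain \<gamma> where \<gamma>: "\<And>\<alpha>. 0 \<le> \<gamma> \<alpha>" "\<And>f \<alpha>. f \<in> B \<Longrightarrow> cmod (hcoeff \<alpha> f) \<le> \<gamma> \<alpha>" "rapid_real weight \<gamma>" using hcoeff_sup[OF B] by blast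
    let ?s = "\<lambda>\<alpha>. \<gamma> \<alpha> * cmod (T (hermite_fun \<alpha>))"
    \<comment> \<open>The majorant is itself the coefficient sequence of a Schwartz function, so
      \<open>T\<close> applied to its series is summable; for complex numbers summability in this
      sense is absolute.\<close>
    have "(\<lambda>\<alpha>. complex_of_real (\<gamma> \<alpha>) * T (hermite_fun \<alpha>)) summable_on UNIV"
      using hermite_series(3)[OF \<gamma>(3) T] by (rule has_sum_imp_summable)
    then have s: "?s summable_on UNIV"
      unfolding summable_on_iff_abs_summable_on_complex norm_mult norm_of_real abs_of_nonneg[OF \<gamma>(1)] .
    have bound: "q (?G I - T) \<le> infsum ?s (- I)" if I: "finite I" for I unfolding q
    proof (rule cSUP_least[OF B(2)])
      fix f assume f: "f \<in> B"
      then have f': "f \<in> S_funs" using B(1) by (auto simp: bounded_in_def)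
      let ?t = "\<lambda>\<alpha>. hcoeff \<alpha> f * T (hermite_fun \<alpha>)"
      have t: "(?t has_sum T f) UNIV" using hermite_series(3)[OF rapid_hcoeff[OF f'] T] by (simp only: hermite_expansion[OF f'])
      then have ts: "?t summable_on UNIV" by (rule has_sum_imp_summable)
      have "infsum ?t (- I) = T f - sum ?t I" using infsum_Compl[OF ts I] infsumI[OF t] by simp
      also have "sum ?t I = ?G I f" unfolding functional_sum_hermite(2)[OF I f'] by (simp only: mult.commute)
      finally have d: "cmod ((?G I - T) f) = cmod (infsum ?t (- I))" by (simp add: norm_minus_commute)
      have "(?t has_sum infsum ?t (- I)) (- I)" by (rule has_sum_infsum[OF summable_on_subset_banach[OF ts subset_UNIV]])
      moreover have "(?s has_sum infsum ?s (- I)) (- I)" by (rule has_sum_infsum[OF summable_on_subset_banach[OF s subset_UNIV]])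
      moreover have "norm (?t \<alpha>) \<le> ?s \<alpha>" for \<alpha> unfolding norm_mult by (rule mult_right_mono[OF \<gamma>(2)[OF f]]) simp
      ultimately show "cmod ((?G I - T) f) \<le> infsum ?s (- I)" unfolding d by (rule norm_infsum_le)
    qed
    have mem: "?G I \<in> vectors S_dual" if "finite I" for I unfolding vectors_strong_dual
      by (rule functional_schwartz_dual[OF functional_sum_hermite(1)[OF that hermite_fun_schwartz]])
    have lt: "eventually (\<lambda>I. infsum ?s (- I) < e) (finite_subsets_at_top UNIV)"
      by (rule order_tendstoD(2)[OF infsum_Compl_tendsto[OF s] e])
    have fin: "eventually finite (finite_subsets_at_top (UNIV :: 'n mindex set))"
      by (rule eventually_finite_subsets_at_top_weakI) assumption
    show "eventually (\<lambda>I. ?G I \<in> vectors S_dual \<and> q (?G I - T) < e) (finite_subsets_at_top UNIV)"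
    proof (rule eventually_elim2[OF fin lt])
      fix I :: "'n mindex set" assume I: "finite I" "infsum ?s (- I) < e"
      show "?G I \<in> vectors S_dual \<and> q (?G I - T) < e" by (rule conjI[OF mem[OF I(1)] order_le_less_trans[OF bound[OF I(1)] I(2)]])
    qed
  qed
qed

text \<open>Finite Hermite sums are functions and converge to \<open>T\<close> in the strong dual.
  Continuity of both maps reduces the claim to limits of complex numbers at each test function,
  which are unique.\<close>

lemma lin_dual_ext:
  fixes D D' :: "((real^'n \<Rightarrow> complex) \<Rightarrow> complex) \<Rightarrow> ((real^'n \<Rightarrow> complex) \<Rightarrow> complex)"
  assumes D: "D \<in> lin_vectors S_dual S_dual" and D': "D' \<in> lin_vectors S_dual S_dual"
    and eq: "\<And>f. f \<in> S_funs \<Longrightarrow> D (functional UNIV f) = D' (functional UNIV f)"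
  shows "D = D'"
proof
  fix T
  show "D T = D' T"
  proof (cases "T \<in> vectors S_dual")
    case False
    show ?thesis unfolding lin_vectorsD(4)[OF D False] lin_vectorsD(4)[OF D' False] ..
  next
    case T: True
    show ?thesis
    proof
      fix g
      have v: "D T \<in> dual_vectors S_space" "D' T \<in> dual_vectors S_space"
        using lin_vectors_into[OF D S_dual_lcs S_dual_lcs, of T] lin_vectors_into[OF D' S_dual_lcs S_dual_lcs, of T] by simp_all
      show "D T g = D' T g"
      proof (cases "g \<in> vectors S_space")
        case False
        show ?thesis unfolding dual_vectorsD(4)[OF v(1) False] dual_vectorsD(4)[OF v(2) False] ..
      next
        case g: True
        let ?F = "finite_subsets_at_top (UNIV :: 'n mindex set)"
        let ?f = "\<lambda>I x. \<Sum>\<alpha>\<in>I. T (hermite_fun \<alpha>) * hermite_fun \<alpha> x"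
        have L: "limitin (lcs_topology S_dual) (\<lambda>I. functional UNIV (?f I)) T ?F" using hermite_dual_expansion T by simp
        have 1: "((\<lambda>I. D (functional UNIV (?f I)) g) \<longlongrightarrow> D T g) ?F"
          using limitin_strong_dual_pointwise[OF S_lcs continuous_map_limit[OF lin_vectorsD(3)[OF D] L] g] by (simp only: comp_def)
        have 2: "((\<lambda>I. D' (functional UNIV (?f I)) g) \<longlongrightarrow> D' T g) ?F"
          using limitin_strong_dual_pointwise[OF S_lcs continuous_map_limit[OF lin_vectorsD(3)[OF D'] L] g] by (simp only: comp_def)
        have "eventually (\<lambda>I. D (functional UNIV (?f I)) g = D' (functional UNIV (?f I)) g) ?F"
          by (rule eventually_finite_subsets_at_top_weakI)
            (simp only: eq[OF functional_sum_hermite(1)[OF _ hermite_fun_schwartz]])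
        then have "((\<lambda>I. D' (functional UNIV (?f I)) g) \<longlongrightarrow> D T g) ?F" by (rule Lim_transform_eventually[OF 1])
        from tendsto_unique[OF _ this 2] show ?thesis by simp
      qed
    qed
  qed
qed

text \<open>Both claims compare expansions over the diagonal. In the second one the eigenvalue is
  attached to the test function rather than to \<open>f\<close>, which leaves the sum
  unchanged.\<close>

lemma functional_multiplier:
  fixes f g :: "real^'n \<Rightarrow> complex"
  assumes \<sigma>: "polynomially_L2 \<sigma>" and f: "f \<in> S_funs"
  shows "functional UNIV (multiplier (weyl_eigenvalue \<sigma>) f) = weyl (functional UNIV (radial \<sigma>)) f"
    "dual_multiplier (weyl_eigenvalue \<sigma>) (functional UNIV f) = weyl (functional UNIV (radial \<sigma>)) f"
proof -
  note l = poly_bounded_weyl_eigenvalue[OF \<sigma>]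
  let ?l = "weyl_eigenvalue \<sigma>"
  note H = multiplier_schwartz[OF l]
  show "functional UNIV (multiplier ?l f) = weyl (functional UNIV (radial \<sigma>)) f"
  proof
    fix g :: "real^'n \<Rightarrow> complex"
    show "functional UNIV (multiplier ?l f) g = weyl (functional UNIV (radial \<sigma>)) f g"
    proof (cases "g \<in> S_funs")
      case True
      have "((\<lambda>\<alpha>. ?l \<alpha> * (hcoeff \<alpha> f * hcoeff \<alpha> g)) has_sum functional UNIV (multiplier ?l f) g) UNIV"
        using functional_pairing(2)[OF H(1)[OF f] True] by (simp only: H(2)[OF f] mult.assoc)
      then show ?thesis by (rule has_sum_unique[OF _ weyl_expansion[OF \<sigma> f True]])
    qed (simp add: functional_def weyl_def)
  qed
  show "dual_multiplier ?l (functional UNIV f) = weyl (functional UNIV (radial \<sigma>)) f"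
  proof
    fix g :: "real^'n \<Rightarrow> complex"
    have d: "dual_multiplier ?l (functional UNIV f) g = functional UNIV f (multiplier ?l g)"
      by (simp add: dual_multiplier_def functional_schwartz_dual[OF f])
    show "dual_multiplier ?l (functional UNIV f) g = weyl (functional UNIV (radial \<sigma>)) f g"
    proof (cases "g \<in> S_funs")
      case True
      have "((\<lambda>\<alpha>. ?l \<alpha> * (hcoeff \<alpha> f * hcoeff \<alpha> g)) has_sum functional UNIV f (multiplier ?l g)) UNIV"
        using functional_pairing(2)[OF f H(1)[OF True]] by (simp only: H(2)[OF True] mult.left_commute)
      then show ?thesis unfolding d by (rule has_sum_unique[OF _ weyl_expansion[OF \<sigma> f True]])
    next
      case False
      then show ?thesis unfolding d by (simp add: multiplier_def weyl_def functional_def)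
    qed
  qed
qed

section \<open>Uniqueness of the Weyl operators\<close>

text \<open>Evaluating the functional of \<open>A f\<close> at the Hermite functions gives all
  coefficients of \<open>A f\<close>, so the values of \<open>weyl\<close> determine the
  operator.\<close>

lemma weyl_on_S_iff:
  assumes \<sigma>: "polynomially_L2 \<sigma>"
  shows "weyl_on_S (functional UNIV (radial \<sigma>)) A \<longleftrightarrow> A = multiplier (weyl_eigenvalue \<sigma>)"
proof
  note l = poly_bounded_weyl_eigenvalue[OF \<sigma>]
  let ?H = "multiplier (weyl_eigenvalue \<sigma>)"
  show "weyl_on_S (functional UNIV (radial \<sigma>)) A" if "A = ?H"
    using that multiplier_lin[OF l] functional_multiplier(1)[OF \<sigma>] by (simp add: weyl_on_S_def)
  assume "weyl_on_S (functional UNIV (radial \<sigma>)) A"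
  then have A: "A \<in> lin_vectors S_space S_space"
    and w: "\<And>f. f \<in> S_funs \<Longrightarrow> functional UNIV (A f) = weyl (functional UNIV (radial \<sigma>)) f" by (simp_all add: weyl_on_S_def)
  show "A = ?H"
  proof
    fix f
    show "A f = ?H f"
    proof (cases "f \<in> S_funs")
      case True
      have Af: "A f \<in> S_funs" using lin_vectors_into[OF A S_lcs S_lcs, of f] by simp
      have Hf: "?H f \<in> S_funs" by (rule multiplier_schwartz(1)[OF l True])
      show ?thesis
      proof (rule hermite_ext[OF Af Hf])
        fix \<alpha>
        show "hcoeff \<alpha> (A f) = hcoeff \<alpha> (?H f)"
          unfolding functional_pairing(1)[OF Af Af, symmetric] functional_pairing(1)[OF Hf Hf, symmetric]
            w[OF True] functional_multiplier(1)[OF \<sigma> True] ..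
      qed
    next
      case False
      then show ?thesis using lin_vectorsD(4)[OF A, of f] by (simp add: multiplier_def)
    qed
  qed
qed

lemma weyl_on_S_dual_iff:
  assumes \<sigma>: "polynomially_L2 \<sigma>"
  shows "weyl_on_S_dual (functional UNIV (radial \<sigma>)) A \<longleftrightarrow> A = dual_multiplier (weyl_eigenvalue \<sigma>)"
proof
  note D = dual_multiplier_lin[OF poly_bounded_weyl_eigenvalue[OF \<sigma>]]
  note F = functional_multiplier(2)[OF \<sigma>]
  show "weyl_on_S_dual (functional UNIV (radial \<sigma>)) A" if "A = dual_multiplier (weyl_eigenvalue \<sigma>)"
    using that D F by (simp add: weyl_on_S_dual_def)
  assume "weyl_on_S_dual (functional UNIV (radial \<sigma>)) A"
  then have A: "A \<in> lin_vectors S_dual S_dual"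
    and w: "\<And>f. f \<in> S_funs \<Longrightarrow> A (functional UNIV f) = weyl (functional UNIV (radial \<sigma>)) f" by (simp_all add: weyl_on_S_dual_def)
  show "A = dual_multiplier (weyl_eigenvalue \<sigma>)" by (rule lin_dual_ext[OF A D]) (simp only: w F)
qed

section \<open>Convergence of eigenvalues and of operators\<close>

text \<open>Strong convergence is tested on the bounded set of all functions
  \<open>\<gamma> \<alpha>\<close> times \<open>laguerre_fun \<alpha>\<close>. This gives one null
  sequence for all \<open>\<alpha>\<close> at once, since \<open>weyl_const\<close> has constant
  modulus.\<close>

lemma weyl_eigenvalue_converges:
  fixes \<sigma> :: "real^'n \<Rightarrow> complex" and \<gamma> :: "'n mindex \<Rightarrow> real"
  assumes \<sigma>: "polynomially_L2 \<sigma>" and \<sigma>s: "\<And>j. polynomially_L2 (\<sigma>s j)"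
    and lim: "limitin (lcs_topology (strong_dual (schwartz orthant))) (\<lambda>j. functional orthant (\<sigma>s j)) (functional orthant \<sigma>) sequentially"
    and \<gamma>: "\<And>\<alpha>. 0 \<le> \<gamma> \<alpha>" and r: "rapid_real weight \<gamma>"
  shows "\<exists>r. (\<forall>j \<alpha>. cmod (weyl_eigenvalue (\<sigma>s j) \<alpha> - weyl_eigenvalue \<sigma> \<alpha>) * \<gamma> \<alpha> \<le> r j) \<and> r \<longlonglongrightarrow> 0"
proof -
  note lcs = fun_lcs_schwartz[OF open_orthant orthant_nonempty]
  note dlcs = fun_lcs_strong_dual[OF lcs]
  let ?B = "range (\<lambda>(\<alpha>::'n mindex) x. complex_of_real (\<gamma> \<alpha>) * laguerre_fun \<alpha> x)"
  let ?p = "\<lambda>T. SUP f\<in>?B. cmod (T f)"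
  let ?\<Psi> = "\<lambda>j. functional orthant (\<sigma>s j) - functional orthant \<sigma>"
  let ?K = "((2 * pi) powr (- (real CARD('n) / 2))) ^ 2 * pi ^ CARD('n)"
  have B: "bounded_in (schwartz orthant) ?B"
    by (rule rapid_family_bounded[OF weight_ge_1 open_orthant orthant_nonempty laguerre_fun_schwartz poly_bounded_snorm_laguerre \<gamma> r])
  then have p: "?p \<in> seminorms (strong_dual (schwartz orthant))" by (rule strong_dual_seminormI) simp
  have \<Psi>: "?\<Psi> j \<in> dual_vectors (schwartz orthant)" for j
    by (rule fun_lcs_minus[OF dlcs, unfolded vectors_strong_dual, OF functional_orthant_dual(1)[OF \<sigma>s] functional_orthant_dual(1)[OF \<sigma>]])
  have "(\<lambda>j. ?p (?\<Psi> j)) \<longlonglongrightarrow> 0"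
  proof (rule tendstoI)
    fix e :: real assume "e > 0"
    then have "eventually (\<lambda>j. ?p (?\<Psi> j) < e) sequentially"
      using lim p unfolding limitin_lcs_iff[OF fun_lcs_triangle[OF dlcs]] by (blast intro: eventually_mono)
    moreover have "0 \<le> ?p (?\<Psi> j)" for j by (rule fun_lcs_nonneg[OF dlcs p]) (simp only: vectors_strong_dual \<Psi>)
    ultimately show "eventually (\<lambda>j. dist (?p (?\<Psi> j)) 0 < e) sequentially" unfolding dist_real_def by (auto elim: eventually_mono)
  qed
  then have "(\<lambda>j. ?K * ?p (?\<Psi> j)) \<longlonglongrightarrow> 0" by (rule tendsto_mult_right_zero)
  moreover have "cmod (weyl_eigenvalue (\<sigma>s j) \<alpha> - weyl_eigenvalue \<sigma> \<alpha>) * \<gamma> \<alpha> \<le> ?K * ?p (?\<Psi> j)" for j \<alpha>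
  proof -
    have "cmod (weyl_eigenvalue (\<sigma>s j) \<alpha> - weyl_eigenvalue \<sigma> \<alpha>) * \<gamma> \<alpha> = ?K * (\<gamma> \<alpha> * cmod (?\<Psi> j (laguerre_fun \<alpha>)))"
      unfolding weyl_eigenvalue_def right_diff_distrib[symmetric] norm_mult cmod_weyl_const minus_apply by (simp only: mult_ac)
    also have "\<gamma> \<alpha> * cmod (?\<Psi> j (laguerre_fun \<alpha>)) = cmod (?\<Psi> j (\<lambda>x. complex_of_real (\<gamma> \<alpha>) * laguerre_fun \<alpha> x))"
      using dual_vectorsD(2)[OF \<Psi>, of "laguerre_fun \<alpha>" j "complex_of_real (\<gamma> \<alpha>)"] \<gamma>[of \<alpha>]
      by (simp only: vectors_schwartz laguerre_fun_schwartz norm_mult norm_of_real abs_of_nonneg)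
    also have "?K * \<dots> \<le> ?K * ?p (?\<Psi> j)" by (intro mult_left_mono strong_dual_seminorm_ge[OF lcs B _ \<Psi>]) auto
    finally show ?thesis .
  qed
  ultimately show ?thesis by (intro exI[of _ "\<lambda>j. ?K * ?p (?\<Psi> j)"]) blast
qed

text \<open>Convergence of the symbols against rapid weights is used with a weight adapted to the
  test sets: on the Schwartz space a majorant of the coefficients of \<open>B\<close>, on the dual a
  majorant of their products with the values of the functionals in \<open>\<B>\<close> at Hermite
  functions.\<close>

lemma multiplier_converges:
  fixes l :: "'n::finite mindex \<Rightarrow> complex"
  assumes l: "multiplier_symbol l" and ls: "\<And>j. multiplier_symbol (ls j)"
    and conv: "\<And>\<gamma>. (\<And>\<alpha>. 0 \<le> \<gamma> \<alpha>) \<Longrightarrow> rapid_real weight \<gamma> \<Longrightarrow>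
      \<exists>r. (\<forall>j \<alpha>. cmod (ls j \<alpha> - l \<alpha>) * \<gamma> \<alpha> \<le> r j) \<and> r \<longlonglongrightarrow> 0"
  shows "limitin (lcs_topology (Lin S_space S_space)) (\<lambda>j. multiplier (ls j)) (multiplier l) sequentially"
    "limitin (lcs_topology (Lin S_dual S_dual)) (\<lambda>j. dual_multiplier (ls j)) (dual_multiplier l) sequentially"
proof -
  note d = multiplier_symbol_diff[OF ls l]
  show "limitin (lcs_topology (Lin S_space S_space)) (\<lambda>j. multiplier (ls j)) (multiplier l) sequentially"
  proof (rule limitin_lcs_I[OF triangle_lcs_Lin[OF S_lcs S_lcs]])
    show "multiplier l \<in> vectors (Lin S_space S_space)" "multiplier (ls j) \<in> vectors (Lin S_space S_space)" for j
      using multiplier_lin[OF l] multiplier_lin[OF ls] by simp_all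
    fix p assume "p \<in> seminorms (Lin (S_space :: (real^'n \<Rightarrow> complex) lcs) (S_space :: (real^'n \<Rightarrow> complex) lcs))"
    then obtain B q where p: "p = (\<lambda>A. SUP f\<in>B. q (A f))" and B: "bounded_in S_space B" "B \<noteq> {}"
      and q: "q \<in> seminorms (S_space :: (real^'n \<Rightarrow> complex) lcs)" by (auto simp: Lin_def)
    obtain m where m: "\<And>f. f \<in> S_funs \<Longrightarrow> q f \<le> snorm UNIV m f" using seminorm_le_snorm[OF q UNIV_not_empty] by blast
    obtain C k where C: "C \<ge> 0" and k: "\<And>(l :: 'n mindex \<Rightarrow> complex) f K. multiplier_symbol l \<Longrightarrow> f \<in> S_funs \<Longrightarrow>
       (\<And>\<alpha>. cmod (l \<alpha> * hcoeff \<alpha> f) * weight \<alpha> ^ k \<le> K) \<Longrightarrow> snorm UNIV m (multiplier l f) \<le> C * K"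
      using snorm_multiplier[where 'n = 'n, of m] by blast
    obtain \<gamma> where \<gamma>: "\<And>\<alpha>. 0 \<le> \<gamma> \<alpha>" "\<And>f \<alpha>. f \<in> B \<Longrightarrow> cmod (hcoeff \<alpha> f) \<le> \<gamma> \<alpha>" "rapid_real weight \<gamma>" using hcoeff_sup[OF B] by blast
    \<comment> \<open>The factor \<open>weight \<alpha> ^ k\<close> is the one that
      \<open>snorm_multiplier\<close> asks for in the chosen norm.\<close>
    obtain r where r: "\<And>j \<alpha>. cmod (ls j \<alpha> - l \<alpha>) * (\<gamma> \<alpha> * weight \<alpha> ^ k) \<le> r j" "r \<longlonglongrightarrow> 0"
      using conv[of "\<lambda>\<alpha>. \<gamma> \<alpha> * weight \<alpha> ^ k"] rapid_weight_mult[OF weight_ge_1 \<gamma>(3,1)] by blast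
    have "p (multiplier (ls j) - multiplier l) \<le> C * r j" for j unfolding p
    proof (rule cSUP_least[OF B(2)])
      fix f assume f: "f \<in> B"
      then have f': "f \<in> S_funs" using B(1) by (auto simp: bounded_in_def)
      have "cmod ((ls j \<alpha> - l \<alpha>) * hcoeff \<alpha> f) * weight \<alpha> ^ k \<le> r j" for \<alpha>
      proof -
        have "cmod (ls j \<alpha> - l \<alpha>) * (cmod (hcoeff \<alpha> f) * weight \<alpha> ^ k) \<le> cmod (ls j \<alpha> - l \<alpha>) * (\<gamma> \<alpha> * weight \<alpha> ^ k)"
          using weight_pos[of \<alpha>] by (intro mult_left_mono mult_right_mono \<gamma>(2) f) simp_all
        with r(1)[of j \<alpha>] show ?thesis unfolding norm_mult mult.assoc by linarith
      qed
      then have "snorm UNIV m (multiplier (\<lambda>\<alpha>. ls j \<alpha> - l \<alpha>) f) \<le> C * r j" by (rule k[OF d f'])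
      moreover have "q (multiplier (\<lambda>\<alpha>. ls j \<alpha> - l \<alpha>) f) \<le> snorm UNIV m (multiplier (\<lambda>\<alpha>. ls j \<alpha> - l \<alpha>) f)"
        by (rule m[OF multiplier_schwartz(1)[OF d f']])
      ultimately show "q ((multiplier (ls j) - multiplier l) f) \<le> C * r j" unfolding minus_apply multiplier_diff[OF ls l] by linarith
    qed
    moreover have "(\<lambda>j. C * r j) \<longlonglongrightarrow> 0" by (rule tendsto_mult_right_zero[OF r(2)])
    ultimately show "\<exists>r. (\<forall>j. p (multiplier (ls j) - multiplier l) \<le> r j) \<and> r \<longlonglongrightarrow> 0" by (intro exI[of _ "\<lambda>j. C * r j"] conjI allI)
  qed
  show "limitin (lcs_topology (Lin S_dual S_dual)) (\<lambda>j. dual_multiplier (ls j)) (dual_multiplier l) sequentially"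
  proof (rule limitin_lcs_I[OF triangle_lcs_Lin[OF S_dual_lcs S_dual_lcs]])
    show "dual_multiplier l \<in> vectors (Lin S_dual S_dual)" "dual_multiplier (ls j) \<in> vectors (Lin S_dual S_dual)" for j
      using dual_multiplier_lin[OF l] dual_multiplier_lin[OF ls] by simp_all
    fix p assume "p \<in> seminorms (Lin (S_dual :: ((real^'n \<Rightarrow> complex) \<Rightarrow> complex) lcs) (S_dual :: ((real^'n \<Rightarrow> complex) \<Rightarrow> complex) lcs))"
    then obtain \<B> q where p: "p = (\<lambda>A. SUP T\<in>\<B>. q (A T))" and \<B>: "bounded_in S_dual \<B>" "\<B> \<noteq> {}"
      and q': "q \<in> seminorms (S_dual :: ((real^'n \<Rightarrow> complex) \<Rightarrow> complex) lcs)" unfolding Lin_def by auto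
    obtain B :: "(real^'n \<Rightarrow> complex) set" where q: "q = (\<lambda>T. SUP f\<in>B. cmod (T f))" and B: "bounded_in S_space B" "B \<noteq> {}"
      using q' by (auto simp: strong_dual_def)
    obtain \<gamma> where \<gamma>: "\<And>\<alpha>. 0 \<le> \<gamma> \<alpha>" "\<And>f \<alpha>. f \<in> B \<Longrightarrow> cmod (hcoeff \<alpha> f) \<le> \<gamma> \<alpha>" "rapid_real weight \<gamma>" using hcoeff_sup[OF B] by blast
    obtain c where c: "\<And>\<alpha>. 0 \<le> c \<alpha>" "\<And>T \<alpha>. T \<in> \<B> \<Longrightarrow> \<gamma> \<alpha> * cmod (T (hermite_fun \<alpha>)) \<le> c \<alpha>" "rapid_real weight c"
      using dual_hermite_sup[OF \<B> \<gamma>(1,3)] by blast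
    \<comment> \<open>The additional \<open>weight \<alpha> ^ 2\<close> leaves the summable factor
      \<open>1 / weight \<alpha> ^ 2\<close> in the estimate of each term.\<close>
    obtain r where r: "\<And>j \<alpha>. cmod (ls j \<alpha> - l \<alpha>) * (c \<alpha> * weight \<alpha> ^ 2) \<le> r j" "r \<longlonglongrightarrow> 0"
      using conv[of "\<lambda>\<alpha>. c \<alpha> * weight \<alpha> ^ 2"] rapid_weight_mult[OF weight_ge_1 c(3,1)] by blast
    let ?W = "\<Sum>\<^sub>\<infinity>\<alpha>::'n mindex. 1 / weight \<alpha> ^ 2"
    have "p (dual_multiplier (ls j) - dual_multiplier l) \<le> r j * ?W" for j unfolding p q
    proof (intro cSUP_least \<B>(2) B(2))
      fix T f assume T: "T \<in> \<B>" and f: "f \<in> B"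
      then have f': "f \<in> S_funs" and T': "T \<in> dual_vectors S_space" using B(1) \<B>(1) by (auto simp: bounded_in_def)
      note H = multiplier_schwartz(1)[OF _ f']
      have "(dual_multiplier (ls j) - dual_multiplier l) T f = T (multiplier (ls j) f) - T (multiplier l f)"
        using T' by (simp add: dual_multiplier_def)
      also have "... = T (multiplier (ls j) f - multiplier l f)"
        by (rule dual_vectors_minus[OF T' S_lcs, symmetric]) (simp_all add: H l ls)
      also have "... = T (multiplier (\<lambda>\<alpha>. ls j \<alpha> - l \<alpha>) f)" by (simp only: multiplier_diff[OF ls l])
      finally have eq: "(dual_multiplier (ls j) - dual_multiplier l) T f = T (multiplier (\<lambda>\<alpha>. ls j \<alpha> - l \<alpha>) f)" .
      have "norm (T (multiplier (\<lambda>\<alpha>. ls j \<alpha> - l \<alpha>) f)) \<le> r j * ?W"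
      proof (rule norm_infsum_le[OF multiplier_schwartz(3)[OF d f' T'] has_sum_cmult_right[OF has_sum_infsum[OF summable_weight]]])
        fix \<alpha> :: "'n mindex"
        have w: "0 < weight \<alpha> ^ 2" by (rule zero_less_power[OF weight_pos])
        have "cmod (hcoeff \<alpha> f) * cmod (T (hermite_fun \<alpha>)) \<le> \<gamma> \<alpha> * cmod (T (hermite_fun \<alpha>))"
          by (rule mult_right_mono[OF \<gamma>(2)[OF f]]) simp
        also have "... \<le> c \<alpha>" by (rule c(2)[OF T])
        finally have "cmod (ls j \<alpha> - l \<alpha>) * (cmod (hcoeff \<alpha> f) * cmod (T (hermite_fun \<alpha>))) \<le> cmod (ls j \<alpha> - l \<alpha>) * c \<alpha>"
          by (rule mult_left_mono) simp
        also have "... \<le> r j * (1 / weight \<alpha> ^ 2)" using r(1)[of j \<alpha>] w by (simp add: field_simps)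
        finally show "norm ((ls j \<alpha> - l \<alpha>) * hcoeff \<alpha> f * T (hermite_fun \<alpha>)) \<le> r j * (1 / weight \<alpha> ^ 2)"
          by (simp only: norm_mult mult.assoc)
      qed
      then show "cmod ((dual_multiplier (ls j) - dual_multiplier l) T f) \<le> r j * ?W" by (simp only: eq)
    qed
    moreover have "(\<lambda>j. r j * ?W) \<longlonglongrightarrow> 0" by (rule tendsto_mult_left_zero[OF r(2)])
    ultimately show "\<exists>r. (\<forall>j. p (dual_multiplier (ls j) - dual_multiplier l) \<le> r j) \<and> r \<longlonglongrightarrow> 0"
      by (intro exI[of _ "\<lambda>j. r j * ?W"] conjI allI)
  qed
qed

theorem theorem7p7:
  fixes \<sigma> :: "real^'n \<Rightarrow> complex"
  assumes "polynomially_L2 \<sigma>"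
  shows "tempered_function (radial \<sigma>) \<and>
    (\<exists>A. weyl_on_S (functional UNIV (radial \<sigma>)) A) \<and>
    (\<exists>A. weyl_on_S_dual (functional UNIV (radial \<sigma>)) A) \<and>
    (\<forall>\<sigma>s :: nat \<Rightarrow> real^'n \<Rightarrow> complex.
       (\<forall>j. polynomially_L2 (\<sigma>s j)) \<and>
       limitin (lcs_topology (strong_dual (schwartz orthant)))
         (\<lambda>j. functional orthant (\<sigma>s j)) (functional orthant \<sigma>) sequentially \<longrightarrow>
       (\<forall>As A. (\<forall>j. weyl_on_S (functional UNIV (radial (\<sigma>s j))) (As j)) \<and>
           weyl_on_S (functional UNIV (radial \<sigma>)) A \<longrightarrow>
         limitin (lcs_topology (Lin S_space S_space)) As A sequentially) \<and>
       (\<forall>As A. (\<forall>j. weyl_on_S_dual (functional UNIV (radial (\<sigma>s j))) (As j)) \<and>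
           weyl_on_S_dual (functional UNIV (radial \<sigma>)) A \<longrightarrow>
         limitin (lcs_topology (Lin S_dual S_dual)) As A sequentially))"
proof (intro conjI allI impI)
  show "tempered_function (radial \<sigma>)" by (rule functional_radial_dual(2)[OF assms])
  show "\<exists>A. weyl_on_S (functional UNIV (radial \<sigma>)) A" unfolding weyl_on_S_iff[OF assms] by blast
  show "\<exists>A. weyl_on_S_dual (functional UNIV (radial \<sigma>)) A" unfolding weyl_on_S_dual_iff[OF assms] by blast
  fix \<sigma>s :: "nat \<Rightarrow> real^'n \<Rightarrow> complex"
  assume H: "(\<forall>j. polynomially_L2 (\<sigma>s j)) \<and> limitin (lcs_topology (strong_dual (schwartz orthant)))
         (\<lambda>j. functional orthant (\<sigma>s j)) (functional orthant \<sigma>) sequentially"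
  then have \<sigma>s: "polynomially_L2 (\<sigma>s j)" for j by blast
  have conv: "\<exists>r. (\<forall>j \<alpha>. cmod (weyl_eigenvalue (\<sigma>s j) \<alpha> - weyl_eigenvalue \<sigma> \<alpha>) * \<gamma> \<alpha> \<le> r j) \<and> r \<longlonglongrightarrow> 0"
    if "\<And>\<alpha>. 0 \<le> \<gamma> \<alpha>" "rapid weight (\<lambda>\<alpha>. complex_of_real (\<gamma> \<alpha>))" for \<gamma>
    by (rule weyl_eigenvalue_converges[OF assms \<sigma>s conjunct2[OF H] that])
  note L = multiplier_converges[OF poly_bounded_weyl_eigenvalue[OF assms] poly_bounded_weyl_eigenvalue[OF \<sigma>s] conv]
  show "limitin (lcs_topology (Lin S_space S_space)) As A sequentially"
    if "(\<forall>j. weyl_on_S (functional UNIV (radial (\<sigma>s j))) (As j)) \<and> weyl_on_S (functional UNIV (radial \<sigma>)) A" for As A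
  proof -
    \<comment> \<open>Weyl operators are unique, so arbitrary choices of \<open>As\<close> and
      \<open>A\<close> are the multipliers themselves.\<close>
    have "As = (\<lambda>j. multiplier (weyl_eigenvalue (\<sigma>s j)))" "A = multiplier (weyl_eigenvalue \<sigma>)"
      using that unfolding weyl_on_S_iff[OF assms] weyl_on_S_iff[OF \<sigma>s] by auto
    then show ?thesis using L(1) by (simp only:)
  qed
  show "limitin (lcs_topology (Lin S_dual S_dual)) As A sequentially"
    if "(\<forall>j. weyl_on_S_dual (functional UNIV (radial (\<sigma>s j))) (As j)) \<and> weyl_on_S_dual (functional UNIV (radial \<sigma>)) A" for As A
  proof -
    have "As = (\<lambda>j. dual_multiplier (weyl_eigenvalue (\<sigma>s j)))" "A = dual_multiplier (weyl_eigenvalue \<sigma>)"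
      using that unfolding weyl_on_S_dual_iff[OF assms] weyl_on_S_dual_iff[OF \<sigma>s] by auto
    then show ?thesis using L(2) by (simp only:)
  qed
qed

end
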